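(* Let $F:S\to T$ be a morphism of operads. (1) $(T/\Sigma)^S=(T/\Sigma)^{(S/\Sigma)}=C_T(T^S)$. (2) If $T$ is $\Sigma$-free, then $r_{T^S}:T^S\to(T/\Sigma)^{(S/\Sigma)}$ is an equivalence in $T\text{-Alg}$.
   Context: **Operads.** "Operad" means coloured symmetric operad in $\mathbf{Set}$, with $\alpha\rho:(i_{\rho k})_k\to i$ for $\alpha:(i_k)_{1\le k\le n}\to i$, $\rho\in\Sigma_n$. An operad is $\Sigma$-free if $\alpha\rho=\alpha$ implies $\rho=1$. Let $f:I\to J$ be the object function of $F$. **2-monad algebras.** For a 2-monad $T$, a lax morphism $(A,a)\to(B,b)$ of strict $T$-algebras is $(g,\overline g)$ with $\overline g:bT(g)\to ga$, $\overline g\eta_A=1$, $\overline g\mu_A=(\overline gT(a))(bT(\overline g))$; it is a pseudomorphism if $\overline g$ is invertible and strict if $\overline g$ is an identity; 2-cells are 2-cells $\phi:g\to g'$ with $\overline{g'}(bT(\phi))=(\phi a)\overline g$. $T\text{-Alg}_s$, $T\text{-Alg}$, $T\text{-Alg}_l$ are the 2-categories of strict $T$-algebras with strict, pseudo, lax morphisms. **The 2-monad of an operad.** An operad $T$ with colours $J$ gives a 2-monad $T$ on $\mathbf{Cat}/J$: $(TX)_j$ has objects $(\alpha,(x_k)_k)$ with $\alpha:(j_k)_k\to j$ in $T$, $x_k\in X_{j_k}$, and morphisms $(\rho,(\gamma_k)_k):(\alpha,(x_k)_k)\to(\beta,(y_k)_k)$ with $\alpha=\beta\rho$, $\gamma_k:x_k\to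 y_{\rho k}$; unit $x\mapsto(1_j,(x))$, multiplication by substitution of operations (and of permutations). **$T/\Sigma$, $C_T$, $r$.** $T/\Sigma$ is the 2-monad on $\mathbf{Cat}/J$ with a 2-monad morphism $q_T:T\to T/\Sigma$, where $q_{T,X}:TX\to(T/\Sigma)X$ is the universal functor over $J$ sending all morphisms of the form $(\rho,(1_{x_{\rho k}})_k):(\alpha\rho,(x_{\rho k})_k)\to(\alpha,(x_k)_k)$ to identities, and the 2-monad structure is the unique one making $q_T$ a morphism of 2-monads. Strict $T/\Sigma$-algebras are identified, via the fully faithful inclusion $\overline q_T:(T/\Sigma)\text{-Alg}_s\to T\text{-Alg}_s$, with the commutative strict $T$-algebras: those whose action $TX\to X$ sends every such $(\rho,(1_{x_{\rho k}})_k)$ to an identity (equivalently, $\mathbf{Cat}$-valued algebras of the operad $T$ in the usual sense). $C_T$ is the left adjoint of $\overline q_T$, and $r_X:X\to C_TX$ is the component at $X\in T\text{-Alg}_s$ of the unit of $C_T\dashv\overline q_T$. **Adjunctions of 2-monads and classifiers.** An adjunction of 2-monads $G:(\mathcal L,S')\to(\mathcal K,T')$ is a 2-adjunction $G_!\dashv G^*$, $G_!:\mathcal L\to\mathcal K$, with a lax monad morphism coherence $G^l:S'G^*\to G^*T'$, i.e. $G^l(\eta^{S'}G^* )=G^*\eta^{T'}$ and $G^l(\mu^{S'}G^* )=(G^*\mu^{T'})(G^lT')(S'G^l)$ (equivalently its mate $G_!S'\to T'G_!$ is a colax one). It induces $\overline G$ from strict $T'$-algebras to strict $S'$-algebras,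 $\overline G(A,a)=(G^*A,G^*(a)G^l_A)$. The internal $S'$-algebra classifier relative to $G$ is a strict $T'$-algebra ${T'}^{S'}$ with a lax morphism $g:1\to\overline G({T'}^{S'})$ of $S'$-algebras such that for all strict $T'$-algebras $B$, $k\mapsto\overline G(k)g$ is an isomorphism of categories $T'\text{-Alg}_s({T'}^{S'},B)\cong S'\text{-Alg}_l(1,\overline GB)$. It is determined up to isomorphism. The morphism $F$ gives three adjunctions of 2-monads, each with underlying adjunction $\Sigma_f\dashv\Delta_f$ ($\Sigma_f$: composition with $f$, $\Delta_f$: pullback along $f$) between $\mathbf{Cat}/I$ and $\mathbf{Cat}/J$: (a) $F:(\mathbf{Cat}/I,S)\to(\mathbf{Cat}/J,T)$ with $F^l(\alpha,(y_k)_k)=(F\alpha,(y_k)_k)$, $F^l(\rho,(\gamma_k)_k)=(\rho,(\gamma_k)_k)$; (b) $q_TF:(\mathbf{Cat}/I,S)\to(\mathbf{Cat}/J,T/\Sigma)$ with coherence $(\Delta_fq_T)F^l$; (c) $F/\Sigma:(\mathbf{Cat}/I,S/\Sigma)\to(\mathbf{Cat}/J,T/\Sigma)$ with $(F/\Sigma)^l$ the unique 2-natural transformation with $(F/\Sigma)^l(q_S\Delta_f)=(\Delta_fq_T)F^l$. $T^S$, $(T/\Sigma)^S$ and $(T/\Sigma)^{(S/\Sigma)}$ are the internal algebra classifiers relative to (a), (b) and (c) respectively, all regarded as strict $T$-algebras. The equalities in (1) are canonical isomorphisms of strict $T$-algebras, and in (2) $(T/\Sigma)^{(S/\Sigma)}$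 is identified with $C_T(T^S)$ via (1). *)

theory Defs
  imports Main "HOL-Library.FuncSet"
begin

section \<open>Strict 2-categories\<close>

text \<open>
  Composites are written in applicative order: \<open>Cmp K h g\<close> is \<open>h\<close> after \<open>g\<close>, \<open>Vc K \<psi> \<phi>\<close> is the
  vertical composite of \<open>\<phi> : g \<Rightarrow> h\<close> and \<open>\<psi> : h \<Rightarrow> k\<close>, and \<open>Hc K \<psi> \<phi>\<close> is the horizontal composite.
  Whiskering with a 1-cell \<open>h\<close> is horizontal composition with \<open>Idc K h\<close>.  The record carries data only;
  it is used for \<open>Cat/J\<close> and for the 2-categories of algebras of 2-monads on \<open>Cat/J\<close>, defined below.
\<close>

record ('o, 'm, 'c) twocat =
  Ob :: "'o set"
  Mor :: "'m set"
  Cell :: "'c set"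
  Src :: "'m \<Rightarrow> 'o"
  Tgt :: "'m \<Rightarrow> 'o"
  Idm :: "'o \<Rightarrow> 'm"
  Cmp :: "'m \<Rightarrow> 'm \<Rightarrow> 'm"
  SrcC :: "'c \<Rightarrow> 'm"
  TgtC :: "'c \<Rightarrow> 'm"
  Idc :: "'m \<Rightarrow> 'c"
  Vc :: "'c \<Rightarrow> 'c \<Rightarrow> 'c"
  Hc :: "'c \<Rightarrow> 'c \<Rightarrow> 'c"

definition hom :: "('o, 'm, 'c) twocat \<Rightarrow> 'o \<Rightarrow> 'o \<Rightarrow> 'm set" where
  "hom K A B = {g \<in> Mor K. Src K g = A \<and> Tgt K g = B}"

definition cells :: "('o, 'm, 'c) twocat \<Rightarrow> 'm \<Rightarrow> 'm \<Rightarrow> 'c set" where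
  "cells K g h = {\<phi> \<in> Cell K. SrcC K \<phi> = g \<and> TgtC K \<phi> = h}"

definition hom_cells :: "('o, 'm, 'c) twocat \<Rightarrow> 'o \<Rightarrow> 'o \<Rightarrow> 'c set" where
  "hom_cells K A B = {\<phi> \<in> Cell K. SrcC K \<phi> \<in> hom K A B \<and> TgtC K \<phi> \<in> hom K A B}"

definition isomorphism_in :: "('o, 'm, 'c) twocat \<Rightarrow> 'm \<Rightarrow> bool" where
  "isomorphism_in K g \<longleftrightarrow> g \<in> Mor K \<and>
     (\<exists>h \<in> hom K (Tgt K g) (Src K g).
        Cmp K h g = Idm K (Src K g) \<and> Cmp K g h = Idm K (Tgt K g))"

definition invertible_cell :: "('o, 'm, 'c) twocat \<Rightarrow> 'c \<Rightarrow> bool" where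
  "invertible_cell K \<phi> \<longleftrightarrow> \<phi> \<in> Cell K \<and>
     (\<exists>\<psi> \<in> cells K (TgtC K \<phi>) (SrcC K \<phi>).
        Vc K \<psi> \<phi> = Idc K (SrcC K \<phi>) \<and> Vc K \<phi> \<psi> = Idc K (TgtC K \<phi>))"

definition equivalence_in :: "('o, 'm, 'c) twocat \<Rightarrow> 'm \<Rightarrow> bool" where
  "equivalence_in K g \<longleftrightarrow> g \<in> Mor K \<and>
     (\<exists>h \<in> hom K (Tgt K g) (Src K g).
        (\<exists>\<phi> \<in> cells K (Idm K (Src K g)) (Cmp K h g). invertible_cell K \<phi>) \<and>
        (\<exists>\<psi> \<in> cells K (Cmp K g h) (Idm K (Tgt K g)). invertible_cell K \<psi>))"

text \<open>The locally full sub-2-category with all objects and the 1-cells satisfying \<open>P\<close>.\<close>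

definition restrict_mor :: "('o, 'm, 'c) twocat \<Rightarrow> ('m \<Rightarrow> bool) \<Rightarrow> ('o, 'm, 'c) twocat" where
  "restrict_mor K P = K\<lparr>Mor := {g \<in> Mor K. P g},
                        Cell := {\<phi> \<in> Cell K. P (SrcC K \<phi>) \<and> P (TgtC K \<phi>)}\<rparr>"

section \<open>2-functors, 2-natural transformations, 2-adjunctions\<close>

record ('o, 'm, 'c, 'p, 'n, 'd) twofun =
  F0 :: "'o \<Rightarrow> 'p"
  F1 :: "'m \<Rightarrow> 'n"
  F2 :: "'c \<Rightarrow> 'd"

definition two_functor ::
    "('o, 'm, 'c) twocat \<Rightarrow> ('p, 'n, 'd) twocat \<Rightarrow> ('o, 'm, 'c, 'p, 'n, 'd) twofun \<Rightarrow> bool" where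
  "two_functor K L H \<longleftrightarrow>
     (\<forall>A\<in>Ob K. F0 H A \<in> Ob L) \<and>
     (\<forall>g\<in>Mor K. F1 H g \<in> hom L (F0 H (Src K g)) (F0 H (Tgt K g))) \<and>
     (\<forall>\<phi>\<in>Cell K. F2 H \<phi> \<in> cells L (F1 H (SrcC K \<phi>)) (F1 H (TgtC K \<phi>))) \<and>
     (\<forall>A\<in>Ob K. F1 H (Idm K A) = Idm L (F0 H A)) \<and>
     (\<forall>g\<in>Mor K. \<forall>h\<in>Mor K. Tgt K g = Src K h \<longrightarrow>
        F1 H (Cmp K h g) = Cmp L (F1 H h) (F1 H g)) \<and>
     (\<forall>g\<in>Mor K. F2 H (Idc K g) = Idc L (F1 H g)) \<and>
     (\<forall>\<phi>\<in>Cell K. \<forall>\<psi>\<in>Cell K. TgtC K \<phi> = SrcC K \<psi> \<longrightarrow>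
        F2 H (Vc K \<psi> \<phi>) = Vc L (F2 H \<psi>) (F2 H \<phi>)) \<and>
     (\<forall>\<phi>\<in>Cell K. \<forall>\<psi>\<in>Cell K. Tgt K (SrcC K \<phi>) = Src K (SrcC K \<psi>) \<longrightarrow>
        F2 H (Hc K \<psi> \<phi>) = Hc L (F2 H \<psi>) (F2 H \<phi>))"

definition id_fun :: "('o, 'm, 'c, 'o, 'm, 'c) twofun" where
  "id_fun = \<lparr>F0 = (\<lambda>A. A), F1 = (\<lambda>g. g), F2 = (\<lambda>\<phi>. \<phi>)\<rparr>"

definition comp_fun ::
    "('p, 'n, 'd, 'q, 'r, 's) twofun \<Rightarrow> ('o, 'm, 'c, 'p, 'n, 'd) twofun \<Rightarrow>
     ('o, 'm, 'c, 'q, 'r, 's) twofun" where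
  "comp_fun G H = \<lparr>F0 = F0 G \<circ> F0 H, F1 = F1 G \<circ> F1 H, F2 = F2 G \<circ> F2 H\<rparr>"

definition two_natural ::
    "('o, 'm, 'c) twocat \<Rightarrow> ('p, 'n, 'd) twocat \<Rightarrow> ('o, 'm, 'c, 'p, 'n, 'd) twofun \<Rightarrow>
     ('o, 'm, 'c, 'p, 'n, 'd) twofun \<Rightarrow> ('o \<Rightarrow> 'n) \<Rightarrow> bool" where
  "two_natural K L G H t \<longleftrightarrow>
     (\<forall>A\<in>Ob K. t A \<in> hom L (F0 G A) (F0 H A)) \<and>
     (\<forall>g\<in>Mor K. Cmp L (t (Tgt K g)) (F1 G g) = Cmp L (F1 H g) (t (Src K g))) \<and>
     (\<forall>\<phi>\<in>Cell K. Hc L (Idc L (t (Tgt K (SrcC K \<phi>)))) (F2 G \<phi>) =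
                  Hc L (F2 H \<phi>) (Idc L (t (Src K (SrcC K \<phi>)))))"

definition two_adjunction ::
    "('o, 'm, 'c) twocat \<Rightarrow> ('p, 'n, 'd) twocat \<Rightarrow> ('o, 'm, 'c, 'p, 'n, 'd) twofun \<Rightarrow>
     ('p, 'n, 'd, 'o, 'm, 'c) twofun \<Rightarrow> ('o \<Rightarrow> 'm) \<Rightarrow> ('p \<Rightarrow> 'n) \<Rightarrow> bool" where
  "two_adjunction K L H U \<eta> \<epsilon> \<longleftrightarrow>
     two_functor K L H \<and> two_functor L K U \<and>
     two_natural K K id_fun (comp_fun U H) \<eta> \<and>
     two_natural L L (comp_fun H U) id_fun \<epsilon> \<and>
     (\<forall>A\<in>Ob K. Cmp L (\<epsilon> (F0 H A)) (F1 H (\<eta> A)) = Idm L (F0 H A)) \<and>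
     (\<forall>B\<in>Ob L. Cmp K (F1 U (\<epsilon> B)) (\<eta> (F0 U B)) = Idm K (F0 U B))"

text \<open>
  \<open>u : x \<rightarrow> U c\<close> is a universal arrow when \<open>k \<mapsto> U(k) u\<close> is an isomorphism from the category
  \<open>A(c, b)\<close> to the category \<open>X(x, U b)\<close>, i.e. bijective on 1-cells and on 2-cells, for all \<open>b\<close>.
\<close>

definition universal_arrow ::
    "('o, 'm, 'c) twocat \<Rightarrow> ('p, 'n, 'd) twocat \<Rightarrow> ('o, 'm, 'c, 'p, 'n, 'd) twofun \<Rightarrow>
     'p \<Rightarrow> 'o \<Rightarrow> 'n \<Rightarrow> bool" where
  "universal_arrow A X U x c u \<longleftrightarrow>
     c \<in> Ob A \<and> u \<in> hom X x (F0 U c) \<and>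
     (\<forall>b\<in>Ob A.
        bij_betw (\<lambda>k. Cmp X (F1 U k) u) (hom A c b) (hom X x (F0 U b)) \<and>
        bij_betw (\<lambda>\<phi>. Hc X (F2 U \<phi>) (Idc X u)) (hom_cells A c b) (hom_cells X x (F0 U b)))"

section \<open>2-monads and their algebras\<close>

record ('o, 'm, 'c) twomonad =
  fnc :: "('o, 'm, 'c, 'o, 'm, 'c) twofun"
  eta :: "'o \<Rightarrow> 'm"
  mu :: "'o \<Rightarrow> 'm"

definition two_monad :: "('o, 'm, 'c) twocat \<Rightarrow> ('o, 'm, 'c) twomonad \<Rightarrow> bool" where
  "two_monad K T \<longleftrightarrow>
     two_functor K K (fnc T) \<and>
     two_natural K K id_fun (fnc T) (eta T) \<and>
     two_natural K K (comp_fun (fnc T) (fnc T)) (fnc T) (mu T) \<and>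
     (\<forall>A\<in>Ob K. Cmp K (mu T A) (eta T (F0 (fnc T) A)) = Idm K (F0 (fnc T) A) \<and>
                Cmp K (mu T A) (F1 (fnc T) (eta T A)) = Idm K (F0 (fnc T) A) \<and>
                Cmp K (mu T A) (mu T (F0 (fnc T) A)) = Cmp K (mu T A) (F1 (fnc T) (mu T A)))"

definition two_monad_morphism ::
    "('o, 'm, 'c) twocat \<Rightarrow> ('o, 'm, 'c) twomonad \<Rightarrow> ('o, 'm, 'c) twomonad \<Rightarrow> ('o \<Rightarrow> 'm) \<Rightarrow> bool" where
  "two_monad_morphism K T Q q \<longleftrightarrow>
     two_natural K K (fnc T) (fnc Q) q \<and>
     (\<forall>A\<in>Ob K. Cmp K (q A) (eta T A) = eta Q A \<and>
                Cmp K (q A) (mu T A) =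
                  Cmp K (mu Q A) (Cmp K (q (F0 (fnc Q) A)) (F1 (fnc T) (q A))))"

text \<open>A strict algebra is a pair \<open>(A, a)\<close> of an object and its action \<open>a : T A \<rightarrow> A\<close>.\<close>

definition algs :: "('o, 'm, 'c) twocat \<Rightarrow> ('o, 'm, 'c) twomonad \<Rightarrow> ('o \<times> 'm) set" where
  "algs K T = {(A, a). A \<in> Ob K \<and> a \<in> hom K (F0 (fnc T) A) A \<and>
     Cmp K a (eta T A) = Idm K A \<and> Cmp K a (mu T A) = Cmp K a (F1 (fnc T) a)}"

record ('o, 'm, 'c) lmor =
  msrc :: "'o \<times> 'm"
  mtgt :: "'o \<times> 'm"
  und :: 'm
  coh :: 'c

record ('o, 'm, 'c) acell =
  csrc :: "('o, 'm, 'c) lmor"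
  ctgt :: "('o, 'm, 'c) lmor"
  cund :: 'c

definition lax_mors ::
    "('o, 'm, 'c) twocat \<Rightarrow> ('o, 'm, 'c) twomonad \<Rightarrow> ('o, 'm, 'c) lmor set" where
  "lax_mors K T = {m. msrc m \<in> algs K T \<and> mtgt m \<in> algs K T \<and>
     (let (A, a) = msrc m; (B, b) = mtgt m; g = und m; g' = coh m in
        g \<in> hom K A B \<and>
        g' \<in> cells K (Cmp K b (F1 (fnc T) g)) (Cmp K g a) \<and>
        Hc K g' (Idc K (eta T A)) = Idc K g \<and>
        Hc K g' (Idc K (mu T A)) =
          Vc K (Hc K g' (Idc K (F1 (fnc T) a))) (Hc K (Idc K b) (F2 (fnc T) g')))}"

definition alg_cells ::
    "('o, 'm, 'c) twocat \<Rightarrow> ('o, 'm, 'c) twomonad \<Rightarrow> ('o, 'm, 'c) acell set" where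
  "alg_cells K T = {c. csrc c \<in> lax_mors K T \<and> ctgt c \<in> lax_mors K T \<and>
     msrc (ctgt c) = msrc (csrc c) \<and> mtgt (ctgt c) = mtgt (csrc c) \<and>
     (let (A, a) = msrc (csrc c); (B, b) = mtgt (csrc c); \<phi> = cund c in
        \<phi> \<in> cells K (und (csrc c)) (und (ctgt c)) \<and>
        Vc K (coh (ctgt c)) (Hc K (Idc K b) (F2 (fnc T) \<phi>)) =
          Vc K (Hc K \<phi> (Idc K a)) (coh (csrc c)))}"

definition alg_id :: "('o, 'm, 'c) twocat \<Rightarrow> 'o \<times> 'm \<Rightarrow> ('o, 'm, 'c) lmor" where
  "alg_id K X = \<lparr>msrc = X, mtgt = X, und = Idm K (fst X), coh = Idc K (snd X)\<rparr>"

definition alg_comp ::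
    "('o, 'm, 'c) twocat \<Rightarrow> ('o, 'm, 'c) twomonad \<Rightarrow>
     ('o, 'm, 'c) lmor \<Rightarrow> ('o, 'm, 'c) lmor \<Rightarrow> ('o, 'm, 'c) lmor" where
  "alg_comp K T n m = \<lparr>msrc = msrc m, mtgt = mtgt n, und = Cmp K (und n) (und m),
     coh = Vc K (Hc K (Idc K (und n)) (coh m)) (Hc K (coh n) (Idc K (F1 (fnc T) (und m))))\<rparr>"

text \<open>The 2-categories of strict algebras with lax, pseudo and strict morphisms.\<close>

type_synonym ('o, 'm, 'c) alg_twocat =
  "('o \<times> 'm, ('o, 'm, 'c) lmor, ('o, 'm, 'c) acell) twocat"

definition Alg_l :: "('o, 'm, 'c) twocat \<Rightarrow> ('o, 'm, 'c) twomonad \<Rightarrow> ('o, 'm, 'c) alg_twocat" where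
  "Alg_l K T =
    \<lparr>Ob = algs K T, Mor = lax_mors K T, Cell = alg_cells K T,
     Src = msrc, Tgt = mtgt, Idm = alg_id K, Cmp = alg_comp K T,
     SrcC = csrc, TgtC = ctgt,
     Idc = (\<lambda>m. \<lparr>csrc = m, ctgt = m, cund = Idc K (und m)\<rparr>),
     Vc = (\<lambda>d c. \<lparr>csrc = csrc c, ctgt = ctgt d, cund = Vc K (cund d) (cund c)\<rparr>),
     Hc = (\<lambda>d c. \<lparr>csrc = alg_comp K T (csrc d) (csrc c), ctgt = alg_comp K T (ctgt d) (ctgt c),
                  cund = Hc K (cund d) (cund c)\<rparr>)\<rparr>"

definition Alg :: "('o, 'm, 'c) twocat \<Rightarrow> ('o, 'm, 'c) twomonad \<Rightarrow> ('o, 'm, 'c) alg_twocat" where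
  "Alg K T = restrict_mor (Alg_l K T) (\<lambda>m. invertible_cell K (coh m))"

definition Alg_s :: "('o, 'm, 'c) twocat \<Rightarrow> ('o, 'm, 'c) twomonad \<Rightarrow> ('o, 'm, 'c) alg_twocat" where
  "Alg_s K T = restrict_mor (Alg_l K T) (\<lambda>m. coh m = Idc K (Cmp K (und m) (snd (msrc m))))"

section \<open>Adjunctions of 2-monads and internal algebra classifiers\<close>

text \<open>
  An adjunction of 2-monads \<open>G : (L, S) \<rightarrow> (K, T)\<close> consists of \<open>G\<^sub>! : L \<rightarrow> K\<close> with right adjoint
  \<open>G\<^sup>* : K \<rightarrow> L\<close> and a coherence \<open>S G\<^sup>* \<rightarrow> G\<^sup>* T\<close>, subject to \<open>monad_adjunction\<close>.  Induced algebras and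
  classifiers depend only on \<open>G\<^sup>*\<close> and the coherence; they are defined for arbitrary such data.
\<close>

record ('o, 'm, 'c, 'p, 'n, 'd) madj =
  ladj :: "('p, 'n, 'd, 'o, 'm, 'c) twofun"
  radj :: "('o, 'm, 'c, 'p, 'n, 'd) twofun"
  lcoh :: "'o \<Rightarrow> 'n"

definition monad_adjunction ::
    "('p, 'n, 'd) twocat \<Rightarrow> ('p, 'n, 'd) twomonad \<Rightarrow> ('o, 'm, 'c) twocat \<Rightarrow> ('o, 'm, 'c) twomonad \<Rightarrow>
     ('o, 'm, 'c, 'p, 'n, 'd) madj \<Rightarrow> bool" where
  "monad_adjunction L S K T G \<longleftrightarrow>
     (\<exists>\<eta> \<epsilon>. two_adjunction L K (ladj G) (radj G) \<eta> \<epsilon>) \<and>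
     two_natural K L (comp_fun (fnc S) (radj G)) (comp_fun (radj G) (fnc T)) (lcoh G) \<and>
     (\<forall>A\<in>Ob K.
        Cmp L (lcoh G A) (eta S (F0 (radj G) A)) = F1 (radj G) (eta T A) \<and>
        Cmp L (lcoh G A) (mu S (F0 (radj G) A)) =
          Cmp L (F1 (radj G) (mu T A))
            (Cmp L (lcoh G (F0 (fnc T) A)) (F1 (fnc S) (lcoh G A))))"

text \<open>
  The 2-functor from strict \<open>T\<close>-algebras to strict \<open>S\<close>-algebras induced by \<open>R : K \<rightarrow> L\<close> and a coherence
  \<open>l : S R \<rightarrow> R T\<close>, with its evident extension to lax morphisms.  For \<open>R = G\<^sup>*\<close>, \<open>l = G\<^sup>l\<close> it is the
  \<open>G\<close>-bar of an adjunction of 2-monads; for \<open>R\<close> the identity and \<open>l\<close> a 2-monad morphism it is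
  precomposition of actions with \<open>l\<close>.
\<close>

definition alg_lift ::
    "('p, 'n, 'd) twocat \<Rightarrow> ('o, 'm, 'c, 'p, 'n, 'd) twofun \<Rightarrow> ('o \<Rightarrow> 'n) \<Rightarrow>
     ('o \<times> 'm, ('o, 'm, 'c) lmor, ('o, 'm, 'c) acell,
      'p \<times> 'n, ('p, 'n, 'd) lmor, ('p, 'n, 'd) acell) twofun" where
  "alg_lift L R l =
    (let obj = (\<lambda>(A, a). (F0 R A, Cmp L (F1 R a) (l A)));
         mor = (\<lambda>m. \<lparr>msrc = obj (msrc m), mtgt = obj (mtgt m), und = F1 R (und m),
                     coh = Hc L (F2 R (coh m)) (Idc L (l (fst (msrc m))))\<rparr>)
     in \<lparr>F0 = obj, F1 = mor,
         F2 = (\<lambda>c. \<lparr>csrc = mor (csrc c), ctgt = mor (ctgt c), cund = F2 R (cund c)\<rparr>)\<rparr>)"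

definition G_bar ::
    "('p, 'n, 'd) twocat \<Rightarrow> ('o, 'm, 'c, 'p, 'n, 'd) madj \<Rightarrow>
     ('o \<times> 'm, ('o, 'm, 'c) lmor, ('o, 'm, 'c) acell,
      'p \<times> 'n, ('p, 'n, 'd) lmor, ('p, 'n, 'd) acell) twofun" where
  "G_bar L G = alg_lift L (radj G) (lcoh G)"

definition q_bar ::
    "('o, 'm, 'c) twocat \<Rightarrow> ('o \<Rightarrow> 'm) \<Rightarrow>
     ('o \<times> 'm, ('o, 'm, 'c) lmor, ('o, 'm, 'c) acell,
      'o \<times> 'm, ('o, 'm, 'c) lmor, ('o, 'm, 'c) acell) twofun" where
  "q_bar K q = alg_lift K id_fun q"

text \<open>
  The internal \<open>S\<close>-algebra classifier relative to \<open>G : (L, S) \<rightarrow> (K, T)\<close>: a strict \<open>T\<close>-algebra \<open>P\<close>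
  with a universal lax morphism \<open>g\<close> from \<open>e\<close> to the underlying \<open>S\<close>-algebra of \<open>P\<close>; here \<open>e\<close> is the
  terminal \<open>S\<close>-algebra.
\<close>

definition classifier ::
    "('p, 'n, 'd) twocat \<Rightarrow> ('p, 'n, 'd) twomonad \<Rightarrow> ('o, 'm, 'c) twocat \<Rightarrow> ('o, 'm, 'c) twomonad \<Rightarrow>
     ('o, 'm, 'c, 'p, 'n, 'd) madj \<Rightarrow> 'p \<times> 'n \<Rightarrow> 'o \<times> 'm \<Rightarrow> ('p, 'n, 'd) lmor \<Rightarrow> bool" where
  "classifier L S K T G e P g \<longleftrightarrow>
     universal_arrow (Alg_s K T) (Alg_l L S) (G_bar L G) e P g"

section \<open>Small sets\<close>

text \<open>
  Small sets are the subsets of a type \<open>'u\<close>, and categories, operads and algebras are small in this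
  sense.  The type must be able to code tuples, so that \<open>T X\<close> is again small; it is infinite, hence the
  quotients \<open>T/\<Sigma>\<close>, the reflections and the classifiers of operads in \<open>'u\<close> also have copies in \<open>'u\<close>.  An
  arbitrary type \<open>'a\<close> embeds, as the set of atoms, in the instance \<open>'a tuples\<close> below.
\<close>

class small =
  fixes enc :: "nat list \<times> 'a list \<Rightarrow> 'a"
  assumes inj_enc: "inj enc"

definition dec :: "'u::small \<Rightarrow> nat list \<times> 'u list" where
  "dec = inv enc"

lemma dec_enc [simp]: "dec (enc p) = p"
  by (simp add: dec_def inj_enc)

datatype 'a tuples = Atom 'a | Tup "nat list" "'a tuples list"

instantiation tuples :: (type) small
begin

definition enc_tuples :: "nat list \<times> 'a tuples list \<Rightarrow> 'a tuples" where
  "enc_tuples p = Tup (fst p) (snd p)"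

instance
  by standard (auto simp: enc_tuples_def inj_def)

end

section \<open>The 2-category of categories over a set\<close>

text \<open>
  An object of \<open>Cat/J\<close> is a category with a functor to the discrete category \<open>J\<close>, given by the colour
  \<open>Col X x\<close> of each object.  Outside of the stated carriers the operations have no meaning.
\<close>

record 'u cat =
  Obj :: "'u set"
  Arr :: "'u set"
  Dom :: "'u \<Rightarrow> 'u"
  Cod :: "'u \<Rightarrow> 'u"
  Ide :: "'u \<Rightarrow> 'u"
  Com :: "'u \<Rightarrow> 'u \<Rightarrow> 'u"
  Col :: "'u \<Rightarrow> 'u"

definition cat_over :: "'u set \<Rightarrow> 'u cat \<Rightarrow> bool" where
  "cat_over J X \<longleftrightarrow>
     (\<forall>f\<in>Arr X. Dom X f \<in> Obj X \<and> Cod X f \<in> Obj X \<and> Col X (Dom X f) = Col X (Cod X f)) \<and>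
     (\<forall>x\<in>Obj X. Col X x \<in> J \<and> Ide X x \<in> Arr X \<and> Dom X (Ide X x) = x \<and> Cod X (Ide X x) = x) \<and>
     (\<forall>f\<in>Arr X. Com X f (Ide X (Dom X f)) = f \<and> Com X (Ide X (Cod X f)) f = f) \<and>
     (\<forall>f\<in>Arr X. \<forall>g\<in>Arr X. Cod X f = Dom X g \<longrightarrow>
        Com X g f \<in> Arr X \<and> Dom X (Com X g f) = Dom X f \<and> Cod X (Com X g f) = Cod X g) \<and>
     (\<forall>f\<in>Arr X. \<forall>g\<in>Arr X. \<forall>h\<in>Arr X. Cod X f = Dom X g \<longrightarrow> Cod X g = Dom X h \<longrightarrow>
        Com X h (Com X g f) = Com X (Com X h g) f)"

record 'u func =
  fsrc :: "'u cat"
  ftgt :: "'u cat"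
  fob :: "'u \<Rightarrow> 'u"
  far :: "'u \<Rightarrow> 'u"

definition func_over :: "'u set \<Rightarrow> 'u func \<Rightarrow> bool" where
  "func_over J H \<longleftrightarrow>
     (let X = fsrc H; Y = ftgt H in
       cat_over J X \<and> cat_over J Y \<and>
       fob H \<in> Obj X \<rightarrow>\<^sub>E Obj Y \<and> far H \<in> Arr X \<rightarrow>\<^sub>E Arr Y \<and>
       (\<forall>x\<in>Obj X. Col Y (fob H x) = Col X x \<and> far H (Ide X x) = Ide Y (fob H x)) \<and>
       (\<forall>f\<in>Arr X. Dom Y (far H f) = fob H (Dom X f) \<and> Cod Y (far H f) = fob H (Cod X f)) \<and>
       (\<forall>f\<in>Arr X. \<forall>g\<in>Arr X. Cod X f = Dom X g \<longrightarrow>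
          far H (Com X g f) = Com Y (far H g) (far H f)))"

text \<open>Functors are built from maps on objects and arrows cut down to the carriers.\<close>

definition mk_func :: "'u cat \<Rightarrow> 'u cat \<Rightarrow> ('u \<Rightarrow> 'u) \<Rightarrow> ('u \<Rightarrow> 'u) \<Rightarrow> 'u func" where
  "mk_func X Y p r = \<lparr>fsrc = X, ftgt = Y, fob = restrict p (Obj X), far = restrict r (Arr X)\<rparr>"

record 'u ntrans =
  nsrc :: "'u func"
  ntgt :: "'u func"
  ncmp :: "'u \<Rightarrow> 'u"

text \<open>Since \<open>J\<close> is discrete, every natural transformation lies over the identity.\<close>

definition ntrans_over :: "'u set \<Rightarrow> 'u ntrans \<Rightarrow> bool" where
  "ntrans_over J t \<longleftrightarrow>
     (let G = nsrc t; H = ntgt t; X = fsrc G; Y = ftgt G in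
       func_over J G \<and> func_over J H \<and> fsrc H = X \<and> ftgt H = Y \<and>
       ncmp t \<in> Obj X \<rightarrow>\<^sub>E Arr Y \<and>
       (\<forall>x\<in>Obj X. Dom Y (ncmp t x) = fob G x \<and> Cod Y (ncmp t x) = fob H x) \<and>
       (\<forall>f\<in>Arr X. Com Y (ncmp t (Cod X f)) (far G f) = Com Y (far H f) (ncmp t (Dom X f))))"

definition mk_ntrans :: "'u func \<Rightarrow> 'u func \<Rightarrow> ('u \<Rightarrow> 'u) \<Rightarrow> 'u ntrans" where
  "mk_ntrans G H t = \<lparr>nsrc = G, ntgt = H, ncmp = restrict t (Obj (fsrc G))\<rparr>"

definition func_comp :: "'u func \<Rightarrow> 'u func \<Rightarrow> 'u func" where
  "func_comp H G = mk_func (fsrc G) (ftgt H) (fob H \<circ> fob G) (far H \<circ> far G)"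

type_synonym 'u over_cat = "('u cat, 'u func, 'u ntrans) twocat"
type_synonym 'u over_monad = "('u cat, 'u func, 'u ntrans) twomonad"
type_synonym 'u over_fun = "('u cat, 'u func, 'u ntrans, 'u cat, 'u func, 'u ntrans) twofun"
type_synonym 'u over_madj = "('u cat, 'u func, 'u ntrans, 'u cat, 'u func, 'u ntrans) madj"

definition over :: "'u set \<Rightarrow> 'u over_cat" where
  "over J =
    \<lparr>Ob = Collect (cat_over J), Mor = Collect (func_over J), Cell = Collect (ntrans_over J),
     Src = fsrc, Tgt = ftgt,
     Idm = (\<lambda>X. mk_func X X (\<lambda>x. x) (\<lambda>f. f)),
     Cmp = func_comp,
     SrcC = nsrc, TgtC = ntgt,
     Idc = (\<lambda>H. mk_ntrans H H (\<lambda>x. Ide (ftgt H) (fob H x))),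
     Vc = (\<lambda>s t. mk_ntrans (nsrc t) (ntgt s) (\<lambda>x. Com (ftgt (nsrc t)) (ncmp s x) (ncmp t x))),
     Hc = (\<lambda>s t. mk_ntrans (func_comp (nsrc s) (nsrc t)) (func_comp (ntgt s) (ntgt t))
             (\<lambda>x. Com (ftgt (nsrc s)) (ncmp s (fob (ntgt t) x)) (far (nsrc s) (ncmp t x))))\<rparr>"

text \<open>The terminal object of \<open>Cat/J\<close>, and the terminal algebra of a 2-monad on \<open>Cat/J\<close>.\<close>

definition terminal_over :: "'u set \<Rightarrow> 'u cat" where
  "terminal_over J = \<lparr>Obj = J, Arr = J, Dom = (\<lambda>j. j), Cod = (\<lambda>j. j), Ide = (\<lambda>j. j),
                      Com = (\<lambda>j i. j), Col = (\<lambda>j. j)\<rparr>"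

definition terminal_alg :: "'u set \<Rightarrow> 'u over_monad \<Rightarrow> 'u cat \<times> 'u func" where
  "terminal_alg J T = (let E = terminal_over J; X = F0 (fnc T) E
     in (E, mk_func X E (Col X) (\<lambda>f. Col X (Dom X f))))"

section \<open>Operads\<close>

text \<open>
  A permutation \<open>\<rho>\<close> of \<open>{0,\<dots>,n-1}\<close> is the list of its values; \<open>perm_inv\<close> inverts it.
\<close>

definition perms :: "nat \<Rightarrow> nat list set" where
  "perms n = {\<rho>. length \<rho> = n \<and> distinct \<rho> \<and> set \<rho> = {..<n}}"

definition perm_inv :: "nat list \<Rightarrow> nat list" where
  "perm_inv \<rho> = map (\<lambda>m. THE k. k < length \<rho> \<and> \<rho> ! k = m) [0..<length \<rho>]"

definition perm_comp :: "nat list \<Rightarrow> nat list \<Rightarrow> nat list" where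
  "perm_comp \<sigma> \<rho> = map (\<lambda>k. \<sigma> ! k) \<rho>"

text \<open>
  Substitution of permutations: \<open>block_perm \<rho> [\<rho>\<^sub>0, \<dots>]\<close> sends the \<open>l\<close>-th position of the \<open>k\<close>-th block to
  the \<open>\<rho>\<^sub>k(l)\<close>-th position of the \<open>\<rho>(k)\<close>-th block.  The \<open>m\<close>-th block of the codomain has the length of
  the \<open>\<rho>\<^sup>-\<^sup>1(m)\<close>-th block of the domain.
\<close>

definition block_perm :: "nat list \<Rightarrow> nat list list \<Rightarrow> nat list" where
  "block_perm \<rho> \<rho>s = concat (map (\<lambda>k. map (\<lambda>l. (\<Sum>m<\<rho> ! k. length (\<rho>s ! (perm_inv \<rho> ! m))) + l) (\<rho>s ! k))
                       [0..<length \<rho>])"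

record 'u operad =
  colours :: "'u set"
  ops :: "'u set"
  ins :: "'u \<Rightarrow> 'u list"
  out :: "'u \<Rightarrow> 'u"
  unt :: "'u \<Rightarrow> 'u"
  sub :: "'u \<Rightarrow> 'u list \<Rightarrow> 'u"
  act :: "'u \<Rightarrow> nat list \<Rightarrow> 'u"

definition plugs :: "'u operad \<Rightarrow> 'u \<Rightarrow> 'u list \<Rightarrow> bool" where
  "plugs T \<alpha> \<beta>s \<longleftrightarrow> \<alpha> \<in> ops T \<and> set \<beta>s \<subseteq> ops T \<and> map (out T) \<beta>s = ins T \<alpha>"

definition operad :: "'u operad \<Rightarrow> bool" where
  "operad T \<longleftrightarrow>
     (\<forall>\<alpha>\<in>ops T. set (ins T \<alpha>) \<subseteq> colours T \<and> out T \<alpha> \<in> colours T) \<and>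
     (\<forall>j\<in>colours T. unt T j \<in> ops T \<and> ins T (unt T j) = [j] \<and> out T (unt T j) = j) \<and>
     (\<forall>\<alpha> \<beta>s. plugs T \<alpha> \<beta>s \<longrightarrow> sub T \<alpha> \<beta>s \<in> ops T \<and>
        ins T (sub T \<alpha> \<beta>s) = concat (map (ins T) \<beta>s) \<and> out T (sub T \<alpha> \<beta>s) = out T \<alpha>) \<and>
     (\<forall>\<alpha>\<in>ops T. sub T (unt T (out T \<alpha>)) [\<alpha>] = \<alpha> \<and> sub T \<alpha> (map (unt T) (ins T \<alpha>)) = \<alpha>) \<and>
     (\<forall>\<alpha> \<beta>s \<gamma>ss. plugs T \<alpha> \<beta>s \<longrightarrow> list_all2 (plugs T) \<beta>s \<gamma>ss \<longrightarrow>
        sub T (sub T \<alpha> \<beta>s) (concat \<gamma>ss) = sub T \<alpha> (map2 (sub T) \<beta>s \<gamma>ss)) \<and>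
     (\<forall>\<alpha>\<in>ops T. \<forall>\<rho>\<in>perms (length (ins T \<alpha>)). act T \<alpha> \<rho> \<in> ops T \<and>
        ins T (act T \<alpha> \<rho>) = map (\<lambda>k. ins T \<alpha> ! k) \<rho> \<and> out T (act T \<alpha> \<rho>) = out T \<alpha>) \<and>
     (\<forall>\<alpha>\<in>ops T. act T \<alpha> [0..<length (ins T \<alpha>)] = \<alpha>) \<and>
     (\<forall>\<alpha>\<in>ops T. \<forall>\<rho>\<in>perms (length (ins T \<alpha>)). \<forall>\<sigma>\<in>perms (length (ins T \<alpha>)).
        act T (act T \<alpha> \<rho>) \<sigma> = act T \<alpha> (perm_comp \<rho> \<sigma>)) \<and>
     (\<forall>\<beta> \<beta>s. \<forall>\<rho>\<in>perms (length (ins T \<beta>)). \<forall>\<rho>s. plugs T \<beta> \<beta>s \<longrightarrow>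
        list_all2 (\<lambda>\<rho>' k. \<rho>' \<in> perms (length (ins T (\<beta>s ! k)))) \<rho>s \<rho> \<longrightarrow>
        sub T (act T \<beta> \<rho>) (map2 (\<lambda>\<rho>' k. act T (\<beta>s ! k) \<rho>') \<rho>s \<rho>) =
          act T (sub T \<beta> \<beta>s) (block_perm \<rho> \<rho>s))"

definition sigma_free :: "'u operad \<Rightarrow> bool" where
  "sigma_free T \<longleftrightarrow> (\<forall>\<alpha>\<in>ops T. \<forall>\<rho>\<in>perms (length (ins T \<alpha>)).
     act T \<alpha> \<rho> = \<alpha> \<longrightarrow> \<rho> = [0..<length (ins T \<alpha>)])"

definition operad_morphism :: "'u operad \<Rightarrow> 'u operad \<Rightarrow> ('u \<Rightarrow> 'u) \<Rightarrow> ('u \<Rightarrow> 'u) \<Rightarrow> bool" where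
  "operad_morphism S T f F \<longleftrightarrow>
     (\<forall>i\<in>colours S. f i \<in> colours T \<and> F (unt S i) = unt T (f i)) \<and>
     (\<forall>\<alpha>\<in>ops S. F \<alpha> \<in> ops T \<and> ins T (F \<alpha>) = map f (ins S \<alpha>) \<and> out T (F \<alpha>) = f (out S \<alpha>)) \<and>
     (\<forall>\<alpha> \<beta>s. plugs S \<alpha> \<beta>s \<longrightarrow> F (sub S \<alpha> \<beta>s) = sub T (F \<alpha>) (map F \<beta>s)) \<and>
     (\<forall>\<alpha>\<in>ops S. \<forall>\<rho>\<in>perms (length (ins S \<alpha>)). F (act S \<alpha> \<rho>) = act T (F \<alpha>) \<rho>)"

section \<open>The 2-monad of an operad\<close>

text \<open>
  The object \<open>(\<alpha>, (x\<^sub>k))\<close> of \<open>T X\<close> is \<open>tup [] \<alpha> xs\<close>.  The arrow \<open>(\<rho>, (\<gamma>\<^sub>k)) : (\<beta>\<rho>, _) \<rightarrow> (\<beta>, _)\<close> is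
  \<open>tup \<rho> \<beta> \<gamma>s\<close>: it records \<open>\<beta>\<close> so as to determine its domain and codomain.
\<close>

definition tup :: "nat list \<Rightarrow> 'u::small \<Rightarrow> 'u list \<Rightarrow> 'u" where
  "tup \<rho> \<alpha> xs = enc (\<rho>, \<alpha> # xs)"

definition prm :: "'u::small \<Rightarrow> nat list" where
  "prm u = fst (dec u)"

definition opn :: "'u::small \<Rightarrow> 'u" where
  "opn u = hd (snd (dec u))"

definition args :: "'u::small \<Rightarrow> 'u list" where
  "args u = tl (snd (dec u))"

lemma tup_simps [simp]: "prm (tup \<rho> \<alpha> xs) = \<rho>" "opn (tup \<rho> \<alpha> xs) = \<alpha>" "args (tup \<rho> \<alpha> xs) = xs"
  by (simp_all add: prm_def opn_def args_def tup_def)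

lemma tup_eq_iff [simp]: "tup \<rho> \<alpha> xs = tup \<sigma> \<beta> ys \<longleftrightarrow> \<rho> = \<sigma> \<and> \<alpha> = \<beta> \<and> xs = ys"
  using inj_enc by (auto simp: tup_def inj_def)

definition T_cat :: "'u::small operad \<Rightarrow> 'u cat \<Rightarrow> 'u cat" where
  "T_cat T X =
    \<lparr>Obj = {tup [] \<alpha> xs |\<alpha> xs. \<alpha> \<in> ops T \<and> set xs \<subseteq> Obj X \<and> map (Col X) xs = ins T \<alpha>},
     Arr = {tup \<rho> \<beta> \<gamma>s |\<rho> \<beta> \<gamma>s. \<beta> \<in> ops T \<and> \<rho> \<in> perms (length (ins T \<beta>)) \<and> set \<gamma>s \<subseteq> Arr X \<and>
              map (\<lambda>\<gamma>. Col X (Cod X \<gamma>)) \<gamma>s = map (\<lambda>k. ins T \<beta> ! k) \<rho>},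
     Dom = (\<lambda>u. tup [] (act T (opn u) (prm u)) (map (Dom X) (args u))),
     Cod = (\<lambda>u. tup [] (opn u) (map (\<lambda>k. Cod X (args u ! k)) (perm_inv (prm u)))),
     Ide = (\<lambda>u. tup [0..<length (args u)] (opn u) (map (Ide X) (args u))),
     Com = (\<lambda>v u. tup (perm_comp (prm v) (prm u)) (opn v)
                     (map2 (\<lambda>k \<gamma>. Com X (args v ! k) \<gamma>) (prm u) (args u))),
     Col = (\<lambda>u. out T (opn u))\<rparr>"

definition T_fun :: "'u::small operad \<Rightarrow> 'u over_fun" where
  "T_fun T =
    (let mor = (\<lambda>H. mk_func (T_cat T (fsrc H)) (T_cat T (ftgt H))
                      (\<lambda>u. tup [] (opn u) (map (fob H) (args u)))
                      (\<lambda>u. tup (prm u) (opn u) (map (far H) (args u))))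
     in \<lparr>F0 = T_cat T, F1 = mor,
         F2 = (\<lambda>t. mk_ntrans (mor (nsrc t)) (mor (ntgt t))
                     (\<lambda>u. tup [0..<length (args u)] (opn u) (map (ncmp t) (args u))))\<rparr>)"

definition T_monad :: "'u::small operad \<Rightarrow> 'u over_monad" where
  "T_monad T =
    \<lparr>fnc = T_fun T,
     eta = (\<lambda>X. mk_func X (T_cat T X)
             (\<lambda>x. tup [] (unt T (Col X x)) [x])
             (\<lambda>\<gamma>. tup [0] (unt T (Col X (Cod X \<gamma>))) [\<gamma>])),
     mu = (\<lambda>X. mk_func (T_cat T (T_cat T X)) (T_cat T X)
            (\<lambda>u. tup [] (sub T (opn u) (map opn (args u))) (concat (map args (args u))))
            (\<lambda>u. tup (block_perm (prm u) (map prm (args u)))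
                     (sub T (opn u) (map (\<lambda>k. opn (args u ! k)) (perm_inv (prm u))))
                     (concat (map args (args u)))))\<rparr>"

text \<open>
  The arrow \<open>(\<rho>, (1)) : (\<alpha>\<rho>, (x\<^bsub>\<rho>k\<^esub>)) \<rightarrow> (\<alpha>, (x\<^sub>k))\<close> of \<open>T X\<close>, where \<open>u = (\<alpha>, (x\<^sub>k))\<close>.
\<close>

definition perm_arrow :: "'u::small cat \<Rightarrow> nat list \<Rightarrow> 'u \<Rightarrow> 'u" where
  "perm_arrow X \<rho> u = tup \<rho> (opn u) (map (\<lambda>k. Ide X (args u ! k)) \<rho>)"

definition kills_perms :: "'u::small operad \<Rightarrow> 'u cat \<Rightarrow> 'u func \<Rightarrow> bool" where
  "kills_perms T X H \<longleftrightarrow>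
     (\<forall>u\<in>Obj (T_cat T X). \<forall>\<rho>\<in>perms (length (args u)).
        far H (perm_arrow X \<rho> u) = Ide (ftgt H) (fob H u))"

text \<open>
  \<open>quotient_monad T Q q\<close>: the 2-monad \<open>Q\<close> together with \<open>q : T \<rightarrow> Q\<close> is \<open>T/\<Sigma>\<close> with \<open>q\<^sub>T\<close>.
\<close>

definition quotient_monad :: "'u::small operad \<Rightarrow> 'u over_monad \<Rightarrow> ('u cat \<Rightarrow> 'u func) \<Rightarrow> bool" where
  "quotient_monad T Q q \<longleftrightarrow>
     (let K = over (colours T) in
       two_monad K Q \<and> two_monad_morphism K (T_monad T) Q q \<and>
       (\<forall>X\<in>Ob K. kills_perms T X (q X) \<and>
          (\<forall>Z\<in>Ob K. \<forall>H\<in>hom K (T_cat T X) Z. kills_perms T X H \<longrightarrow>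
             (\<exists>!H'. H' \<in> hom K (F0 (fnc Q) X) Z \<and> Cmp K H' (q X) = H))))"

section \<open>The adjunctions of 2-monads of an operad morphism\<close>

definition Sigma_fun :: "('u \<Rightarrow> 'u) \<Rightarrow> 'u over_fun" where
  "Sigma_fun f =
    (let obj = (\<lambda>X. X\<lparr>Col := f \<circ> Col X\<rparr>);
         mor = (\<lambda>H. H\<lparr>fsrc := obj (fsrc H), ftgt := obj (ftgt H)\<rparr>)
     in \<lparr>F0 = obj, F1 = mor, F2 = (\<lambda>t. t\<lparr>nsrc := mor (nsrc t), ntgt := mor (ntgt t)\<rparr>)\<rparr>)"

text \<open>
  The pullback of \<open>Y\<close> along \<open>f : I \<rightarrow> J\<close> consists of the pairs \<open>pr i y\<close> with \<open>y\<close> of colour \<open>f i\<close>.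
\<close>

definition pr :: "'u::small \<Rightarrow> 'u \<Rightarrow> 'u" where
  "pr i y = tup [] i [y]"

definition pr1 :: "'u::small \<Rightarrow> 'u" where
  "pr1 u = opn u"

definition pr2 :: "'u::small \<Rightarrow> 'u" where
  "pr2 u = hd (args u)"

lemma pr_simps [simp]: "pr1 (pr i y) = i" "pr2 (pr i y) = y"
  by (simp_all add: pr_def pr1_def pr2_def)

definition Delta_cat :: "'u::small set \<Rightarrow> ('u \<Rightarrow> 'u) \<Rightarrow> 'u cat \<Rightarrow> 'u cat" where
  "Delta_cat I f Y =
    \<lparr>Obj = {pr i y |i y. i \<in> I \<and> y \<in> Obj Y \<and> Col Y y = f i},
     Arr = {pr i g |i g. i \<in> I \<and> g \<in> Arr Y \<and> Col Y (Cod Y g) = f i},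
     Dom = (\<lambda>u. pr (pr1 u) (Dom Y (pr2 u))),
     Cod = (\<lambda>u. pr (pr1 u) (Cod Y (pr2 u))),
     Ide = (\<lambda>u. pr (pr1 u) (Ide Y (pr2 u))),
     Com = (\<lambda>v u. pr (pr1 u) (Com Y (pr2 v) (pr2 u))),
     Col = pr1\<rparr>"

definition Delta_fun :: "'u::small set \<Rightarrow> ('u \<Rightarrow> 'u) \<Rightarrow> 'u over_fun" where
  "Delta_fun I f =
    (let mor = (\<lambda>H. mk_func (Delta_cat I f (fsrc H)) (Delta_cat I f (ftgt H))
                      (\<lambda>u. pr (pr1 u) (fob H (pr2 u))) (\<lambda>u. pr (pr1 u) (far H (pr2 u))))
     in \<lparr>F0 = Delta_cat I f, F1 = mor,
         F2 = (\<lambda>t. mk_ntrans (mor (nsrc t)) (mor (ntgt t))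
                     (\<lambda>u. pr (pr1 u) (ncmp t (pr2 u))))\<rparr>)"

definition F_coh ::
    "'u::small operad \<Rightarrow> 'u operad \<Rightarrow> ('u \<Rightarrow> 'u) \<Rightarrow> ('u \<Rightarrow> 'u) \<Rightarrow> 'u cat \<Rightarrow> 'u func" where
  "F_coh S T f F Y =
     mk_func (T_cat S (Delta_cat (colours S) f Y)) (Delta_cat (colours S) f (T_cat T Y))
       (\<lambda>u. pr (out S (opn u)) (tup [] (F (opn u)) (map pr2 (args u))))
       (\<lambda>u. pr (out S (opn u)) (tup (prm u) (F (opn u)) (map pr2 (args u))))"

definition adj_F ::
    "'u::small operad \<Rightarrow> 'u operad \<Rightarrow> ('u \<Rightarrow> 'u) \<Rightarrow> ('u \<Rightarrow> 'u) \<Rightarrow> 'u over_madj" where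
  "adj_F S T f F =
     \<lparr>ladj = Sigma_fun f, radj = Delta_fun (colours S) f, lcoh = F_coh S T f F\<rparr>"

definition adj_qF ::
    "'u::small operad \<Rightarrow> 'u operad \<Rightarrow> ('u \<Rightarrow> 'u) \<Rightarrow> ('u \<Rightarrow> 'u) \<Rightarrow> ('u cat \<Rightarrow> 'u func) \<Rightarrow>
     'u over_madj" where
  "adj_qF S T f F qT =
     \<lparr>ladj = Sigma_fun f, radj = Delta_fun (colours S) f,
      lcoh = (\<lambda>Y. Cmp (over (colours S)) (F1 (Delta_fun (colours S) f) (qT Y)) (F_coh S T f F Y))\<rparr>"

text \<open>\<open>F/\<Sigma>\<close>, with \<open>FQ\<close> the coherence singled out by \<open>quotient_coherence\<close>.\<close>

definition adj_FQ ::
    "'u::small operad \<Rightarrow> ('u \<Rightarrow> 'u) \<Rightarrow> ('u cat \<Rightarrow> 'u func) \<Rightarrow> 'u over_madj" where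
  "adj_FQ S f FQ = \<lparr>ladj = Sigma_fun f, radj = Delta_fun (colours S) f, lcoh = FQ\<rparr>"

definition quotient_coherence ::
    "'u::small operad \<Rightarrow> 'u operad \<Rightarrow> ('u \<Rightarrow> 'u) \<Rightarrow> ('u \<Rightarrow> 'u) \<Rightarrow>
     'u over_monad \<Rightarrow> ('u cat \<Rightarrow> 'u func) \<Rightarrow> 'u over_monad \<Rightarrow> ('u cat \<Rightarrow> 'u func) \<Rightarrow>
     ('u cat \<Rightarrow> 'u func) \<Rightarrow> bool" where
  "quotient_coherence S T f F SQ qS TQ qT FQ \<longleftrightarrow>
     (let \<Delta> = Delta_fun (colours S) f in
       two_natural (over (colours T)) (over (colours S))
         (comp_fun (fnc SQ) \<Delta>) (comp_fun \<Delta> (fnc TQ)) FQ \<and>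
       (\<forall>Y\<in>Ob (over (colours T)).
          Cmp (over (colours S)) (FQ Y) (qS (F0 \<Delta> Y)) =
          Cmp (over (colours S)) (F1 \<Delta> (qT Y)) (F_coh S T f F Y)))"

end

theory Submission
  imports Defs
begin

text \<open>
  The functor \<open>q : TX \<rightarrow> (T/\<Sigma>)X\<close> is surjective on objects and on arrows, and it identifies two objects only if they
  differ by a permutation.  Hence lax \<open>S\<close>-morphisms between commutative algebras are the same as lax
  \<open>S/\<Sigma>\<close>-morphisms, so that \<open>(T/\<Sigma>)\<^sup>S\<close>, \<open>(T/\<Sigma>)\<^bsup>S/\<Sigma>\<^esup>\<close> and \<open>C\<^sub>T(T\<^sup>S)\<close> represent the same functor.

  For the equivalence, the universal property of \<open>A = T\<^sup>S\<close>, applied to chaotic algebras, yields a section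
  \<open>\<tau>\<close> on objects of the action \<open>a : TA \<rightarrow> A\<close> that is compatible with the operations.  If \<open>T\<close> is \<open>\<Sigma>\<close>-free, the
  images under \<open>a\<close> of the permutation arrows between the objects \<open>\<tau>(x)\<close> form a subgroupoid of \<open>A\<close> with at
  most one arrow between any two objects, closed under the operations.  Dividing it out gives an
  equivalent commutative algebra with the universal property of \<open>C\<^sub>T A\<close>.  All coherence conditions on a
  pseudo-inverse hold because they are equations between arrows of this subgroupoid.
\<close>

section \<open>Functors and natural transformations over a set\<close>

text \<open>Neither T/\<Sigma> nor the classifiers are constructed; everything is extracted from
  universal properties by means of test objects. Chaotic categories serve well, since a functor into
  one is just a colour-preserving map of objects: one of them separates the orbits in TX, and
  chaotic algebras make the objects of T^S behave as a free algebra, for the operad without its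
  symmetries, on the objects selected by the universal lax morphism. The section \<tau> comes from
  the strict morphism that sends a generator x to (1, (x)), so \<tau>(x) is the decomposition of x
  into generators. It overcomes an obstacle to thinness: an object of an algebra has many
  presentations a(z), and in a general algebra permutation arrows attached to different
  presentations can be parallel and distinct, even if T is \<Sigma>-free. Between the decompositions
  \<tau>(x) at most one permutation is possible, because \<alpha> and \<alpha>\<rho> determine
  \<rho>. The quotient is taken on representatives, so that its arrows are arrows of A and the
  inclusion supplies the pseudo-inverse.\<close>

lemma over_simps [simp]:
  "Ob (over J) = Collect (cat_over J)" "Mor (over J) = Collect (func_over J)"
  "Cell (over J) = Collect (ntrans_over J)" "Src (over J) = fsrc" "Tgt (over J) = ftgt"
  "Cmp (over J) = func_comp" "SrcC (over J) = nsrc" "TgtC (over J) = ntgt"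
  by (simp_all add: over_def)

lemma Idm_over: "Idm (over J) X = mk_func X X (\<lambda>x. x) (\<lambda>f. f)"
  and Idc_over: "Idc (over J) H = mk_ntrans H H (\<lambda>x. Ide (ftgt H) (fob H x))"
  and Vc_over: "Vc (over J) s t = mk_ntrans (nsrc t) (ntgt s) (\<lambda>x. Com (ftgt (nsrc t)) (ncmp s x) (ncmp t x))"
  and Hc_over: "Hc (over J) s t = mk_ntrans (func_comp (nsrc s) (nsrc t)) (func_comp (ntgt s) (ntgt t))
     (\<lambda>x. Com (ftgt (nsrc s)) (ncmp s (fob (ntgt t) x)) (far (nsrc s) (ncmp t x)))"
  by (simp_all add: over_def)

lemma hom_over: "H \<in> hom (over J) X Y \<longleftrightarrow> func_over J H \<and> fsrc H = X \<and> ftgt H = Y"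
  by (simp add: hom_def)

lemma cells_over: "t \<in> cells (over J) G H \<longleftrightarrow> ntrans_over J t \<and> nsrc t = G \<and> ntgt t = H"
  by (simp add: cells_def)

lemma mk_func_simps [simp]:
  "fsrc (mk_func X Y p r) = X" "ftgt (mk_func X Y p r) = Y"
  "x \<in> Obj X \<Longrightarrow> fob (mk_func X Y p r) x = p x"
  "f \<in> Arr X \<Longrightarrow> far (mk_func X Y p r) f = r f"
  by (simp_all add: mk_func_def)

lemma mk_ntrans_simps [simp]:
  "nsrc (mk_ntrans G H p) = G" "ntgt (mk_ntrans G H p) = H"
  "x \<in> Obj (fsrc G) \<Longrightarrow> ncmp (mk_ntrans G H p) x = p x"
  by (simp_all add: mk_ntrans_def)

lemma Idm_over_simps [simp]:
  "fsrc (Idm (over J) X) = X" "ftgt (Idm (over J) X) = X"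
  "x \<in> Obj X \<Longrightarrow> fob (Idm (over J) X) x = x" "f \<in> Arr X \<Longrightarrow> far (Idm (over J) X) f = f"
  by (simp_all add: Idm_over)

lemma Idc_over_simps [simp]:
  "nsrc (Idc (over J) H) = H" "ntgt (Idc (over J) H) = H"
  "x \<in> Obj (fsrc H) \<Longrightarrow> ncmp (Idc (over J) H) x = Ide (ftgt H) (fob H x)"
  by (simp_all add: Idc_over)

lemma Vc_over_simps [simp]:
  "nsrc (Vc (over J) s t) = nsrc t" "ntgt (Vc (over J) s t) = ntgt s"
  "x \<in> Obj (fsrc (nsrc t)) \<Longrightarrow> ncmp (Vc (over J) s t) x = Com (ftgt (nsrc t)) (ncmp s x) (ncmp t x)"
  by (simp_all add: Vc_over)

lemma func_comp_simps [simp]: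
  "fsrc (func_comp H G) = fsrc G" "ftgt (func_comp H G) = ftgt H"
  "x \<in> Obj (fsrc G) \<Longrightarrow> fob (func_comp H G) x = fob H (fob G x)"
  "f \<in> Arr (fsrc G) \<Longrightarrow> far (func_comp H G) f = far H (far G f)"
  by (simp_all add: func_comp_def)

text \<open>The unit laws take the object as a variable with a side condition, so that they also
  rewrite identities at objects whose equality with the end of the arrow has to be derived.\<close>

lemma cat_overD:
  assumes "cat_over J X"
  shows "f \<in> Arr X \<Longrightarrow> Dom X f \<in> Obj X" "f \<in> Arr X \<Longrightarrow> Cod X f \<in> Obj X"
    "f \<in> Arr X \<Longrightarrow> Col X (Dom X f) = Col X (Cod X f)"
    "x \<in> Obj X \<Longrightarrow> Col X x \<in> J" "x \<in> Obj X \<Longrightarrow> Ide X x \<in> Arr X"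
    "x \<in> Obj X \<Longrightarrow> Dom X (Ide X x) = x" "x \<in> Obj X \<Longrightarrow> Cod X (Ide X x) = x"
    "f \<in> Arr X \<Longrightarrow> Dom X f = x \<Longrightarrow> Com X f (Ide X x) = f"
    "f \<in> Arr X \<Longrightarrow> Cod X f = x \<Longrightarrow> Com X (Ide X x) f = f"
    "f \<in> Arr X \<Longrightarrow> g \<in> Arr X \<Longrightarrow> Cod X f = Dom X g \<Longrightarrow> Com X g f \<in> Arr X"
    "f \<in> Arr X \<Longrightarrow> g \<in> Arr X \<Longrightarrow> Cod X f = Dom X g \<Longrightarrow> Dom X (Com X g f) = Dom X f"
    "f \<in> Arr X \<Longrightarrow> g \<in> Arr X \<Longrightarrow> Cod X f = Dom X g \<Longrightarrow> Cod X (Com X g f) = Cod X g"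
    "f \<in> Arr X \<Longrightarrow> g \<in> Arr X \<Longrightarrow> h \<in> Arr X \<Longrightarrow> Cod X f = Dom X g \<Longrightarrow> Cod X g = Dom X h \<Longrightarrow>
       Com X h (Com X g f) = Com X (Com X h g) f"
  using assms unfolding cat_over_def by (blast | metis)+

lemma cat_overI:
  assumes "\<And>f. f \<in> Arr X \<Longrightarrow> Dom X f \<in> Obj X \<and> Cod X f \<in> Obj X \<and> Col X (Dom X f) = Col X (Cod X f)"
    and "\<And>x. x \<in> Obj X \<Longrightarrow> Col X x \<in> J \<and> Ide X x \<in> Arr X \<and> Dom X (Ide X x) = x \<and> Cod X (Ide X x) = x"
    and "\<And>f. f \<in> Arr X \<Longrightarrow> Com X f (Ide X (Dom X f)) = f \<and> Com X (Ide X (Cod X f)) f = f"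
    and "\<And>f g. f \<in> Arr X \<Longrightarrow> g \<in> Arr X \<Longrightarrow> Cod X f = Dom X g \<Longrightarrow>
        Com X g f \<in> Arr X \<and> Dom X (Com X g f) = Dom X f \<and> Cod X (Com X g f) = Cod X g"
    and "\<And>f g h. f \<in> Arr X \<Longrightarrow> g \<in> Arr X \<Longrightarrow> h \<in> Arr X \<Longrightarrow> Cod X f = Dom X g \<Longrightarrow>
        Cod X g = Dom X h \<Longrightarrow> Com X h (Com X g f) = Com X (Com X h g) f"
  shows "cat_over J X"
  unfolding cat_over_def using assms by blast

lemma
  assumes "H \<in> hom (over J) X Y"
  shows hom_overD: "cat_over J X" "cat_over J Y" "fsrc H = X" "ftgt H = Y"
    "x \<in> Obj X \<Longrightarrow> fob H x \<in> Obj Y" "f \<in> Arr X \<Longrightarrow> far H f \<in> Arr Y"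
    "x \<in> Obj X \<Longrightarrow> Col Y (fob H x) = Col X x" "x \<in> Obj X \<Longrightarrow> far H (Ide X x) = Ide Y (fob H x)"
    "f \<in> Arr X \<Longrightarrow> Dom Y (far H f) = fob H (Dom X f)"
    "f \<in> Arr X \<Longrightarrow> Cod Y (far H f) = fob H (Cod X f)"
    "f \<in> Arr X \<Longrightarrow> g \<in> Arr X \<Longrightarrow> Cod X f = Dom X g \<Longrightarrow>
       far H (Com X g f) = Com Y (far H g) (far H f)"
    and hom_over_PiE: "fob H \<in> Obj X \<rightarrow>\<^sub>E Obj Y" "far H \<in> Arr X \<rightarrow>\<^sub>E Arr Y"
proof -
  have X: "fsrc H = X" and Y: "ftgt H = Y" and H: "func_over J H"
    using assms by (simp_all add: hom_over)
  note H' = H[unfolded func_over_def Let_def X Y]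
  have ob: "\<forall>x\<in>Obj X. Col Y (fob H x) = Col X x \<and> far H (Ide X x) = Ide Y (fob H x)"
    and ar: "\<forall>f\<in>Arr X. Dom Y (far H f) = fob H (Dom X f) \<and> Cod Y (far H f) = fob H (Cod X f)"
    and co: "\<forall>f\<in>Arr X. \<forall>g\<in>Arr X. Cod X f = Dom X g \<longrightarrow> far H (Com X g f) = Com Y (far H g) (far H f)"
    and mem: "fob H \<in> Obj X \<rightarrow>\<^sub>E Obj Y" "far H \<in> Arr X \<rightarrow>\<^sub>E Arr Y"
    and cat: "cat_over J X" "cat_over J Y"
    using H' by - (elim conjE, assumption)+
  show "fsrc H = X" "ftgt H = Y" "cat_over J X" "cat_over J Y"
    "fob H \<in> Obj X \<rightarrow>\<^sub>E Obj Y" "far H \<in> Arr X \<rightarrow>\<^sub>E Arr Y" by fact+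
  show "x \<in> Obj X \<Longrightarrow> fob H x \<in> Obj Y" "f \<in> Arr X \<Longrightarrow> far H f \<in> Arr Y"
    by (rule PiE_mem[OF mem(1)], assumption) (rule PiE_mem[OF mem(2)])
  show "x \<in> Obj X \<Longrightarrow> Col Y (fob H x) = Col X x" "x \<in> Obj X \<Longrightarrow> far H (Ide X x) = Ide Y (fob H x)"
    by (simp_all add: ob)
  show "f \<in> Arr X \<Longrightarrow> Dom Y (far H f) = fob H (Dom X f)"
    "f \<in> Arr X \<Longrightarrow> Cod Y (far H f) = fob H (Cod X f)"
    by (simp_all add: ar)
  show "f \<in> Arr X \<Longrightarrow> g \<in> Arr X \<Longrightarrow> Cod X f = Dom X g \<Longrightarrow>
       far H (Com X g f) = Com Y (far H g) (far H f)"
    using co by simp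
qed

text \<open>The object and arrow maps are extensional functions, so functors that agree on the
  carriers are equal as records.\<close>

lemma hom_over_eqI:
  assumes G: "G \<in> hom (over J) X Y" and H: "H \<in> hom (over J) X Y"
    and ob: "\<And>x. x \<in> Obj X \<Longrightarrow> fob G x = fob H x"
    and ar: "\<And>f. f \<in> Arr X \<Longrightarrow> far G f = far H f"
  shows "G = H"
proof -
  have "fob G = fob H"
    by (rule PiE_ext[OF hom_over_PiE(1)[OF G] hom_over_PiE(1)[OF H] ob])
  moreover have "far G = far H"
    by (rule PiE_ext[OF hom_over_PiE(2)[OF G] hom_over_PiE(2)[OF H] ar])
  ultimately show ?thesis
    by (intro func.equality) (simp_all add: hom_overD(3,4)[OF G] hom_overD(3,4)[OF H])
qed

lemma mk_func_hom:
  assumes "cat_over J X" "cat_over J Y"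
    "\<And>x. x \<in> Obj X \<Longrightarrow> p x \<in> Obj Y" "\<And>x. x \<in> Obj X \<Longrightarrow> Col Y (p x) = Col X x"
    "\<And>x. x \<in> Obj X \<Longrightarrow> r (Ide X x) = Ide Y (p x)"
    "\<And>f. f \<in> Arr X \<Longrightarrow> r f \<in> Arr Y"
    "\<And>f. f \<in> Arr X \<Longrightarrow> Dom Y (r f) = p (Dom X f)"
    "\<And>f. f \<in> Arr X \<Longrightarrow> Cod Y (r f) = p (Cod X f)"
    "\<And>f g. f \<in> Arr X \<Longrightarrow> g \<in> Arr X \<Longrightarrow> Cod X f = Dom X g \<Longrightarrow> r (Com X g f) = Com Y (r g) (r f)"
  shows "mk_func X Y p r \<in> hom (over J) X Y"
  unfolding hom_over func_over_def Let_def mk_func_def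
  using assms(1,2) by (simp add: assms(3-9) cat_overD[OF assms(1)])

lemma Idm_hom: "cat_over J X \<Longrightarrow> Idm (over J) X \<in> hom (over J) X X"
  unfolding Idm_over by (rule mk_func_hom) auto

lemma func_comp_hom:
  assumes G: "G \<in> hom (over J) X Y" and H: "H \<in> hom (over J) Y Z"
  shows "func_comp H G \<in> hom (over J) X Z"
proof -
  have "mk_func X Z (fob H \<circ> fob G) (far H \<circ> far G) \<in> hom (over J) X Z"
    using hom_overD[OF G] hom_overD[OF H] by (intro mk_func_hom) auto
  then show ?thesis
    using G H by (simp add: func_comp_def hom_overD(3,4))
qed

lemma func_comp_assoc:
  assumes "F \<in> hom (over J) W X" "G \<in> hom (over J) X Y" "H \<in> hom (over J) Y Z"
  shows "func_comp (func_comp H G) F = func_comp H (func_comp G F)"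
proof (rule hom_over_eqI)
  show "func_comp (func_comp H G) F \<in> hom (over J) W Z" "func_comp H (func_comp G F) \<in> hom (over J) W Z"
    using assms func_comp_hom by blast+
qed (simp_all add: hom_overD[OF assms(1)] hom_overD(3)[OF assms(2)])

lemma func_comp_Idm:
  assumes "G \<in> hom (over J) X Y"
  shows "func_comp G (Idm (over J) X) = G" "func_comp (Idm (over J) Y) G = G"
proof -
  note I = Idm_hom[OF hom_overD(1)[OF assms]] Idm_hom[OF hom_overD(2)[OF assms]]
  show "func_comp G (Idm (over J) X) = G"
    by (rule hom_over_eqI[OF func_comp_hom[OF I(1) assms] assms]) simp_all
  show "func_comp (Idm (over J) Y) G = G"
    by (rule hom_over_eqI[OF func_comp_hom[OF assms I(2)] assms]) (simp_all add: hom_overD[OF assms])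
qed

section \<open>Natural transformations and whiskering\<close>

lemma cells_overD:
  assumes "t \<in> cells (over J) G H" "G \<in> hom (over J) X Y"
  shows "H \<in> hom (over J) X Y" "nsrc t = G" "ntgt t = H"
    "x \<in> Obj X \<Longrightarrow> ncmp t x \<in> Arr Y"
    "x \<in> Obj X \<Longrightarrow> Dom Y (ncmp t x) = fob G x" "x \<in> Obj X \<Longrightarrow> Cod Y (ncmp t x) = fob H x"
    "f \<in> Arr X \<Longrightarrow> Com Y (ncmp t (Cod X f)) (far G f) = Com Y (far H f) (ncmp t (Dom X f))"
  using assms unfolding cells_over ntrans_over_def Let_def hom_over by (blast dest: PiE_mem)+

lemma cells_over_eqI:
  assumes s: "s \<in> cells (over J) G H" and t: "t \<in> cells (over J) G H" and G: "G \<in> hom (over J) X Y"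
    and eq: "\<And>x. x \<in> Obj X \<Longrightarrow> ncmp s x = ncmp t x"
  shows "s = t"
proof -
  have "ncmp s \<in> Obj X \<rightarrow>\<^sub>E Arr Y" "ncmp t \<in> Obj X \<rightarrow>\<^sub>E Arr Y"
    using s t G by (auto simp: cells_over ntrans_over_def Let_def hom_over)
  then have "ncmp s = ncmp t" using eq by (rule PiE_ext)
  then show ?thesis
    by (intro ntrans.equality) (simp_all add: cells_overD(2,3)[OF s G] cells_overD(2,3)[OF t G])
qed

lemma mk_ntrans_cells:
  assumes "G \<in> hom (over J) X Y" "H \<in> hom (over J) X Y"
    and "\<And>x. x \<in> Obj X \<Longrightarrow> t x \<in> Arr Y \<and> Dom Y (t x) = fob G x \<and> Cod Y (t x) = fob H x"
    and "\<And>f. f \<in> Arr X \<Longrightarrow> Com Y (t (Cod X f)) (far G f) = Com Y (far H f) (t (Dom X f))"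
  shows "mk_ntrans G H t \<in> cells (over J) G H"
  using assms(1,2) unfolding cells_over ntrans_over_def mk_ntrans_def hom_over
  by (simp add: assms(3,4) cat_overD[OF hom_overD(1)[OF assms(1)]])

lemma Idc_cells:
  assumes "H \<in> hom (over J) X Y"
  shows "Idc (over J) H \<in> cells (over J) H H"
  unfolding Idc_over using hom_overD[OF assms]
  by (intro mk_ntrans_cells[OF assms assms]) (simp_all add: cat_overD)

text \<open>The cut-down in \<open>mk_ntrans\<close> makes values off the carrier immaterial. Most
  equations between 2-cells are reduced by this to equal boundary functors and equal
  components.\<close>

lemma mk_ntrans_eq_iff:
  "mk_ntrans G H s = mk_ntrans G' H' t \<longleftrightarrow> G = G' \<and> H = H' \<and> (\<forall>x\<in>Obj (fsrc G). s x = t x)"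
  unfolding mk_ntrans_def ntrans.ext_inject restrict_def fun_eq_iff by auto

text \<open>Horizontal composition with an identity cell puts an extra identity arrow into every
  component. The two whiskerings are the same cells without it, by \<open>Hc_Idc\<close> and
  \<open>Idc_Hc\<close>.\<close>

definition whisker_right :: "'u ntrans \<Rightarrow> 'u func \<Rightarrow> 'u ntrans" where
  "whisker_right t F = mk_ntrans (func_comp (nsrc t) F) (func_comp (ntgt t) F) (\<lambda>x. ncmp t (fob F x))"

definition whisker_left :: "'u func \<Rightarrow> 'u ntrans \<Rightarrow> 'u ntrans" where
  "whisker_left H t = mk_ntrans (func_comp H (nsrc t)) (func_comp H (ntgt t)) (\<lambda>x. far H (ncmp t x))"

lemma whisker_right_cells:
  assumes t: "t \<in> cells (over J) G G'" and G: "G \<in> hom (over J) X Y" and F: "F \<in> hom (over J) W X"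
  shows "whisker_right t F \<in> cells (over J) (func_comp G F) (func_comp G' F)"
proof -
  note T = cells_overD[OF t G]
  note FD = hom_overD[OF F]
  show ?thesis unfolding whisker_right_def T(2,3)
  proof (rule mk_ntrans_cells)
    fix f assume f: "f \<in> Arr W"
    have "Com Y (ncmp t (Cod X (far F f))) (far G (far F f)) = Com Y (far G' (far F f)) (ncmp t (Dom X (far F f)))"
      by (rule T) (simp add: FD f)
    then show "Com Y (ncmp t (fob F (Cod W f))) (far (func_comp G F) f) =
        Com Y (far (func_comp G' F) f) (ncmp t (fob F (Dom W f)))"
      using f by (simp add: FD)
  qed (use func_comp_hom[OF F G] func_comp_hom[OF F T(1)] FD T in simp_all)
qed

lemma whisker_left_cells:
  assumes t: "t \<in> cells (over J) G G'" and G: "G \<in> hom (over J) X Y" and H: "H \<in> hom (over J) Y Z"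
  shows "whisker_left H t \<in> cells (over J) (func_comp H G) (func_comp H G')"
proof -
  note T = cells_overD[OF t G]
  note GD = hom_overD[OF G] and GD' = hom_overD[OF T(1)] and HD = hom_overD[OF H]
  note X = cat_overD[OF GD(1)]
  show ?thesis unfolding whisker_left_def T(2,3)
  proof (rule mk_ntrans_cells)
    fix f assume f: "f \<in> Arr X"
    have "far H (Com Y (ncmp t (Cod X f)) (far G f)) = far H (Com Y (far G' f) (ncmp t (Dom X f)))"
      using T(7)[OF f] by simp
    then show "Com Z (far H (ncmp t (Cod X f))) (far (func_comp H G) f) =
        Com Z (far (func_comp H G') f) (far H (ncmp t (Dom X f)))"
      using f by (simp add: GD GD' HD T(1-6) X)
  qed (use func_comp_hom[OF G H] func_comp_hom[OF T(1) H] GD GD' HD T in simp_all)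
qed

lemma whisker_simps [simp]:
  "nsrc (whisker_right t F) = func_comp (nsrc t) F" "ntgt (whisker_right t F) = func_comp (ntgt t) F"
  "x \<in> Obj (fsrc F) \<Longrightarrow> ncmp (whisker_right t F) x = ncmp t (fob F x)"
  "nsrc (whisker_left H t) = func_comp H (nsrc t)" "ntgt (whisker_left H t) = func_comp H (ntgt t)"
  "x \<in> Obj (fsrc (nsrc t)) \<Longrightarrow> ncmp (whisker_left H t) x = far H (ncmp t x)"
  by (simp_all add: whisker_right_def whisker_left_def)

lemma Hc_Idc:
  assumes t: "t \<in> cells (over J) G G'" and G: "G \<in> hom (over J) X Y" and F: "F \<in> hom (over J) W X"
  shows "Hc (over J) t (Idc (over J) F) = whisker_right t F"
  using cells_overD[OF t G] hom_overD[OF G] hom_overD[OF F]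
  by (simp add: Hc_over whisker_right_def mk_ntrans_eq_iff cat_overD(8))

lemma Idc_Hc:
  assumes t: "t \<in> cells (over J) G G'" and G: "G \<in> hom (over J) X Y" and H: "H \<in> hom (over J) Y Z"
  shows "Hc (over J) (Idc (over J) H) t = whisker_left H t"
  using cells_overD[OF t G] hom_overD[OF G] hom_overD[OF H] hom_overD[OF cells_overD(1)[OF t G]]
  by (simp add: Hc_over whisker_left_def mk_ntrans_eq_iff cat_overD(9))

lemma whisker_left_comp:
  assumes t: "t \<in> cells (over J) G G'" and G: "G \<in> hom (over J) X Y"
    and H: "H \<in> hom (over J) Y Z" and H': "H' \<in> hom (over J) Z V"
  shows "whisker_left H' (whisker_left H t) = whisker_left (func_comp H' H) t"
  using cells_overD[OF t G] hom_overD[OF G] hom_overD[OF H]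
    func_comp_assoc[OF G H H'] func_comp_assoc[OF cells_overD(1)[OF t G] H H']
  by (simp add: whisker_left_def mk_ntrans_eq_iff)

section \<open>Algebras of a 2-monad on categories over a set\<close>

text \<open>A common interface for the 2-monad of an operad, where these facts are proved by
  computing with tuples, and for a quotient 2-monad, where they are read off from
  \<open>two_monad\<close>.\<close>

locale cat_monad =
  fixes J :: "'u set" and M :: "'u over_monad"
  assumes F0: "cat_over J X \<Longrightarrow> cat_over J (F0 (fnc M) X)"
    and F1: "H \<in> hom (over J) X Y \<Longrightarrow> F1 (fnc M) H \<in> hom (over J) (F0 (fnc M) X) (F0 (fnc M) Y)"
    and F1_Idm: "cat_over J X \<Longrightarrow> F1 (fnc M) (Idm (over J) X) = Idm (over J) (F0 (fnc M) X)"
    and F1_comp: "G \<in> hom (over J) X Y \<Longrightarrow> H \<in> hom (over J) Y Z \<Longrightarrow>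
      F1 (fnc M) (func_comp H G) = func_comp (F1 (fnc M) H) (F1 (fnc M) G)"
    and F2: "t \<in> cells (over J) G H \<Longrightarrow> G \<in> hom (over J) X Y \<Longrightarrow>
      F2 (fnc M) t \<in> cells (over J) (F1 (fnc M) G) (F1 (fnc M) H)"
    and F2_Idc: "H \<in> hom (over J) X Y \<Longrightarrow> F2 (fnc M) (Idc (over J) H) = Idc (over J) (F1 (fnc M) H)"
    and eta: "cat_over J X \<Longrightarrow> eta M X \<in> hom (over J) X (F0 (fnc M) X)"
    and eta_natural: "H \<in> hom (over J) X Y \<Longrightarrow>
      func_comp (eta M Y) H = func_comp (F1 (fnc M) H) (eta M X)"
    and mu: "cat_over J X \<Longrightarrow> mu M X \<in> hom (over J) (F0 (fnc M) (F0 (fnc M) X)) (F0 (fnc M) X)"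
    and mu_natural: "H \<in> hom (over J) X Y \<Longrightarrow>
      func_comp (mu M Y) (F1 (fnc M) (F1 (fnc M) H)) = func_comp (F1 (fnc M) H) (mu M X)"

lemma two_monad_cat_monad:
  assumes "two_monad (over J) M"
  shows "cat_monad J M"
proof -
  have 1: "two_functor (over J) (over J) (fnc M)" "two_natural (over J) (over J) id_fun (fnc M) (eta M)"
    "two_natural (over J) (over J) (comp_fun (fnc M) (fnc M)) (fnc M) (mu M)"
    using assms by (simp_all add: two_monad_def)
  note f = 1(1)[unfolded two_functor_def] and e = 1(2)[unfolded two_natural_def]
    and m = 1(3)[unfolded two_natural_def]
  show ?thesis
  proof
    fix X assume X: "cat_over J X"
    show "cat_over J (F0 (fnc M) X)" using f X by simp
    show "F1 (fnc M) (Idm (over J) X) = Idm (over J) (F0 (fnc M) X)" using f X by simp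
    show "eta M X \<in> hom (over J) X (F0 (fnc M) X)" using e X by (simp add: id_fun_def)
    show "mu M X \<in> hom (over J) (F0 (fnc M) (F0 (fnc M) X)) (F0 (fnc M) X)"
      using m X by (simp add: comp_fun_def)
  next
    fix H X Y assume H: "H \<in> hom (over J) X Y"
    then have H': "func_over J H" "fsrc H = X" "ftgt H = Y" by (simp_all add: hom_over)
    show "F1 (fnc M) H \<in> hom (over J) (F0 (fnc M) X) (F0 (fnc M) Y)" using f H' by auto
    show "F2 (fnc M) (Idc (over J) H) = Idc (over J) (F1 (fnc M) H)" using f H'
      unfolding over_simps(2) by blast
    show "func_comp (eta M Y) H = func_comp (F1 (fnc M) H) (eta M X)"
      using e H' by (auto simp: id_fun_def)
    show "func_comp (mu M Y) (F1 (fnc M) (F1 (fnc M) H)) = func_comp (F1 (fnc M) H) (mu M X)"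
      using m H' by (auto simp: comp_fun_def)
  next
    fix G H X Y Z assume "G \<in> hom (over J) X Y" "H \<in> hom (over J) Y Z"
    then show "F1 (fnc M) (func_comp H G) = func_comp (F1 (fnc M) H) (F1 (fnc M) G)"
      using f by (auto simp: hom_over)
  next
    fix t G H X Y assume "t \<in> cells (over J) G H" "G \<in> hom (over J) X Y"
    then show "F2 (fnc M) t \<in> cells (over J) (F1 (fnc M) G) (F1 (fnc M) H)"
      using f unfolding cells_over[of t] by auto
  qed
qed

lemma algs_over:
  "(X, x) \<in> algs (over J) M \<longleftrightarrow> cat_over J X \<and> x \<in> hom (over J) (F0 (fnc M) X) X \<and>
     func_comp x (eta M X) = Idm (over J) X \<and> func_comp x (mu M X) = func_comp x (F1 (fnc M) x)"
  by (simp add: algs_def)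

definition strict_mor :: "'u set \<Rightarrow> 'u cat \<times> 'u func \<Rightarrow> 'u cat \<times> 'u func \<Rightarrow> 'u func \<Rightarrow>
    ('u cat, 'u func, 'u ntrans) lmor" where
  "strict_mor J X Y g = \<lparr>msrc = X, mtgt = Y, und = g, coh = Idc (over J) (func_comp g (snd X))\<rparr>"

text \<open>The composite of the lax morphism \<open>p\<close> with the strict morphism to
  \<open>Y\<close> given by \<open>h\<close>; the identity coherence of the latter drops out of the
  composite coherence (\<open>strict_mor_comp\<close>).\<close>

definition postcomp :: "'u cat \<times> 'u func \<Rightarrow> 'u func \<Rightarrow> ('u cat, 'u func, 'u ntrans) lmor \<Rightarrow>
    ('u cat, 'u func, 'u ntrans) lmor" where
  "postcomp Y h p = \<lparr>msrc = msrc p, mtgt = Y, und = func_comp h (und p), coh = whisker_left h (coh p)\<rparr>"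

lemma Alg_simps [simp]:
  "Ob (Alg_l K M) = algs K M" "Mor (Alg_l K M) = lax_mors K M" "Cell (Alg_l K M) = alg_cells K M"
  "Src (Alg_l K M) = msrc" "Tgt (Alg_l K M) = mtgt" "Idm (Alg_l K M) = alg_id K"
  "Cmp (Alg_l K M) = alg_comp K M" "SrcC (Alg_l K M) = csrc" "TgtC (Alg_l K M) = ctgt"
  "Ob (Alg_s K M) = algs K M" "Src (Alg_s K M) = msrc" "Tgt (Alg_s K M) = mtgt"
  "Mor (Alg_s K M) = {m \<in> lax_mors K M. coh m = Idc K (Cmp K (und m) (snd (msrc m)))}"
  "Idm (Alg_s K M) = alg_id K" "Cmp (Alg_s K M) = alg_comp K M"
  "Ob (Alg K M) = algs K M" "Src (Alg K M) = msrc" "Tgt (Alg K M) = mtgt"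
  "Mor (Alg K M) = {m \<in> lax_mors K M. invertible_cell K (coh m)}"
  "Cell (Alg K M) =
    {c \<in> alg_cells K M. invertible_cell K (coh (csrc c)) \<and> invertible_cell K (coh (ctgt c))}"
  "Idm (Alg K M) = alg_id K" "Cmp (Alg K M) = alg_comp K M" "SrcC (Alg K M) = csrc"
  "TgtC (Alg K M) = ctgt"
  "Idc (Alg K M) m = \<lparr>csrc = m, ctgt = m, cund = Idc K (und m)\<rparr>"
  "Vc (Alg K M) d c = \<lparr>csrc = csrc c, ctgt = ctgt d, cund = Vc K (cund d) (cund c)\<rparr>"
  by (simp_all add: Alg_l_def Alg_s_def Alg_def restrict_mor_def)

lemma hom_Alg_l: "m \<in> hom (Alg_l K M) X Y \<longleftrightarrow> m \<in> lax_mors K M \<and> msrc m = X \<and> mtgt m = Y"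
  by (simp add: hom_def)

context cat_monad
begin

abbreviation "K \<equiv> over J"
abbreviation "MO \<equiv> F0 (fnc M)"
abbreviation "M1 \<equiv> F1 (fnc M)"
abbreviation "M2 \<equiv> F2 (fnc M)"

lemma algD:
  assumes "(X, x) \<in> algs K M"
  shows "cat_over J X" "cat_over J (MO X)" "cat_over J (MO (MO X))" "x \<in> hom K (MO X) X"
    "M1 x \<in> hom K (MO (MO X)) (MO X)" "eta M X \<in> hom K X (MO X)" "mu M X \<in> hom K (MO (MO X)) (MO X)"
    "func_comp x (eta M X) = Idm K X" "func_comp x (mu M X) = func_comp x (M1 x)"
    "y \<in> Obj X \<Longrightarrow> fob x (fob (eta M X) y) = y" "f \<in> Arr X \<Longrightarrow> far x (far (eta M X) f) = f"
    "z \<in> Obj (MO (MO X)) \<Longrightarrow> fob x (fob (mu M X) z) = fob x (fob (M1 x) z)"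
    "w \<in> Arr (MO (MO X)) \<Longrightarrow> far x (far (mu M X) w) = far x (far (M1 x) w)"
proof -
  show X: "cat_over J X" and x: "x \<in> hom K (MO X) X"
    and u: "func_comp x (eta M X) = Idm K X" and m: "func_comp x (mu M X) = func_comp x (M1 x)"
    using assms by (simp_all add: algs_over)
  show "cat_over J (MO X)" "cat_over J (MO (MO X))" using X F0 by auto
  show e: "eta M X \<in> hom K X (MO X)" and mu: "mu M X \<in> hom K (MO (MO X)) (MO X)"
    using X eta mu by auto
  show Mx: "M1 x \<in> hom K (MO (MO X)) (MO X)" using F1 x by blast
  show "y \<in> Obj X \<Longrightarrow> fob x (fob (eta M X) y) = y"
    using arg_cong[OF u, of "\<lambda>H. fob H y"] by (simp add: hom_overD(3)[OF e])
  show "f \<in> Arr X \<Longrightarrow> far x (far (eta M X) f) = f"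
    using arg_cong[OF u, of "\<lambda>H. far H f"] by (simp add: hom_overD(3)[OF e])
  show "z \<in> Obj (MO (MO X)) \<Longrightarrow> fob x (fob (mu M X) z) = fob x (fob (M1 x) z)"
    using arg_cong[OF m, of "\<lambda>H. fob H z"] by (simp add: hom_overD(3)[OF mu] hom_overD(3)[OF Mx])
  show "w \<in> Arr (MO (MO X)) \<Longrightarrow> far x (far (mu M X) w) = far x (far (M1 x) w)"
    using arg_cong[OF m, of "\<lambda>H. far H w"] by (simp add: hom_overD(3)[OF mu] hom_overD(3)[OF Mx])
qed

text \<open>In both laws the two sides are cells with the same boundary functors, by naturality of
  unit and multiplication and by the laws of the actions. What remains is an equality of
  components.\<close>

lemma lax_mors_iff:
  assumes A: "(A, a) \<in> algs K M" and B: "(B, b) \<in> algs K M"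
  shows "\<lparr>msrc = (A, a), mtgt = (B, b), und = g, coh = g'\<rparr> \<in> lax_mors K M \<longleftrightarrow>
    g \<in> hom K A B \<and> g' \<in> cells K (func_comp b (M1 g)) (func_comp g a) \<and>
    (\<forall>x\<in>Obj A. ncmp g' (fob (eta M A) x) = Ide B (fob g x)) \<and>
    (\<forall>w\<in>Obj (MO (MO A)). ncmp g' (fob (mu M A) w) =
       Com B (ncmp g' (fob (M1 a) w)) (far b (ncmp (M2 g') w)))"
proof (cases "g \<in> hom K A B \<and> g' \<in> cells K (func_comp b (M1 g)) (func_comp g a)")
  case True
  then have g: "g \<in> hom K A B" and g': "g' \<in> cells K (func_comp b (M1 g)) (func_comp g a)" by auto
  note A' = algD[OF A] and B' = algD[OF B] and Mg = F1[OF g]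
  have bMg: "func_comp b (M1 g) \<in> hom K (MO A) B" using Mg B'(4) by (rule func_comp_hom)
  note c = cells_overD[OF g' bMg]
  have Mg': "M2 g' \<in> cells K (M1 (func_comp b (M1 g))) (M1 (func_comp g a))"
    using g' bMg by (rule F2)
  have MbMg: "M1 (func_comp b (M1 g)) \<in> hom K (MO (MO A)) (MO B)" using bMg by (rule F1)
  note c' = cells_overD[OF Mg' MbMg]
  note A'(1)[simp] hom_overD(3,4)[OF A'(6), simp] hom_overD(3,4)[OF A'(7), simp]
    hom_overD(3,4)[OF A'(5), simp] hom_overD(3,4)[OF A'(4), simp] hom_overD(3,4)[OF g, simp]
    hom_overD(3,4)[OF B'(4), simp] c(2,3)[simp] c'(2,3)[simp] hom_overD(3,4)[OF MbMg, simp]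
    hom_overD(3,4)[OF Mg, simp]
  have 1: "Hc K g' (Idc K (eta M A)) = Idc K g \<longleftrightarrow>
      (\<forall>x\<in>Obj A. ncmp g' (fob (eta M A) x) = Ide B (fob g x))"
  proof -
    have "func_comp (func_comp b (M1 g)) (eta M A) = func_comp b (func_comp (eta M B) g)"
      using func_comp_assoc[OF A'(6) Mg B'(4)] eta_natural[OF g] by simp
    also have "\<dots> = func_comp (func_comp b (eta M B)) g"
      using func_comp_assoc[OF g B'(6) B'(4)] by simp
    also have "\<dots> = g" using B'(8) func_comp_Idm[OF g] by simp
    finally have s: "func_comp (func_comp b (M1 g)) (eta M A) = g" .
    have "func_comp (func_comp g a) (eta M A) = func_comp g (func_comp a (eta M A))"
      by (rule func_comp_assoc[OF A'(6) A'(4) g])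
    also have "\<dots> = g" using A'(8) func_comp_Idm[OF g] by simp
    finally have t: "func_comp (func_comp g a) (eta M A) = g" .
    show ?thesis unfolding Hc_Idc[OF g' bMg A'(6)] unfolding whisker_right_def Idc_over
      by (simp add: mk_ntrans_eq_iff s t)
  qed
  have 2: "Hc K g' (Idc K (mu M A)) = Vc K (Hc K g' (Idc K (M1 a))) (Hc K (Idc K b) (M2 g')) \<longleftrightarrow>
      (\<forall>w\<in>Obj (MO (MO A)). ncmp g' (fob (mu M A) w) =
         Com B (ncmp g' (fob (M1 a) w)) (far b (ncmp (M2 g') w)))"
  proof -
    note MMg = F1[OF Mg]
    have "func_comp (func_comp b (M1 g)) (mu M A) = func_comp b (func_comp (mu M B) (M1 (M1 g)))"
      using func_comp_assoc[OF A'(7) Mg B'(4)] mu_natural[OF g] by simp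
    also have "\<dots> = func_comp (func_comp b (M1 b)) (M1 (M1 g))"
      using func_comp_assoc[OF MMg B'(7) B'(4)] B'(9) by simp
    also have "\<dots> = func_comp b (M1 (func_comp b (M1 g)))"
      using func_comp_assoc[OF MMg B'(5) B'(4)] F1_comp[OF Mg B'(4)] by simp
    finally have s: "func_comp (func_comp b (M1 g)) (mu M A) = func_comp b (M1 (func_comp b (M1 g)))" .
    have t: "func_comp (func_comp g a) (mu M A) = func_comp (func_comp g a) (M1 a)"
      using func_comp_assoc[OF A'(7) A'(4) g] func_comp_assoc[OF A'(5) A'(4) g] A'(9) by simp
    show ?thesis
      unfolding Hc_Idc[OF g' bMg A'(7)] Hc_Idc[OF g' bMg A'(5)] Idc_Hc[OF Mg' MbMg B'(4)]
      unfolding Vc_over whisker_right_def[of g' "mu M A"]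
      by (simp add: mk_ntrans_eq_iff s t)
  qed
  show ?thesis using A B g g' 1 2 by (simp add: lax_mors_def)
next
  case False
  then show ?thesis by (auto simp: lax_mors_def)
qed

lemma lax_morsD:
  assumes m: "m \<in> lax_mors K M" and X: "msrc m = (A, a)" and Y: "mtgt m = (B, b)"
  shows "(A, a) \<in> algs K M" "(B, b) \<in> algs K M" "und m \<in> hom K A B"
    "coh m \<in> cells K (func_comp b (M1 (und m))) (func_comp (und m) a)"
    "func_comp b (M1 (und m)) \<in> hom K (MO A) B"
proof -
  show A: "(A, a) \<in> algs K M" and B: "(B, b) \<in> algs K M" and u: "und m \<in> hom K A B"
    and "coh m \<in> cells K (func_comp b (M1 (und m))) (func_comp (und m) a)"
    using m X Y by (simp_all add: lax_mors_def Let_def)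
  show "func_comp b (M1 (und m)) \<in> hom K (MO A) B"
    using func_comp_hom[OF F1[OF u] algD(4)[OF B]] .
qed

lemma strict_mor_lax:
  assumes A: "(A, a) \<in> algs K M" and B: "(B, b) \<in> algs K M" and g: "g \<in> hom K A B"
    and eq: "func_comp b (M1 g) = func_comp g a"
  shows "strict_mor J (A, a) (B, b) g \<in> lax_mors K M"
proof -
  note A' = algD[OF A] and B' = algD[OF B] and Mg = F1[OF g]
  note aD = hom_overD[OF A'(4)] and gD = hom_overD[OF g] and bD = hom_overD[OF B'(4)]
    and eD = hom_overD[OF A'(6)] and mD = hom_overD[OF A'(7)] and MaD = hom_overD[OF A'(5)]
  have ga: "func_comp g a \<in> hom K (MO A) B" using A'(4) g by (rule func_comp_hom)
  have id: "Idc K (func_comp g a) \<in> cells K (func_comp b (M1 g)) (func_comp g a)"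
    using Idc_cells[OF ga] hom_overD(4)[OF ga] eq by simp
  have Mga: "M1 (func_comp g a) \<in> hom K (MO (MO A)) (MO B)" using ga by (rule F1)
  note MgaD = hom_overD[OF Mga]
  have "ncmp (Idc K (func_comp g a)) (fob (mu M A) w) =
       Com B (ncmp (Idc K (func_comp g a)) (fob (M1 a) w)) (far b (ncmp (M2 (Idc K (func_comp g a))) w))"
    if w: "w \<in> Obj (MO (MO A))" for w
  proof -
    have "fob b (fob (M1 (func_comp g a)) w) = fob (func_comp b (M1 g)) (fob (M1 a) w)"
      using w by (simp add: F1_comp[OF A'(4) g] hom_overD[OF A'(5)] hom_overD[OF Mg])
    also have "\<dots> = fob g (fob a (fob (mu M A) w))"
      unfolding eq using w by (simp add: MaD aD A')
    finally have "fob b (fob (M1 (func_comp g a)) w) = fob g (fob a (fob (mu M A) w))" .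
    moreover have "Ide B (fob g (fob a (fob (mu M A) w))) \<in> Arr B"
      using w by (simp add: mD aD gD cat_overD(5)[OF B'(1)])
    ultimately show ?thesis
      using w by (simp add: F2_Idc[OF ga] MgaD bD MaD mD gD aD A' cat_overD[OF B'(1)])
  qed
  then have "\<lparr>msrc = (A, a), mtgt = (B, b), und = g, coh = Idc K (func_comp g a)\<rparr> \<in> lax_mors K M"
    unfolding lax_mors_iff[OF A B] using g id by (simp add: eD aD gD A'(10))
  then show ?thesis by (simp add: strict_mor_def)
qed

text \<open>An identity 2-cell has equal source and target, so an identity coherence amounts to the
  equation between the two composites.\<close>

lemma hom_Alg_s:
  "m \<in> hom (Alg_s K M) (A, a) (B, b) \<longleftrightarrow> (A, a) \<in> algs K M \<and> (B, b) \<in> algs K M \<and>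
     (\<exists>g \<in> hom K A B. func_comp b (M1 g) = func_comp g a \<and> m = strict_mor J (A, a) (B, b) g)"
proof
  assume "m \<in> hom (Alg_s K M) (A, a) (B, b)"
  then have m: "m \<in> lax_mors K M" "msrc m = (A, a)" "mtgt m = (B, b)"
    and c: "coh m = Idc K (func_comp (und m) a)"
    by (auto simp: hom_def)
  note d = lax_morsD[OF m]
  have "func_comp b (M1 (und m)) = func_comp (und m) a"
    using cells_overD(2)[OF d(4,5)] by (simp add: c)
  moreover have "m = strict_mor J (A, a) (B, b) (und m)"
    using m c by (simp add: strict_mor_def)
  ultimately show "(A, a) \<in> algs K M \<and> (B, b) \<in> algs K M \<and>
     (\<exists>g \<in> hom K A B. func_comp b (M1 g) = func_comp g a \<and> m = strict_mor J (A, a) (B, b) g)"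
    using d by blast
next
  assume "(A, a) \<in> algs K M \<and> (B, b) \<in> algs K M \<and>
     (\<exists>g \<in> hom K A B. func_comp b (M1 g) = func_comp g a \<and> m = strict_mor J (A, a) (B, b) g)"
  then show "m \<in> hom (Alg_s K M) (A, a) (B, b)"
    using strict_mor_lax by (auto simp: hom_def strict_mor_def)
qed

lemma strict_mor_comp:
  assumes p: "p \<in> lax_mors K M" "mtgt p = (B, b)" and h: "h \<in> hom K B C"
    and C: "(C, c) \<in> algs K M" and eq: "func_comp c (M1 h) = func_comp h b"
  shows "alg_comp K M (strict_mor J (B, b) (C, c) h) p = postcomp (C, c) h p"
proof -
  obtain A a where A: "msrc p = (A, a)" by (cases "msrc p")
  note d = lax_morsD[OF p(1) A p(2)]
  note B' = algD[OF d(2)]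
  note hb = func_comp_hom[OF B'(4) h] and Mp = F1[OF d(3)]
  note cc = cells_overD[OF d(4,5)]
  note D = hom_overD[OF Mp] hom_overD[OF B'(4)]
  have id: "Idc K (func_comp h b) \<in> cells K (func_comp h b) (func_comp h b)"
    using Idc_cells[OF hb] hom_overD(4)[OF hb] by simp
  have w: "whisker_left h (coh p) \<in> cells K (func_comp h (func_comp b (M1 (und p)))) (func_comp h (func_comp (und p) a))"
    by (rule whisker_left_cells[OF d(4,5) h])
  note wc = cells_overD[OF w func_comp_hom[OF d(5) h]]
  have eq: "Vc K (whisker_left h (coh p)) (whisker_right (Idc K (func_comp h b)) (M1 (und p))) = whisker_left h (coh p)"
    unfolding Vc_over whisker_left_def[of h] mk_ntrans_eq_iff
    using wc D func_comp_assoc[OF Mp B'(4) h] cc hom_overD(4)[OF h]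
    by (simp add: cat_overD(8)[OF hom_overD(2)[OF h]] hom_overD[OF h])
  show ?thesis
    unfolding alg_comp_def strict_mor_def postcomp_def
    using Idc_Hc[OF d(4,5) h] Hc_Idc[OF id hb Mp] eq by simp
qed

lemma postcomp_postcomp:
  assumes p: "p \<in> lax_mors K M" "mtgt p = (B, b)" and "h \<in> hom K B C" "h' \<in> hom K C D"
  shows "postcomp Z' h' (postcomp Z h p) = postcomp Z' (func_comp h' h) p"
proof -
  obtain A a where A: "msrc p = (A, a)" by (cases "msrc p")
  note d = lax_morsD[OF p(1) A p(2)]
  show ?thesis
    using func_comp_assoc[OF d(3) assms(3,4)] whisker_left_comp[OF d(4,5) assms(3,4)]
    by (simp add: postcomp_def)
qed

lemma strict_mor_strict_mor:
  assumes g: "strict_mor J (A, a) (B, b) g \<in> hom (Alg_s K M) (A, a) (B, b)"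
    and h: "strict_mor J (B, b) (C, c) h \<in> hom (Alg_s K M) (B, b) (C, c)"
  shows "alg_comp K M (strict_mor J (B, b) (C, c) h) (strict_mor J (A, a) (B, b) g) =
      strict_mor J (A, a) (C, c) (func_comp h g)"
    "strict_mor J (A, a) (C, c) (func_comp h g) \<in> hom (Alg_s K M) (A, a) (C, c)"
proof -
  have A: "(A, a) \<in> algs K M" "(B, b) \<in> algs K M" "(C, c) \<in> algs K M"
    and g': "g \<in> hom K A B" "func_comp b (M1 g) = func_comp g a"
    and h': "h \<in> hom K B C" "func_comp c (M1 h) = func_comp h b"
    using g h unfolding hom_Alg_s by (auto simp: strict_mor_def)
  note A' = algD[OF A(1)] and B' = algD[OF A(2)] and C' = algD[OF A(3)]
  note Mg = F1[OF g'(1)] and Mh = F1[OF h'(1)]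
  have "strict_mor J (A, a) (B, b) g \<in> lax_mors K M" using g by (simp add: hom_def)
  note 1 = strict_mor_comp[OF this _ h'(1) A(3) h'(2)]
  have "whisker_left h (Idc K (func_comp g a)) = Idc K (func_comp (func_comp h g) a)"
    using func_comp_assoc[OF A'(4) g'(1) h'(1)] hom_overD[OF g'(1)] hom_overD[OF h'(1)] hom_overD[OF A'(4)]
    by (simp add: whisker_left_def Idc_over mk_ntrans_eq_iff)
  then show "alg_comp K M (strict_mor J (B, b) (C, c) h) (strict_mor J (A, a) (B, b) g) =
      strict_mor J (A, a) (C, c) (func_comp h g)"
    using 1 by (simp add: strict_mor_def postcomp_def)
  have "func_comp c (M1 (func_comp h g)) = func_comp (func_comp c (M1 h)) (M1 g)"
    using func_comp_assoc[OF Mg Mh C'(4)] F1_comp[OF g'(1) h'(1)] by simp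
  also have "\<dots> = func_comp h (func_comp b (M1 g))"
    using func_comp_assoc[OF Mg B'(4) h'(1)] h'(2) by simp
  also have "\<dots> = func_comp (func_comp h g) a"
    using func_comp_assoc[OF A'(4) g'(1) h'(1)] g'(2) by simp
  finally show "strict_mor J (A, a) (C, c) (func_comp h g) \<in> hom (Alg_s K M) (A, a) (C, c)"
    unfolding hom_Alg_s using A func_comp_hom[OF g'(1) h'(1)] by blast
qed

lemma alg_id_strict:
  assumes A: "(A, a) \<in> algs K M"
  shows "alg_id K (A, a) = strict_mor J (A, a) (A, a) (Idm K A)" "alg_id K (A, a) \<in> hom (Alg_s K M) (A, a) (A, a)"
proof -
  note A' = algD[OF A]
  show 1: "alg_id K (A, a) = strict_mor J (A, a) (A, a) (Idm K A)"
    using func_comp_Idm[OF A'(4)] by (simp add: alg_id_def strict_mor_def)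
  have "func_comp a (M1 (Idm K A)) = func_comp (Idm K A) a"
    using func_comp_Idm[OF A'(4)] F1_Idm[OF A'(1)] by simp
  then show "alg_id K (A, a) \<in> hom (Alg_s K M) (A, a) (A, a)"
    unfolding 1 hom_Alg_s using A Idm_hom[OF A'(1)] by auto
qed

end

section \<open>Permutations\<close>

lemma permsD:
  assumes "\<rho> \<in> perms n"
  shows "length \<rho> = n" "distinct \<rho>" "set \<rho> = {..<n}" "k < n \<Longrightarrow> \<rho> ! k < n"
    "k < n \<Longrightarrow> l < n \<Longrightarrow> \<rho> ! k = \<rho> ! l \<longleftrightarrow> k = l"
  using assms nth_mem[of k \<rho>] by (auto simp: perms_def nth_eq_iff_index_eq)

lemma perms_surj:
  assumes "\<rho> \<in> perms n" "i < n"
  obtains k where "k < n" "\<rho> ! k = i"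
proof -
  have "i \<in> set \<rho>" using assms by (simp add: perms_def)
  then show ?thesis using that permsD(1)[OF assms(1)] by (auto simp: in_set_conv_nth)
qed

lemma length_perm_inv [simp]: "length (perm_inv \<rho>) = length \<rho>"
  by (simp add: perm_inv_def)

lemma perm_inv_nth:
  assumes "\<rho> \<in> perms n" "k < n"
  shows "perm_inv \<rho> ! (\<rho> ! k) = k"
proof -
  have "(THE l. l < length \<rho> \<and> \<rho> ! l = \<rho> ! k) = k"
    using permsD[OF assms(1)] assms(2) by (intro the_equality) auto
  then show ?thesis
    using permsD[OF assms(1)] assms(2) by (simp add: perm_inv_def)
qed

lemma nth_perm_inv:
  assumes "\<rho> \<in> perms n" "i < n"
  shows "\<rho> ! (perm_inv \<rho> ! i) = i" "perm_inv \<rho> ! i < n"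
  using assms(1) perms_surj[OF assms] perm_inv_nth by metis+

text \<open>Distinctness follows by counting, so only the length and the set of values of a
  candidate permutation have to be found.\<close>

lemma perms_card:
  assumes "length \<rho> = n" "set \<rho> = {..<n}"
  shows "\<rho> \<in> perms n"
  using assms by (simp add: perms_def card_distinct)

lemma perm_inv_perms: "\<rho> \<in> perms n \<Longrightarrow> perm_inv \<rho> \<in> perms n"
proof (rule perms_card)
  assume r: "\<rho> \<in> perms n"
  show "length (perm_inv \<rho>) = n" using permsD[OF r] by simp
  show "set (perm_inv \<rho>) = {..<n}"
    using permsD[OF r] perm_inv_nth[OF r] nth_perm_inv[OF r] by (auto simp: set_conv_nth; metis)
qed

lemma id_perms [simp]: "[0..<n] \<in> perms n"
  by (rule perms_card) (auto simp: lessThan_atLeast0)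

lemma perm_comp_nth: "k < length \<rho> \<Longrightarrow> perm_comp \<sigma> \<rho> ! k = \<sigma> ! (\<rho> ! k)"
  by (simp add: perm_comp_def)

lemma length_perm_comp [simp]: "length (perm_comp \<sigma> \<rho>) = length \<rho>"
  by (simp add: perm_comp_def)

lemma perm_comp_perms: "\<sigma> \<in> perms n \<Longrightarrow> \<rho> \<in> perms n \<Longrightarrow> perm_comp \<sigma> \<rho> \<in> perms n"
proof (rule perms_card)
  assume s: "\<sigma> \<in> perms n" and r: "\<rho> \<in> perms n"
  show "length (perm_comp \<sigma> \<rho>) = n" using permsD[OF r] by simp
  have "set (perm_comp \<sigma> \<rho>) = (!) \<sigma> ` {..<n}" using permsD(3)[OF r] by (simp add: perm_comp_def)
  also have "\<dots> = set \<sigma>" using permsD(1)[OF s] by (auto simp: set_conv_nth)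
  finally show "set (perm_comp \<sigma> \<rho>) = {..<n}" using permsD(3)[OF s] by simp
qed

lemma perm_comp_inv:
  assumes "\<rho> \<in> perms n"
  shows "perm_comp \<rho> (perm_inv \<rho>) = [0..<n]" "perm_comp (perm_inv \<rho>) \<rho> = [0..<n]"
  using permsD[OF assms] nth_perm_inv[OF assms] perm_inv_nth[OF assms]
  by (auto intro!: nth_equalityI simp: perm_comp_nth)

lemma perm_comp_id:
  assumes "\<rho> \<in> perms n"
  shows "perm_comp \<rho> [0..<n] = \<rho>" "perm_comp [0..<n] \<rho> = \<rho>"
  using permsD[OF assms] by (auto intro!: nth_equalityI simp: perm_comp_nth)

text \<open>Codomains in \<open>T_cat\<close> are listed through \<open>perm_inv\<close>; this moves
  the permutation to the other side, where no inverse occurs.\<close>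

lemma map_perm_inv_eq_iff:
  assumes r: "\<rho> \<in> perms n" and "length xs = n" "length ys = n"
  shows "map (\<lambda>k. f (xs ! k)) (perm_inv \<rho>) = ys \<longleftrightarrow> map f xs = map (\<lambda>k. ys ! k) \<rho>"
proof
  assume "map (\<lambda>k. f (xs ! k)) (perm_inv \<rho>) = ys"
  then show "map f xs = map (\<lambda>k. ys ! k) \<rho>"
    using permsD[OF r] assms perm_inv_nth[OF r] by (auto intro!: nth_equalityI)
next
  assume "map f xs = map (\<lambda>k. ys ! k) \<rho>"
  then have "f (xs ! k) = ys ! (\<rho> ! k)" if "k < n" for k
    using that permsD[OF r] assms by (auto simp: list_eq_iff_nth_eq)
  then show "map (\<lambda>k. f (xs ! k)) (perm_inv \<rho>) = ys"
    using permsD[OF r] assms nth_perm_inv[OF r] by (auto intro!: nth_equalityI)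
qed

section \<open>Permutations of blocks\<close>

lemma concat_nth_block:
  assumes "j < length xss" "l < length (xss ! j)"
  shows "concat xss ! ((\<Sum>i<j. length (xss ! i)) + l) = xss ! j ! l"
    "(\<Sum>i<j. length (xss ! i)) + l < length (concat xss)"
proof -
  have "concat xss ! ((\<Sum>i<j. length (xss ! i)) + l) = xss ! j ! l \<and>
      (\<Sum>i<j. length (xss ! i)) + l < length (concat xss)"
    using assms
  proof (induction xss arbitrary: j)
    case (Cons xs xss)
    show ?case
    proof (cases j)
      case 0
      then show ?thesis using Cons.prems by (simp add: nth_append)
    next
      case (Suc j')
      have "(\<Sum>i<j. length ((xs # xss) ! i)) = length xs + (\<Sum>i<j'. length (xss ! i))"
        unfolding Suc by (subst sum.lessThan_Suc_shift) simp
      then show ?thesis using Cons.IH[of j'] Cons.prems Suc by (simp add: nth_append)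
    qed
  qed simp
  then show "concat xss ! ((\<Sum>i<j. length (xss ! i)) + l) = xss ! j ! l"
    "(\<Sum>i<j. length (xss ! i)) + l < length (concat xss)" by auto
qed

lemma block_split:
  fixes m :: "nat \<Rightarrow> nat"
  assumes "i < (\<Sum>j<n. m j)"
  obtains j l where "j < n" "l < m j" "i = (\<Sum>j'<j. m j') + l"
  using assms
proof (induction n arbitrary: thesis)
  case (Suc n)
  show ?case
  proof (cases "i < (\<Sum>j<n. m j)")
    case True
    then show ?thesis by (rule Suc.IH[rotated]) (rule Suc.prems(1), simp_all)
  next
    case False
    then show ?thesis using Suc.prems(2) by (intro Suc.prems(1)[of n "i - (\<Sum>j<n. m j)"]) auto
  qed
qed simp

text \<open>The block sizes \<open>m\<close> are those of the codomain.\<close>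

definition block_fam :: "(nat \<Rightarrow> nat) \<Rightarrow> nat \<Rightarrow> nat list \<Rightarrow> nat list list \<Rightarrow> bool" where
  "block_fam m n \<rho> \<rho>s \<longleftrightarrow> \<rho> \<in> perms n \<and> length \<rho>s = n \<and> (\<forall>k<n. \<rho>s ! k \<in> perms (m (\<rho> ! k)))"

text \<open>Once the block sizes of the codomain are given as \<open>m\<close>, the inverse
  permutation in \<open>block_perm\<close> disappears.\<close>

lemma block_perm_eq:
  assumes "block_fam m n \<rho> \<rho>s"
  shows "block_perm \<rho> \<rho>s = concat (map (\<lambda>k. map (\<lambda>l. (\<Sum>j<\<rho> ! k. m j) + l) (\<rho>s ! k)) [0..<n])"
proof -
  have r: "\<rho> \<in> perms n" and rs: "\<And>k. k < n \<Longrightarrow> \<rho>s ! k \<in> perms (m (\<rho> ! k))"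
    using assms by (auto simp: block_fam_def)
  have "length (\<rho>s ! (perm_inv \<rho> ! j)) = m j" if "j < n" for j
    using permsD(1)[OF rs] nth_perm_inv[OF r that] by simp
  then have "(\<Sum>j<\<rho> ! k. length (\<rho>s ! (perm_inv \<rho> ! j))) = (\<Sum>j<\<rho> ! k. m j)" if "k < n" for k
    using permsD(4)[OF r that] by (intro sum.cong) auto
  then show ?thesis
    unfolding block_perm_def permsD(1)[OF r] by (intro arg_cong[of _ _ concat] map_cong) auto
qed

text \<open>The main computation with \<open>block_perm\<close>: it controls the colours, the
  codomains and the composites of the arrows in the image of the multiplication.\<close>

lemma map_concat_block_perm:
  assumes bf: "block_fam m n \<rho> \<rho>s" and "length xss = n" and len: "\<And>j. j < n \<Longrightarrow> length (xss ! j) = m j"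
  shows "map (\<lambda>i. concat xss ! i) (block_perm \<rho> \<rho>s) =
    concat (map (\<lambda>k. map (\<lambda>l. xss ! (\<rho> ! k) ! l) (\<rho>s ! k)) [0..<n])"
proof -
  have r: "\<rho> \<in> perms n" and rs: "\<And>k. k < n \<Longrightarrow> \<rho>s ! k \<in> perms (m (\<rho> ! k))"
    using bf by (auto simp: block_fam_def)
  have "concat xss ! ((\<Sum>j<\<rho> ! k. m j) + l) = xss ! (\<rho> ! k) ! l" if "k < n" "l \<in> set (\<rho>s ! k)" for k l
  proof -
    have k: "\<rho> ! k < n" using permsD[OF r] that by simp
    have "(\<Sum>j<\<rho> ! k. length (xss ! j)) = (\<Sum>j<\<rho> ! k. m j)"
      using k len by (intro sum.cong) auto
    then show ?thesis
      using concat_nth_block(1)[of "\<rho> ! k" xss l] permsD(3)[OF rs[OF that(1)]] k that len[OF k] assms(2) by simp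
  qed
  then show ?thesis
    unfolding block_perm_eq[OF bf] map_concat map_map by (intro arg_cong[of _ _ concat] map_cong) auto
qed

text \<open>The lengths add up to the right total because \<rho> only reorders the blocks, and every
  position lies in some block, so all values occur.\<close>

lemma block_perm_perms:
  assumes bf: "block_fam m n \<rho> \<rho>s"
  shows "block_perm \<rho> \<rho>s \<in> perms (\<Sum>j<n. m j)"
proof (rule perms_card)
  have r: "\<rho> \<in> perms n" and rs: "\<And>k. k < n \<Longrightarrow> \<rho>s ! k \<in> perms (m (\<rho> ! k))"
    using bf by (auto simp: block_fam_def)
  have "length (block_perm \<rho> \<rho>s) = (\<Sum>k\<leftarrow>[0..<n]. length (\<rho>s ! k))"
    unfolding block_perm_eq[OF bf] length_concat map_map by (simp add: comp_def)
  also have "\<dots> = (\<Sum>k<n. m (\<rho> ! k))"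
    using permsD(1)[OF rs] by (simp add: sum_list_distinct_conv_sum_set lessThan_atLeast0)
  also have "\<dots> = (\<Sum>j<n. m j)"
  proof (rule sum.reindex_bij_betw)
    show "bij_betw ((!) \<rho>) {..<n} {..<n}"
      using permsD(1-3)[OF r] by (intro bij_betw_nth) simp_all
  qed
  finally show "length (block_perm \<rho> \<rho>s) = (\<Sum>j<n. m j)" .
  show "set (block_perm \<rho> \<rho>s) = {..<\<Sum>j<n. m j}"
  proof
    show "set (block_perm \<rho> \<rho>s) \<subseteq> {..<\<Sum>j<n. m j}"
    proof
      fix i assume "i \<in> set (block_perm \<rho> \<rho>s)"
      then obtain k l where k: "k < n" "l \<in> set (\<rho>s ! k)" and i: "i = (\<Sum>j<\<rho> ! k. m j) + l"
        by (auto simp: block_perm_eq[OF bf])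
      have l: "l < m (\<rho> ! k)" using permsD(3)[OF rs[OF k(1)]] k by auto
      have "(\<Sum>j<\<rho> ! k. m j) + m (\<rho> ! k) = (\<Sum>j<Suc (\<rho> ! k). m j)" by simp
      also have "\<dots> \<le> (\<Sum>j<n. m j)"
        using permsD(4)[OF r k(1)] by (intro sum_mono2) auto
      finally show "i \<in> {..<\<Sum>j<n. m j}" using l i by simp
    qed
    show "{..<\<Sum>j<n. m j} \<subseteq> set (block_perm \<rho> \<rho>s)"
    proof
      fix i assume "i \<in> {..<\<Sum>j<n. m j}"
      then obtain j l where j: "j < n" "l < m j" "i = (\<Sum>j'<j. m j') + l"
        using block_split by (metis lessThan_iff)
      obtain k where k: "k < n" "\<rho> ! k = j" using perms_surj[OF r j(1)] .
      have "l \<in> set (\<rho>s ! k)" using permsD(3)[OF rs[OF k(1)]] k j by simp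
      then show "i \<in> set (block_perm \<rho> \<rho>s)"
        using k j by (auto simp: block_perm_eq[OF bf])
    qed
  qed
qed

lemma block_perm_id:
  "block_perm [0..<n] (map (\<lambda>k. [0..<m k]) [0..<n]) = [0..<\<Sum>j<n. m j]"
proof -
  have bf: "block_fam m n [0..<n] (map (\<lambda>k. [0..<m k]) [0..<n])" by (simp add: block_fam_def)
  have "block_perm [0..<n] (map (\<lambda>k. [0..<m k]) [0..<n]) =
      concat (map (\<lambda>k. map (\<lambda>l. (\<Sum>j<k. m j) + l) [0..<m k]) [0..<n])"
    unfolding block_perm_eq[OF bf] by (intro arg_cong[of _ _ concat] map_cong) auto
  also have "\<dots> = [0..<\<Sum>j<n. m j]"
  proof (induction n)
    case (Suc n)
    have "map (\<lambda>l. (\<Sum>j<n. m j) + l) [0..<m n] = [(\<Sum>j<n. m j)..<(\<Sum>j<n. m j) + m n]"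
      by (rule nth_equalityI) auto
    then show ?case using Suc upt_add_eq_append[of 0 "\<Sum>j<n. m j" "m n"] by simp
  qed simp
  finally show ?thesis .
qed

text \<open>Substitution of permutations preserves composition. As \<rho> is applied after \<sigma>,
  the codomain of \<sigma> has the block sizes already permuted by \<rho>.\<close>

lemma block_fam_comp:
  assumes r: "block_fam m n \<rho> \<rho>s" and s: "block_fam (\<lambda>k. m (\<rho> ! k)) n \<sigma> \<sigma>s"
  shows "block_fam m n (perm_comp \<rho> \<sigma>) (map (\<lambda>k. perm_comp (\<rho>s ! (\<sigma> ! k)) (\<sigma>s ! k)) [0..<n])"
    "perm_comp (block_perm \<rho> \<rho>s) (block_perm \<sigma> \<sigma>s) =
      block_perm (perm_comp \<rho> \<sigma>) (map (\<lambda>k. perm_comp (\<rho>s ! (\<sigma> ! k)) (\<sigma>s ! k)) [0..<n])"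
proof -
  have r': "\<rho> \<in> perms n" "length \<rho>s = n" "\<And>k. k < n \<Longrightarrow> \<rho>s ! k \<in> perms (m (\<rho> ! k))"
    using r by (auto simp: block_fam_def)
  have s': "\<sigma> \<in> perms n" "length \<sigma>s = n" "\<And>k. k < n \<Longrightarrow> \<sigma>s ! k \<in> perms (m (\<rho> ! (\<sigma> ! k)))"
    using s by (auto simp: block_fam_def)
  note sD = permsD[OF s'(1)] and rD = permsD[OF r'(1)]
  show 1: "block_fam m n (perm_comp \<rho> \<sigma>) (map (\<lambda>k. perm_comp (\<rho>s ! (\<sigma> ! k)) (\<sigma>s ! k)) [0..<n])"
    using r' s' sD by (auto simp: block_fam_def perm_comp_nth intro!: perm_comp_perms)
  \<comment> \<open>The list \<open>block_perm \<rho> \<rho>s\<close> is itself a concatenation of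
    blocks, so composing it with a block permutation is an instance of
    \<open>map_concat_block_perm\<close>.\<close>
  let ?xss = "map (\<lambda>k. map (\<lambda>l. (\<Sum>j<\<rho> ! k. m j) + l) (\<rho>s ! k)) [0..<n]"
  have "perm_comp (block_perm \<rho> \<rho>s) (block_perm \<sigma> \<sigma>s) = map (\<lambda>i. concat ?xss ! i) (block_perm \<sigma> \<sigma>s)"
    unfolding block_perm_eq[OF r] perm_comp_def by simp
  also have "\<dots> = concat (map (\<lambda>k. map (\<lambda>l. ?xss ! (\<sigma> ! k) ! l) (\<sigma>s ! k)) [0..<n])"
    using permsD(1)[OF r'(3)] by (intro map_concat_block_perm[OF s]) auto
  also have "\<dots> = block_perm (perm_comp \<rho> \<sigma>) (map (\<lambda>k. perm_comp (\<rho>s ! (\<sigma> ! k)) (\<sigma>s ! k)) [0..<n])"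
    unfolding block_perm_eq[OF 1]
  proof (rule arg_cong[of _ _ concat], rule map_cong[OF refl])
    fix k assume "k \<in> set [0..<n]"
    then have k: "k < n" by simp
    have "l < length (\<rho>s ! (\<sigma> ! k))" if "l \<in> set (\<sigma>s ! k)" for l
      using permsD(3)[OF s'(3)[OF k]] permsD(1)[OF r'(3)[OF sD(4)[OF k]]] that by auto
    then show "map (\<lambda>l. ?xss ! (\<sigma> ! k) ! l) (\<sigma>s ! k) = map (\<lambda>l. (\<Sum>j<perm_comp \<rho> \<sigma> ! k. m j) + l)
        (map (\<lambda>k. perm_comp (\<rho>s ! (\<sigma> ! k)) (\<sigma>s ! k)) [0..<n] ! k)"
      using k sD by (auto simp: perm_comp_nth) (simp add: perm_comp_def)
  qed
  finally show "perm_comp (block_perm \<rho> \<rho>s) (block_perm \<sigma> \<sigma>s) =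
      block_perm (perm_comp \<rho> \<sigma>) (map (\<lambda>k. perm_comp (\<rho>s ! (\<sigma> ! k)) (\<sigma>s ! k)) [0..<n])" .
qed

section \<open>The 2-monad of an operad\<close>

locale set_operad =
  fixes T :: "'u::small operad"
  assumes operad: "operad T"
begin

lemma operadD:
  "\<alpha> \<in> ops T \<Longrightarrow> set (ins T \<alpha>) \<subseteq> colours T" "\<alpha> \<in> ops T \<Longrightarrow> out T \<alpha> \<in> colours T"
  "j \<in> colours T \<Longrightarrow> unt T j \<in> ops T" "j \<in> colours T \<Longrightarrow> ins T (unt T j) = [j]"
  "j \<in> colours T \<Longrightarrow> out T (unt T j) = j"
  "plugs T \<alpha> \<beta>s \<Longrightarrow> sub T \<alpha> \<beta>s \<in> ops T"
  "plugs T \<alpha> \<beta>s \<Longrightarrow> ins T (sub T \<alpha> \<beta>s) = concat (map (ins T) \<beta>s)"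
  "plugs T \<alpha> \<beta>s \<Longrightarrow> out T (sub T \<alpha> \<beta>s) = out T \<alpha>"
  "\<alpha> \<in> ops T \<Longrightarrow> sub T (unt T (out T \<alpha>)) [\<alpha>] = \<alpha>"
  "\<alpha> \<in> ops T \<Longrightarrow> sub T \<alpha> (map (unt T) (ins T \<alpha>)) = \<alpha>"
  "plugs T \<alpha> \<beta>s \<Longrightarrow> list_all2 (plugs T) \<beta>s \<gamma>ss \<Longrightarrow>
     sub T (sub T \<alpha> \<beta>s) (concat \<gamma>ss) = sub T \<alpha> (map2 (sub T) \<beta>s \<gamma>ss)"
  "\<alpha> \<in> ops T \<Longrightarrow> \<rho> \<in> perms (length (ins T \<alpha>)) \<Longrightarrow> act T \<alpha> \<rho> \<in> ops T"
  "\<alpha> \<in> ops T \<Longrightarrow> \<rho> \<in> perms (length (ins T \<alpha>)) \<Longrightarrow> ins T (act T \<alpha> \<rho>) = map (\<lambda>k. ins T \<alpha> ! k) \<rho>"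
  "\<alpha> \<in> ops T \<Longrightarrow> \<rho> \<in> perms (length (ins T \<alpha>)) \<Longrightarrow> out T (act T \<alpha> \<rho>) = out T \<alpha>"
  "\<alpha> \<in> ops T \<Longrightarrow> act T \<alpha> [0..<length (ins T \<alpha>)] = \<alpha>"
  "\<alpha> \<in> ops T \<Longrightarrow> \<rho> \<in> perms (length (ins T \<alpha>)) \<Longrightarrow> \<sigma> \<in> perms (length (ins T \<alpha>)) \<Longrightarrow>
     act T (act T \<alpha> \<rho>) \<sigma> = act T \<alpha> (perm_comp \<rho> \<sigma>)"
proof -
  note O1 = operad[unfolded operad_def]
  note O2 = conjunct2[OF O1] note O3 = conjunct2[OF O2] note O4 = conjunct2[OF O3]
  note O5 = conjunct2[OF O4] note O6 = conjunct2[OF O5] note O7 = conjunct2[OF O6]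
  note O8 = conjunct2[OF O7]
  show "\<alpha> \<in> ops T \<Longrightarrow> set (ins T \<alpha>) \<subseteq> colours T" "\<alpha> \<in> ops T \<Longrightarrow> out T \<alpha> \<in> colours T"
    using conjunct1[OF O1] by blast+
  show "j \<in> colours T \<Longrightarrow> unt T j \<in> ops T" "j \<in> colours T \<Longrightarrow> ins T (unt T j) = [j]"
    "j \<in> colours T \<Longrightarrow> out T (unt T j) = j"
    using conjunct1[OF O2] by blast+
  show "plugs T \<alpha> \<beta>s \<Longrightarrow> sub T \<alpha> \<beta>s \<in> ops T"
    "plugs T \<alpha> \<beta>s \<Longrightarrow> ins T (sub T \<alpha> \<beta>s) = concat (map (ins T) \<beta>s)"
    "plugs T \<alpha> \<beta>s \<Longrightarrow> out T (sub T \<alpha> \<beta>s) = out T \<alpha>"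
    using conjunct1[OF O3] by blast+
  show "\<alpha> \<in> ops T \<Longrightarrow> sub T (unt T (out T \<alpha>)) [\<alpha>] = \<alpha>"
    "\<alpha> \<in> ops T \<Longrightarrow> sub T \<alpha> (map (unt T) (ins T \<alpha>)) = \<alpha>"
    using conjunct1[OF O4] by blast+
  show "plugs T \<alpha> \<beta>s \<Longrightarrow> list_all2 (plugs T) \<beta>s \<gamma>ss \<Longrightarrow>
     sub T (sub T \<alpha> \<beta>s) (concat \<gamma>ss) = sub T \<alpha> (map2 (sub T) \<beta>s \<gamma>ss)"
    using conjunct1[OF O5] by blast
  show "\<alpha> \<in> ops T \<Longrightarrow> \<rho> \<in> perms (length (ins T \<alpha>)) \<Longrightarrow> act T \<alpha> \<rho> \<in> ops T"
    "\<alpha> \<in> ops T \<Longrightarrow> \<rho> \<in> perms (length (ins T \<alpha>)) \<Longrightarrow> ins T (act T \<alpha> \<rho>) = map (\<lambda>k. ins T \<alpha> ! k) \<rho>"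
    "\<alpha> \<in> ops T \<Longrightarrow> \<rho> \<in> perms (length (ins T \<alpha>)) \<Longrightarrow> out T (act T \<alpha> \<rho>) = out T \<alpha>"
    using conjunct1[OF O6] by blast+
  show "\<alpha> \<in> ops T \<Longrightarrow> act T \<alpha> [0..<length (ins T \<alpha>)] = \<alpha>"
    using conjunct1[OF O7] by blast
  show "\<alpha> \<in> ops T \<Longrightarrow> \<rho> \<in> perms (length (ins T \<alpha>)) \<Longrightarrow> \<sigma> \<in> perms (length (ins T \<alpha>)) \<Longrightarrow>
     act T (act T \<alpha> \<rho>) \<sigma> = act T \<alpha> (perm_comp \<rho> \<sigma>)"
    using conjunct1[OF O8] by blast
qed

lemma act_sub:
  assumes "plugs T \<beta> \<beta>s" "\<rho> \<in> perms (length (ins T \<beta>))"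
    "list_all2 (\<lambda>\<rho>' k. \<rho>' \<in> perms (length (ins T (\<beta>s ! k)))) \<rho>s \<rho>"
  shows "sub T (act T \<beta> \<rho>) (map2 (\<lambda>\<rho>' k. act T (\<beta>s ! k) \<rho>') \<rho>s \<rho>) =
    act T (sub T \<beta> \<beta>s) (block_perm \<rho> \<rho>s)"
  using operad assms unfolding operad_def by blast

lemma length_ins_act:
  "\<alpha> \<in> ops T \<Longrightarrow> \<rho> \<in> perms (length (ins T \<alpha>)) \<Longrightarrow> length (ins T (act T \<alpha> \<rho>)) = length (ins T \<alpha>)"
  by (simp add: operadD permsD)

end

lemma T_cat_simps [simp]:
  "Dom (T_cat T X) (tup \<rho> \<beta> \<gamma>s) = tup [] (act T \<beta> \<rho>) (map (Dom X) \<gamma>s)"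
  "Cod (T_cat T X) (tup \<rho> \<beta> \<gamma>s) = tup [] \<beta> (map (\<lambda>k. Cod X (\<gamma>s ! k)) (perm_inv \<rho>))"
  "Ide (T_cat T X) (tup \<rho> \<alpha> xs) = tup [0..<length xs] \<alpha> (map (Ide X) xs)"
  "Col (T_cat T X) (tup \<rho> \<alpha> xs) = out T \<alpha>"
  by (simp_all add: T_cat_def)

lemma T_Com: "Com (T_cat T X) (tup \<rho> \<beta> \<gamma>s) (tup \<sigma> \<beta>' \<delta>s) =
    tup (perm_comp \<rho> \<sigma>) \<beta> (map2 (\<lambda>k \<gamma>. Com X (\<gamma>s ! k) \<gamma>) \<sigma> \<delta>s)"
  by (simp add: T_cat_def)

lemma T_Obj_iff:
  "tup \<rho> \<alpha> xs \<in> Obj (T_cat T X) \<longleftrightarrow> \<rho> = [] \<and> \<alpha> \<in> ops T \<and> length xs = length (ins T \<alpha>) \<and>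
     (\<forall>k<length (ins T \<alpha>). xs ! k \<in> Obj X \<and> Col X (xs ! k) = ins T \<alpha> ! k)"
proof -
  have "tup \<rho> \<alpha> xs \<in> Obj (T_cat T X) \<longleftrightarrow> \<rho> = [] \<and> \<alpha> \<in> ops T \<and> (\<forall>k<length xs. xs ! k \<in> Obj X) \<and>
      length xs = length (ins T \<alpha>) \<and> (\<forall>k<length xs. Col X (xs ! k) = ins T \<alpha> ! k)"
    by (simp add: T_cat_def list_eq_iff_nth_eq[of "map f ys" for f ys] subset_code(1) all_set_conv_all_nth)
  then show ?thesis by metis
qed

lemma T_Arr_iff:
  "tup \<rho> \<beta> \<gamma>s \<in> Arr (T_cat T X) \<longleftrightarrow> \<beta> \<in> ops T \<and> \<rho> \<in> perms (length (ins T \<beta>)) \<and>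
     length \<gamma>s = length (ins T \<beta>) \<and>
     (\<forall>k<length (ins T \<beta>). \<gamma>s ! k \<in> Arr X \<and> Col X (Cod X (\<gamma>s ! k)) = ins T \<beta> ! (\<rho> ! k))"
proof -
  have "tup \<rho> \<beta> \<gamma>s \<in> Arr (T_cat T X) \<longleftrightarrow> \<beta> \<in> ops T \<and> \<rho> \<in> perms (length (ins T \<beta>)) \<and>
      (\<forall>k<length \<gamma>s. \<gamma>s ! k \<in> Arr X) \<and> length \<gamma>s = length \<rho> \<and>
      (\<forall>k<length \<gamma>s. Col X (Cod X (\<gamma>s ! k)) = map ((!) (ins T \<beta>)) \<rho> ! k)"
    by (simp add: T_cat_def list_eq_iff_nth_eq[of "map f ys" for f ys] subset_code(1) all_set_conv_all_nth)
  then show ?thesis using permsD(1)[of \<rho>] by (metis nth_map)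
qed

lemma T_ObjE:
  assumes "z \<in> Obj (T_cat T X)"
  obtains \<alpha> xs where "z = tup [] \<alpha> xs" "\<alpha> \<in> ops T" "length xs = length (ins T \<alpha>)"
    "\<forall>k<length (ins T \<alpha>). xs ! k \<in> Obj X" "\<forall>k<length (ins T \<alpha>). Col X (xs ! k) = ins T \<alpha> ! k"
proof -
  obtain \<alpha> xs where z: "z = tup [] \<alpha> xs" using assms by (auto simp: T_cat_def)
  show ?thesis using assms that[OF z] unfolding z T_Obj_iff by blast
qed

lemma T_ArrE:
  assumes "w \<in> Arr (T_cat T X)"
  obtains \<rho> \<beta> \<gamma>s where "w = tup \<rho> \<beta> \<gamma>s" "\<beta> \<in> ops T" "\<rho> \<in> perms (length (ins T \<beta>))"
    "length \<gamma>s = length (ins T \<beta>)" "\<forall>k<length (ins T \<beta>). \<gamma>s ! k \<in> Arr X"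
    "\<forall>k<length (ins T \<beta>). Col X (Cod X (\<gamma>s ! k)) = ins T \<beta> ! (\<rho> ! k)"
proof -
  obtain \<rho> \<beta> \<gamma>s where z: "w = tup \<rho> \<beta> \<gamma>s" using assms by (auto simp: T_cat_def)
  show ?thesis using assms that[OF z] unfolding z T_Arr_iff by blast
qed

lemma cods_nth:
  assumes "\<rho> \<in> perms n" "k < n"
  shows "map (\<lambda>k. f (\<gamma>s ! k)) (perm_inv \<rho>) ! (\<rho> ! k) = f (\<gamma>s ! k)"
  using permsD[OF assms(1)] perm_inv_nth[OF assms] assms by simp

section \<open>The category TX\<close>

context set_operad
begin

text \<open>Composability says two things: the operation of \<open>u\<close> is \<beta>\<rho>, and
  the \<open>k\<close>-th entry of \<open>u\<close> ends where the entry of \<open>v\<close> at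
  place \<open>\<sigma> ! k\<close> begins. The composite is given in indexed form, ready for
  comparisons by \<open>nth\<close>.\<close>

lemma T_composableE:
  assumes X: "cat_over J X" and u: "u \<in> Arr (T_cat T X)" and v: "v \<in> Arr (T_cat T X)"
    and uv: "Cod (T_cat T X) u = Dom (T_cat T X) v"
  obtains \<rho> \<beta> \<gamma>s \<sigma> \<delta>s n where "v = tup \<rho> \<beta> \<gamma>s" "u = tup \<sigma> (act T \<beta> \<rho>) \<delta>s" "\<beta> \<in> ops T"
    "n = length (ins T \<beta>)" "\<rho> \<in> perms n" "\<sigma> \<in> perms n" "length \<gamma>s = n" "length \<delta>s = n"
    "\<forall>k<n. \<gamma>s ! k \<in> Arr X" "\<forall>k<n. Col X (Cod X (\<gamma>s ! k)) = ins T \<beta> ! (\<rho> ! k)"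
    "\<forall>k<n. \<delta>s ! k \<in> Arr X" "\<forall>k<n. Cod X (\<delta>s ! k) = Dom X (\<gamma>s ! (\<sigma> ! k))"
    "Com (T_cat T X) v u = tup (perm_comp \<rho> \<sigma>) \<beta> (map (\<lambda>k. Com X (\<gamma>s ! (\<sigma> ! k)) (\<delta>s ! k)) [0..<n])"
proof -
  obtain \<rho> \<beta> \<gamma>s where v': "v = tup \<rho> \<beta> \<gamma>s" "\<beta> \<in> ops T" "\<rho> \<in> perms (length (ins T \<beta>))"
    "length \<gamma>s = length (ins T \<beta>)" "\<forall>k<length (ins T \<beta>). \<gamma>s ! k \<in> Arr X"
    "\<forall>k<length (ins T \<beta>). Col X (Cod X (\<gamma>s ! k)) = ins T \<beta> ! (\<rho> ! k)"
    using T_ArrE[OF v] .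
  obtain \<sigma> \<beta>' \<delta>s where u': "u = tup \<sigma> \<beta>' \<delta>s" "\<beta>' \<in> ops T" "\<sigma> \<in> perms (length (ins T \<beta>'))"
    "length \<delta>s = length (ins T \<beta>')" "\<forall>k<length (ins T \<beta>'). \<delta>s ! k \<in> Arr X"
    "\<forall>k<length (ins T \<beta>'). Col X (Cod X (\<delta>s ! k)) = ins T \<beta>' ! (\<sigma> ! k)"
    using T_ArrE[OF u] .
  define n where "n = length (ins T \<beta>)"
  have b: "\<beta>' = act T \<beta> \<rho>" and c: "map (\<lambda>k. Cod X (\<delta>s ! k)) (perm_inv \<sigma>) = map (Dom X) \<gamma>s"
    using uv by (simp_all add: u' v')
  have n': "length (ins T \<beta>') = n" using v' by (simp add: b n_def length_ins_act)
  have s: "\<sigma> \<in> perms n" using u'(3) n' by simp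
  have cod: "Cod X (\<delta>s ! k) = Dom X (\<gamma>s ! (\<sigma> ! k))" if "k < n" for k
    using cods_nth[OF s that, of "Cod X" \<delta>s] permsD[OF s] that v'(4) by (simp add: c n_def)
  have "Com (T_cat T X) v u = tup (perm_comp \<rho> \<sigma>) \<beta> (map (\<lambda>k. Com X (\<gamma>s ! (\<sigma> ! k)) (\<delta>s ! k)) [0..<n])"
    unfolding u'(1) v'(1) T_Com
    using permsD[OF s] u'(4) n' by (auto intro!: nth_equalityI)
  then show ?thesis
    using that[OF v'(1) u'(1)[unfolded b] v'(2) n_def] v' u' s n' cod by (simp add: n_def)
qed

lemma T_cat_over:
  assumes X: "cat_over (colours T) X"
  shows "cat_over (colours T) (T_cat T X)"
proof (rule cat_overI)
  note XD = cat_overD[OF X]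
  fix w assume "w \<in> Arr (T_cat T X)"
  then obtain \<rho> \<beta> \<gamma>s where w: "w = tup \<rho> \<beta> \<gamma>s" "\<beta> \<in> ops T" "\<rho> \<in> perms (length (ins T \<beta>))"
    "length \<gamma>s = length (ins T \<beta>)" "\<forall>k<length (ins T \<beta>). \<gamma>s ! k \<in> Arr X"
    "\<forall>k<length (ins T \<beta>). Col X (Cod X (\<gamma>s ! k)) = ins T \<beta> ! (\<rho> ! k)"
    by (rule T_ArrE)
  note r = permsD[OF w(3)] nth_perm_inv[OF w(3)] perm_inv_nth[OF w(3)]
  show "Dom (T_cat T X) w \<in> Obj (T_cat T X) \<and> Cod (T_cat T X) w \<in> Obj (T_cat T X) \<and>
      Col (T_cat T X) (Dom (T_cat T X) w) = Col (T_cat T X) (Cod (T_cat T X) w)"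
    using w r by (simp add: T_Obj_iff operadD XD)
  have "map (\<lambda>k. Com X (\<gamma>s ! k) (map (Ide X) (map (Dom X) \<gamma>s) ! k)) [0..<length \<gamma>s] = \<gamma>s"
    using w r by (auto intro!: nth_equalityI simp: XD)
  moreover have "map2 (\<lambda>k. Com X (map (Ide X) (map (\<lambda>k. Cod X (\<gamma>s ! k)) (perm_inv \<rho>)) ! k)) \<rho> \<gamma>s = \<gamma>s"
    using w r by (auto intro!: nth_equalityI simp: XD)
  moreover have "map2 (\<lambda>k. Com X (\<gamma>s ! k)) [0..<length \<gamma>s] (map (Ide X) (map (Dom X) \<gamma>s)) = \<gamma>s"
    using w r by (auto intro!: nth_equalityI simp: XD)
  ultimately show "Com (T_cat T X) w (Ide (T_cat T X) (Dom (T_cat T X) w)) = w \<and>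
      Com (T_cat T X) (Ide (T_cat T X) (Cod (T_cat T X) w)) w = w"
    using w r perm_comp_id[OF w(3)] by (simp add: T_Com)
next
  note XD = cat_overD[OF X]
  fix z assume "z \<in> Obj (T_cat T X)"
  then obtain \<alpha> xs where z: "z = tup [] \<alpha> xs" "\<alpha> \<in> ops T" "length xs = length (ins T \<alpha>)"
    "\<forall>k<length (ins T \<alpha>). xs ! k \<in> Obj X" "\<forall>k<length (ins T \<alpha>). Col X (xs ! k) = ins T \<alpha> ! k"
    by (rule T_ObjE)
  have i: "perm_inv [0..<length (ins T \<alpha>)] = [0..<length (ins T \<alpha>)]"
    using perm_inv_nth[OF id_perms, of _ "length (ins T \<alpha>)"] by (auto intro!: nth_equalityI)
  have "map (Dom X) (map (Ide X) xs) = xs" "map (\<lambda>k. Cod X (map (Ide X) xs ! k)) [0..<length (ins T \<alpha>)] = xs"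
    using z by (auto intro!: nth_equalityI simp: XD)
  then show "Col (T_cat T X) z \<in> colours T \<and> Ide (T_cat T X) z \<in> Arr (T_cat T X) \<and>
      Dom (T_cat T X) (Ide (T_cat T X) z) = z \<and> Cod (T_cat T X) (Ide (T_cat T X) z) = z"
    using z i by (simp add: T_Arr_iff operadD XD)
next
  note XD = cat_overD[OF X]
  fix u v assume u: "u \<in> Arr (T_cat T X)" and v: "v \<in> Arr (T_cat T X)"
    and uv: "Cod (T_cat T X) u = Dom (T_cat T X) v"
  obtain \<rho> \<beta> \<gamma>s \<sigma> \<delta>s n where c: "v = tup \<rho> \<beta> \<gamma>s" "u = tup \<sigma> (act T \<beta> \<rho>) \<delta>s" "\<beta> \<in> ops T"
    "n = length (ins T \<beta>)" "\<rho> \<in> perms n" "\<sigma> \<in> perms n" "length \<gamma>s = n" "length \<delta>s = n"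
    "\<forall>k<n. \<gamma>s ! k \<in> Arr X" "\<forall>k<n. Col X (Cod X (\<gamma>s ! k)) = ins T \<beta> ! (\<rho> ! k)"
    "\<forall>k<n. \<delta>s ! k \<in> Arr X" "\<forall>k<n. Cod X (\<delta>s ! k) = Dom X (\<gamma>s ! (\<sigma> ! k))"
    and C: "Com (T_cat T X) v u = tup (perm_comp \<rho> \<sigma>) \<beta> (map (\<lambda>k. Com X (\<gamma>s ! (\<sigma> ! k)) (\<delta>s ! k)) [0..<n])"
    by (rule T_composableE[OF X u v uv])
  note r = permsD[OF c(5)] permsD[OF c(6)] nth_perm_inv[OF c(5)] perm_inv_nth[OF c(5)]
  note rs = perm_comp_perms[OF c(5,6)]
  \<comment> \<open>The codomains of a composite are compared after moving the inverse of the
    composite permutation to the other side.\<close>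
  have "map (\<lambda>k. Cod X (map (\<lambda>k. Com X (\<gamma>s ! (\<sigma> ! k)) (\<delta>s ! k)) [0..<n] ! k)) (perm_inv (perm_comp \<rho> \<sigma>)) =
      map (\<lambda>k. Cod X (\<gamma>s ! k)) (perm_inv \<rho>)"
    unfolding map_perm_inv_eq_iff[OF rs, of "map (\<lambda>k. Com X (\<gamma>s ! (\<sigma> ! k)) (\<delta>s ! k)) [0..<n]" "map (\<lambda>k. Cod X (\<gamma>s ! k)) (perm_inv \<rho>)" "Cod X", simplified, OF r(1)]
    using c r cods_nth[OF c(5), of _ "Cod X" \<gamma>s] permsD[OF rs]
    by (auto intro!: nth_equalityI simp: perm_comp_nth XD)
  then show "Com (T_cat T X) v u \<in> Arr (T_cat T X) \<and>
      Dom (T_cat T X) (Com (T_cat T X) v u) = Dom (T_cat T X) u \<and>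
      Cod (T_cat T X) (Com (T_cat T X) v u) = Cod (T_cat T X) v"
    unfolding C using c(1-6) r rs
    by (auto simp: T_Arr_iff operadD perm_comp_nth XD c(7-12) intro!: nth_equalityI)
next
  note XD = cat_overD[OF X]
  fix u v w assume u: "u \<in> Arr (T_cat T X)" and v: "v \<in> Arr (T_cat T X)" and w: "w \<in> Arr (T_cat T X)"
    and uv: "Cod (T_cat T X) u = Dom (T_cat T X) v" and vw: "Cod (T_cat T X) v = Dom (T_cat T X) w"
  obtain \<rho> \<beta> \<gamma>s \<sigma> \<delta>s n where c: "v = tup \<rho> \<beta> \<gamma>s" "u = tup \<sigma> (act T \<beta> \<rho>) \<delta>s" "\<beta> \<in> ops T"
    "n = length (ins T \<beta>)" "\<rho> \<in> perms n" "\<sigma> \<in> perms n" "length \<gamma>s = n" "length \<delta>s = n"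
    "\<forall>k<n. \<gamma>s ! k \<in> Arr X" "\<forall>k<n. Col X (Cod X (\<gamma>s ! k)) = ins T \<beta> ! (\<rho> ! k)"
    "\<forall>k<n. \<delta>s ! k \<in> Arr X" "\<forall>k<n. Cod X (\<delta>s ! k) = Dom X (\<gamma>s ! (\<sigma> ! k))"
    and C: "Com (T_cat T X) v u = tup (perm_comp \<rho> \<sigma>) \<beta> (map (\<lambda>k. Com X (\<gamma>s ! (\<sigma> ! k)) (\<delta>s ! k)) [0..<n])"
    by (rule T_composableE[OF X u v uv])
  obtain \<tau> \<beta>' \<epsilon>s \<rho>' \<gamma>s' n' where d: "w = tup \<tau> \<beta>' \<epsilon>s" "v = tup \<rho>' (act T \<beta>' \<tau>) \<gamma>s'" "\<beta>' \<in> ops T"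
    "n' = length (ins T \<beta>')" "\<tau> \<in> perms n'" "\<rho>' \<in> perms n'" "length \<epsilon>s = n'" "length \<gamma>s' = n'"
    "\<forall>k<n'. \<epsilon>s ! k \<in> Arr X" "\<forall>k<n'. Col X (Cod X (\<epsilon>s ! k)) = ins T \<beta>' ! (\<tau> ! k)"
    "\<forall>k<n'. \<gamma>s' ! k \<in> Arr X" "\<forall>k<n'. Cod X (\<gamma>s' ! k) = Dom X (\<epsilon>s ! (\<rho>' ! k))"
    and D: "Com (T_cat T X) w v = tup (perm_comp \<tau> \<rho>') \<beta>' (map (\<lambda>k. Com X (\<epsilon>s ! (\<rho>' ! k)) (\<gamma>s' ! k)) [0..<n'])"
    by (rule T_composableE[OF X v w vw])
  have e: "\<rho>' = \<rho>" "\<gamma>s' = \<gamma>s" "n' = n" using c d by (auto simp: operadD permsD)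
  note r = permsD[OF c(5)] permsD[OF c(6)]
  have "perm_comp \<tau> (perm_comp \<rho> \<sigma>) = perm_comp (perm_comp \<tau> \<rho>) \<sigma>"
    using r by (auto simp: perm_comp_def)
  moreover have "map2 (\<lambda>k. Com X (\<epsilon>s ! k)) (perm_comp \<rho> \<sigma>) (map (\<lambda>k. Com X (\<gamma>s ! (\<sigma> ! k)) (\<delta>s ! k)) [0..<n]) =
      map2 (\<lambda>k. Com X (map (\<lambda>k. Com X (\<epsilon>s ! (\<rho> ! k)) (\<gamma>s ! k)) [0..<n] ! k)) \<sigma> \<delta>s"
    using c(7-12) d(7-12) r unfolding e by (auto intro!: nth_equalityI simp: perm_comp_nth XD)
  ultimately show "Com (T_cat T X) w (Com (T_cat T X) v u) = Com (T_cat T X) (Com (T_cat T X) w v) u"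
    unfolding C D unfolding c(2) d(1) T_Com e by simp
qed

end

lemma T_monad_simps [simp]:
  "fnc (T_monad T) = T_fun T" "F0 (T_fun T) = T_cat T"
  "fsrc (F1 (T_fun T) H) = T_cat T (fsrc H)" "ftgt (F1 (T_fun T) H) = T_cat T (ftgt H)"
  "tup \<rho> \<alpha> xs \<in> Obj (T_cat T (fsrc H)) \<Longrightarrow> fob (F1 (T_fun T) H) (tup \<rho> \<alpha> xs) = tup [] \<alpha> (map (fob H) xs)"
  "tup \<rho> \<alpha> xs \<in> Arr (T_cat T (fsrc H)) \<Longrightarrow> far (F1 (T_fun T) H) (tup \<rho> \<alpha> xs) = tup \<rho> \<alpha> (map (far H) xs)"
  "nsrc (F2 (T_fun T) t) = F1 (T_fun T) (nsrc t)" "ntgt (F2 (T_fun T) t) = F1 (T_fun T) (ntgt t)"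
  "tup \<rho> \<alpha> xs \<in> Obj (T_cat T (fsrc (nsrc t))) \<Longrightarrow>
    ncmp (F2 (T_fun T) t) (tup \<rho> \<alpha> xs) = tup [0..<length xs] \<alpha> (map (ncmp t) xs)"
  by (simp_all add: T_monad_def T_fun_def Let_def)

lemma T_monad_eta [simp]:
  "fsrc (eta (T_monad T) X) = X" "ftgt (eta (T_monad T) X) = T_cat T X"
  "x \<in> Obj X \<Longrightarrow> fob (eta (T_monad T) X) x = tup [] (unt T (Col X x)) [x]"
  "f \<in> Arr X \<Longrightarrow> far (eta (T_monad T) X) f = tup [0] (unt T (Col X (Cod X f))) [f]"
  by (simp_all add: T_monad_def)

lemma T_monad_mu [simp]:
  "fsrc (mu (T_monad T) X) = T_cat T (T_cat T X)" "ftgt (mu (T_monad T) X) = T_cat T X"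
  "tup \<rho> \<alpha> zs \<in> Obj (T_cat T (T_cat T X)) \<Longrightarrow>
    fob (mu (T_monad T) X) (tup \<rho> \<alpha> zs) = tup [] (sub T \<alpha> (map opn zs)) (concat (map args zs))"
  "tup \<rho> \<beta> ws \<in> Arr (T_cat T (T_cat T X)) \<Longrightarrow> far (mu (T_monad T) X) (tup \<rho> \<beta> ws) =
    tup (block_perm \<rho> (map prm ws)) (sub T \<beta> (map (\<lambda>k. opn (ws ! k)) (perm_inv \<rho>))) (concat (map args ws))"
  by (simp_all add: T_monad_def)

text \<open>The characterizations by lists suit concatenations, those by index suit
  permutations.\<close>

lemma T_Obj_list_iff:
  "tup \<rho> \<alpha> xs \<in> Obj (T_cat T X) \<longleftrightarrow>
    \<rho> = [] \<and> \<alpha> \<in> ops T \<and> set xs \<subseteq> Obj X \<and> map (Col X) xs = ins T \<alpha>"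
  by (auto simp: T_cat_def)

lemma T_Arr_list_iff:
  "tup \<rho> \<beta> \<gamma>s \<in> Arr (T_cat T X) \<longleftrightarrow> \<beta> \<in> ops T \<and> \<rho> \<in> perms (length (ins T \<beta>)) \<and> set \<gamma>s \<subseteq> Arr X \<and>
     map (\<lambda>\<gamma>. Col X (Cod X \<gamma>)) \<gamma>s = map (\<lambda>k. ins T \<beta> ! k) \<rho>"
  by (auto simp: T_cat_def)

lemma T_arr_components:
  assumes "w \<in> Arr (T_cat T X)"
  shows "w = tup (prm w) (opn w) (args w)" "opn w \<in> ops T" "prm w \<in> perms (length (ins T (opn w)))"
    "length (args w) = length (ins T (opn w))"
    "set (args w) \<subseteq> Arr X"
    "map (\<lambda>\<gamma>. Col X (Cod X \<gamma>)) (args w) = map (\<lambda>k. ins T (opn w) ! k) (prm w)"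
proof -
  obtain \<rho> \<beta> \<gamma>s where w: "w = tup \<rho> \<beta> \<gamma>s" using assms by (auto simp: T_cat_def)
  note a = assms[unfolded w T_Arr_list_iff] and b = assms[unfolded w T_Arr_iff]
  show "w = tup (prm w) (opn w) (args w)" "opn w \<in> ops T" "prm w \<in> perms (length (ins T (opn w)))"
    "length (args w) = length (ins T (opn w))"
    "set (args w) \<subseteq> Arr X"
    "map (\<lambda>\<gamma>. Col X (Cod X \<gamma>)) (args w) = map (\<lambda>k. ins T (opn w) ! k) (prm w)"
    using a b by (simp_all add: w)
qed

lemma T_obj_components:
  assumes "z \<in> Obj (T_cat T X)"
  shows "z = tup [] (opn z) (args z)" "opn z \<in> ops T" "set (args z) \<subseteq> Obj X"
    "map (Col X) (args z) = ins T (opn z)" "length (args z) = length (ins T (opn z))"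
proof -
  obtain \<alpha> xs where z: "z = tup [] \<alpha> xs" using assms by (auto simp: T_cat_def)
  note a = assms[unfolded z T_Obj_list_iff] and b = assms[unfolded z T_Obj_iff]
  show "z = tup [] (opn z) (args z)" "opn z \<in> ops T" "set (args z) \<subseteq> Obj X"
    "map (Col X) (args z) = ins T (opn z)" "length (args z) = length (ins T (opn z))"
    using a b by (simp_all add: z)
qed

lemma map2_concat:
  assumes "length xss = length yss" "\<And>k. k < length xss \<Longrightarrow> length (xss ! k) = length (yss ! k)"
  shows "map2 f (concat xss) (concat yss) = concat (map2 (map2 f) xss yss)"
  using assms
proof (induction xss yss rule: list_induct2)
  case (Cons xs xss ys yss)
  have "length xs = length ys" using Cons.prems[of 0] by simp
  moreover have "map2 f (concat xss) (concat yss) = concat (map2 (map2 f) xss yss)"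
    using Cons.prems[of "Suc k" for k] by (intro Cons.IH) auto
  ultimately show ?case by simp
qed simp

section \<open>The 2-functor, the unit and the multiplication\<close>

context set_operad
begin

abbreviation "J \<equiv> colours T"

lemma T_fun_hom:
  assumes H: "H \<in> hom (over J) X Y"
  shows "F1 (T_fun T) H \<in> hom (over J) (T_cat T X) (T_cat T Y)"
proof -
  note HD = hom_overD[OF H]
  note XD = cat_overD[OF HD(1)]
  have "mk_func (T_cat T X) (T_cat T Y) (\<lambda>u. tup [] (opn u) (map (fob H) (args u)))
     (\<lambda>u. tup (prm u) (opn u) (map (far H) (args u))) \<in> hom (over J) (T_cat T X) (T_cat T Y)"
  proof (rule mk_func_hom)
    show "cat_over J (T_cat T X)" "cat_over J (T_cat T Y)" using HD T_cat_over by auto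
  next
    fix z assume "z \<in> Obj (T_cat T X)"
    then obtain \<alpha> xs where z: "z = tup [] \<alpha> xs" "\<alpha> \<in> ops T" "length xs = length (ins T \<alpha>)"
      "\<forall>k<length (ins T \<alpha>). xs ! k \<in> Obj X" "\<forall>k<length (ins T \<alpha>). Col X (xs ! k) = ins T \<alpha> ! k"
      by (rule T_ObjE)
    then show "tup [] (opn z) (map (fob H) (args z)) \<in> Obj (T_cat T Y)"
      "Col (T_cat T Y) (tup [] (opn z) (map (fob H) (args z))) = Col (T_cat T X) z"
      "tup (prm (Ide (T_cat T X) z)) (opn (Ide (T_cat T X) z)) (map (far H) (args (Ide (T_cat T X) z))) =
         Ide (T_cat T Y) (tup [] (opn z) (map (fob H) (args z)))"
      by (auto simp: T_Obj_iff HD in_set_conv_nth)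
  next
    fix w assume "w \<in> Arr (T_cat T X)"
    then obtain \<rho> \<beta> \<gamma>s where w: "w = tup \<rho> \<beta> \<gamma>s" "\<beta> \<in> ops T" "\<rho> \<in> perms (length (ins T \<beta>))"
      "length \<gamma>s = length (ins T \<beta>)" "\<forall>k<length (ins T \<beta>). \<gamma>s ! k \<in> Arr X"
      "\<forall>k<length (ins T \<beta>). Col X (Cod X (\<gamma>s ! k)) = ins T \<beta> ! (\<rho> ! k)"
      by (rule T_ArrE)
    note r = permsD[OF w(3)] nth_perm_inv[OF w(3)]
    show "tup (prm w) (opn w) (map (far H) (args w)) \<in> Arr (T_cat T Y)"
      "Dom (T_cat T Y) (tup (prm w) (opn w) (map (far H) (args w))) =
        tup [] (opn (Dom (T_cat T X) w)) (map (fob H) (args (Dom (T_cat T X) w)))"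
      "Cod (T_cat T Y) (tup (prm w) (opn w) (map (far H) (args w))) =
        tup [] (opn (Cod (T_cat T X) w)) (map (fob H) (args (Cod (T_cat T X) w)))"
      using w r by (auto simp: T_Arr_iff HD XD in_set_conv_nth intro!: nth_equalityI)
  next
    fix u v assume u: "u \<in> Arr (T_cat T X)" and v: "v \<in> Arr (T_cat T X)"
      and uv: "Cod (T_cat T X) u = Dom (T_cat T X) v"
    obtain \<rho> \<beta> \<gamma>s \<sigma> \<delta>s n where c: "v = tup \<rho> \<beta> \<gamma>s" "u = tup \<sigma> (act T \<beta> \<rho>) \<delta>s" "\<beta> \<in> ops T"
      "n = length (ins T \<beta>)" "\<rho> \<in> perms n" "\<sigma> \<in> perms n" "length \<gamma>s = n" "length \<delta>s = n"
      "\<forall>k<n. \<gamma>s ! k \<in> Arr X" "\<forall>k<n. Col X (Cod X (\<gamma>s ! k)) = ins T \<beta> ! (\<rho> ! k)"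
      "\<forall>k<n. \<delta>s ! k \<in> Arr X" "\<forall>k<n. Cod X (\<delta>s ! k) = Dom X (\<gamma>s ! (\<sigma> ! k))"
      and C: "Com (T_cat T X) v u = tup (perm_comp \<rho> \<sigma>) \<beta> (map (\<lambda>k. Com X (\<gamma>s ! (\<sigma> ! k)) (\<delta>s ! k)) [0..<n])"
      by (rule T_composableE[OF HD(1) u v uv])
    show "tup (prm (Com (T_cat T X) v u)) (opn (Com (T_cat T X) v u)) (map (far H) (args (Com (T_cat T X) v u))) =
      Com (T_cat T Y) (tup (prm v) (opn v) (map (far H) (args v))) (tup (prm u) (opn u) (map (far H) (args u)))"
      unfolding C unfolding c(1,2) tup_simps T_Com
      using c(5-12) permsD[OF c(6)] by (auto simp: HD XD intro!: nth_equalityI)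
  qed
  then show ?thesis by (simp add: T_fun_def HD Let_def)
qed

lemma T_fun_cells:
  assumes t: "t \<in> cells (over J) G H" and G: "G \<in> hom (over J) X Y"
  shows "F2 (T_fun T) t \<in> cells (over J) (F1 (T_fun T) G) (F1 (T_fun T) H)"
proof -
  note tD = cells_overD[OF t G]
  note GD = hom_overD[OF G] and HD = hom_overD[OF tD(1)] and TG = T_fun_hom[OF G] and TH = T_fun_hom[OF tD(1)]
  note XD = cat_overD[OF GD(1)]
  have "mk_ntrans (F1 (T_fun T) G) (F1 (T_fun T) H) (\<lambda>u. tup [0..<length (args u)] (opn u) (map (ncmp t) (args u)))
      \<in> cells (over J) (F1 (T_fun T) G) (F1 (T_fun T) H)"
  proof (rule mk_ntrans_cells[OF TG TH])
    fix z assume zz: "z \<in> Obj (T_cat T X)"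
    then obtain \<alpha> xs where z: "z = tup [] \<alpha> xs" "\<alpha> \<in> ops T" "length xs = length (ins T \<alpha>)"
      "\<forall>k<length (ins T \<alpha>). xs ! k \<in> Obj X" "\<forall>k<length (ins T \<alpha>). Col X (xs ! k) = ins T \<alpha> ! k"
      by (rule T_ObjE)
    have "perm_inv [0..<length (ins T \<alpha>)] ! k = k" if "k < length (ins T \<alpha>)" for k
      using perm_inv_nth[OF id_perms that] that by simp
    moreover have "x \<in> Obj X" if "x \<in> set xs" for x
      using that z by (auto simp: in_set_conv_nth)
    ultimately show "tup [0..<length (args z)] (opn z) (map (ncmp t) (args z)) \<in> Arr (T_cat T Y) \<and>
        Dom (T_cat T Y) (tup [0..<length (args z)] (opn z) (map (ncmp t) (args z))) = fob (F1 (T_fun T) G) z \<and>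
        Cod (T_cat T Y) (tup [0..<length (args z)] (opn z) (map (ncmp t) (args z))) = fob (F1 (T_fun T) H) z"
      using z zz by (auto simp: T_Arr_iff GD HD tD operadD intro!: nth_equalityI)
  next
    fix w assume ww: "w \<in> Arr (T_cat T X)"
    then obtain \<rho> \<beta> \<gamma>s where w: "w = tup \<rho> \<beta> \<gamma>s" "\<beta> \<in> ops T" "\<rho> \<in> perms (length (ins T \<beta>))"
      "length \<gamma>s = length (ins T \<beta>)" "\<forall>k<length (ins T \<beta>). \<gamma>s ! k \<in> Arr X"
      "\<forall>k<length (ins T \<beta>). Col X (Cod X (\<gamma>s ! k)) = ins T \<beta> ! (\<rho> ! k)"
      by (rule T_ArrE)
    note r = permsD[OF w(3)] perm_inv_nth[OF w(3)]
    have W: "tup \<rho> \<beta> \<gamma>s \<in> Arr (T_cat T X)" using ww w by simp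
    show "Com (T_cat T Y) (tup [0..<length (args (Cod (T_cat T X) w))] (opn (Cod (T_cat T X) w))
           (map (ncmp t) (args (Cod (T_cat T X) w)))) (far (F1 (T_fun T) G) w) =
        Com (T_cat T Y) (far (F1 (T_fun T) H) w) (tup [0..<length (args (Dom (T_cat T X) w))]
           (opn (Dom (T_cat T X) w)) (map (ncmp t) (args (Dom (T_cat T X) w))))"
      using W w r by (auto simp: T_Com GD HD tD perm_comp_id[OF w(3)] intro!: nth_equalityI)
  qed
  then show ?thesis by (simp add: T_fun_def tD Let_def)
qed

lemma eta_hom:
  assumes X: "cat_over J X"
  shows "eta (T_monad T) X \<in> hom (over J) X (T_cat T X)"
proof -
  note XD = cat_overD[OF X]
  have i: "perm_inv [0] = [0]" using perm_inv_nth[of "[0]" 1 0] by (intro nth_equalityI) (auto simp: perms_def)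
  have p: "[0] \<in> perms 1" using id_perms[of 1] by simp
  have a: "act T (unt T j) [0] = unt T j" if "j \<in> J" for j
    using operadD(15)[of "unt T j"] that by (simp add: operadD)
  show ?thesis unfolding T_monad_def twomonad.select_convs
    by (rule mk_func_hom[OF X T_cat_over[OF X]])
      (use p in \<open>simp_all add: T_Obj_iff T_Arr_iff operadD XD i a T_Com perm_comp_def\<close>)
qed

text \<open>The list \<open>\<beta>s\<close> holds the operations of the codomain, read through the
  inverse of \<rho> so that the operation of \<open>ws ! k\<close> stands at place
  \<open>\<rho> ! k\<close>. With these sizes, \<rho> and the permutations of \<open>ws\<close> form
  a block family, and this is what makes the image an arrow.\<close>

lemma mu_arr:
  assumes X: "cat_over J X" and u: "tup \<rho> \<beta> ws \<in> Arr (T_cat T (T_cat T X))"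
  defines "n \<equiv> length (ins T \<beta>)" and "\<beta>s \<equiv> map (\<lambda>k. opn (ws ! k)) (perm_inv \<rho>)"
  shows "plugs T \<beta> \<beta>s" "block_fam (\<lambda>j. length (ins T (\<beta>s ! j))) n \<rho> (map prm ws)"
    "length \<beta>s = n" "length ws = n" "k < n \<Longrightarrow> \<beta>s ! (\<rho> ! k) = opn (ws ! k)" "\<rho> \<in> perms n"
    "k < n \<Longrightarrow> ws ! k \<in> Arr (T_cat T X)" "\<beta> \<in> ops T"
    "block_perm \<rho> (map prm ws) \<in> perms (length (ins T (sub T \<beta> \<beta>s)))"
    "length (concat (map args ws)) = length (ins T (sub T \<beta> \<beta>s))"
    "tup (block_perm \<rho> (map prm ws)) (sub T \<beta> \<beta>s) (concat (map args ws)) \<in> Arr (T_cat T X)"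
proof -
  have U: "\<beta> \<in> ops T" "\<rho> \<in> perms n" "length ws = n"
    "\<And>k. k < n \<Longrightarrow> ws ! k \<in> Arr (T_cat T X)" "\<And>k. k < n \<Longrightarrow> Col (T_cat T X) (Cod (T_cat T X) (ws ! k)) = ins T \<beta> ! (\<rho> ! k)"
    using u unfolding T_Arr_iff n_def by auto
  note r = permsD[OF U(2)] nth_perm_inv[OF U(2)]
  note wc = T_arr_components[OF U(4)]
  have out: "out T (opn (ws ! k)) = ins T \<beta> ! (\<rho> ! k)" if "k < n" for k
  proof -
    have "Cod (T_cat T X) (ws ! k) = tup [] (opn (ws ! k)) (map (\<lambda>l. Cod X (args (ws ! k) ! l)) (perm_inv (prm (ws ! k))))"
      by (subst wc(1)[OF that]) simp
    then show ?thesis using U(5)[OF that] by simp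
  qed
  show bl: "length \<beta>s = n" using r by (simp add: \<beta>s_def)
  show b: "\<beta>s ! (\<rho> ! k) = opn (ws ! k)" if "k < n" for k
    unfolding \<beta>s_def using cods_nth[OF U(2) that, of opn ws] .
  show "length ws = n" "\<rho> \<in> perms n" "\<beta> \<in> ops T" "k < n \<Longrightarrow> ws ! k \<in> Arr (T_cat T X)"
    using U by auto
  have "map (out T) \<beta>s = ins T \<beta>"
  proof (rule nth_equalityI)
    fix j assume "j < length (map (out T) \<beta>s)"
    then have j: "j < n" using bl by simp
    show "map (out T) \<beta>s ! j = ins T \<beta> ! j"
      using out[of "perm_inv \<rho> ! j"] r j by (simp add: \<beta>s_def)
  qed (simp add: bl n_def)
  moreover have "set \<beta>s \<subseteq> ops T"
    using r(1) wc(2) r(7) by (auto simp: \<beta>s_def in_set_conv_nth)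
  ultimately show pl: "plugs T \<beta> \<beta>s" using U(1) by (simp add: plugs_def)
  show bf: "block_fam (\<lambda>j. length (ins T (\<beta>s ! j))) n \<rho> (map prm ws)"
    using U(2,3) b wc(3) by (simp add: block_fam_def)
  have sum: "(\<Sum>j<n. length (ins T (\<beta>s ! j))) = length (ins T (sub T \<beta> \<beta>s))"
    using operadD(7)[OF pl] bl by (simp add: length_concat sum_list_sum_nth lessThan_atLeast0)
  show bp: "block_perm \<rho> (map prm ws) \<in> perms (length (ins T (sub T \<beta> \<beta>s)))"
    using block_perm_perms[OF bf] sum by simp
  have "map (\<lambda>i. concat (map (ins T) \<beta>s) ! i) (block_perm \<rho> (map prm ws)) =
      concat (map (\<lambda>k. map (\<lambda>l. map (ins T) \<beta>s ! (\<rho> ! k) ! l) (map prm ws ! k)) [0..<n])"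
    using bl by (intro map_concat_block_perm[OF bf]) auto
  also have "\<dots> = concat (map (\<lambda>k. map (\<lambda>\<gamma>. Col X (Cod X \<gamma>)) (args (ws ! k))) [0..<n])"
    using U(3) bl r b wc(6) by (intro arg_cong[of _ _ concat] map_cong refl) simp
  also have "\<dots> = concat (map (map (\<lambda>\<gamma>. Col X (Cod X \<gamma>))) (map args ws))"
    using U(3) by (intro arg_cong[of _ _ concat]) (auto intro: nth_equalityI)
  finally have col: "map (\<lambda>\<gamma>. Col X (Cod X \<gamma>)) (concat (map args ws)) =
      map (\<lambda>i. ins T (sub T \<beta> \<beta>s) ! i) (block_perm \<rho> (map prm ws))"
    by (simp add: map_concat operadD(7)[OF pl])
  have "set (concat (map args ws)) \<subseteq> Arr X"
    using wc(5) U(3) by (auto simp: in_set_conv_nth) (metis nth_mem subsetD)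
  then show a: "tup (block_perm \<rho> (map prm ws)) (sub T \<beta> \<beta>s) (concat (map args ws)) \<in> Arr (T_cat T X)"
    unfolding T_Arr_list_iff using col bp pl operadD(6) by auto
  then show "length (concat (map args ws)) = length (ins T (sub T \<beta> \<beta>s))"
    unfolding T_Arr_iff by simp
qed

lemma mu_obj:
  assumes "tup \<rho> \<alpha> zs \<in> Obj (T_cat T (T_cat T X))"
  shows "plugs T \<alpha> (map opn zs)" "length zs = length (ins T \<alpha>)" "\<alpha> \<in> ops T"
    "set zs \<subseteq> Obj (T_cat T X)" "concat (map (map (Col X)) (map args zs)) = ins T (sub T \<alpha> (map opn zs))"
    "tup [] (sub T \<alpha> (map opn zs)) (concat (map args zs)) \<in> Obj (T_cat T X)"
proof -
  note U = assms[unfolded T_Obj_list_iff]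
  show a: "length zs = length (ins T \<alpha>)" "\<alpha> \<in> ops T" "set zs \<subseteq> Obj (T_cat T X)"
    using U assms T_Obj_iff by blast+
  note zc = T_obj_components[OF subsetD[OF a(3)]]
  have "Col (T_cat T X) z = out T (opn z)" if "z \<in> set zs" for z
    by (subst zc(1)[OF that]) simp
  then have "map (out T) (map opn zs) = ins T \<alpha>" using U by (auto cong: map_cong)
  then show pl: "plugs T \<alpha> (map opn zs)" using zc(2) a by (auto simp: plugs_def)
  show b: "concat (map (map (Col X)) (map args zs)) = ins T (sub T \<alpha> (map opn zs))"
    using zc(4) operadD(7)[OF pl] by (auto cong: map_cong simp: comp_def)
  show "tup [] (sub T \<alpha> (map opn zs)) (concat (map args zs)) \<in> Obj (T_cat T X)"
    unfolding T_Obj_list_iff using operadD(6)[OF pl] zc(3) b by (auto simp: map_concat)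
qed

text \<open>Preservation of domains is the equivariance axiom of the operad. Preservation of
  identities and composites rests on the same properties of the substitution of
  permutations.\<close>

lemma mu_hom:
  assumes X: "cat_over J X"
  shows "mu (T_monad T) X \<in> hom (over J) (T_cat T (T_cat T X)) (T_cat T X)"
  unfolding T_monad_def twomonad.select_convs
proof (rule mk_func_hom)
  note XD = cat_overD[OF X]
  note TX = T_cat_over[OF X]
  show "cat_over J (T_cat T X)" "cat_over J (T_cat T (T_cat T X))"
    using TX T_cat_over by auto
next
  note XD = cat_overD[OF X]
  fix z assume zz: "z \<in> Obj (T_cat T (T_cat T X))"
  then obtain \<alpha> zs where z: "z = tup [] \<alpha> zs" by (auto simp: T_cat_def)
  note m = mu_obj[OF zz[unfolded z]]
  note zc = T_obj_components[OF subsetD[OF m(4)]]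
  show "tup [] (sub T (opn z) (map opn (args z))) (concat (map args (args z))) \<in> Obj (T_cat T X)"
    using m by (simp add: z)
  show "Col (T_cat T X) (tup [] (sub T (opn z) (map opn (args z))) (concat (map args (args z)))) =
      Col (T_cat T (T_cat T X)) z"
    using operadD(8)[OF m(1)] by (simp add: z)
  have I: "Ide (T_cat T X) y = tup [0..<length (args y)] (opn y) (map (Ide X) (args y))" if "y \<in> set zs" for y
    by (subst zc(1)[OF that]) simp
  let ?n = "length zs"
  have ii: "perm_inv [0..<?n] = [0..<?n]"
    using perm_inv_nth[OF id_perms, of _ ?n] by (auto intro!: nth_equalityI)
  have "map (\<lambda>k. opn (map (Ide (T_cat T X)) zs ! k)) (perm_inv [0..<?n]) = map opn zs"
    unfolding ii by (auto intro!: nth_equalityI simp: I)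
  moreover have "map prm (map (Ide (T_cat T X)) zs) = map (\<lambda>k. [0..<length (args (zs ! k))]) [0..<?n]"
    by (auto intro!: nth_equalityI simp: I)
  then have "block_perm [0..<?n] (map prm (map (Ide (T_cat T X)) zs)) = [0..<\<Sum>j<?n. length (args (zs ! j))]"
    by (simp only: block_perm_id)
  moreover have "(\<Sum>j<?n. length (args (zs ! j))) = length (concat (map args zs))"
    by (simp add: length_concat sum_list_sum_nth lessThan_atLeast0)
  moreover have "concat (map args (map (Ide (T_cat T X)) zs)) = map (Ide X) (concat (map args zs))"
    by (auto simp: map_concat I comp_def cong: map_cong)
  ultimately show "tup (block_perm (prm (Ide (T_cat T (T_cat T X)) z)) (map prm (args (Ide (T_cat T (T_cat T X)) z))))
      (sub T (opn (Ide (T_cat T (T_cat T X)) z)) (map (\<lambda>k. opn (args (Ide (T_cat T (T_cat T X)) z) ! k))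
        (perm_inv (prm (Ide (T_cat T (T_cat T X)) z)))))
      (concat (map args (args (Ide (T_cat T (T_cat T X)) z)))) =
    Ide (T_cat T X) (tup [] (sub T (opn z) (map opn (args z))) (concat (map args (args z))))"
    by (simp add: z)
next
  note XD = cat_overD[OF X]
  fix u assume uu: "u \<in> Arr (T_cat T (T_cat T X))"
  then obtain \<rho> \<beta> ws where u: "u = tup \<rho> \<beta> ws" by (auto simp: T_cat_def)
  define \<beta>s n where bs: "\<beta>s = map (\<lambda>k. opn (ws ! k)) (perm_inv \<rho>)" and n: "n = length (ins T \<beta>)"
  note m = mu_arr[OF X uu[unfolded u], folded bs n]
  note wc = T_arr_components[OF m(7)]
  note r = permsD[OF m(6)] nth_perm_inv[OF m(6)]
  have D: "Dom (T_cat T X) (ws ! k) = tup [] (act T (opn (ws ! k)) (prm (ws ! k))) (map (Dom X) (args (ws ! k)))"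
    if "k < n" for k by (subst wc(1)[OF that]) simp
  have C: "Cod (T_cat T X) (ws ! k) = tup [] (opn (ws ! k)) (map (\<lambda>l. Cod X (args (ws ! k) ! l)) (perm_inv (prm (ws ! k))))"
    if "k < n" for k by (subst wc(1)[OF that]) simp
  show "tup (block_perm (prm u) (map prm (args u)))
      (sub T (opn u) (map (\<lambda>k. opn (args u ! k)) (perm_inv (prm u)))) (concat (map args (args u))) \<in> Arr (T_cat T X)"
    using m(11) by (simp add: u bs)
  \<comment> \<open>Equivariance of substitution, for \<rho> and all inner permutations at
    once.\<close>
  have "sub T (act T \<beta> \<rho>) (map opn (map (Dom (T_cat T X)) ws)) = act T (sub T \<beta> \<beta>s) (block_perm \<rho> (map prm ws))"
  proof -
    have "map opn (map (Dom (T_cat T X)) ws) = map2 (\<lambda>\<rho>' k. act T (\<beta>s ! k) \<rho>') (map prm ws) \<rho>"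
      using m(4,5) r D by (auto intro!: nth_equalityI)
    moreover have "list_all2 (\<lambda>\<rho>' k. \<rho>' \<in> perms (length (ins T (\<beta>s ! k)))) (map prm ws) \<rho>"
      using m(4,5) r wc(3) by (auto simp: list_all2_conv_all_nth)
    ultimately show ?thesis using act_sub[OF m(1), of \<rho>] m(6) by (simp add: n)
  qed
  moreover have "map args (map (Dom (T_cat T X)) ws) = map (map (Dom X)) (map args ws)"
    by (rule nth_equalityI) (simp_all add: D m(4))
  then have "concat (map args (map (Dom (T_cat T X)) ws)) = map (Dom X) (concat (map args ws))"
    by (simp only: map_concat)
  ultimately show "Dom (T_cat T X) (tup (block_perm (prm u) (map prm (args u)))
      (sub T (opn u) (map (\<lambda>k. opn (args u ! k)) (perm_inv (prm u)))) (concat (map args (args u)))) =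
    tup [] (sub T (opn (Dom (T_cat T (T_cat T X)) u)) (map opn (args (Dom (T_cat T (T_cat T X)) u))))
      (concat (map args (args (Dom (T_cat T (T_cat T X)) u))))"
    by (simp add: u bs)
  \<comment> \<open>These are the argument lists of the inner codomains, in the order of the outer
    codomain. Their concatenation, read along the block permutation, must give the codomains of all
    inner arrows.\<close>
  define yss where "yss = map args (map (\<lambda>k. Cod (T_cat T X) (ws ! k)) (perm_inv \<rho>))"
  have yl: "length yss = n" "\<And>j. j < n \<Longrightarrow> length (yss ! j) = length (ins T (\<beta>s ! j))"
    using r C wc(3) by (simp_all add: yss_def bs permsD(1))
  have y: "yss ! (\<rho> ! k) = map (\<lambda>l. Cod X (args (ws ! k) ! l)) (perm_inv (prm (ws ! k)))" if "k < n" for k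
    unfolding yss_def map_map comp_def
    using cods_nth[OF m(6) that, of "\<lambda>w. args (Cod (T_cat T X) w)" ws] C[OF that] by simp
  have "map (\<lambda>i. concat yss ! i) (block_perm \<rho> (map prm ws)) =
      concat (map (\<lambda>k. map (\<lambda>l. yss ! (\<rho> ! k) ! l) (map prm ws ! k)) [0..<n])"
    by (rule map_concat_block_perm[OF m(2) yl])
  also have "\<dots> = concat (map (map (Cod X)) (map args ws))"
  proof (rule arg_cong[of _ _ concat], rule nth_equalityI)
    fix k assume "k < length (map (\<lambda>k. map (\<lambda>l. yss ! (\<rho> ! k) ! l) (map prm ws ! k)) [0..<n])"
    then have k: "k < n" by simp
    have "map (\<lambda>l. yss ! (\<rho> ! k) ! l) (prm (ws ! k)) = map (Cod X) (args (ws ! k))"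
      using cods_nth[OF wc(3)[OF k], of _ "Cod X" "args (ws ! k)"] permsD[OF wc(3)[OF k]] wc(4)[OF k]
      by (auto intro!: nth_equalityI simp: y[OF k])
    then show "map (\<lambda>k. map (\<lambda>l. yss ! (\<rho> ! k) ! l) (map prm ws ! k)) [0..<n] ! k =
        map (map (Cod X)) (map args ws) ! k"
      using k m(4) by simp
  qed (simp add: m(4))
  finally have "map (Cod X) (concat (map args ws)) = map (\<lambda>i. concat yss ! i) (block_perm \<rho> (map prm ws))"
    by (simp add: map_concat)
  moreover have "length (concat yss) = length (ins T (sub T \<beta> \<beta>s))"
  proof -
    have "map length yss = map length (map (ins T) \<beta>s)"
      using yl m(3) by (auto intro!: nth_equalityI)
    then show ?thesis unfolding length_concat operadD(7)[OF m(1)] by simp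
  qed
  ultimately have "map (\<lambda>k. Cod X (concat (map args ws) ! k)) (perm_inv (block_perm \<rho> (map prm ws))) = concat yss"
    using map_perm_inv_eq_iff[OF m(9,10), of "concat yss" "Cod X"] by simp
  moreover have "map opn (map (\<lambda>k. Cod (T_cat T X) (ws ! k)) (perm_inv \<rho>)) = \<beta>s"
    using C permsD(3)[OF perm_inv_perms[OF m(6)]] by (simp add: bs)
  ultimately show "Cod (T_cat T X) (tup (block_perm (prm u) (map prm (args u)))
      (sub T (opn u) (map (\<lambda>k. opn (args u ! k)) (perm_inv (prm u)))) (concat (map args (args u)))) =
    tup [] (sub T (opn (Cod (T_cat T (T_cat T X)) u)) (map opn (args (Cod (T_cat T (T_cat T X)) u))))
      (concat (map args (args (Cod (T_cat T (T_cat T X)) u))))"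
    by (simp add: u bs yss_def comp_def cong: map_cong)
next
  note XD = cat_overD[OF X]
  fix u v assume u: "u \<in> Arr (T_cat T (T_cat T X))" and v: "v \<in> Arr (T_cat T (T_cat T X))"
    and uv: "Cod (T_cat T (T_cat T X)) u = Dom (T_cat T (T_cat T X)) v"
  obtain \<rho> \<beta> \<gamma>s \<sigma> \<delta>s n where c: "v = tup \<rho> \<beta> \<gamma>s" "u = tup \<sigma> (act T \<beta> \<rho>) \<delta>s" "\<beta> \<in> ops T"
    "n = length (ins T \<beta>)" "\<rho> \<in> perms n" "\<sigma> \<in> perms n" "length \<gamma>s = n" "length \<delta>s = n"
    "\<forall>k<n. \<gamma>s ! k \<in> Arr (T_cat T X)" "\<forall>k<n. Col (T_cat T X) (Cod (T_cat T X) (\<gamma>s ! k)) = ins T \<beta> ! (\<rho> ! k)"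
    "\<forall>k<n. \<delta>s ! k \<in> Arr (T_cat T X)" "\<forall>k<n. Cod (T_cat T X) (\<delta>s ! k) = Dom (T_cat T X) (\<gamma>s ! (\<sigma> ! k))"
    and C: "Com (T_cat T (T_cat T X)) v u =
      tup (perm_comp \<rho> \<sigma>) \<beta> (map (\<lambda>k. Com (T_cat T X) (\<gamma>s ! (\<sigma> ! k)) (\<delta>s ! k)) [0..<n])"
    by (rule T_composableE[OF T_cat_over[OF X] u v uv])
  note m = mu_arr[OF X v[unfolded c(1)], folded c(4)]
  define \<beta>s where bs: "\<beta>s = map (\<lambda>k. opn (\<gamma>s ! k)) (perm_inv \<rho>)"
  note m = m[folded bs]
  note rs = perm_comp_perms[OF c(5,6)] and r = permsD[OF c(5)] permsD[OF c(6)]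
  note gc = T_arr_components[OF c(9)[rule_format]] and dc = T_arr_components[OF c(11)[rule_format]]
  have od: "opn (\<delta>s ! k) = act T (opn (\<gamma>s ! (\<sigma> ! k))) (prm (\<gamma>s ! (\<sigma> ! k)))" if k: "k < n" for k
  proof -
    have k': "\<sigma> ! k < n" using r k by simp
    have "opn (\<delta>s ! k) = opn (Cod (T_cat T X) (\<delta>s ! k))" by (subst (2) dc(1)[OF k]) simp
    also have "\<dots> = opn (Dom (T_cat T X) (\<gamma>s ! (\<sigma> ! k)))" using c(12) k by simp
    also have "\<dots> = act T (opn (\<gamma>s ! (\<sigma> ! k))) (prm (\<gamma>s ! (\<sigma> ! k)))" by (subst (1) gc(1)[OF k']) simp
    finally show ?thesis .
  qed
  \<comment> \<open>The inner blocks of \<open>u\<close> have the lengths that the block family of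
    \<open>v\<close> prescribes after \<sigma>, so that the two families compose.\<close>
  have len: "length (ins T (opn (\<delta>s ! k))) = length (ins T (\<beta>s ! (\<rho> ! (\<sigma> ! k))))" if k: "k < n" for k
    using od[OF k] gc(2,3)[of "\<sigma> ! k"] r k m(5)[of "\<sigma> ! k"] by (simp add: length_ins_act)
  have bf: "block_fam (\<lambda>k. length (ins T (\<beta>s ! (\<rho> ! k)))) n \<sigma> (map prm \<delta>s)"
    using c(6,8) dc(3) len by (simp add: block_fam_def)
  have cc: "Com (T_cat T X) (\<gamma>s ! (\<sigma> ! k)) (\<delta>s ! k) =
      tup (perm_comp (prm (\<gamma>s ! (\<sigma> ! k))) (prm (\<delta>s ! k))) (opn (\<gamma>s ! (\<sigma> ! k)))
        (map2 (\<lambda>l. Com X (args (\<gamma>s ! (\<sigma> ! k)) ! l)) (prm (\<delta>s ! k)) (args (\<delta>s ! k)))" if k: "k < n" for k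
  proof -
    have k': "\<sigma> ! k < n" using r k by simp
    show ?thesis using T_Com[of T X "prm (\<gamma>s ! (\<sigma> ! k))" "opn (\<gamma>s ! (\<sigma> ! k))" "args (\<gamma>s ! (\<sigma> ! k))"
        "prm (\<delta>s ! k)" "opn (\<delta>s ! k)" "args (\<delta>s ! k)"]
      unfolding gc(1)[OF k', symmetric] dc(1)[OF k, symmetric] .
  qed
  let ?\<epsilon> = "map (\<lambda>k. Com (T_cat T X) (\<gamma>s ! (\<sigma> ! k)) (\<delta>s ! k)) [0..<n]"
  have 1: "perm_comp (block_perm \<rho> (map prm \<gamma>s)) (block_perm \<sigma> (map prm \<delta>s)) =
      block_perm (perm_comp \<rho> \<sigma>) (map prm ?\<epsilon>)"
  proof -
    have "map prm ?\<epsilon> = map (\<lambda>k. perm_comp (map prm \<gamma>s ! (\<sigma> ! k)) (map prm \<delta>s ! k)) [0..<n]"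
      using cc c(7,8) r by (auto intro!: nth_equalityI)
    then show ?thesis using block_fam_comp(2)[OF m(2) bf] by (simp only:)
  qed
  have 2: "map (\<lambda>k. opn (?\<epsilon> ! k)) (perm_inv (perm_comp \<rho> \<sigma>)) = \<beta>s"
  proof -
    have "map opn ?\<epsilon> = map ((!) \<beta>s) (perm_comp \<rho> \<sigma>)"
      using cc r m(5) by (auto intro!: nth_equalityI simp: perm_comp_nth)
    then show ?thesis using map_perm_inv_eq_iff[OF rs, of ?\<epsilon> \<beta>s opn] m(3) by simp
  qed
  have 3: "map2 (\<lambda>i. Com X (concat (map args \<gamma>s) ! i)) (block_perm \<sigma> (map prm \<delta>s)) (concat (map args \<delta>s)) =
      concat (map args ?\<epsilon>)"
  proof -
    have l: "length (args (\<gamma>s ! j)) = length (ins T (\<beta>s ! (\<rho> ! j)))" if "j < n" for j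
      using gc(4)[OF that] m(5)[OF that] by simp
    have "map2 (\<lambda>i. Com X (concat (map args \<gamma>s) ! i)) (block_perm \<sigma> (map prm \<delta>s)) (concat (map args \<delta>s)) =
        map2 (Com X) (map (\<lambda>i. concat (map args \<gamma>s) ! i) (block_perm \<sigma> (map prm \<delta>s))) (concat (map args \<delta>s))"
      by (simp add: map2_map_map[of _ _ _ id, simplified] zip_map1 case_prod_beta)
    also have "map (\<lambda>i. concat (map args \<gamma>s) ! i) (block_perm \<sigma> (map prm \<delta>s)) =
        concat (map (\<lambda>k. map (\<lambda>l. map args \<gamma>s ! (\<sigma> ! k) ! l) (map prm \<delta>s ! k)) [0..<n])"
      using c(7) l by (intro map_concat_block_perm[OF bf]) auto
    also have "map2 (Com X) \<dots> (concat (map args \<delta>s)) =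
        concat (map2 (map2 (Com X)) (map (\<lambda>k. map (\<lambda>l. map args \<gamma>s ! (\<sigma> ! k) ! l) (map prm \<delta>s ! k)) [0..<n]) (map args \<delta>s))"
      using c(8) permsD(1)[OF dc(3)] dc(4) by (intro map2_concat) auto
    also have "\<dots> = concat (map args ?\<epsilon>)"
      using c(7,8) cc r by (intro arg_cong[of _ _ concat]) (auto intro!: nth_equalityI)
    finally show ?thesis .
  qed
  show "tup (block_perm (prm (Com (T_cat T (T_cat T X)) v u)) (map prm (args (Com (T_cat T (T_cat T X)) v u))))
      (sub T (opn (Com (T_cat T (T_cat T X)) v u))
        (map (\<lambda>k. opn (args (Com (T_cat T (T_cat T X)) v u) ! k)) (perm_inv (prm (Com (T_cat T (T_cat T X)) v u)))))
      (concat (map args (args (Com (T_cat T (T_cat T X)) v u)))) =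
    Com (T_cat T X)
      (tup (block_perm (prm v) (map prm (args v))) (sub T (opn v) (map (\<lambda>k. opn (args v ! k)) (perm_inv (prm v))))
        (concat (map args (args v))))
      (tup (block_perm (prm u) (map prm (args u))) (sub T (opn u) (map (\<lambda>k. opn (args u ! k)) (perm_inv (prm u))))
        (concat (map args (args u))))"
    unfolding C unfolding c(1,2) tup_simps T_Com 1 2 3 bs ..
qed

lemma mu_natural:
  assumes H: "H \<in> hom (over J) X Y"
  shows "func_comp (mu (T_monad T) Y) (F1 (T_fun T) (F1 (T_fun T) H)) = func_comp (F1 (T_fun T) H) (mu (T_monad T) X)"
proof -
  note HD = hom_overD[OF H]
  note TH = T_fun_hom[OF H]
  note TTH = T_fun_hom[OF TH]
  note mX = mu_hom[OF HD(1)] and mY = mu_hom[OF HD(2)]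
  note THD = hom_overD[OF TH] and TTHD = hom_overD[OF TTH] and mXD = hom_overD[OF mX]
  show ?thesis
  proof (rule hom_over_eqI[OF func_comp_hom[OF TTH mY] func_comp_hom[OF mX TH]])
    fix z assume zz: "z \<in> Obj (T_cat T (T_cat T X))"
    then obtain \<alpha> zs where z: "z = tup [] \<alpha> zs" by (auto simp: T_cat_def)
    note m = mu_obj[OF zz[unfolded z]]
    note zc = T_obj_components[OF subsetD[OF m(4)]]
    have F: "fob (F1 (T_fun T) H) y = tup [] (opn y) (map (fob H) (args y))" if "y \<in> set zs" for y
      using m(4) that zc(1)[OF that] HD(3) T_monad_simps(5)[of "[]" "opn y" "args y" T H] by auto
    have "fob (F1 (T_fun T) (F1 (T_fun T) H)) z \<in> Obj (T_cat T (T_cat T Y))"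
      using TTHD(5)[OF zz] .
    then show "fob (func_comp (mu (T_monad T) Y) (F1 (T_fun T) (F1 (T_fun T) H))) z =
        fob (func_comp (F1 (T_fun T) H) (mu (T_monad T) X)) z"
      using zz[unfolded z] m(6) unfolding z
      by (simp add: HD THD TTHD F map_concat comp_def cong: map_cong)
  next
    fix u assume uu: "u \<in> Arr (T_cat T (T_cat T X))"
    then obtain \<rho> \<beta> ws where u: "u = tup \<rho> \<beta> ws" by (auto simp: T_cat_def)
    note m = mu_arr[OF HD(1) uu[unfolded u]]
    note wc = T_arr_components[OF m(7)]
    have wsA: "set ws \<subseteq> Arr (T_cat T X)" using m(4,7) by (auto simp: in_set_conv_nth)
    have F: "far (F1 (T_fun T) H) y = tup (prm y) (opn y) (map (far H) (args y))" if "y \<in> set ws" for y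
      using T_arr_components(1)[OF subsetD[OF wsA that]] subsetD[OF wsA that] HD(3)
        T_monad_simps(6)[of "prm y" "opn y" "args y" T H] by auto
    have o: "map (\<lambda>k. opn (map (far (F1 (T_fun T) H)) ws ! k)) (perm_inv \<rho>) = map (\<lambda>k. opn (ws ! k)) (perm_inv \<rho>)"
      using F m(4) permsD(3)[OF perm_inv_perms[OF m(6)]] by simp
    have "far (F1 (T_fun T) (F1 (T_fun T) H)) u \<in> Arr (T_cat T (T_cat T Y))"
      using TTHD(6)[OF uu] .
    then show "far (func_comp (mu (T_monad T) Y) (F1 (T_fun T) (F1 (T_fun T) H))) u =
        far (func_comp (F1 (T_fun T) H) (mu (T_monad T) X)) u"
      using uu[unfolded u] m(11) o unfolding u
      by (simp add: HD THD TTHD F map_concat comp_def cong: map_cong)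
  qed
qed

lemma T_cat_monad: "cat_monad J (T_monad T)"
proof
  fix X assume X: "cat_over J X"
  show "cat_over J (F0 (fnc (T_monad T)) X)" using T_cat_over[OF X] by simp
  note TI = T_fun_hom[OF Idm_hom[OF X]]
  have "F1 (T_fun T) (Idm (over J) X) = Idm (over J) (T_cat T X)"
  proof (rule hom_over_eqI[OF TI Idm_hom[OF T_cat_over[OF X]]])
    fix z assume z: "z \<in> Obj (T_cat T X)"
    note c = T_obj_components[OF z]
    have "map (fob (Idm (over J) X)) (args z) = args z" using c(3) by (intro map_idI) auto
    then show "fob (F1 (T_fun T) (Idm (over J) X)) z = fob (Idm (over J) (T_cat T X)) z"
      using T_monad_simps(5)[of "[]" "opn z" "args z" T "Idm (over J) X"] z c(1) by simp
  next
    fix w assume w: "w \<in> Arr (T_cat T X)"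
    note c = T_arr_components[OF w]
    have "map (far (Idm (over J) X)) (args w) = args w" using c(5) by (intro map_idI) auto
    then show "far (F1 (T_fun T) (Idm (over J) X)) w = far (Idm (over J) (T_cat T X)) w"
      using T_monad_simps(6)[of "prm w" "opn w" "args w" T "Idm (over J) X"] w c(1) by simp
  qed
  then show "F1 (fnc (T_monad T)) (Idm (over J) X) = Idm (over J) (F0 (fnc (T_monad T)) X)" by simp
  show "eta (T_monad T) X \<in> hom (over J) X (F0 (fnc (T_monad T)) X)" using eta_hom[OF X] by simp
  show "mu (T_monad T) X \<in> hom (over J) (F0 (fnc (T_monad T)) (F0 (fnc (T_monad T)) X)) (F0 (fnc (T_monad T)) X)"
    using mu_hom[OF X] by simp
next
  fix H X Y assume H: "H \<in> hom (over J) X Y"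
  note HD = hom_overD[OF H] and TH = T_fun_hom[OF H]
  note THD = hom_overD[OF TH]
  show "F1 (fnc (T_monad T)) H \<in> hom (over J) (F0 (fnc (T_monad T)) X) (F0 (fnc (T_monad T)) Y)"
    using TH by simp
  have "F2 (T_fun T) (Idc (over J) H) = Idc (over J) (F1 (T_fun T) H)"
  proof (rule cells_over_eqI[OF T_fun_cells[OF Idc_cells[OF H] H] Idc_cells[OF TH] TH])
    fix z assume z: "z \<in> Obj (T_cat T X)"
    note c = T_obj_components[OF z]
    have "map (ncmp (Idc (over J) H)) (args z) = map (Ide Y) (map (fob H) (args z))"
      using c(3) HD by auto
    moreover have "tup [] (opn z) (args z) \<in> Obj (T_cat T X)" using z c(1) by simp
    ultimately show "ncmp (F2 (T_fun T) (Idc (over J) H)) z = ncmp (Idc (over J) (F1 (T_fun T) H)) z"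
      by (subst (1 2) c(1)) (simp add: HD THD)
  qed
  then show "F2 (fnc (T_monad T)) (Idc (over J) H) = Idc (over J) (F1 (fnc (T_monad T)) H)" by simp
  have "func_comp (eta (T_monad T) Y) H = func_comp (F1 (T_fun T) H) (eta (T_monad T) X)"
  proof (rule hom_over_eqI[OF func_comp_hom[OF H eta_hom[OF HD(2)]] func_comp_hom[OF eta_hom[OF HD(1)] TH]])
    note e = hom_overD[OF eta_hom[OF HD(1)]]
    fix x assume x: "x \<in> Obj X"
    then show "fob (func_comp (eta (T_monad T) Y) H) x = fob (func_comp (F1 (T_fun T) H) (eta (T_monad T) X)) x"
      using e(5)[OF x] by (simp add: HD)
  next
    note e = hom_overD[OF eta_hom[OF HD(1)]]
    fix f assume f: "f \<in> Arr X"
    then show "far (func_comp (eta (T_monad T) Y) H) f = far (func_comp (F1 (T_fun T) H) (eta (T_monad T) X)) f"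
      using e(6)[OF f] by (simp add: HD cat_overD[OF HD(1)])
  qed
  then show "func_comp (eta (T_monad T) Y) H = func_comp (F1 (fnc (T_monad T)) H) (eta (T_monad T) X)" by simp
  show "func_comp (mu (T_monad T) Y) (F1 (fnc (T_monad T)) (F1 (fnc (T_monad T)) H)) =
      func_comp (F1 (fnc (T_monad T)) H) (mu (T_monad T) X)"
    using mu_natural[OF H] by simp
next
  fix G H X Y Z assume G: "G \<in> hom (over J) X Y" and H: "H \<in> hom (over J) Y Z"
  note GD = hom_overD[OF G] and HD = hom_overD[OF H] and TG = T_fun_hom[OF G] and TH = T_fun_hom[OF H]
  have "F1 (T_fun T) (func_comp H G) = func_comp (F1 (T_fun T) H) (F1 (T_fun T) G)"
  proof (rule hom_over_eqI[OF T_fun_hom[OF func_comp_hom[OF G H]] func_comp_hom[OF TG TH]])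
    fix z assume z: "z \<in> Obj (T_cat T X)"
    note c = T_obj_components[OF z]
    have "map (fob (func_comp H G)) (args z) = map (fob H) (map (fob G) (args z))"
      using c(3) GD by auto
    moreover have "tup [] (opn z) (args z) \<in> Obj (T_cat T X)" using z c(1) by simp
    moreover have "fob (F1 (T_fun T) G) (tup [] (opn z) (args z)) \<in> Obj (T_cat T Y)"
      using hom_overD(5)[OF TG] z c(1) by simp
    ultimately show "fob (F1 (T_fun T) (func_comp H G)) z = fob (func_comp (F1 (T_fun T) H) (F1 (T_fun T) G)) z"
      by (subst (1 2) c(1)) (simp add: GD HD del: map_map)
  next
    fix w assume w: "w \<in> Arr (T_cat T X)"
    note c = T_arr_components[OF w]
    have "map (far (func_comp H G)) (args w) = map (far H) (map (far G) (args w))"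
      using c(5) GD by auto
    moreover have "tup (prm w) (opn w) (args w) \<in> Arr (T_cat T X)" using w c(1) by simp
    moreover have "far (F1 (T_fun T) G) (tup (prm w) (opn w) (args w)) \<in> Arr (T_cat T Y)"
      using hom_overD(6)[OF TG] w c(1) by simp
    ultimately show "far (F1 (T_fun T) (func_comp H G)) w = far (func_comp (F1 (T_fun T) H) (F1 (T_fun T) G)) w"
      by (subst (1 2) c(1)) (simp add: GD HD del: map_map)
  qed
  then show "F1 (fnc (T_monad T)) (func_comp H G) = func_comp (F1 (fnc (T_monad T)) H) (F1 (fnc (T_monad T)) G)"
    by simp
next
  fix t G H X Y assume "t \<in> cells (over J) G H" "G \<in> hom (over J) X Y"
  then show "F2 (fnc (T_monad T)) t \<in> cells (over J) (F1 (fnc (T_monad T)) G) (F1 (fnc (T_monad T)) H)"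
    using T_fun_cells by simp
qed

end

section \<open>Chaotic categories and subcategories\<close>

text \<open>Any two objects of the same colour are joined by exactly one arrow in each direction,
  coded by the pair of its ends. A functor into this category is an arbitrary colour-preserving map
  of objects.\<close>

definition chaotic :: "'u::small set \<Rightarrow> ('u \<Rightarrow> 'u) \<Rightarrow> 'u cat" where
  "chaotic V c = \<lparr>Obj = V, Arr = {pr x y |x y. x \<in> V \<and> y \<in> V \<and> c x = c y}, Dom = pr1, Cod = pr2,
     Ide = (\<lambda>x. pr x x), Com = (\<lambda>v u. pr (pr1 u) (pr2 v)), Col = c\<rparr>"

lemma chaotic_simps [simp]:
  "Obj (chaotic V c) = V" "Dom (chaotic V c) = pr1" "Cod (chaotic V c) = pr2"
  "Ide (chaotic V c) x = pr x x" "Com (chaotic V c) v u = pr (pr1 u) (pr2 v)" "Col (chaotic V c) = c"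
  "pr x y \<in> Arr (chaotic V c) \<longleftrightarrow> x \<in> V \<and> y \<in> V \<and> c x = c y"
  by (auto simp: chaotic_def pr_def)

lemma chaotic_arrE:
  assumes "f \<in> Arr (chaotic V c)"
  obtains x y where "f = pr x y" "x \<in> V" "y \<in> V" "c x = c y"
  using assms by (auto simp: chaotic_def)

lemma chaotic_over: "c \<in> V \<rightarrow> J \<Longrightarrow> cat_over J (chaotic V c)"
  by (rule cat_overI) (auto elim!: chaotic_arrE)

definition thin :: "'u cat \<Rightarrow> bool" where
  "thin X \<longleftrightarrow> (\<forall>f\<in>Arr X. \<forall>g\<in>Arr X. Dom X f = Dom X g \<longrightarrow> Cod X f = Cod X g \<longrightarrow> f = g)"

lemma thinD: "thin X \<Longrightarrow> f \<in> Arr X \<Longrightarrow> g \<in> Arr X \<Longrightarrow> Dom X f = Dom X g \<Longrightarrow> Cod X f = Cod X g \<Longrightarrow> f = g"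
  by (simp add: thin_def)

lemma chaotic_thin: "thin (chaotic V c)"
  unfolding thin_def by (auto elim!: chaotic_arrE)

definition chaotic_func :: "'u::small cat \<Rightarrow> 'u set \<Rightarrow> ('u \<Rightarrow> 'u) \<Rightarrow> ('u \<Rightarrow> 'u) \<Rightarrow> 'u func" where
  "chaotic_func X V c p = mk_func X (chaotic V c) p (\<lambda>f. pr (p (Dom X f)) (p (Cod X f)))"

lemma chaotic_func_hom:
  assumes X: "cat_over J X" and "c \<in> V \<rightarrow> J" "\<And>x. x \<in> Obj X \<Longrightarrow> p x \<in> V \<and> c (p x) = Col X x"
  shows "chaotic_func X V c p \<in> hom (over J) X (chaotic V c)"
  unfolding chaotic_func_def
  using assms by (intro mk_func_hom[OF X chaotic_over[OF assms(2)]]) (simp_all add: cat_overD[OF X])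

lemma thin_func_eqI:
  assumes G: "G \<in> hom (over J) X Y" and H: "H \<in> hom (over J) X Y" and Y: "thin Y"
    and ob: "\<And>x. x \<in> Obj X \<Longrightarrow> fob G x = fob H x"
  shows "G = H"
proof (rule hom_over_eqI[OF G H ob])
  fix f assume f: "f \<in> Arr X"
  show "far G f = far H f"
    by (rule thinD[OF Y]) (simp_all add: f ob hom_overD[OF G] hom_overD[OF H] cat_overD[OF hom_overD(1)[OF G]])
qed

definition subcat :: "'u cat \<Rightarrow> 'u set \<Rightarrow> 'u set \<Rightarrow> 'u cat" where
  "subcat X V A = X\<lparr>Obj := V, Arr := A\<rparr>"

lemma subcat_simps [simp]:
  "Obj (subcat X V A) = V" "Arr (subcat X V A) = A" "Dom (subcat X V A) = Dom X"
  "Cod (subcat X V A) = Cod X" "Ide (subcat X V A) = Ide X" "Com (subcat X V A) = Com X"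
  "Col (subcat X V A) = Col X"
  by (simp_all add: subcat_def)

lemma subcat_over:
  assumes X: "cat_over J X" and V: "V \<subseteq> Obj X" and A: "A \<subseteq> Arr X"
    and "\<And>f. f \<in> A \<Longrightarrow> Dom X f \<in> V \<and> Cod X f \<in> V" "\<And>x. x \<in> V \<Longrightarrow> Ide X x \<in> A"
    and "\<And>f g. f \<in> A \<Longrightarrow> g \<in> A \<Longrightarrow> Cod X f = Dom X g \<Longrightarrow> Com X g f \<in> A"
  shows "cat_over J (subcat X V A)"
    "mk_func (subcat X V A) X (\<lambda>x. x) (\<lambda>f. f) \<in> hom (over J) (subcat X V A) X"
proof -
  show s: "cat_over J (subcat X V A)"
    using assms(4-6) subsetD[OF V] subsetD[OF A] by (intro cat_overI) (simp_all add: cat_overD[OF X])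
  show "mk_func (subcat X V A) X (\<lambda>x. x) (\<lambda>f. f) \<in> hom (over J) (subcat X V A) X"
    using subsetD[OF V] subsetD[OF A] by (intro mk_func_hom[OF s X]) simp_all
qed

section \<open>Functors surjective on objects and on arrows\<close>

definition surj_func :: "'u func \<Rightarrow> bool" where
  "surj_func H \<longleftrightarrow> fob H ` Obj (fsrc H) = Obj (ftgt H) \<and> far H ` Arr (fsrc H) = Arr (ftgt H)"

lemma surj_funcE:
  assumes "surj_func P" "P \<in> hom (over J) X Y"
  shows "y \<in> Obj Y \<Longrightarrow> \<exists>x\<in>Obj X. y = fob P x" "f \<in> Arr Y \<Longrightarrow> \<exists>g\<in>Arr X. f = far P g"
  using assms unfolding surj_func_def hom_over by blast+

lemma surj_func_epi:
  assumes P: "P \<in> hom (over J) X Y" "surj_func P" and G: "G \<in> hom (over J) Y Z" and H: "H \<in> hom (over J) Y Z"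
    and eq: "func_comp G P = func_comp H P"
  shows "G = H"
proof (rule hom_over_eqI[OF G H])
  note D = hom_overD[OF P(1)]
  fix y assume "y \<in> Obj Y"
  then obtain x where "x \<in> Obj X" "y = fob P x" using surj_funcE(1)[OF P(2,1)] by blast
  then show "fob G y = fob H y" using arg_cong[OF eq, of "\<lambda>F. fob F x"] by (simp add: D)
next
  note D = hom_overD[OF P(1)]
  fix f assume "f \<in> Arr Y"
  then obtain g where "g \<in> Arr X" "f = far P g" using surj_funcE(2)[OF P(2,1)] by blast
  then show "far G f = far H f" using arg_cong[OF eq, of "\<lambda>F. far F g"] by (simp add: D)
qed

lemma surj_func_comp:
  assumes "surj_func G" "surj_func H" "ftgt G = fsrc H"
  shows "surj_func (func_comp H G)"
proof -
  have "fob (func_comp H G) ` Obj (fsrc G) = fob H ` fob G ` Obj (fsrc G)"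
    "far (func_comp H G) ` Arr (fsrc G) = far H ` far G ` Arr (fsrc G)"
    by (simp_all add: image_image cong: image_cong_simp)
  then show ?thesis using assms by (simp add: surj_func_def)
qed

lemma set_subset_imageE:
  assumes "set ys \<subseteq> f ` A"
  obtains xs where "ys = map f xs" "set xs \<subseteq> A"
proof -
  have "ys \<in> map f ` lists A" using assms by (simp add: lists_image[symmetric] in_lists_conv_set subset_iff)
  then show ?thesis using that by (auto simp: in_lists_conv_set subset_iff)
qed

section \<open>The action of permutations\<close>

context set_operad
begin

text \<open>Preimages are taken entry by entry; functors preserve colours, so the resulting tuple
  still fits its operation.\<close>

lemma T_fun_surj:
  assumes H: "H \<in> hom (over J) X Y" and s: "surj_func H"
  shows "surj_func (F1 (T_fun T) H)"
proof -
  note HD = hom_overD[OF H] and TH = T_fun_hom[OF H]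
  note THD = hom_overD[OF TH]
  have "z \<in> fob (F1 (T_fun T) H) ` Obj (T_cat T X)" if z: "z \<in> Obj (T_cat T Y)" for z
  proof -
    note c = T_obj_components[OF z]
    have "set (args z) \<subseteq> fob H ` Obj X" using c(3) s HD by (simp add: surj_func_def)
    then obtain xs where xs: "args z = map (fob H) xs" "set xs \<subseteq> Obj X"
      by (rule set_subset_imageE)
    have "map (Col X) xs = map (Col Y) (args z)"
      using xs(2) by (auto simp: xs(1) HD(7) subset_iff)
    then have x: "tup [] (opn z) xs \<in> Obj (T_cat T X)"
      unfolding T_Obj_list_iff using xs(2) c(2,4) by metis
    moreover have "fob (F1 (T_fun T) H) (tup [] (opn z) xs) = z"
      using x xs c(1) by (simp add: HD)
    ultimately show ?thesis by (metis imageI)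
  qed
  moreover have "w \<in> far (F1 (T_fun T) H) ` Arr (T_cat T X)" if w: "w \<in> Arr (T_cat T Y)" for w
  proof -
    note c = T_arr_components[OF w]
    have "set (args w) \<subseteq> far H ` Arr X" using c(5) s HD by (simp add: surj_func_def)
    then obtain fs where fs: "args w = map (far H) fs" "set fs \<subseteq> Arr X"
      by (rule set_subset_imageE)
    have "map (\<lambda>\<gamma>. Col X (Cod X \<gamma>)) fs = map (\<lambda>\<gamma>. Col Y (Cod Y \<gamma>)) (args w)"
      using fs(2) by (auto simp: fs(1) HD(7,10) cat_overD(2)[OF HD(1)] subset_iff)
    then have x: "tup (prm w) (opn w) fs \<in> Arr (T_cat T X)"
      unfolding T_Arr_list_iff using fs(2) c(2,3,6) by metis
    moreover have "far (F1 (T_fun T) H) (tup (prm w) (opn w) fs) = w"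
      using x fs c(1) by (simp add: HD)
    ultimately show ?thesis by (metis imageI)
  qed
  ultimately show ?thesis using THD by (auto simp: surj_func_def)
qed

text \<open>The domain of \<open>perm_arrow X \<rho> z\<close>; orbits are thus the classes of
  objects linked by permutation arrows.\<close>

definition permute :: "nat list \<Rightarrow> 'u \<Rightarrow> 'u" where
  "permute \<rho> z = tup [] (act T (opn z) \<rho>) (map (\<lambda>k. args z ! k) \<rho>)"

lemma permute_simps [simp]:
  "opn (permute \<rho> z) = act T (opn z) \<rho>" "args (permute \<rho> z) = map (\<lambda>k. args z ! k) \<rho>"
  by (simp_all add: permute_def)

lemma perm_arrow:
  assumes X: "cat_over J X" and z: "z \<in> Obj (T_cat T X)" and r: "\<rho> \<in> perms (length (args z))"
  shows "perm_arrow X \<rho> z \<in> Arr (T_cat T X)" "Dom (T_cat T X) (perm_arrow X \<rho> z) = permute \<rho> z"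
    "Cod (T_cat T X) (perm_arrow X \<rho> z) = z" "permute \<rho> z \<in> Obj (T_cat T X)"
    "Col (T_cat T X) (permute \<rho> z) = Col (T_cat T X) z"
proof -
  note XD = cat_overD[OF X] and c = T_obj_components[OF z] and R = permsD[OF r]
  have xs: "args z ! k \<in> Obj X" if "k \<in> set \<rho>" for k
    using c(3) R that nth_mem[of k "args z"] by auto
  have col: "Col X (args z ! k) = ins T (opn z) ! k" if "k \<in> set \<rho>" for k
    using arg_cong[OF c(4), of "\<lambda>cs. cs ! k"] R(3) that by simp
  show a: "perm_arrow X \<rho> z \<in> Arr (T_cat T X)"
    unfolding perm_arrow_def T_Arr_list_iff
    using c(2,5) r xs col by (auto simp: XD)
  show d: "Dom (T_cat T X) (perm_arrow X \<rho> z) = permute \<rho> z"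
    using xs by (simp add: perm_arrow_def permute_def XD)
  have "map (\<lambda>k. Cod X (map (\<lambda>k. Ide X (args z ! k)) \<rho> ! k)) (perm_inv \<rho>) = args z"
    unfolding map_perm_inv_eq_iff[OF r, of "map (\<lambda>k. Ide X (args z ! k)) \<rho>" "args z" "Cod X", simplified, OF R(1)]
    using xs by (simp add: XD)
  then show "Cod (T_cat T X) (perm_arrow X \<rho> z) = z"
    using c(1) by (simp add: perm_arrow_def)
  then show "permute \<rho> z \<in> Obj (T_cat T X)" "Col (T_cat T X) (permute \<rho> z) = Col (T_cat T X) z"
    using cat_overD(1,3)[OF T_cat_over[OF X] a] d by auto
qed

lemma permute_permute:
  assumes z: "z \<in> Obj (T_cat T X)" and r: "\<rho> \<in> perms (length (args z))" and s: "\<sigma> \<in> perms (length (args z))"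
  shows "permute \<sigma> (permute \<rho> z) = permute (perm_comp \<rho> \<sigma>) z"
  using T_obj_components[OF z] operadD(16)[of "opn z" \<rho> \<sigma>] permsD[OF r] permsD[OF s] r s
  by (simp add: permute_def perm_comp_def)

lemma permute_id:
  assumes z: "z \<in> Obj (T_cat T X)"
  shows "permute [0..<length (args z)] z = z"
  using T_obj_components[OF z] operadD(15)[of "opn z"] map_nth[of "args z"] by (simp add: permute_def)

lemma perm_arrow_id:
  assumes z: "z \<in> Obj (T_cat T X)"
  shows "perm_arrow X [0..<length (args z)] z = Ide (T_cat T X) z"
  by (subst (3) T_obj_components(1)[OF z]) (auto simp: perm_arrow_def intro!: nth_equalityI)

lemma perm_arrow_comp:
  assumes X: "cat_over J X" and z: "z \<in> Obj (T_cat T X)" and r: "\<rho> \<in> perms (length (args z))"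
    and s: "\<sigma> \<in> perms (length (args z))"
  shows "Com (T_cat T X) (perm_arrow X \<rho> z) (perm_arrow X \<sigma> (permute \<rho> z)) = perm_arrow X (perm_comp \<rho> \<sigma>) z"
proof -
  note XD = cat_overD[OF X] and c = T_obj_components[OF z] and R = permsD[OF r] and S = permsD[OF s]
  have xs: "args z ! k \<in> Obj X" if "k < length (args z)" for k
    using c(3) that nth_mem[of k "args z"] by auto
  show ?thesis unfolding perm_arrow_def T_Com permute_simps
    using R S xs by (auto simp: perm_comp_nth XD intro!: nth_equalityI)
qed

definition same_orbit :: "'u \<Rightarrow> 'u \<Rightarrow> bool" where
  "same_orbit z z' \<longleftrightarrow> (\<exists>\<rho>\<in>perms (length (args z')). z = permute \<rho> z')"

lemma same_orbit:
  assumes X: "cat_over J X" and z: "z \<in> Obj (T_cat T X)"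
  shows "same_orbit z z" "same_orbit y z \<Longrightarrow> y \<in> Obj (T_cat T X)"
    "same_orbit y z \<Longrightarrow> Col (T_cat T X) y = Col (T_cat T X) z"
    "same_orbit y z \<Longrightarrow> same_orbit z y" "same_orbit x y \<Longrightarrow> same_orbit y z \<Longrightarrow> same_orbit x z"
proof -
  show "same_orbit z z" unfolding same_orbit_def using permute_id[OF z] id_perms by metis
  show "same_orbit y z \<Longrightarrow> y \<in> Obj (T_cat T X)" "same_orbit y z \<Longrightarrow> Col (T_cat T X) y = Col (T_cat T X) z"
    using perm_arrow(4,5)[OF X z] by (auto simp: same_orbit_def)
  show "same_orbit y z \<Longrightarrow> same_orbit z y"
    unfolding same_orbit_def
  proof (elim bexE)
    fix \<rho> assume r: "\<rho> \<in> perms (length (args z))" and y: "y = permute \<rho> z"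
    have "permute (perm_inv \<rho>) y = z"
      using permute_permute[OF z r perm_inv_perms[OF r]] perm_comp_inv(1)[OF r] permute_id[OF z]
      by (simp add: y)
    moreover have "perm_inv \<rho> \<in> perms (length (args y))"
      using perm_inv_perms[OF r] permsD(1)[OF r] by (simp add: y)
    ultimately show "\<exists>\<rho>\<in>perms (length (args y)). z = permute \<rho> y" by metis
  qed
  show "same_orbit x y \<Longrightarrow> same_orbit y z \<Longrightarrow> same_orbit x z"
    unfolding same_orbit_def
  proof (elim bexE)
    fix \<rho> \<sigma> assume r: "\<rho> \<in> perms (length (args z))" and y: "y = permute \<rho> z"
      and s: "\<sigma> \<in> perms (length (args y))" and x: "x = permute \<sigma> y"
    have s: "\<sigma> \<in> perms (length (args z))" using s permsD(1)[OF r] by (simp add: y)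
    show "\<exists>\<rho>\<in>perms (length (args z)). x = permute \<rho> z"
      using permute_permute[OF z r s] perm_comp_perms[OF r s] unfolding x y by blast
  qed
qed

end

section \<open>The quotient 2-monad and commutative algebras\<close>

sublocale set_operad \<subseteq> TM: cat_monad "colours T" "T_monad T"
  by (rule T_cat_monad)

lemma (in set_operad) T_whisker_right:
  assumes t: "t \<in> cells (over J) G G'" and G: "G \<in> hom (over J) X Y" and F: "F \<in> hom (over J) W X"
    and w: "w \<in> Obj (T_cat T W)"
  shows "ncmp (F2 (T_fun T) (whisker_right t F)) w = ncmp (F2 (T_fun T) t) (fob (F1 (T_fun T) F) w)"
proof -
  note c = T_obj_components[OF w] and tD = cells_overD[OF t G] and FD = hom_overD[OF F] and GD = hom_overD[OF G]
  have m: "map (ncmp (whisker_right t F)) (args w) = map (ncmp t) (map (fob F) (args w))"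
    using c(3) FD(3) by auto
  have W: "tup [] (opn w) (args w) \<in> Obj (T_cat T W)" using w c(1) by simp
  have "fob (F1 (T_fun T) F) (tup [] (opn w) (args w)) \<in> Obj (T_cat T X)"
    using hom_overD(5)[OF T_fun_hom[OF F]] w c(1) by simp
  then show ?thesis
    by (subst (1 2) c(1)) (use W FD GD tD m in \<open>simp del: map_map\<close>)
qed

locale sigma_quotient = set_operad T for T :: "'u::small operad" +
  fixes Q :: "'u over_monad" and q :: "'u cat \<Rightarrow> 'u func"
  assumes quot: "quotient_monad T Q q"
begin

lemma quot_facts:
  "two_monad (over J) Q" "two_monad_morphism (over J) (T_monad T) Q q"
  "cat_over J X \<Longrightarrow> kills_perms T X (q X)"
  "cat_over J X \<Longrightarrow> H \<in> hom (over J) (T_cat T X) Z \<Longrightarrow> kills_perms T X H \<Longrightarrow>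
    \<exists>!H'. H' \<in> hom (over J) (F0 (fnc Q) X) Z \<and> func_comp H' (q X) = H"
  using quot hom_overD(2)[of H J "T_cat T X" Z] unfolding quotient_monad_def Let_def by auto

end

sublocale sigma_quotient \<subseteq> QM: cat_monad "colours T" Q
  by (rule two_monad_cat_monad[OF quot_facts(1)])

context sigma_quotient
begin

lemma q_natural_facts:
  "two_natural (over J) (over J) (fnc (T_monad T)) (fnc Q) q"
  "cat_over J X \<Longrightarrow> func_comp (q X) (eta (T_monad T) X) = eta Q X"
  "cat_over J X \<Longrightarrow> func_comp (q X) (mu (T_monad T) X) =
     func_comp (mu Q X) (func_comp (q (F0 (fnc Q) X)) (F1 (T_fun T) (q X)))"
  using quot_facts(2) by (simp_all add: two_monad_morphism_def)

lemma q_hom: "cat_over J X \<Longrightarrow> q X \<in> hom (over J) (T_cat T X) (QM.MO X)"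
  using q_natural_facts(1) unfolding two_natural_def by simp

lemma q_natural:
  "H \<in> hom (over J) X Y \<Longrightarrow> func_comp (q Y) (F1 (T_fun T) H) = func_comp (QM.M1 H) (q X)"
  using q_natural_facts(1) unfolding two_natural_def by (auto simp: hom_over)

text \<open>The 2-dimensional part of the naturality of \<open>q\<close>, read off at a
  component.\<close>

lemma q_natural_cell:
  assumes t: "t \<in> cells (over J) G H" and G: "G \<in> hom (over J) X Y" and z: "z \<in> Obj (T_cat T X)"
  shows "far (q Y) (ncmp (F2 (T_fun T) t) z) = ncmp (QM.M2 t) (fob (q X) z)"
proof -
  note tD = cells_overD[OF t G] and GD = hom_overD[OF G]
  have "Hc (over J) (Idc (over J) (q Y)) (F2 (T_fun T) t) = Hc (over J) (QM.M2 t) (Idc (over J) (q X))"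
    using q_natural_facts(1) t GD tD unfolding two_natural_def by (auto simp: cells_over)
  then have "whisker_left (q Y) (F2 (T_fun T) t) = whisker_right (QM.M2 t) (q X)"
    unfolding Idc_Hc[OF T_fun_cells[OF t G] T_fun_hom[OF G] q_hom[OF GD(2)]]
      Hc_Idc[OF QM.F2[OF t G] QM.F1[OF G] q_hom[OF GD(1)]] .
  from arg_cong[OF this, of "\<lambda>s. ncmp s z"] show ?thesis
    using z by (simp add: tD GD hom_overD(3)[OF q_hom[OF GD(1)]])
qed

text \<open>A choice \<open>p\<close> of one element in each orbit, viewed as a functor to the
  chaotic category on the objects of \<open>T_cat T X\<close>, sends permutation arrows to
  identities and so factors through \<open>q X\<close>. Objects with the same image under
  \<open>q X\<close> then have the same value of \<open>p\<close>.\<close>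

lemma q_orbit:
  assumes X: "cat_over J X" and z: "z \<in> Obj (T_cat T X)" "z' \<in> Obj (T_cat T X)"
    and eq: "fob (q X) z = fob (q X) z'"
  shows "same_orbit z z'"
proof -
  let ?V = "Obj (T_cat T X)" and ?c = "Col (T_cat T X)"
  note so = same_orbit[OF X]
  define p where "p z = (SOME y. same_orbit y z)" for z
  have p: "same_orbit (p z) z" if "z \<in> ?V" for z
    unfolding p_def using so(1)[OF that] by (rule someI)
  \<comment> \<open>Elements of one orbit give the same predicate, hence the same value of
    \<open>SOME\<close>.\<close>
  have pc: "p y = p z" if "z \<in> ?V" "same_orbit y z" for y z
  proof -
    have "same_orbit x y \<longleftrightarrow> same_orbit x z" for x
      using so(4,5) that so(2)[OF that] by metis
    then show ?thesis by (simp add: p_def)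
  qed
  have V: "?c \<in> ?V \<rightarrow> J" using cat_overD(4)[OF T_cat_over[OF X]] by auto
  let ?H = "chaotic_func (T_cat T X) ?V ?c p"
  have H: "?H \<in> hom (over J) (T_cat T X) (chaotic ?V ?c)"
    using p so(2,3) by (intro chaotic_func_hom[OF T_cat_over[OF X] V]) blast
  have "kills_perms T X ?H"
    unfolding kills_perms_def
  proof (intro ballI)
    fix u \<rho> assume u: "u \<in> ?V" and r: "\<rho> \<in> perms (length (args u))"
    note a = perm_arrow[OF X u r]
    have "same_orbit (permute \<rho> u) u" using r by (auto simp: same_orbit_def)
    then have "p (permute \<rho> u) = p u" by (rule pc[OF u])
    then show "far ?H (perm_arrow X \<rho> u) = Ide (ftgt ?H) (fob ?H u)"
      using a u by (simp add: chaotic_func_def)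
  qed
  then obtain H' where H': "H' \<in> hom (over J) (QM.MO X) (chaotic ?V ?c)" "func_comp H' (q X) = ?H"
    using quot_facts(4)[OF X H] by blast
  have "p y = fob H' (fob (q X) y)" if "y \<in> ?V" for y
    using arg_cong[OF H'(2), of "\<lambda>F. fob F y"] that
    by (simp add: chaotic_func_def hom_overD(3)[OF q_hom[OF X]])
  then have "p z = p z'" using z eq by simp
  then show ?thesis using p[OF z(1)] p[OF z(2)] so(4,5) z by metis
qed

lemma q_perm_arrow:
  assumes "cat_over J X" "z \<in> Obj (T_cat T X)" "\<rho> \<in> perms (length (args z))"
  shows "far (q X) (perm_arrow X \<rho> z) = Ide (QM.MO X) (fob (q X) z)"
  using quot_facts(3)[OF assms(1)] assms(2,3) hom_overD(4)[OF q_hom[OF assms(1)]]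
  by (simp add: kills_perms_def)

text \<open>Arrows of \<open>TX\<close> whose images are composable become composable after inserting an arrow that permutes.\<close>

lemma q_surj:
  assumes X: "cat_over J X"
  shows "surj_func (q X)"
proof -
  let ?Q = "QM.MO X" and ?V = "fob (q X) ` Obj (T_cat T X)" and ?A = "far (q X) ` Arr (T_cat T X)"
  note qD = hom_overD[OF q_hom[OF X]]
  note QD = cat_overD[OF qD(2)] and TD = cat_overD[OF qD(1)]
  have V: "?V \<subseteq> Obj ?Q" and A: "?A \<subseteq> Arr ?Q" using qD by auto
  have c: "Com ?Q g f \<in> ?A" if "f \<in> ?A" "g \<in> ?A" "Cod ?Q f = Dom ?Q g" for f g
  proof -
    obtain f' g' where f': "f' \<in> Arr (T_cat T X)" "f = far (q X) f'" and g': "g' \<in> Arr (T_cat T X)" "g = far (q X) g'"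
      using \<open>f \<in> ?A\<close> \<open>g \<in> ?A\<close> by blast
    have o: "Cod (T_cat T X) f' \<in> Obj (T_cat T X)" "Dom (T_cat T X) g' \<in> Obj (T_cat T X)"
      using f' g' TD by auto
    have "fob (q X) (Cod (T_cat T X) f') = fob (q X) (Dom (T_cat T X) g')"
      using that(3) f' g' qD by simp
    then have "same_orbit (Cod (T_cat T X) f') (Dom (T_cat T X) g')" by (rule q_orbit[OF X o])
    then obtain \<rho> where r: "\<rho> \<in> perms (length (args (Dom (T_cat T X) g')))"
      and p: "Cod (T_cat T X) f' = permute \<rho> (Dom (T_cat T X) g')"
      by (auto simp: same_orbit_def)
    let ?p = "perm_arrow X \<rho> (Dom (T_cat T X) g')"
    note pa = perm_arrow[OF X o(2) r]
    have h: "Com (T_cat T X) ?p f' \<in> Arr (T_cat T X)" "Com (T_cat T X) g' (Com (T_cat T X) ?p f') \<in> Arr (T_cat T X)"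
      using pa p f' g' TD by simp_all
    have "far (q X) (Com (T_cat T X) g' (Com (T_cat T X) ?p f')) = Com ?Q g (Com ?Q (far (q X) ?p) f)"
      using pa p f' g' by (simp add: qD TD(10-12))
    also have "Com ?Q (far (q X) ?p) f = f"
      unfolding q_perm_arrow[OF X o(2) r] using f' g' that(3) qD QD TD by simp
    finally show ?thesis using h(2) by (metis imageI)
  qed
  have i: "Ide ?Q x \<in> ?A" if x: "x \<in> ?V" for x
  proof -
    obtain z where z: "z \<in> Obj (T_cat T X)" "x = fob (q X) z" using x by blast
    then have "Ide ?Q x = far (q X) (Ide (T_cat T X) z)" using qD(8) by simp
    then show ?thesis using TD(5)[OF z(1)] by simp
  qed
  have dc: "Dom ?Q f \<in> ?V \<and> Cod ?Q f \<in> ?V" if "f \<in> ?A" for f using that qD TD by auto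
  \<comment> \<open>\<open>?Z\<close> is the image of \<open>q X\<close>, a subcategory by the
    closure under composition shown above. The corestriction of \<open>q X\<close> to it also kills
    permutations, hence factors through \<open>q X\<close>.\<close>
  let ?Z = "subcat ?Q ?V ?A" and ?I = "mk_func (subcat ?Q ?V ?A) ?Q (\<lambda>x. x) (\<lambda>f. f)"
  note Z = subcat_over[OF qD(2) V A dc i c]
  let ?H = "mk_func (T_cat T X) ?Z (fob (q X)) (far (q X))"
  have H: "?H \<in> hom (over J) (T_cat T X) ?Z"
    using qD by (intro mk_func_hom[OF qD(1) Z(1)]) simp_all
  have IH: "func_comp ?I ?H = q X"
    using qD by (intro hom_over_eqI[OF func_comp_hom[OF H Z(2)] q_hom[OF X]]) simp_all
  have "kills_perms T X ?H"
    unfolding kills_perms_def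
  proof (intro ballI)
    fix u \<rho> assume u: "u \<in> Obj (T_cat T X)" and r: "\<rho> \<in> perms (length (args u))"
    show "far ?H (perm_arrow X \<rho> u) = Ide (ftgt ?H) (fob ?H u)"
      using perm_arrow[OF X u r] q_perm_arrow[OF X u r] u by simp
  qed
  then obtain H' where H': "H' \<in> hom (over J) ?Q ?Z" "func_comp H' (q X) = ?H"
    using quot_facts(4)[OF X H] by blast
  have "func_comp (func_comp ?I H') (q X) = func_comp ?I (func_comp H' (q X))"
    by (rule func_comp_assoc[OF q_hom[OF X] H'(1) Z(2)])
  also have "\<dots> = func_comp ?I ?H" by (rule arg_cong[OF H'(2)])
  also have "\<dots> = q X" by (rule IH)
  finally have "func_comp (func_comp ?I H') (q X) = q X" .
  moreover have "func_comp (Idm (over J) ?Q) (q X) = q X"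
    by (rule func_comp_Idm[OF q_hom[OF X]])
  \<comment> \<open>Both functors factor \<open>q X\<close> through itself, so uniqueness identifies
    them; the inclusion of the image is therefore onto.\<close>
  ultimately have "func_comp ?I H' = Idm (over J) ?Q"
    using quot_facts(4)[OF X q_hom[OF X] quot_facts(3)[OF X]] func_comp_hom[OF H'(1) Z(2)] Idm_hom[OF qD(2)]
    by blast
  then have I: "fob (func_comp ?I H') x = fob (Idm (over J) ?Q) x" "far (func_comp ?I H') x = far (Idm (over J) ?Q) x" for x
    by simp_all
  note HD = hom_overD[OF H'(1)]
  have "x \<in> ?V" if "x \<in> Obj ?Q" for x
    using I(1)[of x] HD(5)[OF that] that by (simp add: HD)
  moreover have "f \<in> ?A" if "f \<in> Arr ?Q" for f
    using I(2)[of f] HD(6)[OF that] that by (simp add: HD)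
  ultimately show ?thesis using V A qD by (auto simp: surj_func_def)
qed

section \<open>Algebras and lax morphisms along the quotient map\<close>

lemma qTq_surj:
  assumes X: "cat_over J X"
  shows "func_comp (q (QM.MO X)) (F1 (T_fun T) (q X)) \<in> hom (over J) (T_cat T (T_cat T X)) (QM.MO (QM.MO X))"
    "surj_func (func_comp (q (QM.MO X)) (F1 (T_fun T) (q X)))"
proof -
  note qX = q_hom[OF X] and QX = QM.F0[OF X]
  show "func_comp (q (QM.MO X)) (F1 (T_fun T) (q X)) \<in> hom (over J) (T_cat T (T_cat T X)) (QM.MO (QM.MO X))"
    using func_comp_hom[OF T_fun_hom[OF qX] q_hom[OF QX]] .
  show "surj_func (func_comp (q (QM.MO X)) (F1 (T_fun T) (q X)))"
    using hom_overD(4)[OF T_fun_hom[OF qX]] hom_overD(3)[OF q_hom[OF QX]]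
    by (intro surj_func_comp[OF T_fun_surj[OF qX q_surj[OF X]] q_surj[OF QX]]) simp
qed

text \<open>Compatibility of \<open>q\<close> with the multiplications writes both sides of the
  associativity law for \<open>func_comp y (q Y)\<close> as those for \<open>y\<close>, composed
  with the surjection of \<open>qTq_surj\<close>, which can be cancelled. The unit law is the same
  for both.\<close>

lemma q_algs_iff:
  assumes y: "y \<in> hom (over J) (QM.MO Y) Y"
  shows "(Y, y) \<in> algs (over J) Q \<longleftrightarrow> (Y, func_comp y (q Y)) \<in> algs (over J) (T_monad T)"
proof -
  have Y: "cat_over J Y" using hom_overD[OF y] by simp
  note qY = q_hom[OF Y] and QY = QM.F0[OF Y]
  note qQ = q_hom[OF QY] and Tq = T_fun_hom[OF qY] and Qy = QM.F1[OF y] and Ty = T_fun_hom[OF y]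
  note e = TM.eta[OF Y, simplified] and mT = mu_hom[OF Y] and mQ = QM.mu[OF Y]
  let ?s = "func_comp (q (QM.MO Y)) (F1 (T_fun T) (q Y))"
  note s = qTq_surj[OF Y]
  have 1: "func_comp (func_comp y (q Y)) (eta (T_monad T) Y) = func_comp y (eta Q Y)"
    using func_comp_assoc[OF e qY y] q_natural_facts(2)[OF Y] by simp
  have 2: "func_comp (func_comp y (q Y)) (mu (T_monad T) Y) = func_comp (func_comp y (mu Q Y)) ?s"
    using func_comp_assoc[OF mT qY y] q_natural_facts(3)[OF Y] func_comp_assoc[OF s(1) mQ y] by simp
  have "func_comp (func_comp y (q Y)) (F1 (T_fun T) (func_comp y (q Y))) =
      func_comp y (func_comp (q Y) (func_comp (F1 (T_fun T) y) (F1 (T_fun T) (q Y))))"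
    using TM.F1_comp[OF qY y] func_comp_assoc[OF func_comp_hom[OF Tq Ty] qY y] by simp
  also have "\<dots> = func_comp y (func_comp (func_comp (QM.M1 y) (q (QM.MO Y))) (F1 (T_fun T) (q Y)))"
    using func_comp_assoc[OF Tq Ty qY] q_natural[OF y] by simp
  also have "\<dots> = func_comp (func_comp y (QM.M1 y)) ?s"
    using func_comp_assoc[OF Tq qQ Qy] func_comp_assoc[OF s(1) Qy y] by simp
  finally have 3: "func_comp (func_comp y (q Y)) (F1 (T_fun T) (func_comp y (q Y))) = func_comp (func_comp y (QM.M1 y)) ?s" .
  have "func_comp (func_comp y (mu Q Y)) ?s = func_comp (func_comp y (QM.M1 y)) ?s \<longleftrightarrow>
      func_comp y (mu Q Y) = func_comp y (QM.M1 y)"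
    using surj_func_epi[OF s func_comp_hom[OF mQ y] func_comp_hom[OF Qy y]] by auto
  then show ?thesis
    unfolding algs_over using Y y func_comp_hom[OF qY y] 1 2 3 by simp
qed

lemma commutative_alg:
  assumes X: "(X, x) \<in> algs (over J) (T_monad T)" and k: "kills_perms T X x"
  obtains y where "(X, y) \<in> algs (over J) Q" "x = func_comp y (q X)"
proof -
  have x: "cat_over J X" "x \<in> hom (over J) (T_cat T X) X" using X by (simp_all add: algs_over)
  then obtain y where y: "y \<in> hom (over J) (QM.MO X) X" "func_comp y (q X) = x"
    using quot_facts(4)[OF x k] by blast
  have "(X, y) \<in> algs (over J) Q" unfolding q_algs_iff[OF y(1)] y(2) by (rule X)
  then show ?thesis using y(2)[symmetric] by (rule that)
qed

lemma q_alg_kills_perms: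
  assumes Y: "(Y, y) \<in> algs (over J) Q"
  shows "kills_perms T Y (func_comp y (q Y))"
proof -
  have y: "cat_over J Y" "y \<in> hom (over J) (QM.MO Y) Y" using Y by (simp_all add: algs_over)
  note qD = hom_overD[OF q_hom[OF y(1)]] and yD = hom_overD[OF y(2)]
  show ?thesis unfolding kills_perms_def
    using perm_arrow[OF y(1)] q_perm_arrow[OF y(1)] by (simp add: qD yD)
qed

lemma q_strict_iff:
  assumes A: "(A, a) \<in> algs (over J) Q" and B: "(B, b) \<in> algs (over J) Q" and g: "g \<in> hom (over J) A B"
  shows "func_comp (func_comp b (q B)) (F1 (T_fun T) g) = func_comp g (func_comp a (q A)) \<longleftrightarrow>
    func_comp b (QM.M1 g) = func_comp g a"
proof -
  note A' = QM.algD[OF A] and B' = QM.algD[OF B]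
  note qA = q_hom[OF A'(1)] and qB = q_hom[OF B'(1)] and Tg = T_fun_hom[OF g] and Qg = QM.F1[OF g]
  have "func_comp (func_comp b (q B)) (F1 (T_fun T) g) = func_comp (func_comp b (QM.M1 g)) (q A)"
    using func_comp_assoc[OF Tg qB B'(4)] q_natural[OF g] func_comp_assoc[OF qA Qg B'(4)] by simp
  moreover have "func_comp g (func_comp a (q A)) = func_comp (func_comp g a) (q A)"
    using func_comp_assoc[OF qA A'(4) g] by simp
  ultimately show ?thesis
    using surj_func_epi[OF qA q_surj[OF A'(1)] func_comp_hom[OF Qg B'(4)] func_comp_hom[OF A'(4) g]] by auto
qed

lemma q_bar_simps:
  "F0 (q_bar (over J) q) (A, a) = (A, func_comp a (q A))"
  "F1 (q_bar (over J) q) \<lparr>msrc = (A, a), mtgt = (B, b), und = g, coh = c\<rparr> =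
    \<lparr>msrc = (A, func_comp a (q A)), mtgt = (B, func_comp b (q B)), und = g,
     coh = Hc (over J) c (Idc (over J) (q A))\<rparr>"
  by (simp_all add: q_bar_def alg_lift_def id_fun_def Let_def)

lemma q_bar_strict:
  assumes A: "(A, a) \<in> algs (over J) Q" and g: "g \<in> hom (over J) A B"
  shows "F1 (q_bar (over J) q) (strict_mor J (A, a) (B, b) g) =
    strict_mor J (A, func_comp a (q A)) (B, func_comp b (q B)) g"
proof -
  note A' = QM.algD[OF A]
  note qA = q_hom[OF A'(1)] and ga = func_comp_hom[OF A'(4) g]
  note D = hom_overD[OF qA] hom_overD[OF A'(4)]
  have "Hc (over J) (Idc (over J) (func_comp g a)) (Idc (over J) (q A)) = Idc (over J) (func_comp g (func_comp a (q A)))"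
    unfolding Hc_Idc[OF Idc_cells[OF ga] ga qA] unfolding whisker_right_def Idc_over mk_ntrans_eq_iff
    using func_comp_assoc[OF qA A'(4) g] by (simp add: D)
  then show ?thesis by (simp add: strict_mor_def q_bar_simps)
qed

text \<open>The laws for the restricted coherence are those for \<open>c\<close>, evaluated at
  images: of the unit, which \<open>q\<close> preserves, and of the objects of
  \<open>T_cat T (T_cat T A)\<close>, which cover all objects on the side of
  \<open>Q\<close>.\<close>

lemma q_bar_lax_iff:
  assumes A: "(A, a) \<in> algs (over J) Q" and B: "(B, b) \<in> algs (over J) Q" and g: "g \<in> hom (over J) A B"
    and c: "c \<in> cells (over J) (func_comp b (QM.M1 g)) (func_comp g a)"
  shows "\<lparr>msrc = (A, a), mtgt = (B, b), und = g, coh = c\<rparr> \<in> lax_mors (over J) Q \<longleftrightarrow>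
    \<lparr>msrc = (A, func_comp a (q A)), mtgt = (B, func_comp b (q B)), und = g, coh = whisker_right c (q A)\<rparr>
      \<in> lax_mors (over J) (T_monad T)"
proof -
  note A' = QM.algD[OF A] and B' = QM.algD[OF B]
  note qA = q_hom[OF A'(1)] and qB = q_hom[OF B'(1)] and Tg = T_fun_hom[OF g] and Qg = QM.F1[OF g]
  note Ta = T_fun_hom[OF A'(4)] and Tq = T_fun_hom[OF qA] and qQA = q_hom[OF A'(2)]
  have TA: "(A, func_comp a (q A)) \<in> algs (over J) (T_monad T)" and TB: "(B, func_comp b (q B)) \<in> algs (over J) (T_monad T)"
    using A B q_algs_iff A'(4) B'(4) by auto
  note TA' = TM.algD[OF TA, simplified]
  note bQg = func_comp_hom[OF Qg B'(4)]
  have s: "func_comp (func_comp b (QM.M1 g)) (q A) = func_comp (func_comp b (q B)) (F1 (T_fun T) g)"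
    using func_comp_assoc[OF Tg qB B'(4)] q_natural[OF g] func_comp_assoc[OF qA Qg B'(4)] by simp
  have t: "func_comp (func_comp g a) (q A) = func_comp g (func_comp a (q A))"
    by (rule func_comp_assoc[OF qA A'(4) g])
  have w: "whisker_right c (q A) \<in> cells (over J) (func_comp (func_comp b (q B)) (F1 (T_fun T) g)) (func_comp g (func_comp a (q A)))"
    using whisker_right_cells[OF c bQg qA] unfolding s t .
  note qAD = hom_overD[OF qA] and eD = hom_overD[OF TA'(6)] and mD = hom_overD[OF TA'(7)]
  note TaqD = hom_overD[OF TA'(5)]
  have u: "ncmp (whisker_right c (q A)) (fob (eta (T_monad T) A) x) = ncmp c (fob (eta Q A) x)" if "x \<in> Obj A" for x
    using that eD(5)[OF that] arg_cong[OF q_natural_facts(2)[OF A'(1)], of "\<lambda>F. fob F x"]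
    by (simp add: qAD)
  let ?s = "func_comp (q (QM.MO A)) (F1 (T_fun T) (q A))"
  note S = qTq_surj[OF A'(1)]
  have m: "ncmp (whisker_right c (q A)) (fob (mu (T_monad T) A) v) = ncmp c (fob (mu Q A) (fob ?s v))"
    "ncmp (whisker_right c (q A)) (fob (F1 (T_fun T) (func_comp a (q A))) v) = ncmp c (fob (QM.M1 a) (fob ?s v))"
    "far (func_comp b (q B)) (ncmp (F2 (T_fun T) (whisker_right c (q A))) v) = far b (ncmp (QM.M2 c) (fob ?s v))"
    if v: "v \<in> Obj (T_cat T (T_cat T A))" for v
  proof -
    show "ncmp (whisker_right c (q A)) (fob (mu (T_monad T) A) v) = ncmp c (fob (mu Q A) (fob ?s v))"
      using v mD(5)[OF v] arg_cong[OF q_natural_facts(3)[OF A'(1)], of "\<lambda>F. fob F v"]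
      by (simp add: qAD hom_overD(3)[OF Tq])
    have "fob (q A) (fob (F1 (T_fun T) (func_comp a (q A))) v) = fob (func_comp (q A) (F1 (T_fun T) a)) (fob (F1 (T_fun T) (q A)) v)"
      unfolding TM.F1_comp[OF qA A'(4), simplified]
      using v hom_overD[OF Tq] hom_overD[OF Ta] by simp
    also have "\<dots> = fob (QM.M1 a) (fob ?s v)"
      unfolding q_natural[OF A'(4)] using v hom_overD[OF Tq] hom_overD[OF qQA] by simp
    finally show "ncmp (whisker_right c (q A)) (fob (F1 (T_fun T) (func_comp a (q A))) v) = ncmp c (fob (QM.M1 a) (fob ?s v))"
      using v TaqD(5)[OF v] by (simp add: qAD)
    have v': "fob (F1 (T_fun T) (q A)) v \<in> Obj (T_cat T (QM.MO A))" using hom_overD(5)[OF Tq v] .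
    have "ncmp (F2 (T_fun T) c) (fob (F1 (T_fun T) (q A)) v) \<in> Arr (T_cat T B)"
      using cells_overD(4)[OF T_fun_cells[OF c bQg] T_fun_hom[OF bQg] v'] .
    then show "far (func_comp b (q B)) (ncmp (F2 (T_fun T) (whisker_right c (q A))) v) = far b (ncmp (QM.M2 c) (fob ?s v))"
      using v v' T_whisker_right[OF c bQg qA v] q_natural_cell[OF c bQg v'] hom_overD(3)[OF qB] hom_overD(3)[OF Tq] by simp
  qed
  have "(\<forall>y\<in>Obj (QM.MO (QM.MO A)). P y) \<longleftrightarrow> (\<forall>v\<in>Obj (T_cat T (T_cat T A)). P (fob ?s v))" for P
    using surj_funcE(1)[OF S(2,1)] hom_overD(5)[OF S(1)] by metis
  then show ?thesis
    unfolding QM.lax_mors_iff[OF A B] TM.lax_mors_iff[OF TA TB, simplified]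
    using g c w u m by simp
qed

text \<open>Both functors that bound the coherence of \<open>m\<close> go through
  \<open>q A\<close>, so they send permutation arrows to identities. Naturality at such an arrow
  makes the components constant on orbits, and therefore the coherence descends along
  \<open>q A\<close>.\<close>

lemma q_bar_lax_ex:
  assumes A: "(A, a) \<in> algs (over J) Q" and B: "(B, b) \<in> algs (over J) Q"
    and m: "m \<in> hom (Alg_l (over J) (T_monad T)) (A, func_comp a (q A)) (B, func_comp b (q B))"
  shows "\<exists>m'\<in>hom (Alg_l (over J) Q) (A, a) (B, b). F1 (q_bar (over J) q) m' = m"
proof -
  note A' = QM.algD[OF A] and B' = QM.algD[OF B]
  define g c where "g = und m" and "c = coh m"
  have m': "m = \<lparr>msrc = (A, func_comp a (q A)), mtgt = (B, func_comp b (q B)), und = g, coh = c\<rparr>"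
    using m by (simp add: g_def c_def hom_Alg_l)
  have TA: "(A, func_comp a (q A)) \<in> algs (over J) (T_monad T)" and TB: "(B, func_comp b (q B)) \<in> algs (over J) (T_monad T)"
    using A B q_algs_iff A'(4) B'(4) by auto
  have g: "g \<in> hom (over J) A B"
    and c: "c \<in> cells (over J) (func_comp (func_comp b (q B)) (F1 (T_fun T) g)) (func_comp g (func_comp a (q A)))"
    using m TM.lax_morsD[of m] by (auto simp: m' hom_Alg_l)
  note qA = q_hom[OF A'(1)] and qB = q_hom[OF B'(1)] and Tg = T_fun_hom[OF g] and Qg = QM.F1[OF g]
  note bQg = func_comp_hom[OF Qg B'(4)] and ga = func_comp_hom[OF A'(4) g]
  have s: "func_comp (func_comp b (QM.M1 g)) (q A) = func_comp (func_comp b (q B)) (F1 (T_fun T) g)"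
    using func_comp_assoc[OF Tg qB B'(4)] q_natural[OF g] func_comp_assoc[OF qA Qg B'(4)] by simp
  have t: "func_comp (func_comp g a) (q A) = func_comp g (func_comp a (q A))"
    by (rule func_comp_assoc[OF qA A'(4) g])
  note c = c[folded s t]
  note cD = cells_overD[OF c func_comp_hom[OF qA bQg]]
  note qD = hom_overD[OF qA] and BD = cat_overD[OF B'(1)] and GD = hom_overD[OF bQg] and HD = hom_overD[OF ga]
  note TD = cat_overD[OF qD(1)] and QD = cat_overD[OF qD(2)]
  have inv: "ncmp c z = ncmp c z'" if z: "z \<in> Obj (T_cat T A)" "z' \<in> Obj (T_cat T A)"
    and eq: "fob (q A) z = fob (q A) z'" for z z'
  proof -
    obtain \<rho> where r: "\<rho> \<in> perms (length (args z'))" and p: "z = permute \<rho> z'"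
      using q_orbit[OF A'(1) z eq] by (auto simp: same_orbit_def)
    note pa = perm_arrow[OF A'(1) z(2) r] and qp = q_perm_arrow[OF A'(1) z(2) r]
    have "Com B (ncmp c z') (Ide B (fob (func_comp b (QM.M1 g)) (fob (q A) z'))) =
        Com B (Ide B (fob (func_comp g a) (fob (q A) z'))) (ncmp c z)"
      using cD(7)[OF pa(1)] pa qp z p by (simp add: qD GD HD)
    moreover have "Com B (ncmp c z') (Ide B (fob (func_comp b (QM.M1 g)) (fob (q A) z'))) = ncmp c z'"
      using z cD(4,5)[OF z(2)] by (intro BD(8)) (simp_all add: qD)
    moreover have "Com B (Ide B (fob (func_comp g a) (fob (q A) z'))) (ncmp c z) = ncmp c z"
      using z cD(4,6)[OF z(1)] eq by (intro BD(9)) (simp_all add: qD)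
    ultimately show ?thesis by simp
  qed
  \<comment> \<open>The component at \<open>y\<close> is the one at any preimage; by
    \<open>inv\<close> the choice does not matter. Naturality descends because arrows have preimages
    too.\<close>
  define d where "d y = ncmp c (SOME z. z \<in> Obj (T_cat T A) \<and> fob (q A) z = y)" for y
  have d: "d (fob (q A) z) = ncmp c z" if z: "z \<in> Obj (T_cat T A)" for z
    unfolding d_def using someI[of "\<lambda>y. y \<in> Obj (T_cat T A) \<and> fob (q A) y = fob (q A) z" z] z
    by (intro inv) auto
  note sur = surj_funcE[OF q_surj[OF A'(1)] qA]
  let ?c = "mk_ntrans (func_comp b (QM.M1 g)) (func_comp g a) d"
  have c': "?c \<in> cells (over J) (func_comp b (QM.M1 g)) (func_comp g a)"
  proof (rule mk_ntrans_cells[OF bQg ga])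
    fix y assume "y \<in> Obj (QM.MO A)"
    then obtain z where z: "z \<in> Obj (T_cat T A)" "y = fob (q A) z" using sur(1) by blast
    then show "d y \<in> Arr B \<and> Dom B (d y) = fob (func_comp b (QM.M1 g)) y \<and> Cod B (d y) = fob (func_comp g a) y"
      using cD(4-6)[OF z(1)] d[OF z(1)] by (simp add: qD)
  next
    fix f assume "f \<in> Arr (QM.MO A)"
    then obtain h where h: "h \<in> Arr (T_cat T A)" "f = far (q A) h" using sur(2) by blast
    then show "Com B (d (Cod (QM.MO A) f)) (far (func_comp b (QM.M1 g)) f) =
        Com B (far (func_comp g a) f) (d (Dom (QM.MO A) f))"
      using cD(7)[OF h(1)] d by (simp add: qD TD)
  qed
  have wc: "whisker_right ?c (q A) = c"
  proof (rule cells_over_eqI[OF whisker_right_cells[OF c' bQg qA] c func_comp_hom[OF qA bQg]])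
    fix z assume "z \<in> Obj (T_cat T A)"
    then show "ncmp (whisker_right ?c (q A)) z = ncmp c z"
      using d by (simp add: qD hom_overD(3)[OF Qg])
  qed
  let ?m = "\<lparr>msrc = (A, a), mtgt = (B, b), und = g, coh = ?c\<rparr>"
  have "?m \<in> lax_mors (over J) Q"
    unfolding q_bar_lax_iff[OF A B g c'] wc using m by (simp add: m' hom_Alg_l)
  moreover have "F1 (q_bar (over J) q) ?m = m"
    using Hc_Idc[OF c' bQg qA] wc by (simp add: q_bar_simps m')
  ultimately show ?thesis by (intro bexI[of _ ?m]) (simp_all add: hom_Alg_l)
qed

lemma q_bar_lax:
  assumes m: "m \<in> hom (Alg_l (over J) Q) (A, a) (B, b)"
  shows "F1 (q_bar (over J) q) m = \<lparr>msrc = (A, func_comp a (q A)), mtgt = (B, func_comp b (q B)),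
      und = und m, coh = whisker_right (coh m) (q A)\<rparr>"
    "F1 (q_bar (over J) q) m \<in> hom (Alg_l (over J) (T_monad T)) (A, func_comp a (q A)) (B, func_comp b (q B))"
    "n \<in> hom (Alg_l (over J) Q) (A, a) (B, b) \<Longrightarrow> F1 (q_bar (over J) q) m = F1 (q_bar (over J) q) n \<Longrightarrow> m = n"
    "h \<in> hom (over J) B C \<Longrightarrow> F1 (q_bar (over J) q) (postcomp (C, c) h m) =
      postcomp (C, func_comp c (q C)) h (F1 (q_bar (over J) q) m)"
proof -
  have *: "F1 (q_bar (over J) q) m = \<lparr>msrc = (A, func_comp a (q A)), mtgt = (B, func_comp b (q B)),
      und = und m, coh = whisker_right (coh m) (q A)\<rparr> \<and>
      F1 (q_bar (over J) q) m \<in> hom (Alg_l (over J) (T_monad T)) (A, func_comp a (q A)) (B, func_comp b (q B))"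
    if m: "m \<in> hom (Alg_l (over J) Q) (A, a) (B, b)" for m
  proof -
    have m': "m \<in> lax_mors (over J) Q" "m = \<lparr>msrc = (A, a), mtgt = (B, b), und = und m, coh = coh m\<rparr>"
      using m by (simp_all add: hom_Alg_l)
    note d = QM.lax_morsD[of m A a B b]
    have d: "(A, a) \<in> algs (over J) Q" "(B, b) \<in> algs (over J) Q" "und m \<in> hom (over J) A B"
      "coh m \<in> cells (over J) (func_comp b (QM.M1 (und m))) (func_comp (und m) a)"
      "func_comp b (QM.M1 (und m)) \<in> hom (over J) (QM.MO A) B"
      using m d by (simp_all add: hom_Alg_l)
    note qA = q_hom[OF QM.algD(1)[OF d(1)]]
    have "F1 (q_bar (over J) q) m = \<lparr>msrc = (A, func_comp a (q A)), mtgt = (B, func_comp b (q B)),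
      und = und m, coh = whisker_right (coh m) (q A)\<rparr>"
      using Hc_Idc[OF d(4,5) qA] by (subst m'(2)) (simp add: q_bar_simps)
    then show ?thesis using q_bar_lax_iff[OF d(1-4)] m' by (simp add: hom_Alg_l)
  qed
  show 1: "F1 (q_bar (over J) q) m = \<lparr>msrc = (A, func_comp a (q A)), mtgt = (B, func_comp b (q B)),
      und = und m, coh = whisker_right (coh m) (q A)\<rparr>"
    and "F1 (q_bar (over J) q) m \<in> hom (Alg_l (over J) (T_monad T)) (A, func_comp a (q A)) (B, func_comp b (q B))"
    using *[OF m] by auto
  have d: "(A, a) \<in> algs (over J) Q" "(B, b) \<in> algs (over J) Q" "und m \<in> hom (over J) A B"
    "coh m \<in> cells (over J) (func_comp b (QM.M1 (und m))) (func_comp (und m) a)"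
    "func_comp b (QM.M1 (und m)) \<in> hom (over J) (QM.MO A) B"
    using m QM.lax_morsD[of m A a B b] by (simp_all add: hom_Alg_l)
  note qA = q_hom[OF QM.algD(1)[OF d(1)]]
  show "m = n" if n: "n \<in> hom (Alg_l (over J) Q) (A, a) (B, b)" and eq: "F1 (q_bar (over J) q) m = F1 (q_bar (over J) q) n"
  proof -
    have u: "und m = und n" and w: "whisker_right (coh m) (q A) = whisker_right (coh n) (q A)"
      using *[OF m] *[OF n] eq by simp_all
    have "coh n \<in> cells (over J) (func_comp b (QM.M1 (und m))) (func_comp (und m) a)"
      using n QM.lax_morsD(4)[of n A a B b] u by (simp add: hom_Alg_l)
    then have "coh m = coh n"
    proof (rule cells_over_eqI[OF d(4) _ d(5)])
      fix y assume "y \<in> Obj (QM.MO A)"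
      then obtain z where "z \<in> Obj (T_cat T A)" "y = fob (q A) z"
        using surj_funcE(1)[OF q_surj[OF QM.algD(1)[OF d(1)]] qA] by blast
      then show "ncmp (coh m) y = ncmp (coh n) y"
        using arg_cong[OF w, of "\<lambda>t. ncmp t z"] by (simp add: hom_overD(3)[OF qA])
    qed
    then show ?thesis using u m n by (simp add: hom_Alg_l)
  qed
  assume h: "h \<in> hom (over J) B C"
  note ga = cells_overD(1)[OF d(4,5)]
  note w = whisker_left_cells[OF d(4,5) h]
  have "Hc (over J) (whisker_left h (coh m)) (Idc (over J) (q A)) = whisker_left h (whisker_right (coh m) (q A))"
    unfolding Hc_Idc[OF w func_comp_hom[OF d(5) h] qA]
    unfolding whisker_right_def whisker_left_def mk_ntrans_eq_iff
    using func_comp_assoc[OF qA d(5) h] func_comp_assoc[OF qA ga h] hom_overD[OF qA] hom_overD[OF d(5)] cells_overD(2,3)[OF d(4,5)]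
    by simp
  then show "F1 (q_bar (over J) q) (postcomp (C, c) h m) =
      postcomp (C, func_comp c (q C)) h (F1 (q_bar (over J) q) m)"
    unfolding 1 using m by (simp add: postcomp_def q_bar_simps hom_Alg_l)
qed

end

section \<open>Pulling back along a morphism of operads\<close>

lemma pr_eq_iff [simp]: "pr i x = pr j y \<longleftrightarrow> i = j \<and> x = y"
  by (simp add: pr_def)

lemma Delta_cat_simps [simp]:
  "Dom (Delta_cat I f Y) (pr i y) = pr i (Dom Y y)" "Cod (Delta_cat I f Y) (pr i y) = pr i (Cod Y y)"
  "Ide (Delta_cat I f Y) (pr i y) = pr i (Ide Y y)" "Col (Delta_cat I f Y) (pr i y) = i"
  "Com (Delta_cat I f Y) (pr i y) (pr i' y') = pr i' (Com Y y y')"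
  "pr i y \<in> Obj (Delta_cat I f Y) \<longleftrightarrow> i \<in> I \<and> y \<in> Obj Y \<and> Col Y y = f i"
  "pr i y \<in> Arr (Delta_cat I f Y) \<longleftrightarrow> i \<in> I \<and> y \<in> Arr Y \<and> Col Y (Cod Y y) = f i"
  by (auto simp: Delta_cat_def)

lemma Delta_objE:
  assumes "x \<in> Obj (Delta_cat I f Y)"
  obtains i y where "x = pr i y" "i \<in> I" "y \<in> Obj Y" "Col Y y = f i"
  using assms by (auto simp: Delta_cat_def)

lemma Delta_arrE:
  assumes "x \<in> Arr (Delta_cat I f Y)"
  obtains i y where "x = pr i y" "i \<in> I" "y \<in> Arr Y" "Col Y (Cod Y y) = f i"
  using assms by (auto simp: Delta_cat_def)

lemma Delta_obj_components:
  assumes "x \<in> Obj (Delta_cat I f Y)"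
  shows "pr2 x \<in> Obj Y" "Col Y (pr2 x) = f (Col (Delta_cat I f Y) x)"
  using assms by (auto elim!: Delta_objE)

lemma Delta_arr_components:
  assumes "x \<in> Arr (Delta_cat I f Y)"
  shows "pr2 x \<in> Arr Y" "Col Y (Cod Y (pr2 x)) = f (Col (Delta_cat I f Y) (Cod (Delta_cat I f Y) x))"
  using assms by (auto elim!: Delta_arrE)

lemma Delta_over:
  assumes Y: "cat_over J Y"
  shows "cat_over I (Delta_cat I f Y)"
  by (rule cat_overI) (auto elim!: Delta_objE Delta_arrE simp: cat_overD[OF Y])

lemma Delta_thin: "thin Y \<Longrightarrow> thin (Delta_cat I f Y)"
  unfolding thin_def by (auto elim!: Delta_arrE)

lemma Delta_fun_simps [simp]:
  "F0 (Delta_fun I f) = Delta_cat I f"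
  "fsrc (F1 (Delta_fun I f) H) = Delta_cat I f (fsrc H)" "ftgt (F1 (Delta_fun I f) H) = Delta_cat I f (ftgt H)"
  "pr i y \<in> Obj (Delta_cat I f (fsrc H)) \<Longrightarrow> fob (F1 (Delta_fun I f) H) (pr i y) = pr i (fob H y)"
  "pr i y \<in> Arr (Delta_cat I f (fsrc H)) \<Longrightarrow> far (F1 (Delta_fun I f) H) (pr i y) = pr i (far H y)"
  "nsrc (F2 (Delta_fun I f) t) = F1 (Delta_fun I f) (nsrc t)" "ntgt (F2 (Delta_fun I f) t) = F1 (Delta_fun I f) (ntgt t)"
  "pr i y \<in> Obj (Delta_cat I f (fsrc (nsrc t))) \<Longrightarrow> ncmp (F2 (Delta_fun I f) t) (pr i y) = pr i (ncmp t y)"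
  by (simp_all add: Delta_fun_def Let_def)

lemma Delta_hom:
  assumes H: "H \<in> hom (over J) X Y"
  shows "F1 (Delta_fun I f) H \<in> hom (over I) (Delta_cat I f X) (Delta_cat I f Y)"
proof -
  note HD = hom_overD[OF H]
  have "mk_func (Delta_cat I f X) (Delta_cat I f Y) (\<lambda>u. pr (pr1 u) (fob H (pr2 u))) (\<lambda>u. pr (pr1 u) (far H (pr2 u)))
      \<in> hom (over I) (Delta_cat I f X) (Delta_cat I f Y)"
    by (rule mk_func_hom[OF Delta_over[OF HD(1)] Delta_over[OF HD(2)]])
      (auto elim!: Delta_objE Delta_arrE simp: HD cat_overD[OF HD(1)])
  then show ?thesis by (simp add: Delta_fun_def Let_def HD)
qed

lemma Delta_comp:
  assumes G: "G \<in> hom (over J) X Y" and H: "H \<in> hom (over J) Y Z"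
  shows "F1 (Delta_fun I f) (func_comp H G) = func_comp (F1 (Delta_fun I f) H) (F1 (Delta_fun I f) G)"
proof (rule hom_over_eqI[OF Delta_hom[OF func_comp_hom[OF G H]] func_comp_hom[OF Delta_hom[OF G] Delta_hom[OF H]]])
  note GD = hom_overD[OF G] and HD = hom_overD[OF H]
  show "fob (F1 (Delta_fun I f) (func_comp H G)) x = fob (func_comp (F1 (Delta_fun I f) H) (F1 (Delta_fun I f) G)) x"
    if "x \<in> Obj (Delta_cat I f X)" for x
    using that by (auto elim!: Delta_objE simp: GD HD)
  show "far (F1 (Delta_fun I f) (func_comp H G)) x = far (func_comp (F1 (Delta_fun I f) H) (F1 (Delta_fun I f) G)) x"
    if "x \<in> Arr (Delta_cat I f X)" for x
    using that by (auto elim!: Delta_arrE simp: GD HD cat_overD[OF GD(1)])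
qed

lemma Delta_Idm:
  assumes X: "cat_over J X"
  shows "F1 (Delta_fun I f) (Idm (over J) X) = Idm (over I) (Delta_cat I f X)"
  by (rule hom_over_eqI[OF Delta_hom[OF Idm_hom[OF X]] Idm_hom[OF Delta_over[OF X]]])
    (auto elim!: Delta_objE Delta_arrE simp: cat_overD[OF X])

lemma Delta_Idc:
  assumes H: "H \<in> hom (over J) X Y"
  shows "F2 (Delta_fun I f) (Idc (over J) H) = Idc (over I) (F1 (Delta_fun I f) H)"
proof -
  note HD = hom_overD[OF H]
  have "F2 (Delta_fun I f) (Idc (over J) H) = mk_ntrans (F1 (Delta_fun I f) H) (F1 (Delta_fun I f) H)
      (\<lambda>u. pr (pr1 u) (ncmp (Idc (over J) H) (pr2 u)))"
    by (simp add: Delta_fun_def Let_def)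
  also have "\<dots> = Idc (over I) (F1 (Delta_fun I f) H)"
    unfolding Idc_over mk_ntrans_eq_iff by (auto elim!: Delta_objE simp: HD)
  finally show ?thesis .
qed

text \<open>The coherence \<open>l\<close> is kept arbitrary so that the lemma serves all three
  adjunctions.\<close>

lemma alg_lift_strict:
  assumes a: "a \<in> hom (over J) A' A" and g: "g \<in> hom (over J) A B"
    and l: "l A \<in> hom (over I) P (Delta_cat I f A')"
  shows "F1 (alg_lift (over I) (Delta_fun I f) l) (strict_mor J (A, a) (B, b) g) =
    strict_mor I (F0 (alg_lift (over I) (Delta_fun I f) l) (A, a)) (F0 (alg_lift (over I) (Delta_fun I f) l) (B, b))
      (F1 (Delta_fun I f) g)"
proof -
  note Da = Delta_hom[OF a, of I f] and Dg = Delta_hom[OF g, of I f] and ga = func_comp_hom[OF a g]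
  note lD = hom_overD[OF l]
  have "Hc (over I) (Idc (over I) (F1 (Delta_fun I f) (func_comp g a))) (Idc (over I) (l A)) =
      Idc (over I) (func_comp (F1 (Delta_fun I f) g) (func_comp (F1 (Delta_fun I f) a) (l A)))"
    unfolding Hc_Idc[OF Idc_cells[OF Delta_hom[OF ga]] Delta_hom[OF ga] l]
    unfolding whisker_right_def Idc_over mk_ntrans_eq_iff
    using func_comp_assoc[OF l Da Dg] Delta_comp[OF a g, of I f] hom_overD(3)[OF ga]
    by (simp add: lD hom_overD[OF Da] hom_overD(3,4)[OF a] hom_overD(3,4)[OF g])
  then show ?thesis
    using Delta_Idc[OF ga] by (simp add: alg_lift_def strict_mor_def Let_def)
qed

section \<open>The coherence of a morphism of operads\<close>

locale operad_map = S: set_operad S + T: set_operad T for S T :: "'u::small operad" +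
  fixes f F :: "'u \<Rightarrow> 'u"
  assumes mor: "operad_morphism S T f F"
begin

lemma morD:
  "i \<in> colours S \<Longrightarrow> f i \<in> colours T" "i \<in> colours S \<Longrightarrow> F (unt S i) = unt T (f i)"
  "\<alpha> \<in> ops S \<Longrightarrow> F \<alpha> \<in> ops T" "\<alpha> \<in> ops S \<Longrightarrow> ins T (F \<alpha>) = map f (ins S \<alpha>)"
  "\<alpha> \<in> ops S \<Longrightarrow> out T (F \<alpha>) = f (out S \<alpha>)"
  "plugs S \<alpha> \<beta>s \<Longrightarrow> F (sub S \<alpha> \<beta>s) = sub T (F \<alpha>) (map F \<beta>s)"
  "\<alpha> \<in> ops S \<Longrightarrow> \<rho> \<in> perms (length (ins S \<alpha>)) \<Longrightarrow> F (act S \<alpha> \<rho>) = act T (F \<alpha>) \<rho>"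
  using mor unfolding operad_morphism_def by blast+

abbreviation "I \<equiv> colours S"
abbreviation "J \<equiv> colours T"
abbreviation "\<Delta> \<equiv> Delta_cat (colours S) f"
abbreviation "\<Delta>1 \<equiv> F1 (Delta_fun (colours S) f)"
abbreviation "FC \<equiv> F_coh S T f F"

lemma F_coh_simps [simp]:
  "fsrc (FC Y) = T_cat S (\<Delta> Y)" "ftgt (FC Y) = \<Delta> (T_cat T Y)"
  "tup \<rho> \<alpha> zs \<in> Obj (T_cat S (\<Delta> Y)) \<Longrightarrow> fob (FC Y) (tup \<rho> \<alpha> zs) = pr (out S \<alpha>) (tup [] (F \<alpha>) (map pr2 zs))"
  "tup \<rho> \<beta> ws \<in> Arr (T_cat S (\<Delta> Y)) \<Longrightarrow> far (FC Y) (tup \<rho> \<beta> ws) = pr (out S \<beta>) (tup \<rho> (F \<beta>) (map pr2 ws))"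
  by (simp_all add: F_coh_def)

lemma F_coh_hom:
  assumes Y: "cat_over J Y"
  shows "FC Y \<in> hom (over I) (T_cat S (\<Delta> Y)) (\<Delta> (T_cat T Y))"
  unfolding F_coh_def
proof (rule mk_func_hom)
  note YD = cat_overD[OF Y]
  note DY = Delta_over[OF Y, of I f]
  show "cat_over I (T_cat S (\<Delta> Y))" "cat_over I (\<Delta> (T_cat T Y))"
    using S.T_cat_over[OF DY] Delta_over[OF T.T_cat_over[OF Y]] by auto
next
  note YD = cat_overD[OF Y]
  note DY = Delta_over[OF Y, of I f]
  fix u assume "u \<in> Obj (T_cat S (\<Delta> Y))"
  then obtain \<alpha> zs where u: "u = tup [] \<alpha> zs" "\<alpha> \<in> ops S" "length zs = length (ins S \<alpha>)"
    "\<forall>k<length (ins S \<alpha>). zs ! k \<in> Obj (\<Delta> Y)" "\<forall>k<length (ins S \<alpha>). Col (\<Delta> Y) (zs ! k) = ins S \<alpha> ! k"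
    by (rule T_ObjE)
  show "pr (out S (opn u)) (tup [] (F (opn u)) (map pr2 (args u))) \<in> Obj (\<Delta> (T_cat T Y))"
    using u Delta_obj_components[of _ I f Y] by (simp add: T_Obj_iff morD S.operadD)
  show "Col (\<Delta> (T_cat T Y)) (pr (out S (opn u)) (tup [] (F (opn u)) (map pr2 (args u)))) = Col (T_cat S (\<Delta> Y)) u"
    using u by simp
  have "map (pr2 \<circ> Ide (\<Delta> Y)) zs = map (Ide Y \<circ> pr2) zs"
    by (simp add: Delta_cat_def)
  then show "pr (out S (opn (Ide (T_cat S (\<Delta> Y)) u))) (tup (prm (Ide (T_cat S (\<Delta> Y)) u))
      (F (opn (Ide (T_cat S (\<Delta> Y)) u))) (map pr2 (args (Ide (T_cat S (\<Delta> Y)) u)))) =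
    Ide (\<Delta> (T_cat T Y)) (pr (out S (opn u)) (tup [] (F (opn u)) (map pr2 (args u))))"
    using u by simp
next
  note YD = cat_overD[OF Y]
  fix w assume "w \<in> Arr (T_cat S (\<Delta> Y))"
  then obtain \<rho> \<beta> \<gamma>s where w: "w = tup \<rho> \<beta> \<gamma>s" "\<beta> \<in> ops S" "\<rho> \<in> perms (length (ins S \<beta>))"
    "length \<gamma>s = length (ins S \<beta>)" "\<forall>k<length (ins S \<beta>). \<gamma>s ! k \<in> Arr (\<Delta> Y)"
    "\<forall>k<length (ins S \<beta>). Col (\<Delta> Y) (Cod (\<Delta> Y) (\<gamma>s ! k)) = ins S \<beta> ! (\<rho> ! k)"
    by (rule T_ArrE)
  note r = permsD[OF w(3)] nth_perm_inv[OF w(3)]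
  have out: "out T (F \<beta>) = f (out S \<beta>)" "out S \<beta> \<in> I" using w by (simp_all add: morD S.operadD)
  show "pr (out S (opn w)) (tup (prm w) (F (opn w)) (map pr2 (args w))) \<in> Arr (\<Delta> (T_cat T Y))"
    using w r out Delta_arr_components[of _ I f Y] by (simp add: T_Arr_iff morD)
  show "Dom (\<Delta> (T_cat T Y)) (pr (out S (opn w)) (tup (prm w) (F (opn w)) (map pr2 (args w)))) =
      pr (out S (opn (Dom (T_cat S (\<Delta> Y)) w))) (tup [] (F (opn (Dom (T_cat S (\<Delta> Y)) w))) (map pr2 (args (Dom (T_cat S (\<Delta> Y)) w))))"
    using w by (simp add: morD S.operadD) (simp add: Delta_cat_def)
  show "Cod (\<Delta> (T_cat T Y)) (pr (out S (opn w)) (tup (prm w) (F (opn w)) (map pr2 (args w)))) =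
      pr (out S (opn (Cod (T_cat S (\<Delta> Y)) w))) (tup [] (F (opn (Cod (T_cat S (\<Delta> Y)) w))) (map pr2 (args (Cod (T_cat S (\<Delta> Y)) w))))"
    using w r permsD(3)[OF perm_inv_perms[OF w(3)]] by (simp add: Delta_cat_def)
next
  note DY = Delta_over[OF Y, of I f]
  fix u v assume u: "u \<in> Arr (T_cat S (\<Delta> Y))" and v: "v \<in> Arr (T_cat S (\<Delta> Y))"
    and uv: "Cod (T_cat S (\<Delta> Y)) u = Dom (T_cat S (\<Delta> Y)) v"
  obtain \<rho> \<beta> \<gamma>s \<sigma> \<delta>s n where c: "v = tup \<rho> \<beta> \<gamma>s" "u = tup \<sigma> (act S \<beta> \<rho>) \<delta>s" "\<beta> \<in> ops S"
    "n = length (ins S \<beta>)" "\<rho> \<in> perms n" "\<sigma> \<in> perms n" "length \<gamma>s = n" "length \<delta>s = n"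
    "\<forall>k<n. \<gamma>s ! k \<in> Arr (\<Delta> Y)" "\<forall>k<n. Col (\<Delta> Y) (Cod (\<Delta> Y) (\<gamma>s ! k)) = ins S \<beta> ! (\<rho> ! k)"
    "\<forall>k<n. \<delta>s ! k \<in> Arr (\<Delta> Y)" "\<forall>k<n. Cod (\<Delta> Y) (\<delta>s ! k) = Dom (\<Delta> Y) (\<gamma>s ! (\<sigma> ! k))"
    and C: "Com (T_cat S (\<Delta> Y)) v u = tup (perm_comp \<rho> \<sigma>) \<beta> (map (\<lambda>k. Com (\<Delta> Y) (\<gamma>s ! (\<sigma> ! k)) (\<delta>s ! k)) [0..<n])"
    by (rule S.T_composableE[OF DY u v uv])
  have "out S (act S \<beta> \<rho>) = out S \<beta>" using c by (simp add: S.operadD)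
  moreover have "map2 (\<lambda>k. Com Y (map pr2 \<gamma>s ! k)) \<sigma> (map pr2 \<delta>s) =
      map pr2 (map (\<lambda>k. Com (\<Delta> Y) (\<gamma>s ! (\<sigma> ! k)) (\<delta>s ! k)) [0..<n])"
    using c permsD[OF c(6)] by (auto simp: Delta_cat_def intro!: nth_equalityI)
  ultimately show "pr (out S (opn (Com (T_cat S (\<Delta> Y)) v u))) (tup (prm (Com (T_cat S (\<Delta> Y)) v u))
      (F (opn (Com (T_cat S (\<Delta> Y)) v u))) (map pr2 (args (Com (T_cat S (\<Delta> Y)) v u)))) =
    Com (\<Delta> (T_cat T Y)) (pr (out S (opn v)) (tup (prm v) (F (opn v)) (map pr2 (args v))))
      (pr (out S (opn u)) (tup (prm u) (F (opn u)) (map pr2 (args u))))"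
    unfolding C unfolding c(1,2) by (simp add: T_Com)
qed

lemma F_coh_natural:
  assumes H: "H \<in> hom (over J) X Y"
  shows "func_comp (FC Y) (F1 (T_fun S) (\<Delta>1 H)) = func_comp (\<Delta>1 (F1 (T_fun T) H)) (FC X)"
proof -
  note HD = hom_overD[OF H]
  note DH = Delta_hom[OF H, of I f] and TH = T.T_fun_hom[OF H]
  note SDH = S.T_fun_hom[OF DH] and DTH = Delta_hom[OF TH, of I f]
  note FX = F_coh_hom[OF HD(1)] and FY = F_coh_hom[OF HD(2)]
  note FXD = hom_overD[OF FX] and SD = hom_overD[OF SDH]
  show ?thesis
  proof (rule hom_over_eqI[OF func_comp_hom[OF SDH FY] func_comp_hom[OF FX DTH]])
    fix z assume z: "z \<in> Obj (T_cat S (\<Delta> X))"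
    note c = T_obj_components[OF z]
    have "pr2 (fob (\<Delta>1 H) x) = fob H (pr2 x)" if "x \<in> set (args z)" for x
      using subsetD[OF c(3) that] by (auto elim!: Delta_objE simp: HD)
    then have m: "map pr2 (map (fob (\<Delta>1 H)) (args z)) = map (fob H) (map pr2 (args z))" by simp
    have z': "tup [] (opn z) (args z) \<in> Obj (T_cat S (\<Delta> X))" using z c(1) by simp
    show "fob (func_comp (FC Y) (F1 (T_fun S) (\<Delta>1 H))) z = fob (func_comp (\<Delta>1 (F1 (T_fun T) H)) (FC X)) z"
      using z' SD(5)[OF z'] FXD(5)[OF z'] m by (subst (1 2) c(1)) (simp add: HD del: map_map)
  next
    fix w assume w: "w \<in> Arr (T_cat S (\<Delta> X))"
    note c = T_arr_components[OF w]
    have "pr2 (far (\<Delta>1 H) x) = far H (pr2 x)" if "x \<in> set (args w)" for x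
      using subsetD[OF c(5) that] by (auto elim!: Delta_arrE simp: HD)
    then have m: "map pr2 (map (far (\<Delta>1 H)) (args w)) = map (far H) (map pr2 (args w))" by simp
    have w': "tup (prm w) (opn w) (args w) \<in> Arr (T_cat S (\<Delta> X))" using w c(1) by simp
    show "far (func_comp (FC Y) (F1 (T_fun S) (\<Delta>1 H))) w = far (func_comp (\<Delta>1 (F1 (T_fun T) H)) (FC X)) w"
      using w' SD(6)[OF w'] FXD(6)[OF w'] m by (subst (1 2) c(1)) (simp add: HD del: map_map)
  qed
qed

lemma F_coh_eta:
  assumes Y: "cat_over J Y"
  shows "func_comp (FC Y) (eta (T_monad S) (\<Delta> Y)) = \<Delta>1 (eta (T_monad T) Y)"
proof -
  note e = S.eta_hom[OF Delta_over[OF Y]] and e' = T.eta_hom[OF Y]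
  note eD = hom_overD[OF e]
  show ?thesis
  proof (rule hom_over_eqI[OF func_comp_hom[OF e F_coh_hom[OF Y]] Delta_hom[OF e']])
    fix x assume x: "x \<in> Obj (\<Delta> Y)"
    then obtain i y where x': "x = pr i y" "i \<in> I" "y \<in> Obj Y" "Col Y y = f i" by (rule Delta_objE)
    then show "fob (func_comp (FC Y) (eta (T_monad S) (\<Delta> Y))) x = fob (\<Delta>1 (eta (T_monad T) Y)) x"
      using eD(5)[OF x] by (simp add: morD S.operadD)
  next
    fix x assume x: "x \<in> Arr (\<Delta> Y)"
    then obtain i y where x': "x = pr i y" "i \<in> I" "y \<in> Arr Y" "Col Y (Cod Y y) = f i" by (rule Delta_arrE)
    then show "far (func_comp (FC Y) (eta (T_monad S) (\<Delta> Y))) x = far (\<Delta>1 (eta (T_monad T) Y)) x"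
      using eD(6)[OF x] by (simp add: morD S.operadD)
  qed
qed

text \<open>\<open>F\<close> preserves substitution and leaves permutations alone, so applying it to
  the outer and inner operations before substituting gives the same as applying it
  afterwards.\<close>

lemma F_coh_mu:
  assumes Y: "cat_over J Y"
  shows "func_comp (FC Y) (mu (T_monad S) (\<Delta> Y)) =
    func_comp (\<Delta>1 (mu (T_monad T) Y)) (func_comp (FC (T_cat T Y)) (F1 (T_fun S) (FC Y)))"
proof -
  note DY = Delta_over[OF Y, of I f] and TY = T.T_cat_over[OF Y]
  note m = S.mu_hom[OF DY] and m' = T.mu_hom[OF Y] and FY = F_coh_hom[OF Y] and FTY = F_coh_hom[OF TY]
  note SF = S.T_fun_hom[OF FY] and Dm = Delta_hom[OF m', of I f]
  note FF = func_comp_hom[OF SF FTY]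
  note mD = hom_overD[OF m] and SFD = hom_overD[OF SF] and FFD = hom_overD[OF FF]
  show ?thesis
  proof (rule hom_over_eqI[OF func_comp_hom[OF m FY] func_comp_hom[OF FF Dm]])
    fix z assume z: "z \<in> Obj (T_cat S (T_cat S (\<Delta> Y)))"
    then obtain \<alpha> zs where z': "z = tup [] \<alpha> zs" by (auto simp: T_cat_def)
    note mo = S.mu_obj[OF z[unfolded z']]
    have Fx: "fob (FC Y) x = pr (out S (opn x)) (tup [] (F (opn x)) (map pr2 (args x)))" if "x \<in> set zs" for x
      using subsetD[OF mo(4) that] T_obj_components(1)[OF subsetD[OF mo(4) that]]
        F_coh_simps(3)[of "[]" "opn x" "args x" Y] by simp
    have a: "map (fob (FC Y)) zs = map (\<lambda>x. pr (out S (opn x)) (tup [] (F (opn x)) (map pr2 (args x)))) zs"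
      using Fx by simp
    note z2 = z[unfolded z']
    have l: "fob (func_comp (FC Y) (mu (T_monad S) (\<Delta> Y))) z =
        pr (out S \<alpha>) (tup [] (sub T (F \<alpha>) (map F (map opn zs))) (map pr2 (concat (map args zs))))"
      using z2 mo(6) morD(6)[OF mo(1)] S.operadD(8)[OF mo(1)] by (simp add: z' del: map_map)
    have F1: "fob (F1 (T_fun S) (FC Y)) z = tup [] \<alpha> (map (fob (FC Y)) zs)" using z2 by (simp add: z')
    have F2: "tup [] \<alpha> (map (fob (FC Y)) zs) \<in> Obj (T_cat S (\<Delta> (T_cat T Y)))" using SFD(5)[OF z] F1 by simp
    then have F3: "fob (func_comp (FC (T_cat T Y)) (F1 (T_fun S) (FC Y))) z =
        pr (out S \<alpha>) (tup [] (F \<alpha>) (map pr2 (map (fob (FC Y)) zs)))"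
      using z F1 by (simp add: SFD)
    then have F4: "pr (out S \<alpha>) (tup [] (F \<alpha>) (map pr2 (map (fob (FC Y)) zs))) \<in> Obj (\<Delta> (T_cat T (T_cat T Y)))"
      using FFD(5)[OF z] by simp
    have "fob (func_comp (\<Delta>1 (mu (T_monad T) Y)) (func_comp (FC (T_cat T Y)) (F1 (T_fun S) (FC Y)))) z =
        fob (\<Delta>1 (mu (T_monad T) Y)) (pr (out S \<alpha>) (tup [] (F \<alpha>) (map pr2 (map (fob (FC Y)) zs))))"
      using z F3 by (simp add: SFD)
    also have "\<dots> = pr (out S \<alpha>) (tup [] (sub T (F \<alpha>) (map opn (map pr2 (map (fob (FC Y)) zs))))
        (concat (map args (map pr2 (map (fob (FC Y)) zs)))))"
      using F4 by (simp del: map_map)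
    also have "\<dots> = fob (func_comp (FC Y) (mu (T_monad S) (\<Delta> Y))) z"
      unfolding l a by (simp add: map_concat comp_def)
    finally show "fob (func_comp (FC Y) (mu (T_monad S) (\<Delta> Y))) z =
        fob (func_comp (\<Delta>1 (mu (T_monad T) Y)) (func_comp (FC (T_cat T Y)) (F1 (T_fun S) (FC Y)))) z" ..
  next
    fix w assume w: "w \<in> Arr (T_cat S (T_cat S (\<Delta> Y)))"
    then obtain \<rho> \<beta> ws where w': "w = tup \<rho> \<beta> ws" by (auto simp: T_cat_def)
    note w2 = w[unfolded w']
    note mo = S.mu_arr[OF DY w2]
    have wsA: "set ws \<subseteq> Arr (T_cat S (\<Delta> Y))" using mo(4,7) by (auto simp: in_set_conv_nth)
    have Fx: "far (FC Y) x = pr (out S (opn x)) (tup (prm x) (F (opn x)) (map pr2 (args x)))" if "x \<in> set ws" for x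
      using subsetD[OF wsA that] T_arr_components(1)[OF subsetD[OF wsA that]]
        F_coh_simps(4)[of "prm x" "opn x" "args x" Y] by simp
    have a: "map (far (FC Y)) ws = map (\<lambda>x. pr (out S (opn x)) (tup (prm x) (F (opn x)) (map pr2 (args x)))) ws"
      using Fx by simp
    have l: "far (func_comp (FC Y) (mu (T_monad S) (\<Delta> Y))) w =
        pr (out S \<beta>) (tup (block_perm \<rho> (map prm ws))
          (sub T (F \<beta>) (map F (map (\<lambda>k. opn (ws ! k)) (perm_inv \<rho>)))) (map pr2 (concat (map args ws))))"
      using w2 mo(11) morD(6)[OF mo(1)] S.operadD(8)[OF mo(1)] by (simp add: w' del: map_map)
    have F1: "far (F1 (T_fun S) (FC Y)) w = tup \<rho> \<beta> (map (far (FC Y)) ws)" using w2 by (simp add: w')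
    have F2: "tup \<rho> \<beta> (map (far (FC Y)) ws) \<in> Arr (T_cat S (\<Delta> (T_cat T Y)))" using SFD(6)[OF w] F1 by simp
    then have F3: "far (func_comp (FC (T_cat T Y)) (F1 (T_fun S) (FC Y))) w =
        pr (out S \<beta>) (tup \<rho> (F \<beta>) (map pr2 (map (far (FC Y)) ws)))"
      using w F1 by (simp add: SFD)
    then have F4: "pr (out S \<beta>) (tup \<rho> (F \<beta>) (map pr2 (map (far (FC Y)) ws))) \<in> Arr (\<Delta> (T_cat T (T_cat T Y)))"
      using FFD(6)[OF w] by simp
    have "far (func_comp (\<Delta>1 (mu (T_monad T) Y)) (func_comp (FC (T_cat T Y)) (F1 (T_fun S) (FC Y)))) w =
        far (\<Delta>1 (mu (T_monad T) Y)) (pr (out S \<beta>) (tup \<rho> (F \<beta>) (map pr2 (map (far (FC Y)) ws))))"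
      using w F3 by (simp add: SFD)
    also have "\<dots> = pr (out S \<beta>) (tup (block_perm \<rho> (map prm (map pr2 (map (far (FC Y)) ws))))
        (sub T (F \<beta>) (map (\<lambda>k. opn (map pr2 (map (far (FC Y)) ws) ! k)) (perm_inv \<rho>)))
        (concat (map args (map pr2 (map (far (FC Y)) ws)))))"
      using F4 by (simp del: map_map)
    also have "\<dots> = far (func_comp (FC Y) (mu (T_monad S) (\<Delta> Y))) w"
    proof -
      have "map (\<lambda>k. opn (map pr2 (map (far (FC Y)) ws) ! k)) (perm_inv \<rho>) =
          map F (map (\<lambda>k. opn (ws ! k)) (perm_inv \<rho>))"
        unfolding a using mo(4) permsD(3)[OF perm_inv_perms[OF mo(6)]] by simp
      then show ?thesis unfolding l a by (simp add: map_concat comp_def cong: map_cong)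
    qed
    finally show "far (func_comp (FC Y) (mu (T_monad S) (\<Delta> Y))) w =
        far (func_comp (\<Delta>1 (mu (T_monad T) Y)) (func_comp (FC (T_cat T Y)) (F1 (T_fun S) (FC Y)))) w" ..
  qed
qed

section \<open>Induced algebras and induced strict morphisms\<close>

abbreviation "G \<equiv> G_bar (over (colours S)) (adj_F S T f F)"

lemma G_ob: "F0 G (X, x) = (\<Delta> X, func_comp (\<Delta>1 x) (FC X))"
  by (simp add: G_bar_def alg_lift_def adj_F_def Let_def)

text \<open>The unit and multiplication axioms of the coherence, \<open>F_coh_eta\<close> and
  \<open>F_coh_mu\<close>, together with its naturality turn the laws of \<open>x\<close> into those
  of the induced action.\<close>

lemma G_algs:
  assumes X: "(X, x) \<in> algs (over J) (T_monad T)"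
  shows "(\<Delta> X, func_comp (\<Delta>1 x) (FC X)) \<in> algs (over I) (T_monad S)"
proof -
  note XD = T.TM.algD[OF X, simplified]
  note FX = F_coh_hom[OF XD(1)] and FTX = F_coh_hom[OF XD(2)]
  note Dx = Delta_hom[OF XD(4), of I f] and De = Delta_hom[OF XD(6), of I f] and Dm = Delta_hom[OF XD(7), of I f]
    and DTx = Delta_hom[OF XD(5), of I f]
  note DX = Delta_over[OF XD(1), of I f]
  note e = S.eta_hom[OF DX] and m = S.mu_hom[OF DX]
  note SDx = S.T_fun_hom[OF Dx] and SF = S.T_fun_hom[OF FX]
  have 1: "func_comp (func_comp (\<Delta>1 x) (FC X)) (eta (T_monad S) (\<Delta> X)) = Idm (over I) (\<Delta> X)"
    using func_comp_assoc[OF e FX Dx] F_coh_eta[OF XD(1)] Delta_comp[OF XD(6,4), of I f] XD(8) Delta_Idm[OF XD(1), of I f]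
    by simp
  have "func_comp (func_comp (\<Delta>1 x) (FC X)) (mu (T_monad S) (\<Delta> X)) =
      func_comp (\<Delta>1 x) (func_comp (\<Delta>1 (mu (T_monad T) X)) (func_comp (FC (T_cat T X)) (F1 (T_fun S) (FC X))))"
    using func_comp_assoc[OF m FX Dx] F_coh_mu[OF XD(1)] by simp
  also have "\<dots> = func_comp (\<Delta>1 (func_comp x (mu (T_monad T) X))) (func_comp (FC (T_cat T X)) (F1 (T_fun S) (FC X)))"
    using func_comp_assoc[OF func_comp_hom[OF SF FTX] Dm Dx] Delta_comp[OF XD(7,4), of I f] by simp
  also have "\<dots> = func_comp (\<Delta>1 x) (func_comp (\<Delta>1 (F1 (T_fun T) x)) (func_comp (FC (T_cat T X)) (F1 (T_fun S) (FC X))))"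
    using func_comp_assoc[OF func_comp_hom[OF SF FTX] DTx Dx] Delta_comp[OF XD(5,4), of I f] XD(9) by simp
  also have "\<dots> = func_comp (\<Delta>1 x) (func_comp (func_comp (FC X) (F1 (T_fun S) (\<Delta>1 x))) (F1 (T_fun S) (FC X)))"
    using func_comp_assoc[OF SF FTX DTx] F_coh_natural[OF XD(4)] by simp
  also have "\<dots> = func_comp (func_comp (\<Delta>1 x) (FC X)) (F1 (T_fun S) (func_comp (\<Delta>1 x) (FC X)))"
    using func_comp_assoc[OF SF SDx FX] func_comp_assoc[OF func_comp_hom[OF SF SDx] FX Dx]
      S.TM.F1_comp[OF FX Dx] by simp
  finally show ?thesis unfolding algs_over using DX func_comp_hom[OF FX Dx] 1 by simp
qed

lemma G_strict:
  assumes m: "strict_mor J (A, a) (B, b) g \<in> hom (Alg_s (over J) (T_monad T)) (A, a) (B, b)"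
  shows "F1 G (strict_mor J (A, a) (B, b) g) = strict_mor I (F0 G (A, a)) (F0 G (B, b)) (\<Delta>1 g)"
    "func_comp (func_comp (\<Delta>1 b) (FC B)) (F1 (T_fun S) (\<Delta>1 g)) = func_comp (\<Delta>1 g) (func_comp (\<Delta>1 a) (FC A))"
proof -
  have A: "(A, a) \<in> algs (over J) (T_monad T)" and B: "(B, b) \<in> algs (over J) (T_monad T)"
    and g: "g \<in> hom (over J) A B" "func_comp b (F1 (T_fun T) g) = func_comp g a"
    using m unfolding T.TM.hom_Alg_s by (auto simp: strict_mor_def)
  note A' = T.TM.algD[OF A, simplified] and B' = T.TM.algD[OF B, simplified]
  show "F1 G (strict_mor J (A, a) (B, b) g) = strict_mor I (F0 G (A, a)) (F0 G (B, b)) (\<Delta>1 g)"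
    unfolding G_bar_def adj_F_def madj.select_convs
    by (rule alg_lift_strict[where l = FC, OF A'(4) g(1) F_coh_hom[OF A'(1)]])
  note Dg = Delta_hom[OF g(1), of I f] and Tg = T.T_fun_hom[OF g(1)]
  note FA = F_coh_hom[OF A'(1)] and FB = F_coh_hom[OF B'(1)]
  note Da = Delta_hom[OF A'(4), of I f] and Db = Delta_hom[OF B'(4), of I f] and DTg = Delta_hom[OF Tg, of I f]
  have "func_comp (func_comp (\<Delta>1 b) (FC B)) (F1 (T_fun S) (\<Delta>1 g)) = func_comp (\<Delta>1 b) (func_comp (\<Delta>1 (F1 (T_fun T) g)) (FC A))"
    using func_comp_assoc[OF S.T_fun_hom[OF Dg] FB Db] F_coh_natural[OF g(1)] by simp
  also have "\<dots> = func_comp (\<Delta>1 (func_comp g a)) (FC A)"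
    using func_comp_assoc[OF FA DTg Db] Delta_comp[OF Tg B'(4), of I f] g(2) by simp
  also have "\<dots> = func_comp (\<Delta>1 g) (func_comp (\<Delta>1 a) (FC A))"
    using func_comp_assoc[OF FA Da Dg] Delta_comp[OF A'(4) g(1), of I f] by simp
  finally show "func_comp (func_comp (\<Delta>1 b) (FC B)) (F1 (T_fun S) (\<Delta>1 g)) = func_comp (\<Delta>1 g) (func_comp (\<Delta>1 a) (FC A))" .
qed

text \<open>This turns the map in the universal property of a classifier into
  \<open>postcomp\<close>, that is, into composition of functors and whiskering.\<close>

lemma G_strict_comp:
  assumes m: "strict_mor J (A, a) (B, b) g \<in> hom (Alg_s (over J) (T_monad T)) (A, a) (B, b)"
    and p: "p \<in> hom (Alg_l (over I) (T_monad S)) E (F0 G (A, a))"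
  shows "Cmp (Alg_l (over I) (T_monad S)) (F1 G (strict_mor J (A, a) (B, b) g)) p = postcomp (F0 G (B, b)) (\<Delta>1 g) p"
proof -
  have B: "(B, b) \<in> algs (over J) (T_monad T)" and g: "g \<in> hom (over J) A B"
    using m unfolding T.TM.hom_Alg_s by (auto simp: strict_mor_def)
  show ?thesis
    using S.TM.strict_mor_comp[of p, OF _ _ Delta_hom[OF g] G_algs[OF B]] p G_strict[OF m]
    by (simp add: hom_Alg_l G_ob)
qed

end

section \<open>Universal arrows\<close>

text \<open>A \<open>twocat\<close> is data only; these are the laws of 1-cells on which
  transposition along an adjunction relies.\<close>

definition category_laws :: "('o, 'm, 'c) twocat \<Rightarrow> bool" where
  "category_laws K \<longleftrightarrow>
     (\<forall>A B f. f \<in> hom K A B \<longrightarrow> A \<in> Ob K \<and> B \<in> Ob K \<and> Cmp K f (Idm K A) = f \<and> Cmp K (Idm K B) f = f) \<and>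
     (\<forall>A B C f g. f \<in> hom K A B \<longrightarrow> g \<in> hom K B C \<longrightarrow> Cmp K g f \<in> hom K A C) \<and>
     (\<forall>A B C D f g h. f \<in> hom K A B \<longrightarrow> g \<in> hom K B C \<longrightarrow> h \<in> hom K C D \<longrightarrow>
        Cmp K h (Cmp K g f) = Cmp K (Cmp K h g) f)"

lemma category_lawsD:
  assumes "category_laws K"
  shows "f \<in> hom K A B \<Longrightarrow> A \<in> Ob K" "f \<in> hom K A B \<Longrightarrow> B \<in> Ob K"
    "f \<in> hom K A B \<Longrightarrow> Cmp K f (Idm K A) = f" "f \<in> hom K A B \<Longrightarrow> Cmp K (Idm K B) f = f"
    "f \<in> hom K A B \<Longrightarrow> g \<in> hom K B C \<Longrightarrow> Cmp K g f \<in> hom K A C"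
    "f \<in> hom K A B \<Longrightarrow> g \<in> hom K B C \<Longrightarrow> h \<in> hom K C D \<Longrightarrow> Cmp K h (Cmp K g f) = Cmp K (Cmp K h g) f"
  using assms unfolding category_laws_def by blast+

lemma two_functorD:
  assumes "two_functor K L H"
  shows "A \<in> Ob K \<Longrightarrow> F0 H A \<in> Ob L" "g \<in> hom K A B \<Longrightarrow> F1 H g \<in> hom L (F0 H A) (F0 H B)"
    "A \<in> Ob K \<Longrightarrow> F1 H (Idm K A) = Idm L (F0 H A)"
    "g \<in> hom K A B \<Longrightarrow> h \<in> hom K B C \<Longrightarrow> F1 H (Cmp K h g) = Cmp L (F1 H h) (F1 H g)"
  using assms unfolding two_functor_def hom_def by auto

text \<open>The usual transposition: its inverse sends \<open>w\<close> to the counit after the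
  image of \<open>w\<close>, and the triangle identities give the two round trips.\<close>

lemma two_adjunction_bij:
  assumes adj: "two_adjunction K L H U \<eta> \<epsilon>" and K: "category_laws K" and L: "category_laws L"
    and A: "A \<in> Ob K"
  shows "\<eta> A \<in> hom K A (F0 U (F0 H A))" "F0 H A \<in> Ob L"
    "B \<in> Ob L \<Longrightarrow> bij_betw (\<lambda>n. Cmp K (F1 U n) (\<eta> A)) (hom L (F0 H A) B) (hom K A (F0 U B))"
proof -
  note KD = category_lawsD[OF K] and LD = category_lawsD[OF L]
  have H: "two_functor K L H" and U: "two_functor L K U"
    and n: "two_natural K K id_fun (comp_fun U H) \<eta>" and e: "two_natural L L (comp_fun H U) id_fun \<epsilon>"
    and t1: "\<And>A. A \<in> Ob K \<Longrightarrow> Cmp L (\<epsilon> (F0 H A)) (F1 H (\<eta> A)) = Idm L (F0 H A)"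
    and t2: "\<And>B. B \<in> Ob L \<Longrightarrow> Cmp K (F1 U (\<epsilon> B)) (\<eta> (F0 U B)) = Idm K (F0 U B)"
    using adj unfolding two_adjunction_def by auto
  note HD = two_functorD[OF H] and UD = two_functorD[OF U]
  have nh: "\<eta> A \<in> hom K A (F0 U (F0 H A))" if "A \<in> Ob K" for A
    using n that unfolding two_natural_def id_fun_def comp_fun_def by simp
  have nn: "Cmp K (\<eta> A') g = Cmp K (F1 U (F1 H g)) (\<eta> A)" if "g \<in> hom K A A'" for g A A'
    using n that unfolding two_natural_def id_fun_def comp_fun_def by (auto simp: hom_def)
  have eh: "\<epsilon> B \<in> hom L (F0 H (F0 U B)) B" if "B \<in> Ob L" for B
    using e that unfolding two_natural_def id_fun_def comp_fun_def by simp
  have en: "Cmp L (\<epsilon> B') (F1 H (F1 U g)) = Cmp L g (\<epsilon> B)" if "g \<in> hom L B B'" for g B B'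
    using e that unfolding two_natural_def id_fun_def comp_fun_def by (auto simp: hom_def)
  show "F0 H A \<in> Ob L" "\<eta> A \<in> hom K A (F0 U (F0 H A))" using HD(1) nh A by auto
  assume B: "B \<in> Ob L"
  show "bij_betw (\<lambda>n. Cmp K (F1 U n) (\<eta> A)) (hom L (F0 H A) B) (hom K A (F0 U B))"
  proof (rule bij_betw_byWitness[where f' = "\<lambda>w. Cmp L (\<epsilon> B) (F1 H w)"])
    show "\<forall>n\<in>hom L (F0 H A) B. Cmp L (\<epsilon> B) (F1 H (Cmp K (F1 U n) (\<eta> A))) = n"
    proof
      fix n assume n: "n \<in> hom L (F0 H A) B"
      have "Cmp L (\<epsilon> B) (F1 H (Cmp K (F1 U n) (\<eta> A))) = Cmp L (\<epsilon> B) (Cmp L (F1 H (F1 U n)) (F1 H (\<eta> A)))"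
        using HD(4)[OF nh[OF A] UD(2)[OF n]] by simp
      also have "\<dots> = Cmp L (Cmp L (\<epsilon> B) (F1 H (F1 U n))) (F1 H (\<eta> A))"
        by (rule LD(6)[OF HD(2)[OF nh[OF A]] HD(2)[OF UD(2)[OF n]] eh[OF B]])
      also have "\<dots> = Cmp L (Cmp L n (\<epsilon> (F0 H A))) (F1 H (\<eta> A))" using en[OF n] by simp
      also have "\<dots> = Cmp L n (Cmp L (\<epsilon> (F0 H A)) (F1 H (\<eta> A)))"
        by (rule LD(6)[OF HD(2)[OF nh[OF A]] eh[OF HD(1)[OF A]] n, symmetric])
      also have "\<dots> = n" using t1[OF A] LD(3)[OF n] by simp
      finally show "Cmp L (\<epsilon> B) (F1 H (Cmp K (F1 U n) (\<eta> A))) = n" .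
    qed
    show "\<forall>w\<in>hom K A (F0 U B). Cmp K (F1 U (Cmp L (\<epsilon> B) (F1 H w))) (\<eta> A) = w"
    proof
      fix w assume w: "w \<in> hom K A (F0 U B)"
      note Hw = HD(2)[OF w]
      have "Cmp K (F1 U (Cmp L (\<epsilon> B) (F1 H w))) (\<eta> A) = Cmp K (Cmp K (F1 U (\<epsilon> B)) (F1 U (F1 H w))) (\<eta> A)"
        using UD(4)[OF Hw eh[OF B]] by simp
      also have "\<dots> = Cmp K (F1 U (\<epsilon> B)) (Cmp K (F1 U (F1 H w)) (\<eta> A))"
        by (rule KD(6)[OF nh[OF A] UD(2)[OF Hw] UD(2)[OF eh[OF B]], symmetric])
      also have "\<dots> = Cmp K (F1 U (\<epsilon> B)) (Cmp K (\<eta> (F0 U B)) w)" using nn[OF w] by simp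
      also have "\<dots> = Cmp K (Cmp K (F1 U (\<epsilon> B)) (\<eta> (F0 U B))) w"
        by (rule KD(6)[OF w nh[OF UD(1)[OF B]] UD(2)[OF eh[OF B]]])
      also have "\<dots> = w" using t2[OF B] KD(4)[OF w] by simp
      finally show "Cmp K (F1 U (Cmp L (\<epsilon> B) (F1 H w))) (\<eta> A) = w" .
    qed
    show "(\<lambda>n. Cmp K (F1 U n) (\<eta> A)) ` hom L (F0 H A) B \<subseteq> hom K A (F0 U B)"
      using KD(5)[OF nh[OF A]] UD(2) by blast
    show "(\<lambda>w. Cmp L (\<epsilon> B) (F1 H w)) ` hom K A (F0 U B) \<subseteq> hom L (F0 H A) B"
      using LD(5)[OF _ eh[OF B]] HD(2) by blast
  qed
qed

text \<open>Strict morphisms are determined by their functors. Passing to these makes the strict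
  morphisms between commutative algebras, over the operad and over the quotient 2-monad, literally
  the same set (\<open>q_bar_sfun\<close>).\<close>

definition sfun :: "'u set \<Rightarrow> 'u over_monad \<Rightarrow> 'u cat \<times> 'u func \<Rightarrow> 'u cat \<times> 'u func \<Rightarrow> 'u func set" where
  "sfun J M X Y = {g \<in> hom (over J) (fst X) (fst Y). func_comp (snd Y) (F1 (fnc M) g) = func_comp g (snd X)}"

lemma sfun_iff: "g \<in> sfun J M (A, a) (B, b) \<longleftrightarrow>
    g \<in> hom (over J) A B \<and> func_comp b (F1 (fnc M) g) = func_comp g a"
  by (simp add: sfun_def)

context cat_monad
begin

lemma sfun_bij:
  assumes "X \<in> algs K M" "Y \<in> algs K M"
  shows "bij_betw (strict_mor J X Y) (sfun J M X Y) (hom (Alg_s K M) X Y)"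
proof -
  obtain A a B b where XY: "X = (A, a)" "Y = (B, b)" by (cases X, cases Y)
  have "inj_on (strict_mor J X Y) (sfun J M X Y)" by (auto simp: inj_on_def strict_mor_def)
  moreover have "hom (Alg_s K M) X Y = strict_mor J X Y ` sfun J M X Y"
    unfolding XY set_eq_iff hom_Alg_s image_iff using assms[unfolded XY] by (auto simp: sfun_iff)
  ultimately show ?thesis by (simp add: bij_betw_def)
qed

lemma strict_mor_sfun:
  assumes "X \<in> algs K M" "Y \<in> algs K M" "g \<in> sfun J M X Y"
  shows "strict_mor J X Y g \<in> hom (Alg_s K M) X Y"
  using sfun_bij[OF assms(1,2)] assms(3) by (auto simp: bij_betw_def)

lemma sfun_comp:
  assumes "X \<in> algs K M" "Y \<in> algs K M" "Z \<in> algs K M" "g \<in> sfun J M X Y" "h \<in> sfun J M Y Z"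
  shows "func_comp h g \<in> sfun J M X Z"
    "alg_comp K M (strict_mor J Y Z h) (strict_mor J X Y g) = strict_mor J X Z (func_comp h g)"
proof -
  obtain A a B b C c where XYZ: "X = (A, a)" "Y = (B, b)" "Z = (C, c)" by (cases X, cases Y, cases Z)
  note s = strict_mor_strict_mor[OF strict_mor_sfun[OF assms(1,2,4), unfolded XYZ] strict_mor_sfun[OF assms(2,3,5), unfolded XYZ]]
  show "alg_comp K M (strict_mor J Y Z h) (strict_mor J X Y g) = strict_mor J X Z (func_comp h g)"
    using s(1) by (simp add: XYZ)
  show "func_comp h g \<in> sfun J M X Z"
    using s(2) unfolding hom_Alg_s XYZ sfun_iff by (auto simp: strict_mor_def)
qed

lemma sfun_Idm:
  assumes "X \<in> algs K M"
  shows "Idm K (fst X) \<in> sfun J M X X" "alg_id K X = strict_mor J X X (Idm K (fst X))"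
proof -
  obtain A a where X: "X = (A, a)" by (cases X)
  note s = alg_id_strict[OF assms[unfolded X]]
  show "alg_id K X = strict_mor J X X (Idm K (fst X))" using s(1) by (simp add: X)
  show "Idm K (fst X) \<in> sfun J M X X"
    using s unfolding hom_Alg_s X sfun_iff by (auto simp: strict_mor_def)
qed

lemma hom_Alg_sE:
  assumes "m \<in> hom (Alg_s K M) X Y"
  obtains g where "X \<in> algs K M" "Y \<in> algs K M" "g \<in> sfun J M X Y" "m = strict_mor J X Y g"
proof -
  obtain A a B b where XY: "X = (A, a)" "Y = (B, b)" by (cases X, cases Y)
  show ?thesis using assms that unfolding XY hom_Alg_s sfun_iff[symmetric] by (auto simp: sfun_iff)
qed

lemma sfunD: "g \<in> sfun J M X Y \<Longrightarrow> g \<in> hom K (fst X) (fst Y)"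
  by (simp add: sfun_def)

lemma Alg_s_laws: "category_laws (Alg_s K M)"
  unfolding category_laws_def
proof (intro conjI allI impI)
  fix A B f assume "f \<in> hom (Alg_s K M) A B"
  then obtain g where g: "A \<in> algs K M" "B \<in> algs K M" "g \<in> sfun J M A B" "f = strict_mor J A B g"
    by (rule hom_Alg_sE)
  show "A \<in> Ob (Alg_s K M)" "B \<in> Ob (Alg_s K M)" using g by simp_all
  show "Cmp (Alg_s K M) f (Idm (Alg_s K M) A) = f" "Cmp (Alg_s K M) (Idm (Alg_s K M) B) f = f"
    using sfun_comp(2)[OF g(1,1,2) sfun_Idm(1)[OF g(1)] g(3)] sfun_comp(2)[OF g(1,2,2) g(3) sfun_Idm(1)[OF g(2)]]
      sfun_Idm(2)[OF g(1)] sfun_Idm(2)[OF g(2)] func_comp_Idm[OF sfunD[OF g(3)]]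
    by (simp_all add: g(4))
next
  fix A B C f g assume "f \<in> hom (Alg_s K M) A B" "g \<in> hom (Alg_s K M) B C"
  then obtain f' g' where g: "A \<in> algs K M" "B \<in> algs K M" "C \<in> algs K M" "f' \<in> sfun J M A B" "f = strict_mor J A B f'"
    "g' \<in> sfun J M B C" "g = strict_mor J B C g'"
    by (metis hom_Alg_sE)
  show "Cmp (Alg_s K M) g f \<in> hom (Alg_s K M) A C"
    using sfun_comp[OF g(1-4,6)] strict_mor_sfun[OF g(1,3)] by (simp add: g(5,7))
next
  fix A B C D f g h
  assume "f \<in> hom (Alg_s K M) A B" "g \<in> hom (Alg_s K M) B C" "h \<in> hom (Alg_s K M) C D"
  then obtain f' g' h' where g: "A \<in> algs K M" "B \<in> algs K M" "C \<in> algs K M" "D \<in> algs K M"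
    "f' \<in> sfun J M A B" "f = strict_mor J A B f'"
    "g' \<in> sfun J M B C" "g = strict_mor J B C g'" "h' \<in> sfun J M C D" "h = strict_mor J C D h'"
    by (metis hom_Alg_sE)
  note c = sfun_comp[OF g(1-3,5,7)] sfun_comp[OF g(2-4,7,9)]
  show "Cmp (Alg_s K M) h (Cmp (Alg_s K M) g f) = Cmp (Alg_s K M) (Cmp (Alg_s K M) h g) f"
    using c sfun_comp(2)[OF g(1,3,4) c(1) g(9)] sfun_comp(2)[OF g(1,2,4) g(5) c(3)]
      func_comp_assoc[OF sfunD[OF g(5)] sfunD[OF g(7)] sfunD[OF g(9)]]
    by (simp add: g(6,8,10))
qed

end

context sigma_quotient
begin

lemma q_bar_algs:
  assumes "X \<in> algs (over J) Q"
  shows "F0 (q_bar (over J) q) X \<in> algs (over J) (T_monad T)" "fst (F0 (q_bar (over J) q) X) = fst X"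
proof -
  obtain A a where X: "X = (A, a)" by (cases X)
  show "F0 (q_bar (over J) q) X \<in> algs (over J) (T_monad T)"
    using q_algs_iff[OF QM.algD(4)[OF assms[unfolded X]]] assms by (simp add: X q_bar_simps)
  show "fst (F0 (q_bar (over J) q) X) = fst X" by (simp add: X q_bar_simps)
qed

lemma q_bar_sfun:
  assumes "X \<in> algs (over J) Q" "Y \<in> algs (over J) Q"
  shows "sfun J (T_monad T) (F0 (q_bar (over J) q) X) (F0 (q_bar (over J) q) Y) = sfun J Q X Y"
    "g \<in> sfun J Q X Y \<Longrightarrow> F1 (q_bar (over J) q) (strict_mor J X Y g) =
      strict_mor J (F0 (q_bar (over J) q) X) (F0 (q_bar (over J) q) Y) g"
proof -
  obtain A a B b where XY: "X = (A, a)" "Y = (B, b)" by (cases X, cases Y)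
  show "sfun J (T_monad T) (F0 (q_bar (over J) q) X) (F0 (q_bar (over J) q) Y) = sfun J Q X Y"
    unfolding XY set_eq_iff q_bar_simps sfun_iff using q_strict_iff[OF assms[unfolded XY]] by auto
  show "g \<in> sfun J Q X Y \<Longrightarrow> F1 (q_bar (over J) q) (strict_mor J X Y g) =
      strict_mor J (F0 (q_bar (over J) q) X) (F0 (q_bar (over J) q) Y) g"
    using q_bar_strict[OF assms(1)[unfolded XY(1)]] by (simp add: XY q_bar_simps sfun_iff)
qed

end

section \<open>Comparison of the classifiers\<close>

locale sigma_map = operad_map S T f F + S: sigma_quotient S SQ qS + T: sigma_quotient T TQ qT
  for S T :: "'u::small operad" and f F :: "'u \<Rightarrow> 'u" and SQ TQ :: "'u over_monad"
    and qS qT :: "'u cat \<Rightarrow> 'u func" +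
  fixes FQ :: "'u cat \<Rightarrow> 'u func"
  assumes FQ: "quotient_coherence S T f F SQ qS TQ qT FQ"
begin

abbreviation "qbS \<equiv> q_bar (over (colours S)) qS"
abbreviation "qbT \<equiv> q_bar (over (colours T)) qT"
abbreviation "GQ \<equiv> G_bar (over (colours S)) (adj_FQ S f FQ)"
abbreviation "GqF \<equiv> G_bar (over (colours S)) (adj_qF S T f F qT)"

lemma FQ_facts:
  assumes "cat_over J Y"
  shows "FQ Y \<in> hom (over I) (S.QM.MO (\<Delta> Y)) (\<Delta> (T.QM.MO Y))"
    "func_comp (FQ Y) (qS (\<Delta> Y)) = func_comp (\<Delta>1 (qT Y)) (FC Y)"
  using FQ assms unfolding quotient_coherence_def Let_def two_natural_def comp_fun_def by simp_all

text \<open>The defining equation of \<open>FQ\<close> makes the three induced actions on a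
  commutative algebra agree once they are restricted to \<open>T_monad S\<close>. That the action
  over \<open>SQ\<close> is an algebra then follows from \<open>q_algs_iff\<close>.\<close>

lemma GQ_ob:
  assumes X: "X \<in> algs (over J) TQ"
  shows "F0 GQ X \<in> algs (over I) SQ" "F0 qbS (F0 GQ X) = F0 G (F0 qbT X)" "F0 GqF X = F0 G (F0 qbT X)"
    "F0 G (F0 qbT X) \<in> algs (over I) (T_monad S)"
proof -
  obtain A a where XA: "X = (A, a)" by (cases X)
  note A' = T.QM.algD[OF X[unfolded XA]]
  note qA = T.q_hom[OF A'(1)] and FA = F_coh_hom[OF A'(1)] and FQA = FQ_facts[OF A'(1)]
  note Dq = Delta_hom[OF qA, of I f] and Da = Delta_hom[OF A'(4), of I f] and DA = Delta_over[OF A'(1), of I f]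
  have 1: "F0 G (F0 qbT X) = (\<Delta> A, func_comp (func_comp (\<Delta>1 a) (\<Delta>1 (qT A))) (FC A))"
    using Delta_comp[OF qA A'(4), of I f] by (simp add: XA T.q_bar_simps G_ob)
  have 2: "F0 GQ X = (\<Delta> A, func_comp (\<Delta>1 a) (FQ A))"
    by (simp add: XA G_bar_def alg_lift_def adj_FQ_def Let_def)
  show 3: "F0 qbS (F0 GQ X) = F0 G (F0 qbT X)"
    unfolding 1 2 S.q_bar_simps using func_comp_assoc[OF S.q_hom[OF DA] FQA(1) Da] FQA(2) func_comp_assoc[OF FA Dq Da] by simp
  show "F0 GqF X = F0 G (F0 qbT X)"
    unfolding 1 using func_comp_assoc[OF FA Dq Da] by (simp add: XA G_bar_def alg_lift_def adj_qF_def Let_def)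
  show "F0 G (F0 qbT X) \<in> algs (over I) (T_monad S)"
    using G_algs T.q_bar_algs(1)[OF X] by (cases "F0 qbT X") (auto simp: G_ob)
  then have "(\<Delta> A, func_comp (func_comp (\<Delta>1 a) (FQ A)) (qS (\<Delta> A))) \<in> algs (over I) (T_monad S)"
    using 3 by (simp add: 2 S.q_bar_simps)
  then show "F0 GQ X \<in> algs (over I) SQ"
    unfolding 2 S.q_algs_iff[OF func_comp_hom[OF FQA(1) Da]] .
qed

lemma G_postcomp:
  assumes X: "X \<in> algs (over J) (T_monad T)" "Y \<in> algs (over J) (T_monad T)" and g: "g \<in> sfun J (T_monad T) X Y"
  shows "p \<in> hom (Alg_l (over I) (T_monad S)) E (F0 G X) \<Longrightarrow>
    Cmp (Alg_l (over I) (T_monad S)) (F1 G (strict_mor J X Y g)) p = postcomp (F0 G Y) (\<Delta>1 g) p"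
    "\<Delta>1 g \<in> hom (over I) (fst (F0 G X)) (fst (F0 G Y))"
    "\<Delta>1 g \<in> sfun I (T_monad S) (F0 G X) (F0 G Y)"
proof -
  obtain A a B b where XY: "X = (A, a)" "Y = (B, b)" by (cases X, cases Y)
  note s = T.TM.strict_mor_sfun[OF X g, unfolded XY]
  show "p \<in> hom (Alg_l (over I) (T_monad S)) E (F0 G X) \<Longrightarrow>
    Cmp (Alg_l (over I) (T_monad S)) (F1 G (strict_mor J X Y g)) p = postcomp (F0 G Y) (\<Delta>1 g) p"
    using G_strict_comp[OF s] by (simp add: XY)
  show h: "\<Delta>1 g \<in> hom (over I) (fst (F0 G X)) (fst (F0 G Y))"
    using Delta_hom[OF T.TM.sfunD[OF g], of I f] by (simp add: XY G_ob)
  show "\<Delta>1 g \<in> sfun I (T_monad S) (F0 G X) (F0 G Y)"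
    using h G_strict(2)[OF s] by (simp add: XY G_ob sfun_iff)
qed

lemma GqF_Cmp:
  assumes X: "X \<in> algs (over J) TQ" "Y \<in> algs (over J) TQ" and g: "g \<in> sfun J TQ X Y"
    and p: "p \<in> hom (Alg_l (over I) (T_monad S)) E (F0 G (F0 qbT X))"
  shows "Cmp (Alg_l (over I) (T_monad S)) (F1 GqF (strict_mor J X Y g)) p = postcomp (F0 G (F0 qbT Y)) (\<Delta>1 g) p"
proof -
  obtain A a B b where XY: "X = (A, a)" "Y = (B, b)" by (cases X, cases Y)
  note A' = T.QM.algD[OF X(1)[unfolded XY]]
  have g': "g \<in> sfun J (T_monad T) (F0 qbT X) (F0 qbT Y)" using T.q_bar_sfun(1)[OF X] g by simp
  note tX = T.q_bar_algs(1)[OF X(1)] and tY = T.q_bar_algs(1)[OF X(2)]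
  have "F1 GqF (strict_mor J X Y g) = strict_mor I (F0 GqF X) (F0 GqF Y) (\<Delta>1 g)"
    unfolding XY G_bar_def adj_qF_def madj.select_convs
    by (rule alg_lift_strict[OF A'(4)])
      (use g func_comp_hom[OF F_coh_hom[OF A'(1)] Delta_hom[OF T.q_hom[OF A'(1)], of I f]] in \<open>simp_all add: XY sfun_iff\<close>)
  also have "\<dots> = F1 G (strict_mor J (F0 qbT X) (F0 qbT Y) g)"
    using G_strict(1)[of "fst (F0 qbT X)" "snd (F0 qbT X)" "fst (F0 qbT Y)" "snd (F0 qbT Y)" g]
      T.TM.strict_mor_sfun[OF tX tY g'] GQ_ob(3)[OF X(1)] GQ_ob(3)[OF X(2)] by simp
  finally show ?thesis using G_postcomp(1)[OF tX tY g' p] by simp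
qed

lemma GQ_Cmp:
  assumes X: "X \<in> algs (over J) TQ" "Y \<in> algs (over J) TQ" and g: "g \<in> sfun J TQ X Y"
    and p: "p \<in> hom (Alg_l (over I) SQ) E (F0 GQ X)"
  shows "Cmp (Alg_l (over I) SQ) (F1 GQ (strict_mor J X Y g)) p = postcomp (F0 GQ Y) (\<Delta>1 g) p"
    "F1 qbS (postcomp (F0 GQ Y) (\<Delta>1 g) p) = postcomp (F0 G (F0 qbT Y)) (\<Delta>1 g) (F1 qbS p)"
proof -
  obtain A a B b where XY: "X = (A, a)" "Y = (B, b)" by (cases X, cases Y)
  obtain E1 E2 where E: "E = (E1, E2)" by (cases E)
  note A' = T.QM.algD[OF X(1)[unfolded XY]]
  have g': "g \<in> sfun J (T_monad T) (F0 qbT X) (F0 qbT Y)" using T.q_bar_sfun(1)[OF X] g by simp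
  note tX = T.q_bar_algs(1)[OF X(1)] and tY = T.q_bar_algs(1)[OF X(2)]
  have "\<Delta>1 g \<in> sfun I (T_monad S) (F0 qbS (F0 GQ X)) (F0 qbS (F0 GQ Y))"
    using G_postcomp(3)[OF tX tY g'] GQ_ob(2)[OF X(1)] GQ_ob(2)[OF X(2)] by simp
  then have s: "\<Delta>1 g \<in> sfun I SQ (F0 GQ X) (F0 GQ Y)"
    using S.q_bar_sfun(1)[OF GQ_ob(1)[OF X(1)] GQ_ob(1)[OF X(2)]] by simp
  have G: "F0 GQ X = (\<Delta> A, func_comp (\<Delta>1 a) (FQ A))" "F0 GQ Y = (\<Delta> B, func_comp (\<Delta>1 b) (FQ B))"
    by (simp_all add: XY G_bar_def alg_lift_def adj_FQ_def Let_def)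
  have "F1 GQ (strict_mor J X Y g) = strict_mor I (F0 GQ X) (F0 GQ Y) (\<Delta>1 g)"
    unfolding XY G_bar_def adj_FQ_def madj.select_convs
    by (rule alg_lift_strict[where l = FQ, OF A'(4) _ FQ_facts(1)[OF A'(1)]])
      (use g in \<open>simp add: XY sfun_iff\<close>)
  then show "Cmp (Alg_l (over I) SQ) (F1 GQ (strict_mor J X Y g)) p = postcomp (F0 GQ Y) (\<Delta>1 g) p"
    using S.QM.strict_mor_comp[of p, OF _ _ _ GQ_ob(1)[OF X(2), unfolded G]] p s G
    by (simp add: hom_Alg_l sfun_iff)
  show "F1 qbS (postcomp (F0 GQ Y) (\<Delta>1 g) p) = postcomp (F0 G (F0 qbT Y)) (\<Delta>1 g) (F1 qbS p)"
    using S.q_bar_lax(4)[OF p[unfolded E G]] s GQ_ob(2)[OF X(2)] unfolding G S.q_bar_simps sfun_iff by simp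
qed

text \<open>The common universal property: \<open>P\<close> represents the functor that sends a
  commutative \<open>T\<close>-algebra to the set of lax \<open>S\<close>-morphisms from
  \<open>E\<close> to its induced algebra. Each of the three algebras to be compared is shown to
  have it.\<close>

definition represents :: "'u cat \<times> 'u func \<Rightarrow> 'u cat \<times> 'u func \<Rightarrow> ('u cat, 'u func, 'u ntrans) lmor \<Rightarrow> bool" where
  "represents E P p \<longleftrightarrow> P \<in> algs (over J) TQ \<and> p \<in> hom (Alg_l (over I) (T_monad S)) E (F0 G (F0 qbT P)) \<and>
    (\<forall>X\<in>algs (over J) TQ. bij_betw (\<lambda>u. postcomp (F0 G (F0 qbT X)) (\<Delta>1 u) p) (sfun J TQ P X)
       (hom (Alg_l (over I) (T_monad S)) E (F0 G (F0 qbT X))))"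

lemma postcomp_Idm:
  assumes p: "p \<in> hom (Alg_l (over I) (T_monad S)) E (B, b)"
  shows "postcomp (B, b) (Idm (over I) B) p = p"
proof -
  obtain E1 E2 where E: "E = (E1, E2)" by (cases E)
  have p': "p \<in> lax_mors (over I) (T_monad S)" "msrc p = (E1, E2)" "mtgt p = (B, b)"
    using p by (simp_all add: hom_Alg_l E)
  note d = S.TM.lax_morsD[OF p', simplified]
  note c = cells_overD[OF d(4,5)]
  have "whisker_left (Idm (over I) B) (coh p) = coh p"
  proof (rule cells_over_eqI[OF _ d(4,5)])
    note I = Idm_hom[OF hom_overD(2)[OF d(3)]]
    show "whisker_left (Idm (over I) B) (coh p) \<in>
        cells (over I) (func_comp b (F1 (T_fun S) (und p))) (func_comp (und p) E2)"
      using whisker_left_cells[OF d(4,5) I] func_comp_Idm[OF d(5)] func_comp_Idm[OF c(1)] by simp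
    fix x assume "x \<in> Obj (T_cat S E1)"
    then show "ncmp (whisker_left (Idm (over I) B) (coh p)) x = ncmp (coh p) x"
      using c(2,4) hom_overD[OF S.T_fun_hom[OF d(3)]] by simp
  qed
  then show ?thesis using func_comp_Idm[OF d(3)] p' by (simp add: postcomp_def)
qed

text \<open>The uniqueness of representing objects: each round trip gives back the universal
  morphism, as the identity does, and so equals the identity.\<close>

lemma represents_unique:
  assumes P: "represents E P p" and P': "represents E P' p'"
  obtains u v where "u \<in> sfun J TQ P P'" "v \<in> sfun J TQ P' P"
    "func_comp v u = Idm (over J) (fst P)" "func_comp u v = Idm (over J) (fst P')"
    "postcomp (F0 G (F0 qbT P')) (\<Delta>1 u) p = p'"
proof -
  \<comment> \<open>One half, stated so that it applies in both directions: a comparison back to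
    \<open>R\<close> exists, and it is left inverse to every comparison from \<open>R\<close> that
    respects the universal morphisms.\<close>
  have half: "\<exists>v\<in>sfun J TQ R' R. postcomp (F0 G (F0 qbT R)) (\<Delta>1 v) r' = r \<and>
      (\<forall>u\<in>sfun J TQ R R'. postcomp (F0 G (F0 qbT R')) (\<Delta>1 u) r = r' \<longrightarrow> func_comp v u = Idm (over J) (fst R))"
    if R: "represents E R r" and R': "represents E R' r'" for R r R' r'
  proof -
    have a: "R \<in> algs (over J) TQ" "R' \<in> algs (over J) TQ"
      "r \<in> hom (Alg_l (over I) (T_monad S)) E (F0 G (F0 qbT R))"
      and b: "bij_betw (\<lambda>u. postcomp (F0 G (F0 qbT R)) (\<Delta>1 u) r') (sfun J TQ R' R)
        (hom (Alg_l (over I) (T_monad S)) E (F0 G (F0 qbT R)))"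
      and b': "bij_betw (\<lambda>u. postcomp (F0 G (F0 qbT R)) (\<Delta>1 u) r) (sfun J TQ R R)
        (hom (Alg_l (over I) (T_monad S)) E (F0 G (F0 qbT R)))"
      using R R' by (auto simp: represents_def)
    obtain v where v: "v \<in> sfun J TQ R' R" "postcomp (F0 G (F0 qbT R)) (\<Delta>1 v) r' = r"
      using a(3) bij_betw_imp_surj_on[OF b, symmetric] by auto
    have "func_comp v u = Idm (over J) (fst R)" if u: "u \<in> sfun J TQ R R'" and eq: "postcomp (F0 G (F0 qbT R')) (\<Delta>1 u) r = r'" for u
    proof -
      obtain X x where X: "F0 G (F0 qbT R) = (X, x)" by (cases "F0 G (F0 qbT R)")
      have Xf: "X = \<Delta> (fst R)" using X T.q_bar_algs(2)[OF a(1)] by (cases "F0 qbT R") (simp add: G_ob)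
      note uh = T.QM.sfunD[OF u] and vh = T.QM.sfunD[OF v(1)]
      have Du: "\<Delta>1 u \<in> hom (over I) X (\<Delta> (fst R'))" using Delta_hom[OF uh, of I f] Xf by simp
      note Dv = Delta_hom[OF vh, of I f]
      have "postcomp (X, x) (\<Delta>1 (func_comp v u)) r = postcomp (X, x) (\<Delta>1 v) (postcomp (F0 G (F0 qbT R')) (\<Delta>1 u) r)"
        using S.TM.postcomp_postcomp[of r X x, OF _ _ Du Dv] a(3) Delta_comp[OF uh vh, of I f] X by (simp add: hom_Alg_l)
      also have "\<dots> = r" using eq v(2) X by simp
      also have "\<dots> = postcomp (X, x) (\<Delta>1 (Idm (over J) (fst R))) r"
        using postcomp_Idm[OF a(3)[unfolded X]] Delta_Idm[OF hom_overD(1)[OF uh], of I f] Xf by simp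
      finally show ?thesis
        using inj_onD[OF bij_betw_imp_inj_on[OF b'], unfolded X, of "func_comp v u" "Idm (over J) (fst R)"]
          T.QM.sfun_comp(1)[OF a(1,2,1) u v(1)] T.QM.sfun_Idm(1)[OF a(1)] by simp
    qed
    then show ?thesis using v by blast
  qed
  obtain v where v: "v \<in> sfun J TQ P' P" "postcomp (F0 G (F0 qbT P)) (\<Delta>1 v) p' = p"
    "\<forall>u\<in>sfun J TQ P P'. postcomp (F0 G (F0 qbT P')) (\<Delta>1 u) p = p' \<longrightarrow> func_comp v u = Idm (over J) (fst P)"
    using half[OF P P'] by blast
  obtain u where u: "u \<in> sfun J TQ P P'" "postcomp (F0 G (F0 qbT P')) (\<Delta>1 u) p = p'"
    "\<forall>v\<in>sfun J TQ P' P. postcomp (F0 G (F0 qbT P)) (\<Delta>1 v) p' = p \<longrightarrow> func_comp u v = Idm (over J) (fst P')"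
    using half[OF P' P] by blast
  show ?thesis using that[OF u(1) v(1)] u v by blast
qed

lemma classifier_qF_represents:
  assumes "classifier (over I) (T_monad S) (over J) TQ (adj_qF S T f F qT) E B h"
  shows "represents E B h"
  unfolding represents_def
proof (intro conjI ballI)
  have c: "B \<in> algs (over J) TQ" "h \<in> hom (Alg_l (over I) (T_monad S)) E (F0 GqF B)"
    and b: "\<And>X. X \<in> algs (over J) TQ \<Longrightarrow> bij_betw (\<lambda>k. Cmp (Alg_l (over I) (T_monad S)) (F1 GqF k) h)
      (hom (Alg_s (over J) TQ) B X) (hom (Alg_l (over I) (T_monad S)) E (F0 GqF X))"
    using assms unfolding classifier_def universal_arrow_def by auto
  show B: "B \<in> algs (over J) TQ" and h: "h \<in> hom (Alg_l (over I) (T_monad S)) E (F0 G (F0 qbT B))"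
    using c GQ_ob(3) by auto
  fix X assume X: "X \<in> algs (over J) TQ"
  show "bij_betw (\<lambda>u. postcomp (F0 G (F0 qbT X)) (\<Delta>1 u) h) (sfun J TQ B X)
      (hom (Alg_l (over I) (T_monad S)) E (F0 G (F0 qbT X)))"
    using bij_betw_trans[OF T.QM.sfun_bij[OF B X] b[OF X, unfolded GQ_ob(3)[OF X]]] GqF_Cmp[OF B X _ h]
    by (simp add: comp_def cong: bij_betw_cong)
qed

text \<open>The universal bijection over \<open>SQ\<close> is followed by restriction along
  \<open>qS\<close>, which is bijective on lax morphisms between commutative algebras.\<close>

lemma classifier_Q_represents:
  assumes cl: "classifier (over I) SQ (over J) TQ (adj_FQ S f FQ) E D k" and E: "E \<in> algs (over I) SQ"
  shows "represents (F0 qbS E) D (F1 qbS k)"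
  unfolding represents_def
proof (intro conjI ballI)
  have k: "k \<in> hom (Alg_l (over I) SQ) E (F0 GQ D)"
    and b: "\<And>X. X \<in> algs (over J) TQ \<Longrightarrow> bij_betw (\<lambda>m. Cmp (Alg_l (over I) SQ) (F1 GQ m) k)
      (hom (Alg_s (over J) TQ) D X) (hom (Alg_l (over I) SQ) E (F0 GQ X))"
    and D: "D \<in> algs (over J) TQ"
    using cl unfolding classifier_def universal_arrow_def by auto
  show "D \<in> algs (over J) TQ" by fact
  have qb: "bij_betw (F1 qbS) (hom (Alg_l (over I) SQ) E (F0 GQ X)) (hom (Alg_l (over I) (T_monad S)) (F0 qbS E) (F0 G (F0 qbT X)))"
    if X: "X \<in> algs (over J) TQ" for X
  proof -
    obtain E1 E2 G1 G2 where e: "E = (E1, E2)" "F0 GQ X = (G1, G2)" by (cases E, cases "F0 GQ X")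
    have g: "F0 G (F0 qbT X) = (G1, func_comp G2 (qS G1))"
      using GQ_ob(2)[OF X] e by (simp add: S.q_bar_simps)
    show ?thesis unfolding e g S.q_bar_simps
      unfolding bij_betw_def inj_on_def
      using S.q_bar_lax(2,3) S.q_bar_lax_ex[OF E[unfolded e] GQ_ob(1)[OF X, unfolded e]]
      by (fastforce simp: image_iff)
  qed
  show "F1 qbS k \<in> hom (Alg_l (over I) (T_monad S)) (F0 qbS E) (F0 G (F0 qbT D))"
    using qb[OF D] k by (auto simp: bij_betw_def)
  fix X assume X: "X \<in> algs (over J) TQ"
  have "F1 qbS (Cmp (Alg_l (over I) SQ) (F1 GQ (strict_mor J D X u)) k) =
      postcomp (F0 G (F0 qbT X)) (\<Delta>1 u) (F1 qbS k)" if "u \<in> sfun J TQ D X" for u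
    using GQ_Cmp[OF D X that k] by simp
  then show "bij_betw (\<lambda>u. postcomp (F0 G (F0 qbT X)) (\<Delta>1 u) (F1 qbS k)) (sfun J TQ D X)
      (hom (Alg_l (over I) (T_monad S)) (F0 qbS E) (F0 G (F0 qbT X)))"
    using bij_betw_trans[OF bij_betw_trans[OF T.QM.sfun_bij[OF D X] b[OF X]] qb[OF X]]
    by (simp add: comp_def cong: bij_betw_cong)
qed

lemma classifier_bij:
  assumes cl: "classifier (over I) (T_monad S) (over J) (T_monad T) (adj_F S T f F) E A g"
  shows "A \<in> algs (over J) (T_monad T)" "g \<in> hom (Alg_l (over I) (T_monad S)) E (F0 G A)"
    "X \<in> algs (over J) (T_monad T) \<Longrightarrow> bij_betw (\<lambda>u. postcomp (F0 G X) (\<Delta>1 u) g) (sfun J (T_monad T) A X)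
      (hom (Alg_l (over I) (T_monad S)) E (F0 G X))"
proof -
  have b: "\<And>X. X \<in> algs (over J) (T_monad T) \<Longrightarrow> bij_betw (\<lambda>k. Cmp (Alg_l (over I) (T_monad S)) (F1 G k) g)
      (hom (Alg_s (over J) (T_monad T)) A X) (hom (Alg_l (over I) (T_monad S)) E (F0 G X))"
    and A: "A \<in> algs (over J) (T_monad T)" and g: "g \<in> hom (Alg_l (over I) (T_monad S)) E (F0 G A)"
    using cl unfolding classifier_def universal_arrow_def by auto
  then show "A \<in> algs (over J) (T_monad T)" "g \<in> hom (Alg_l (over I) (T_monad S)) E (F0 G A)" by auto
  assume X: "X \<in> algs (over J) (T_monad T)"
  show "bij_betw (\<lambda>u. postcomp (F0 G X) (\<Delta>1 u) g) (sfun J (T_monad T) A X)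
      (hom (Alg_l (over I) (T_monad S)) E (F0 G X))"
    using bij_betw_trans[OF T.TM.sfun_bij[OF A X] b[OF X]] G_postcomp(1)[OF A X _ g]
    by (simp add: comp_def cong: bij_betw_cong)
qed

section \<open>Reflections into the commutative algebras\<close>

definition reflection :: "'u cat \<times> 'u func \<Rightarrow> 'u cat \<times> 'u func \<Rightarrow> 'u func \<Rightarrow> bool" where
  "reflection A P m \<longleftrightarrow> P \<in> algs (over J) TQ \<and> m \<in> sfun J (T_monad T) A (F0 qbT P) \<and>
    (\<forall>X\<in>algs (over J) TQ. bij_betw (\<lambda>u. func_comp u m) (sfun J TQ P X) (sfun J (T_monad T) A (F0 qbT X)))"

lemma two_adjunction_reflection:
  assumes adj: "two_adjunction (Alg_s (over J) (T_monad T)) (Alg_s (over J) TQ) C qbT r e"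
    and A: "A \<in> algs (over J) (T_monad T)"
  shows "\<exists>m. r A = strict_mor J A (F0 qbT (F0 C A)) m \<and> reflection A (F0 C A) m"
proof -
  note b = two_adjunction_bij[OF adj T.TM.Alg_s_laws T.QM.Alg_s_laws]
  have CA: "F0 C A \<in> algs (over J) TQ" and r: "r A \<in> hom (Alg_s (over J) (T_monad T)) A (F0 qbT (F0 C A))"
    using b(1,2)[of A] A by simp_all
  note tCA = T.q_bar_algs(1)[OF CA]
  obtain m where m: "m \<in> sfun J (T_monad T) A (F0 qbT (F0 C A))" "r A = strict_mor J A (F0 qbT (F0 C A)) m"
    using T.TM.hom_Alg_sE[OF r] by metis
  have "bij_betw (\<lambda>u. func_comp u m) (sfun J TQ (F0 C A) X) (sfun J (T_monad T) A (F0 qbT X))"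
    if X: "X \<in> algs (over J) TQ" for X
  proof -
    note tX = T.q_bar_algs(1)[OF X]
    have B: "bij_betw (\<lambda>n. Cmp (Alg_s (over J) (T_monad T)) (F1 qbT n) (r A)) (hom (Alg_s (over J) TQ) (F0 C A) X)
        (hom (Alg_s (over J) (T_monad T)) A (F0 qbT X))"
      using b(3)[of A X] A X by simp
    have "Cmp (Alg_s (over J) (T_monad T)) (F1 qbT (strict_mor J (F0 C A) X u)) (r A) = strict_mor J A (F0 qbT X) (func_comp u m)"
      "func_comp u m \<in> sfun J (T_monad T) A (F0 qbT X)"
      if u: "u \<in> sfun J TQ (F0 C A) X" for u
      using T.TM.sfun_comp[OF A tCA tX m(1)] u T.q_bar_sfun[OF CA X] by (simp_all add: m(2))
    then have "bij_betw (\<lambda>u. strict_mor J A (F0 qbT X) (func_comp u m)) (sfun J TQ (F0 C A) X)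
        (hom (Alg_s (over J) (T_monad T)) A (F0 qbT X))" and s: "(\<lambda>u. func_comp u m) ` sfun J TQ (F0 C A) X \<subseteq> sfun J (T_monad T) A (F0 qbT X)"
      using bij_betw_trans[OF T.QM.sfun_bij[OF CA X] B] by (auto simp: comp_def cong: bij_betw_cong)
    then have "bij_betw (strict_mor J A (F0 qbT X) \<circ> (\<lambda>u. func_comp u m)) (sfun J TQ (F0 C A) X)
        (hom (Alg_s (over J) (T_monad T)) A (F0 qbT X))" by (simp add: comp_def)
    then show ?thesis
      using bij_betw_comp_iff2[OF T.TM.sfun_bij[OF A tX] s] by simp
  qed
  then show ?thesis using m CA by (auto simp: reflection_def)
qed

text \<open>Functors out of the reflection correspond to functors out of the classifier, and these
  correspond to lax morphisms.\<close>

lemma reflection_represents: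
  assumes cl: "classifier (over I) (T_monad S) (over J) (T_monad T) (adj_F S T f F) E A g" and m: "reflection A P m"
  shows "represents E P (postcomp (F0 G (F0 qbT P)) (\<Delta>1 m) g)"
  unfolding represents_def
proof (intro conjI ballI)
  note c = classifier_bij[OF cl]
  have P: "P \<in> algs (over J) TQ" and mm: "m \<in> sfun J (T_monad T) A (F0 qbT P)"
    using m by (auto simp: reflection_def)
  show "P \<in> algs (over J) TQ" by fact
  show "postcomp (F0 G (F0 qbT P)) (\<Delta>1 m) g \<in> hom (Alg_l (over I) (T_monad S)) E (F0 G (F0 qbT P))"
    using c(3)[OF T.q_bar_algs(1)[OF P]] mm by (auto simp: bij_betw_def)
  fix X assume X: "X \<in> algs (over J) TQ"
  obtain A1 A2 where A: "F0 G A = (A1, A2)" by (cases "F0 G A")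
  have "postcomp (F0 G (F0 qbT X)) (\<Delta>1 (func_comp u m)) g = postcomp (F0 G (F0 qbT X)) (\<Delta>1 u) (postcomp (F0 G (F0 qbT P)) (\<Delta>1 m) g)"
    if u: "u \<in> sfun J TQ P X" for u
  proof -
    note mh = T.TM.sfunD[OF mm, unfolded T.q_bar_algs(2)[OF P]] and uh = T.QM.sfunD[OF u]
    have "A1 = \<Delta> (fst A)" using A by (cases A) (simp add: G_ob)
    then show ?thesis
      using S.TM.postcomp_postcomp[of g A1 A2, OF _ _ _ Delta_hom[OF uh, of I f]] Delta_hom[OF mh, of I f] c(2) A
        Delta_comp[OF mh uh, of I f] by (simp add: hom_Alg_l)
  qed
  then show "bij_betw (\<lambda>u. postcomp (F0 G (F0 qbT X)) (\<Delta>1 u) (postcomp (F0 G (F0 qbT P)) (\<Delta>1 m) g)) (sfun J TQ P X)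
      (hom (Alg_l (over I) (T_monad S)) E (F0 G (F0 qbT X)))"
    using bij_betw_trans[OF _ c(3)[OF T.q_bar_algs(1)[OF X]], of "\<lambda>u. func_comp u m" "sfun J TQ P X"] m X
    by (simp add: comp_def reflection_def cong: bij_betw_cong)
qed

text \<open>Transport along an isomorphism lets the equivalence be proved with \<open>D\<close> in
  place of the reflection that the adjunction supplies.\<close>

lemma reflection_iso:
  assumes m: "reflection A P m" and A: "A \<in> algs (over J) (T_monad T)" and D: "D \<in> algs (over J) TQ"
    and u: "u \<in> sfun J TQ P D" and v: "v \<in> sfun J TQ D P"
    and vu: "func_comp v u = Idm (over J) (fst P)" "func_comp u v = Idm (over J) (fst D)"
  shows "reflection A D (func_comp u m)"
  unfolding reflection_def
proof (intro conjI ballI)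
  have P: "P \<in> algs (over J) TQ" and mm: "m \<in> sfun J (T_monad T) A (F0 qbT P)"
    using m by (auto simp: reflection_def)
  show "D \<in> algs (over J) TQ" by fact
  show "func_comp u m \<in> sfun J (T_monad T) A (F0 qbT D)"
    using T.TM.sfun_comp(1)[OF A T.q_bar_algs(1)[OF P] T.q_bar_algs(1)[OF D] mm] T.q_bar_sfun(1)[OF P D] u by simp
  fix X assume X: "X \<in> algs (over J) TQ"
  note mh = T.TM.sfunD[OF mm, unfolded T.q_bar_algs(2)[OF P]] and uh = T.QM.sfunD[OF u] and vh = T.QM.sfunD[OF v]
  have w: "func_comp (func_comp w u) v = w" if "w \<in> sfun J TQ D X" for w
    using func_comp_assoc[OF vh uh T.QM.sfunD[OF that]] func_comp_Idm(1)[OF T.QM.sfunD[OF that]] vu(2) by simp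
  have w': "func_comp (func_comp w v) u = w" if "w \<in> sfun J TQ P X" for w
    using func_comp_assoc[OF uh vh T.QM.sfunD[OF that]] func_comp_Idm(1)[OF T.QM.sfunD[OF that]] vu(1) by simp
  have "bij_betw (\<lambda>w. func_comp w u) (sfun J TQ D X) (sfun J TQ P X)"
    using w w' T.QM.sfun_comp(1)[OF P D X u] T.QM.sfun_comp(1)[OF D P X v]
    by (intro bij_betw_byWitness[where f' = "\<lambda>w. func_comp w v"]) auto
  then have "bij_betw (\<lambda>w. func_comp (func_comp w u) m) (sfun J TQ D X) (sfun J (T_monad T) A (F0 qbT X))"
    using bij_betw_trans[of _ _ "sfun J TQ P X" "\<lambda>u. func_comp u m" "sfun J (T_monad T) A (F0 qbT X)"] m X
    by (simp add: comp_def reflection_def)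
  moreover have "func_comp (func_comp w u) m = func_comp w (func_comp u m)" if "w \<in> sfun J TQ D X" for w
    by (rule func_comp_assoc[OF mh uh T.QM.sfunD[OF that]])
  ultimately show "bij_betw (\<lambda>w. func_comp w (func_comp u m)) (sfun J TQ D X) (sfun J (T_monad T) A (F0 qbT X))"
    by (simp cong: bij_betw_cong)
qed

text \<open>Both actions send everything to its colour, and \<open>qS\<close> preserves colours. The
  assumption says that the terminal category and its action over \<open>SQ\<close> are well
  formed.\<close>

lemma terminal_alg_q_bar:
  assumes E: "terminal_alg I SQ \<in> algs (over I) SQ"
  shows "F0 qbS (terminal_alg I SQ) = terminal_alg I (T_monad S)"
proof -
  let ?E = "terminal_over I"
  let ?t = "\<lambda>X. mk_func X ?E (Col X) (\<lambda>f. Col X (Dom X f))"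
  have t: "?t (S.QM.MO ?E) \<in> hom (over I) (S.QM.MO ?E) ?E" "cat_over I ?E"
    using S.QM.algD(1,4)[of ?E "?t (S.QM.MO ?E)"] E by (simp_all add: terminal_alg_def Let_def)
  note qE = S.q_hom[OF t(2)]
  note qD = hom_overD[OF qE]
  have TE: "?t (T_cat S ?E) \<in> hom (over I) (T_cat S ?E) ?E"
    using cat_overD[OF qD(1)] by (intro mk_func_hom[OF qD(1) t(2)]) (simp_all add: terminal_over_def)
  have "func_comp (?t (S.QM.MO ?E)) (qS ?E) = ?t (T_cat S ?E)"
    by (rule hom_over_eqI[OF func_comp_hom[OF qE t(1)] TE]) (simp_all add: qD cat_overD[OF qD(1)])
  then show ?thesis by (simp add: terminal_alg_def Let_def S.q_bar_simps)
qed

end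

section \<open>Chaotic algebras\<close>

context set_operad
begin

lemma T_fun_ob:
  assumes H: "H \<in> hom (over J) X Y" and z: "z \<in> Obj (T_cat T X)"
  shows "fob (F1 (T_fun T) H) z = tup [] (opn z) (map (fob H) (args z))"
  using T_monad_simps(5)[of "[]" "opn z" "args z" T H] T_obj_components(1)[OF z] z hom_overD(3)[OF H] by simp

lemma T_fun_ar:
  assumes H: "H \<in> hom (over J) X Y" and w: "w \<in> Arr (T_cat T X)"
  shows "far (F1 (T_fun T) H) w = tup (prm w) (opn w) (map (far H) (args w))"
  using T_monad_simps(6)[of "prm w" "opn w" "args w" T H] T_arr_components(1)[OF w] w hom_overD(3)[OF H] by simp

lemma T_fun_cell:
  assumes t: "t \<in> cells (over J) G H" and G: "G \<in> hom (over J) X Y" and z: "z \<in> Obj (T_cat T X)"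
  shows "ncmp (F2 (T_fun T) t) z = tup [0..<length (args z)] (opn z) (map (ncmp t) (args z))"
  using T_monad_simps(9)[of "[]" "opn z" "args z" T t] T_obj_components(1)[OF z] z
    hom_overD(3)[OF G] cells_overD(2)[OF t G] by simp

lemma T_mu_ob:
  assumes z: "z \<in> Obj (T_cat T (T_cat T X))"
  shows "fob (mu (T_monad T) X) z = tup [] (sub T (opn z) (map opn (args z))) (concat (map args (args z)))"
  using T_monad_mu(3)[of "[]" "opn z" "args z" T X] T_obj_components(1)[OF z] z by simp

text \<open>An action on a chaotic category is given by its values on objects, so \<open>a\<close>
  is a structure for the operad without its symmetries.\<close>

definition chaotic_alg :: "'u set \<Rightarrow> ('u \<Rightarrow> 'u) \<Rightarrow> ('u \<Rightarrow> 'u) \<Rightarrow> 'u cat \<times> 'u func" where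
  "chaotic_alg V c a = (chaotic V c, chaotic_func (T_cat T (chaotic V c)) V c a)"

text \<open>The laws of an algebra are here equations between functors into a thin category, so they
  have to be checked on objects only.\<close>

lemma chaotic_alg_algs:
  assumes V: "c \<in> V \<rightarrow> J"
    and a: "\<And>z. z \<in> Obj (T_cat T (chaotic V c)) \<Longrightarrow> a z \<in> V \<and> c (a z) = out T (opn z)"
    and unit: "\<And>x. x \<in> V \<Longrightarrow> a (tup [] (unt T (c x)) [x]) = x"
    and mult: "\<And>w. w \<in> Obj (T_cat T (T_cat T (chaotic V c))) \<Longrightarrow>
      a (tup [] (sub T (opn w) (map opn (args w))) (concat (map args (args w)))) = a (tup [] (opn w) (map a (args w)))"
  shows "chaotic_alg V c a \<in> algs (over J) (T_monad T)"
proof -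
  let ?X = "chaotic V c" and ?a = "chaotic_func (T_cat T (chaotic V c)) V c a"
  have X: "cat_over J ?X" using V by (rule chaotic_over)
  have C: "Col (T_cat T ?X) z = out T (opn z)" if "z \<in> Obj (T_cat T ?X)" for z
    by (subst T_obj_components(1)[OF that]) simp
  have ah: "?a \<in> hom (over J) (T_cat T ?X) ?X"
    using a C by (intro chaotic_func_hom[OF T_cat_over[OF X] V]) auto
  have ao: "fob ?a z = a z" if "z \<in> Obj (T_cat T ?X)" for z
    using that by (simp add: chaotic_func_def)
  note e = eta_hom[OF X] and m = mu_hom[OF X] and Ta = T_fun_hom[OF ah]
  have "func_comp ?a (eta (T_monad T) ?X) = Idm (over J) ?X"
  proof (rule thin_func_eqI[OF func_comp_hom[OF e ah] Idm_hom[OF X] chaotic_thin])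
    fix x assume x: "x \<in> Obj ?X"
    show "fob (func_comp ?a (eta (T_monad T) ?X)) x = fob (Idm (over J) ?X) x"
      using x ao hom_overD(5)[OF e x] unit[of x] by simp
  qed
  moreover have "func_comp ?a (mu (T_monad T) ?X) = func_comp ?a (F1 (T_fun T) ?a)"
  proof (rule thin_func_eqI[OF func_comp_hom[OF m ah] func_comp_hom[OF Ta ah] chaotic_thin])
    fix z assume z: "z \<in> Obj (T_cat T (T_cat T ?X))"
    note zc = T_obj_components[OF z]
    have "map (fob ?a) (args z) = map a (args z)" using zc(3) ao by auto
    then show "fob (func_comp ?a (mu (T_monad T) ?X)) z = fob (func_comp ?a (F1 (T_fun T) ?a)) z"
      using z ao[OF hom_overD(5)[OF m z]] ao[OF hom_overD(5)[OF Ta z]] mult[OF z]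
      by (simp add: T_mu_ob[OF z] T_fun_ob[OF ah z] hom_overD(3)[OF ah] cong: map_cong)
  qed
  ultimately show ?thesis unfolding chaotic_alg_def algs_over using X ah by simp
qed

lemma T_Obj_chaotic [simp]: "Obj (T_cat T (chaotic (Obj X) (Col X))) = Obj (T_cat T X)"
  by (simp add: T_cat_def)

lemma TT_Obj_chaotic [simp]:
  "Obj (T_cat T (T_cat T (chaotic (Obj X) (Col X)))) = Obj (T_cat T (T_cat T X))"
  unfolding T_cat_def[of T "T_cat T (chaotic (Obj X) (Col X))"] T_cat_def[of T "T_cat T X"]
  by (simp add: T_cat_def[of T "chaotic (Obj X) (Col X)"] T_cat_def[of T X])

lemma underlying_chaotic_alg:
  assumes A: "(A, a) \<in> algs (over J) (T_monad T)"
  shows "chaotic_alg (Obj A) (Col A) (fob a) \<in> algs (over J) (T_monad T)"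
proof (rule chaotic_alg_algs)
  note A' = TM.algD[OF A, simplified]
  show "Col A \<in> Obj A \<rightarrow> J" using cat_overD(4)[OF A'(1)] by auto
  show "fob a z \<in> Obj A \<and> Col A (fob a z) = out T (opn z)" if z: "z \<in> Obj (T_cat T (chaotic (Obj A) (Col A)))" for z
  proof -
    have z': "z \<in> Obj (T_cat T A)" using z by simp
    have "Col (T_cat T A) z = out T (opn z)" by (subst T_obj_components(1)[OF z']) simp
    then show ?thesis using hom_overD(5,7)[OF A'(4) z'] by simp
  qed
  show "fob a (tup [] (unt T (Col A x)) [x]) = x" if "x \<in> Obj A" for x
    using A'(10)[OF that] that by simp
  show "fob a (tup [] (sub T (opn w) (map opn (args w))) (concat (map args (args w)))) =
      fob a (tup [] (opn w) (map (fob a) (args w)))"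
    if "w \<in> Obj (T_cat T (T_cat T (chaotic (Obj A) (Col A))))" for w
    using A'(12)[of w] that T_mu_ob[of w A] T_fun_ob[OF A'(4), of w] by simp
qed

text \<open>Associativity of substitution in the operad, in the form in which it enters the
  associativity of the multiplication.\<close>

lemma mu_mu_ob:
  assumes w: "w \<in> Obj (T_cat T (T_cat T (T_cat T X)))"
  shows "sub T (sub T (opn w) (map opn (args w))) (map opn (concat (map args (args w)))) =
    sub T (opn w) (map (\<lambda>z. sub T (opn z) (map opn (args z))) (args w))"
proof -
  note c = T_obj_components[OF w]
  have "tup [] (opn w) (args w) \<in> Obj (T_cat T (T_cat T (T_cat T X)))"
    unfolding c(1)[symmetric] by (rule w)
  note m = mu_obj[OF this]
  have pl: "plugs T (opn z) (map opn (args z))" if "z \<in> set (args w)" for z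
  proof (rule mu_obj(1)[of "[]" _ _ X])
    have z: "z \<in> Obj (T_cat T (T_cat T X))" using c(3) that by auto
    show "tup [] (opn z) (args z) \<in> Obj (T_cat T (T_cat T X))"
      unfolding T_obj_components(1)[OF z, symmetric] by (rule z)
  qed
  have "list_all2 (plugs T) (map opn (args w)) (map (\<lambda>z. map opn (args z)) (args w))"
    using pl by (auto simp: list_all2_conv_all_nth)
  note e = operadD(11)[OF m(1) this]
  have "concat (map (\<lambda>z. map opn (args z)) (args w)) = map opn (concat (map args (args w)))"
    by (simp add: map_concat comp_def)
  then show ?thesis using e unfolding map2_map_map by (simp only:)
qed

lemma concat_concat_eq: "concat (concat xsss) = concat (map concat xsss)"
  by (induction xsss) auto

text \<open>The objects of the free algebra with all arrows replaced by chaotic ones; this algebra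
  is the target of the splitting.\<close>

lemma free_chaotic_alg:
  assumes A: "cat_over J A"
  defines "V \<equiv> Obj (T_cat T A)" and "c \<equiv> Col (T_cat T A)"
    and "fm \<equiv> \<lambda>z. tup [] (sub T (opn z) (map opn (args z))) (concat (map args (args z)))"
  shows "chaotic_alg V c fm \<in> algs (over J) (T_monad T)"
proof (rule chaotic_alg_algs)
  note TA = T_cat_over[OF A]
  show "c \<in> V \<rightarrow> J" using cat_overD(4)[OF TA] by (auto simp: V_def c_def)
  show "fm z \<in> V \<and> c (fm z) = out T (opn z)" if z: "z \<in> Obj (T_cat T (chaotic V c))" for z
  proof -
    have z': "z \<in> Obj (T_cat T (T_cat T A))" using z by (simp add: V_def c_def)
    have "Col (T_cat T (T_cat T A)) z = out T (opn z)" by (subst T_obj_components(1)[OF z']) simp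
    then show ?thesis using hom_overD(5,7)[OF mu_hom[OF A] z'] by (simp add: T_mu_ob[OF z'] fm_def V_def c_def)
  qed
  show "fm (tup [] (unt T (c x)) [x]) = x" if x: "x \<in> V" for x
  proof -
    note xc = T_obj_components[OF x[unfolded V_def]]
    have "c x = out T (opn x)" unfolding c_def by (subst xc(1)) simp
    then show ?thesis using operadD(9)[OF xc(2)] xc(1) by (simp add: fm_def)
  qed
  show "fm (tup [] (sub T (opn w) (map opn (args w))) (concat (map args (args w)))) = fm (tup [] (opn w) (map fm (args w)))"
    if w: "w \<in> Obj (T_cat T (T_cat T (chaotic V c)))" for w
  proof -
    have w': "w \<in> Obj (T_cat T (T_cat T (T_cat T A)))" using w by (simp add: V_def c_def)
    show ?thesis using mu_mu_ob[OF w'] concat_concat_eq[of "map (\<lambda>z. map args (args z)) (args w)"]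
      by (simp add: fm_def map_concat comp_def)
  qed
qed

lemma chaotic_sfunI:
  assumes A: "(A, a) \<in> algs (over J) (T_monad T)" and B: "chaotic_alg V c b \<in> algs (over J) (T_monad T)"
    and p: "\<And>x. x \<in> Obj A \<Longrightarrow> p x \<in> V \<and> c (p x) = Col A x"
    and eq: "\<And>z. z \<in> Obj (T_cat T A) \<Longrightarrow> b (tup [] (opn z) (map p (args z))) = p (fob a z)"
  shows "chaotic_func A V c p \<in> sfun J (T_monad T) (A, a) (chaotic_alg V c b)"
proof -
  note A' = TM.algD[OF A, simplified] and B' = TM.algD[OF B[unfolded chaotic_alg_def], simplified]
  have V: "c \<in> V \<rightarrow> J" using cat_overD(4)[OF B'(1)] by auto
  note h = chaotic_func_hom[OF A'(1) V p]
  note Th = T_fun_hom[OF h]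
  have "func_comp (chaotic_func (T_cat T (chaotic V c)) V c b) (F1 (T_fun T) (chaotic_func A V c p)) = func_comp (chaotic_func A V c p) a"
  proof (rule thin_func_eqI[OF func_comp_hom[OF Th B'(4)] func_comp_hom[OF A'(4) h] chaotic_thin])
    fix z assume z: "z \<in> Obj (T_cat T A)"
    have "map (fob (chaotic_func A V c p)) (args z) = map p (args z)"
      using T_obj_components(3)[OF z] by (auto simp: chaotic_func_def)
    then have "fob (F1 (T_fun T) (chaotic_func A V c p)) z = tup [] (opn z) (map p (args z))"
      using T_fun_ob[OF h z] by simp
    then show "fob (func_comp (chaotic_func (T_cat T (chaotic V c)) V c b) (F1 (T_fun T) (chaotic_func A V c p))) z =
        fob (func_comp (chaotic_func A V c p) a) z"
      using z hom_overD(5)[OF Th z] eq[OF z] hom_overD[OF A'(4)] hom_overD(3)[OF h]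
      by (simp add: chaotic_func_def)
  qed
  then show ?thesis using h by (simp add: chaotic_alg_def sfun_iff)
qed

end

section \<open>Lax morphisms into chaotic algebras\<close>

context operad_map
begin

text \<open>Between two objects of the same colour there is exactly one arrow, so components exist
  and naturality is automatic. In a component, the outer pair belongs to the pullback and the inner
  one is the arrow of the chaotic category.\<close>

lemma Delta_chaotic_cells:
  assumes L: "L \<in> hom (over I) X (\<Delta> (chaotic V c))" and H: "H \<in> hom (over I) X (\<Delta> (chaotic V c))"
  shows "mk_ntrans L H (\<lambda>x. pr (Col X x) (pr (pr2 (fob L x)) (pr2 (fob H x)))) \<in> cells (over I) L H"
proof (rule mk_ntrans_cells[OF L H])
  note GD = hom_overD[OF L] and HD = hom_overD[OF H]
  have t: "thin (\<Delta> (chaotic V c))" by (rule Delta_thin[OF chaotic_thin])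
  show 1: "pr (Col X x) (pr (pr2 (fob L x)) (pr2 (fob H x))) \<in> Arr (\<Delta> (chaotic V c)) \<and>
      Dom (\<Delta> (chaotic V c)) (pr (Col X x) (pr (pr2 (fob L x)) (pr2 (fob H x)))) = fob L x \<and>
      Cod (\<Delta> (chaotic V c)) (pr (Col X x) (pr (pr2 (fob L x)) (pr2 (fob H x)))) = fob H x"
    if x: "x \<in> Obj X" for x
    using GD(5,7)[OF x] HD(5,7)[OF x] by (auto elim!: Delta_objE)
  fix h assume h: "h \<in> Arr X"
  note D = cat_overD[OF GD(2)] and XD = cat_overD[OF GD(1)]
  let ?t = "\<lambda>x. pr (Col X x) (pr (pr2 (fob L x)) (pr2 (fob H x)))"
  note d = 1[OF XD(1)[OF h]] 1[OF XD(2)[OF h]]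
  show "Com (\<Delta> (chaotic V c)) (?t (Cod X h)) (far L h) = Com (\<Delta> (chaotic V c)) (far H h) (?t (Dom X h))"
    by (rule thinD[OF t]) (use d h in \<open>simp_all add: GD HD D(10-12)\<close>)
qed

text \<open>The coherence has uniquely determined components, and both of its laws compare parallel
  arrows of a thin category; so nothing is required of \<open>u\<close>.\<close>

lemma lax_into_chaotic:
  assumes E: "(E1, e) \<in> algs (over I) (T_monad S)" and B: "(chaotic V c, b) \<in> algs (over J) (T_monad T)"
    and u: "u \<in> hom (over I) E1 (\<Delta> (chaotic V c))"
  shows "\<exists>p\<in>hom (Alg_l (over I) (T_monad S)) (E1, e) (F0 G (chaotic V c, b)). und p = u"
proof -
  let ?b = "func_comp (\<Delta>1 b) (FC (chaotic V c))" and ?B = "\<Delta> (chaotic V c)"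
  have GB: "(?B, ?b) \<in> algs (over I) (T_monad S)" using G_algs[OF B] .
  note E' = S.TM.algD[OF E, simplified] and GB' = S.TM.algD[OF GB, simplified]
  note Su = S.T_fun_hom[OF u]
  have l: "func_comp ?b (F1 (T_fun S) u) \<in> hom (over I) (T_cat S E1) ?B"
    and r: "func_comp u e \<in> hom (over I) (T_cat S E1) ?B"
    using func_comp_hom[OF Su GB'(4)] func_comp_hom[OF E'(4) u] by auto
  let ?t = "mk_ntrans (func_comp ?b (F1 (T_fun S) u)) (func_comp u e)
    (\<lambda>x. pr (Col (T_cat S E1) x) (pr (pr2 (fob (func_comp ?b (F1 (T_fun S) u)) x)) (pr2 (fob (func_comp u e) x))))"
  have t: "?t \<in> cells (over I) (func_comp ?b (F1 (T_fun S) u)) (func_comp u e)"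
    using Delta_chaotic_cells[OF l r] .
  have th: "thin ?B" by (rule Delta_thin[OF chaotic_thin])
  note tD = cells_overD[OF t l] and BD = cat_overD[OF GB'(1)] and uD = hom_overD[OF u]
    and bD = hom_overD[OF GB'(4)] and eD = hom_overD[OF E'(4)]
  have St: "F2 (T_fun S) ?t \<in> cells (over I) (F1 (T_fun S) (func_comp ?b (F1 (T_fun S) u))) (F1 (T_fun S) (func_comp u e))"
    by (rule S.T_fun_cells[OF t l])
  note StD = cells_overD[OF St S.T_fun_hom[OF l]]
  have 1: "ncmp ?t (fob (eta (T_monad S) E1) x) = Ide ?B (fob u x)" if x: "x \<in> Obj E1" for x
  proof (rule thinD[OF th])
    have ob: "fob (eta (T_monad S) E1) x \<in> Obj (T_cat S E1)" using hom_overD(5)[OF E'(6) x] .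
    show "ncmp ?t (fob (eta (T_monad S) E1) x) \<in> Arr ?B" using tD(4)[OF ob] .
    show "Ide ?B (fob u x) \<in> Arr ?B" using BD uD x by simp
    have "fob (F1 (T_fun S) u) (fob (eta (T_monad S) E1) x) = fob (eta (T_monad S) ?B) (fob u x)"
      using arg_cong[OF S.TM.eta_natural[OF u], of "\<lambda>H. fob H x"] x uD hom_overD(3)[OF E'(6)] by simp
    then have "fob (func_comp ?b (F1 (T_fun S) u)) (fob (eta (T_monad S) E1) x) = fob u x"
      using ob GB'(10)[OF uD(5)[OF x]] hom_overD(3)[OF Su] by simp
    then show "Dom ?B (ncmp ?t (fob (eta (T_monad S) E1) x)) = Dom ?B (Ide ?B (fob u x))"
      using tD(5)[OF ob] BD(6)[OF uD(5)[OF x]] by simp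
    have "fob (func_comp u e) (fob (eta (T_monad S) E1) x) = fob u x"
      using ob E'(10)[OF x] eD by simp
    then show "Cod ?B (ncmp ?t (fob (eta (T_monad S) E1) x)) = Cod ?B (Ide ?B (fob u x))"
      using tD(6)[OF ob] BD(7)[OF uD(5)[OF x]] by simp
  qed
  have 2: "ncmp ?t (fob (mu (T_monad S) E1) w) =
       Com ?B (ncmp ?t (fob (F1 (T_fun S) e) w)) (far ?b (ncmp (F2 (T_fun S) ?t) w))"
    if w: "w \<in> Obj (T_cat S (T_cat S E1))" for w
  proof -
    have ob: "fob (mu (T_monad S) E1) w \<in> Obj (T_cat S E1)" "fob (F1 (T_fun S) e) w \<in> Obj (T_cat S E1)"
      using hom_overD(5)[OF E'(7) w] hom_overD(5)[OF E'(5) w] by auto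
    note a = tD(4-6)[OF ob(1)] tD(4-6)[OF ob(2)] StD(4-6)[OF w]
    note SSu = S.T_fun_hom[OF Su]
    have "func_comp (func_comp ?b (F1 (T_fun S) u)) (mu (T_monad S) E1) =
        func_comp ?b (func_comp (mu (T_monad S) ?B) (F1 (T_fun S) (F1 (T_fun S) u)))"
      using func_comp_assoc[OF E'(7) Su GB'(4)] S.mu_natural[OF u] by simp
    also have "\<dots> = func_comp (func_comp ?b (F1 (T_fun S) ?b)) (F1 (T_fun S) (F1 (T_fun S) u))"
      using func_comp_assoc[OF SSu GB'(7) GB'(4)] GB'(9) by simp
    also have "\<dots> = func_comp ?b (F1 (T_fun S) (func_comp ?b (F1 (T_fun S) u)))"
      using func_comp_assoc[OF SSu GB'(5) GB'(4)] S.TM.F1_comp[OF Su GB'(4)] by simp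
    finally have e: "func_comp (func_comp ?b (F1 (T_fun S) u)) (mu (T_monad S) E1) =
        func_comp ?b (F1 (T_fun S) (func_comp ?b (F1 (T_fun S) u)))" .
    \<comment> \<open>The equations \<open>s\<close>, \<open>c\<close> and \<open>d\<close> match
      the ends of the two sides of the multiplication law; thinness does the rest.\<close>
    have s: "fob (func_comp ?b (F1 (T_fun S) u)) (fob (mu (T_monad S) E1) w) =
        fob ?b (fob (F1 (T_fun S) (func_comp ?b (F1 (T_fun S) u))) w)"
      using arg_cong[OF e, of "\<lambda>H. fob H w"] w hom_overD(3)[OF E'(7)] hom_overD(3)[OF S.T_fun_hom[OF l]] by simp
    have c: "fob ?b (fob (F1 (T_fun S) (func_comp u e)) w) = fob (func_comp ?b (F1 (T_fun S) u)) (fob (F1 (T_fun S) e) w)"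
      using S.TM.F1_comp[OF E'(4) u] w ob hom_overD(3)[OF E'(5)] hom_overD(3)[OF Su] by simp
    have d: "fob (func_comp u e) (fob (mu (T_monad S) E1) w) = fob (func_comp u e) (fob (F1 (T_fun S) e) w)"
      using ob E'(12)[OF w] eD by simp
    have x: "far ?b (ncmp (F2 (T_fun S) ?t) w) \<in> Arr ?B"
      "Dom ?B (far ?b (ncmp (F2 (T_fun S) ?t) w)) = fob ?b (fob (F1 (T_fun S) (func_comp ?b (F1 (T_fun S) u))) w)"
      "Cod ?B (far ?b (ncmp (F2 (T_fun S) ?t) w)) = fob ?b (fob (F1 (T_fun S) (func_comp u e)) w)"
      using a bD(6)[OF a(7)] bD(9)[OF a(7)] bD(10)[OF a(7)] by simp_all
    have y: "Cod ?B (far ?b (ncmp (F2 (T_fun S) ?t) w)) = Dom ?B (ncmp ?t (fob (F1 (T_fun S) e) w))"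
      using x c a(5) by (simp only:)
    show ?thesis
    proof (rule thinD[OF th a(1)])
      show "Com ?B (ncmp ?t (fob (F1 (T_fun S) e) w)) (far ?b (ncmp (F2 (T_fun S) ?t) w)) \<in> Arr ?B"
        by (rule BD(10)[OF x(1) a(4) y])
      show "Dom ?B (ncmp ?t (fob (mu (T_monad S) E1) w)) =
          Dom ?B (Com ?B (ncmp ?t (fob (F1 (T_fun S) e) w)) (far ?b (ncmp (F2 (T_fun S) ?t) w)))"
        unfolding BD(11)[OF x(1) a(4) y] a(2) x(2) by (rule s)
      show "Cod ?B (ncmp ?t (fob (mu (T_monad S) E1) w)) =
          Cod ?B (Com ?B (ncmp ?t (fob (F1 (T_fun S) e) w)) (far ?b (ncmp (F2 (T_fun S) ?t) w)))"
        unfolding BD(12)[OF x(1) a(4) y] a(3) a(6) by (rule d)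
    qed
  qed
  have "\<lparr>msrc = (E1, e), mtgt = (?B, ?b), und = u, coh = ?t\<rparr> \<in> lax_mors (over I) (T_monad S)"
    unfolding S.TM.lax_mors_iff[OF E GB] using u t 1 2 by simp
  then show ?thesis
    by (intro bexI[of _ "\<lparr>msrc = (E1, e), mtgt = (?B, ?b), und = u, coh = ?t\<rparr>"]) (simp_all add: hom_Alg_l G_ob)
qed

text \<open>Thinness determines the functor on arrows, and the coherence, from the values on
  objects.\<close>

lemma lax_into_chaotic_eq:
  assumes p: "p \<in> hom (Alg_l (over I) (T_monad S)) E (F0 G (chaotic V c, b))"
    and p': "p' \<in> hom (Alg_l (over I) (T_monad S)) E (F0 G (chaotic V c, b))"
    and eq: "\<And>x. x \<in> Obj (fst E) \<Longrightarrow> fob (und p) x = fob (und p') x"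
  shows "p = p'"
proof -
  obtain E1 e where E: "E = (E1, e)" by (cases E)
  have d: "p \<in> lax_mors (over I) (T_monad S)" "p' \<in> lax_mors (over I) (T_monad S)"
    "msrc p = (E1, e)" "msrc p' = (E1, e)"
    "mtgt p = (\<Delta> (chaotic V c), func_comp (\<Delta>1 b) (FC (chaotic V c)))"
    "mtgt p' = (\<Delta> (chaotic V c), func_comp (\<Delta>1 b) (FC (chaotic V c)))"
    using p p' by (simp_all add: hom_Alg_l G_ob E)
  note l = S.TM.lax_morsD[OF d(1,3,5)] and l' = S.TM.lax_morsD[OF d(2,4,6)]
  have th: "thin (\<Delta> (chaotic V c))" by (rule Delta_thin[OF chaotic_thin])
  have u: "und p = und p'"
    using eq E by (intro thin_func_eqI[OF l(3) l'(3) th]) simp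
  note c = cells_overD[OF l(4,5)] and c' = cells_overD[OF l'(4)[folded u] l(5)]
  have "coh p = coh p'"
  proof (rule cells_over_eqI[OF l(4) l'(4)[folded u] l(5)])
    fix x assume "x \<in> Obj (S.TM.MO E1)"
    then show "ncmp (coh p) x = ncmp (coh p') x" using c(4-6) c'(4-6) by - (rule thinD[OF th], simp_all)
  qed
  then show ?thesis using u d by simp
qed

end

text \<open>
  The classifier has a splitting of its action on objects: it is built from the strict morphism to the
  chaotic algebra on the objects of the free algebra that classifies the unit.
\<close>

lemma (in sigma_map) classifier_splitting:
  assumes cl: "classifier (over I) (T_monad S) (over J) (T_monad T) (adj_F S T f F) E (A, a) g"
  shows "\<exists>\<tau>. (\<forall>x\<in>Obj A. \<tau> x \<in> Obj (T_cat T A) \<and> fob a (\<tau> x) = x) \<and>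
    (\<forall>z\<in>Obj (T_cat T A). \<tau> (fob a z) = fob (mu (T_monad T) A) (tup [] (opn z) (map \<tau> (args z))))"
proof -
  note c = classifier_bij[OF cl]
  note A = c(1) and g = c(2)
  note A' = T.TM.algD[OF A, simplified]
  let ?V = "Obj (T_cat T A)" and ?c = "Col (T_cat T A)"
  define fm where "fm z = tup [] (sub T (opn z) (map opn (args z))) (concat (map args (args z)))" for z :: 'u
  have fm: "fm z = fob (mu (T_monad T) A) z" if "z \<in> Obj (T_cat T (T_cat T A))" for z
    using T.T_mu_ob[OF that] by (simp add: fm_def)
  have F: "T.chaotic_alg ?V ?c fm \<in> algs (over J) (T_monad T)"
    unfolding fm_def[abs_def] by (rule T.free_chaotic_alg[OF A'(1)])
  have U: "T.chaotic_alg (Obj A) (Col A) (fob a) \<in> algs (over J) (T_monad T)"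
    by (rule T.underlying_chaotic_alg[OF A])
  obtain E1 e where E: "E = (E1, e)" by (cases E)
  have gl: "g \<in> lax_mors (over I) (T_monad S)" "msrc g = (E1, e)" "mtgt g = (\<Delta> A, func_comp (\<Delta>1 a) (FC A))"
    using g by (simp_all add: hom_Alg_l E G_ob)
  note gD = S.TM.lax_morsD[OF gl, simplified]
  note ug = hom_overD[OF gD(3)]
  \<comment> \<open>The unit of the 2-monad, kept on objects only and taken as a functor to the
    chaotic category on the objects of the free algebra.\<close>
  have eta: "\<Delta>1 (chaotic_func A ?V ?c (fob (eta (T_monad T) A))) \<in> hom (over I) (\<Delta> A) (\<Delta> (chaotic ?V ?c))"
  proof (rule Delta_hom[OF chaotic_func_hom[OF A'(1)]])
    show "?c \<in> ?V \<rightarrow> J" using cat_overD(4)[OF A'(2)] by auto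
    show "fob (eta (T_monad T) A) x \<in> ?V \<and> ?c (fob (eta (T_monad T) A) x) = Col A x" if "x \<in> Obj A" for x
      using hom_overD(5,7)[OF A'(6) that] by simp
  qed
  \<comment> \<open>On the generators, the objects selected by \<open>und g\<close>, the splitting
    is prescribed to be the unit.\<close>
  let ?u = "func_comp (\<Delta>1 (chaotic_func A ?V ?c (fob (eta (T_monad T) A)))) (und g)"
  obtain l where l: "l \<in> hom (Alg_l (over I) (T_monad S)) E (F0 G (T.chaotic_alg ?V ?c fm))" "und l = ?u"
    using lax_into_chaotic[OF gD(1) F[unfolded T.chaotic_alg_def] func_comp_hom[OF gD(3) eta]]
    unfolding T.chaotic_alg_def E by blast
  obtain t where t: "t \<in> sfun J (T_monad T) (A, a) (T.chaotic_alg ?V ?c fm)" "postcomp (F0 G (T.chaotic_alg ?V ?c fm)) (\<Delta>1 t) g = l"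
    using l(1) bij_betw_imp_surj_on[OF c(3)[OF F], symmetric] by auto
  have th: "t \<in> hom (over J) A (chaotic ?V ?c)"
    and ts: "func_comp (chaotic_func (T_cat T (chaotic ?V ?c)) ?V ?c fm) (F1 (T_fun T) t) = func_comp t a"
    using t(1) by (simp_all add: T.chaotic_alg_def sfun_iff)
  have tV: "fob t x \<in> ?V" if "x \<in> Obj A" for x using hom_overD(5)[OF th that] by simp
  \<comment> \<open>The action of \<open>A\<close>, as a strict morphism from the chaotic free
    algebra to the chaotic algebra on the objects of \<open>A\<close>. After \<open>t\<close> it is
    to agree with \<open>?w\<close>, the identity on objects.\<close>
  let ?a = "chaotic_func (chaotic ?V ?c) (Obj A) (Col A) (fob a)"
  have as: "?a \<in> sfun J (T_monad T) (T.chaotic_alg ?V ?c fm) (T.chaotic_alg (Obj A) (Col A) (fob a))"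
    unfolding T.chaotic_alg_def[of ?V ?c fm]
  proof (rule T.chaotic_sfunI[OF F[unfolded T.chaotic_alg_def] U])
    show "fob a x \<in> Obj A \<and> Col A (fob a x) = Col (chaotic ?V ?c) x" if "x \<in> Obj (chaotic ?V ?c)" for x
      using that hom_overD(5,7)[OF A'(4)] by simp
    fix z assume "z \<in> Obj (T_cat T (chaotic ?V ?c))"
    then have z: "z \<in> Obj (T_cat T (T_cat T A))" by simp
    show "fob a (tup [] (opn z) (map (fob a) (args z))) = fob a (fob (chaotic_func (T_cat T (chaotic ?V ?c)) ?V ?c fm) z)"
      using A'(12)[OF z] fm[OF z] z by (simp add: T.T_fun_ob[OF A'(4) z] chaotic_func_def)
  qed
  let ?w = "chaotic_func A (Obj A) (Col A) (\<lambda>x. x)"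
  have ws: "?w \<in> sfun J (T_monad T) (A, a) (T.chaotic_alg (Obj A) (Col A) (fob a))"
  proof (rule T.chaotic_sfunI[OF A U])
    show "fob a (tup [] (opn z) (map (\<lambda>x. x) (args z))) = fob a z" if "z \<in> Obj (T_cat T A)" for z
      using T_obj_components(1)[OF that] by simp
  qed simp
  note at = T.TM.sfun_comp(1)[OF A F U t(1) as]
  have pc: "postcomp (F0 G (T.chaotic_alg (Obj A) (Col A) (fob a))) (\<Delta>1 v) g \<in>
      hom (Alg_l (over I) (T_monad S)) E (F0 G (T.chaotic_alg (Obj A) (Col A) (fob a)))"
    if "v \<in> sfun J (T_monad T) (A, a) (T.chaotic_alg (Obj A) (Col A) (fob a))" for v
    using c(3)[OF U] that by (auto simp: bij_betw_def)
  have tu: "func_comp (\<Delta>1 t) (und g) = ?u" using t(2) l(2) by (auto simp: postcomp_def)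
  \<comment> \<open>On generators both morphisms are the identity, by the unit law of
    \<open>a\<close>; so they correspond to the same lax morphism and are equal.\<close>
  have "postcomp (F0 G (T.chaotic_alg (Obj A) (Col A) (fob a))) (\<Delta>1 (func_comp ?a t)) g =
      postcomp (F0 G (T.chaotic_alg (Obj A) (Col A) (fob a))) (\<Delta>1 ?w) g"
  proof (rule lax_into_chaotic_eq[OF pc[OF at, unfolded T.chaotic_alg_def[of "Obj A"]] pc[OF ws, unfolded T.chaotic_alg_def[of "Obj A"]], folded T.chaotic_alg_def])
    fix x assume "x \<in> Obj (fst E)"
    then have x: "x \<in> Obj E1" by (simp add: E)
    obtain i y where y: "fob (und g) x = pr i y" "i \<in> I" "y \<in> Obj A" "Col A y = f i"
      using ug(5)[OF x] by (rule Delta_objE)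
    have gt: "pr i y \<in> Obj (\<Delta> A)" using y by simp
    have "fob (func_comp (\<Delta>1 t) (und g)) x = fob ?u x" unfolding tu ..
    then have ty: "fob t y = fob (eta (T_monad T) A) y"
      using x y by (simp add: ug hom_overD[OF th] chaotic_func_def)
    have "fob (func_comp ?a t) y = y"
      using y(3) ty A'(10)[OF y(3)] tV[OF y(3)] hom_overD(3)[OF th] by (simp add: chaotic_func_def)
    then show "fob (und (postcomp (F0 G (T.chaotic_alg (Obj A) (Col A) (fob a))) (\<Delta>1 (func_comp ?a t)) g)) x =
        fob (und (postcomp (F0 G (T.chaotic_alg (Obj A) (Col A) (fob a))) (\<Delta>1 ?w) g)) x"
      using x y by (simp add: postcomp_def ug chaotic_func_def hom_overD(3)[OF th])
  qed
  then have atw: "func_comp ?a t = ?w"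
    using inj_onD[OF bij_betw_imp_inj_on[OF c(3)[OF U]]] at ws by blast
  have 1: "fob a (fob t x) = x" if "x \<in> Obj A" for x
    using arg_cong[OF atw, of "\<lambda>H. fob H x"] that tV[OF that] hom_overD(3)[OF th]
    by (simp add: chaotic_func_def)
  \<comment> \<open>Compatibility with the operations is the strictness of \<open>t\<close>, read on
    objects.\<close>
  have 2: "fob t (fob a z) = fob (mu (T_monad T) A) (tup [] (opn z) (map (fob t) (args z)))" if z: "z \<in> Obj (T_cat T A)" for z
  proof -
    have "fob (F1 (T_fun T) t) z \<in> Obj (T_cat T (chaotic ?V ?c))" using hom_overD(5)[OF T.T_fun_hom[OF th] z] .
    then have z': "tup [] (opn z) (map (fob t) (args z)) \<in> Obj (T_cat T (T_cat T A))"
      using T.T_fun_ob[OF th z] by simp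
    then show ?thesis
      using arg_cong[OF ts, of "\<lambda>H. fob H z"] z T.T_fun_ob[OF th z] hom_overD(3)[OF T.T_fun_hom[OF th]] hom_overD(3)[OF A'(4)] fm[OF z']
      by (simp add: chaotic_func_def hom_overD(3)[OF th])
  qed
  show ?thesis using tV 1 2 by (intro exI[of _ "fob t"]) simp
qed

section \<open>Quotients by thin congruences\<close>

text \<open>
  \<open>N x y f\<close> singles out arrows \<open>f : x \<rightarrow> y\<close> of an algebra that form a wide subgroupoid with at most one
  arrow between any two objects.  The quotient by \<open>N\<close> is realized on representatives of the objects.
\<close>

locale thin_congruence = set_operad T for T :: "'u::small operad" +
  fixes A :: "'u cat" and a :: "'u func" and N :: "'u \<Rightarrow> 'u \<Rightarrow> 'u \<Rightarrow> bool"
  assumes alg: "(A, a) \<in> algs (over (colours T)) (T_monad T)"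
    and N_arr: "N x y f \<Longrightarrow> x \<in> Obj A" "N x y f \<Longrightarrow> y \<in> Obj A" "N x y f \<Longrightarrow> f \<in> Arr A"
      "N x y f \<Longrightarrow> Dom A f = x" "N x y f \<Longrightarrow> Cod A f = y"
    and N_thin: "N x y f \<Longrightarrow> N x y g \<Longrightarrow> f = g"
    and N_Ide: "x \<in> Obj A \<Longrightarrow> N x x (Ide A x)"
    and N_sym: "N x y f \<Longrightarrow> \<exists>g. N y x g"
    and N_Com: "N x y f \<Longrightarrow> N y z g \<Longrightarrow> N x z (Com A g f)"
    and N_action: "w \<in> Arr (T_cat T A) \<Longrightarrow> (\<And>f. f \<in> set (args w) \<Longrightarrow> N (Dom A f) (Cod A f) f) \<Longrightarrow>
      N (Dom A (far a w)) (Cod A (far a w)) (far a w)"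
begin

lemmas AD = TM.algD[OF alg, simplified]

text \<open>Since \<open>SOME\<close> depends only on the predicate, objects related by
  \<open>N\<close> get the same representative.\<close>

definition rep :: "'u \<Rightarrow> 'u" where
  "rep x = (SOME y. \<exists>f. N x y f)"

definition nu :: "'u \<Rightarrow> 'u" where
  "nu x = (THE f. N x (rep x) f)"

definition nui :: "'u \<Rightarrow> 'u" where
  "nui x = (THE f. N (rep x) x f)"

lemma nu: "x \<in> Obj A \<Longrightarrow> N x (rep x) (nu x)"
proof -
  assume x: "x \<in> Obj A"
  have "\<exists>f. N x (rep x) f" unfolding rep_def
    using N_Ide[OF x] by (intro someI[of "\<lambda>y. \<exists>f. N x y f" x]) blast
  then obtain f where f: "N x (rep x) f" by blast
  show ?thesis unfolding nu_def by (rule theI[of "\<lambda>f. N x (rep x) f", OF f]) (rule N_thin[OF _ f])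
qed

lemma nui: "x \<in> Obj A \<Longrightarrow> N (rep x) x (nui x)"
proof -
  assume x: "x \<in> Obj A"
  obtain f where f: "N (rep x) x f" using N_sym[OF nu[OF x]] by blast
  show ?thesis unfolding nui_def by (rule theI[of "\<lambda>f. N (rep x) x f", OF f]) (rule N_thin[OF _ f])
qed

lemma rep_eq: "N x y f \<Longrightarrow> rep x = rep y"
proof -
  assume f: "N x y f"
  obtain g where g: "N y x g" using N_sym[OF f] by blast
  have "(\<exists>h. N x z h) \<longleftrightarrow> (\<exists>h. N y z h)" for z using N_Com[OF f] N_Com[OF g] by blast
  then show ?thesis by (simp add: rep_def)
qed

lemma rep_Obj: "x \<in> Obj A \<Longrightarrow> rep x \<in> Obj A"
  using N_arr(2)[OF nu] .

lemma rep_rep: "x \<in> Obj A \<Longrightarrow> rep (rep x) = rep x"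
  using rep_eq[OF nu] by simp

lemma nu_arr:
  assumes "x \<in> Obj A"
  shows "nu x \<in> Arr A" "Dom A (nu x) = x" "Cod A (nu x) = rep x"
    "nui x \<in> Arr A" "Dom A (nui x) = rep x" "Cod A (nui x) = x"
    "Com A (nui x) (nu x) = Ide A x" "Com A (nu x) (nui x) = Ide A (rep x)"
proof -
  note n = nu[OF assms] and i = nui[OF assms]
  show "nu x \<in> Arr A" "Dom A (nu x) = x" "Cod A (nu x) = rep x"
    "nui x \<in> Arr A" "Dom A (nui x) = rep x" "Cod A (nui x) = x"
    using N_arr(3-5)[OF n] N_arr(3-5)[OF i] by auto
  show "Com A (nui x) (nu x) = Ide A x" by (rule N_thin[OF N_Com[OF n i] N_Ide[OF assms]])
  show "Com A (nu x) (nui x) = Ide A (rep x)" by (rule N_thin[OF N_Com[OF i n] N_Ide[OF rep_Obj[OF assms]]])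
qed

lemma nu_rep:
  assumes x: "x \<in> Obj A"
  shows "nu (rep x) = Ide A (rep x)" "nui (rep x) = Ide A (rep x)"
  using N_thin nu[OF rep_Obj[OF x]] nui[OF rep_Obj[OF x]] N_Ide[OF rep_Obj[OF x]] unfolding rep_rep[OF x] by blast+

text \<open>As \<open>N\<close> has at most one arrow between two objects, dividing it out amounts
  to passing to the full subcategory on one object of each class.\<close>

definition B :: "'u cat" where
  "B = subcat A (rep ` Obj A) {f \<in> Arr A. Dom A f \<in> rep ` Obj A \<and> Cod A f \<in> rep ` Obj A}"

definition iota :: "'u func" where
  "iota = mk_func B A (\<lambda>x. x) (\<lambda>f. f)"

definition eps :: "'u func" where
  "eps = mk_func A B rep (\<lambda>f. Com A (nu (Cod A f)) (Com A f (nui (Dom A f))))"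

lemma B_simps [simp]:
  "Obj B = rep ` Obj A" "Dom B = Dom A" "Cod B = Cod A" "Ide B = Ide A" "Com B = Com A" "Col B = Col A"
  "f \<in> Arr B \<longleftrightarrow> f \<in> Arr A \<and> Dom A f \<in> rep ` Obj A \<and> Cod A f \<in> rep ` Obj A"
  by (simp_all add: B_def)

lemma iota: "iota \<in> hom (over J) B A" and B_over: "cat_over J B"
proof -
  note D = cat_overD[OF AD(1)]
  have s: "rep ` Obj A \<subseteq> Obj A" using rep_Obj by auto
  show "iota \<in> hom (over J) B A" "cat_over J B"
    unfolding iota_def B_def
    by (rule subcat_over[OF AD(1) s]; use s in \<open>auto simp: D rep_Obj\<close>)+
qed

lemma eps_arr:
  assumes f: "f \<in> Arr A"
  shows "Com A (nu (Cod A f)) (Com A f (nui (Dom A f))) \<in> Arr A"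
    "Dom A (Com A (nu (Cod A f)) (Com A f (nui (Dom A f)))) = rep (Dom A f)"
    "Cod A (Com A (nu (Cod A f)) (Com A f (nui (Dom A f)))) = rep (Cod A f)"
  using f by (simp_all add: cat_overD[OF AD(1)] nu_arr)

text \<open>In the image of a composite, the arrows to and from the middle representative cancel;
  this gives functoriality.\<close>

lemma eps: "eps \<in> hom (over J) A B"
  unfolding eps_def
proof (rule mk_func_hom[OF AD(1) B_over])
  note D = cat_overD[OF AD(1)]
  show "rep x \<in> Obj B" if "x \<in> Obj A" for x using that by simp
  show "Col B (rep x) = Col A x" if "x \<in> Obj A" for x
    using D(3)[OF nu_arr(1)[OF that]] nu_arr[OF that] by simp
  show "Com A (nu (Cod A (Ide A x))) (Com A (Ide A x) (nui (Dom A (Ide A x)))) = Ide B (rep x)" if "x \<in> Obj A" for x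
    using nu_arr[OF that] that by (simp add: D)
  fix f assume f: "f \<in> Arr A"
  note e = eps_arr[OF f]
  show "Com A (nu (Cod A f)) (Com A f (nui (Dom A f))) \<in> Arr B"
    "Dom B (Com A (nu (Cod A f)) (Com A f (nui (Dom A f)))) = rep (Dom A f)"
    "Cod B (Com A (nu (Cod A f)) (Com A f (nui (Dom A f)))) = rep (Cod A f)"
    using e f by (simp_all add: D)
next
  note D = cat_overD[OF AD(1)]
  fix f g assume f: "f \<in> Arr A" and g: "g \<in> Arr A" and fg: "Cod A f = Dom A g"
  note n = nu_arr[OF D(1)[OF f]] nu_arr[OF D(2)[OF f]] nu_arr[OF D(2)[OF g]]
  let ?nc = "nu (Cod A g)" and ?nd = "nui (Dom A f)" and ?n = "nu (Cod A f)" and ?m = "nui (Cod A f)"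
  have "Com A (Com A ?nc (Com A g ?m)) (Com A ?n (Com A f ?nd)) = Com A ?nc (Com A (Com A g ?m) (Com A ?n (Com A f ?nd)))"
    using f g fg n by (intro D(13)[symmetric]) (simp_all add: D)
  also have "Com A (Com A g ?m) (Com A ?n (Com A f ?nd)) = Com A g (Com A ?m (Com A ?n (Com A f ?nd)))"
    using f g fg n by (intro D(13)[symmetric]) (simp_all add: D)
  also have "Com A ?m (Com A ?n (Com A f ?nd)) = Com A (Com A ?m ?n) (Com A f ?nd)"
    using f g fg n by (intro D(13)) (simp_all add: D)
  also have "\<dots> = Com A f ?nd" using f n by (simp add: D)
  also have "Com A g (Com A f ?nd) = Com A (Com A g f) ?nd"
    using f g fg n by (intro D(13)) (simp_all add: D)
  finally show "Com A (nu (Cod A (Com A g f))) (Com A (Com A g f) (nui (Dom A (Com A g f)))) =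
      Com B (Com A (nu (Cod A g)) (Com A g (nui (Dom A g)))) (Com A (nu (Cod A f)) (Com A f (nui (Dom A f))))"
    using f g fg by (simp add: D(11,12))
qed

lemma iota_simps [simp]:
  "fsrc iota = B" "ftgt iota = A" "x \<in> Obj B \<Longrightarrow> fob iota x = x" "f \<in> Arr B \<Longrightarrow> far iota f = f"
  by (simp_all add: iota_def)

lemma eps_simps [simp]:
  "fsrc eps = A" "ftgt eps = B" "x \<in> Obj A \<Longrightarrow> fob eps x = rep x"
  "f \<in> Arr A \<Longrightarrow> far eps f = Com A (nu (Cod A f)) (Com A f (nui (Dom A f)))"
  by (simp_all add: eps_def)

text \<open>The conjugate of an arrow of \<open>N\<close> is an arrow of \<open>N\<close> from a
  representative to itself, hence the identity.\<close>

lemma eps_N: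
  assumes n: "N x y f"
  shows "far eps f = Ide A (rep y)"
proof -
  note a = N_arr[OF n]
  have "N (rep x) (rep y) (Com A (nu y) (Com A f (nui x)))"
    by (rule N_Com[OF N_Com[OF nui[OF a(1)] n] nu[OF a(2)]])
  then have "Com A (nu y) (Com A f (nui x)) = Ide A (rep y)"
    using N_thin N_Ide[OF rep_Obj[OF a(2)]] rep_eq[OF n] by metis
  then show ?thesis using a by simp
qed

text \<open>At representatives the connecting arrows are identities, so the retraction is strict and
  not merely up to isomorphism.\<close>

lemma eps_iota: "func_comp eps iota = Idm (over J) B"
proof (rule hom_over_eqI[OF func_comp_hom[OF iota eps] Idm_hom[OF B_over]])
  note D = cat_overD[OF AD(1)]
  show "fob (func_comp eps iota) x = fob (Idm (over J) B) x" if "x \<in> Obj B" for x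
    using that rep_Obj rep_rep by auto
  fix f assume f: "f \<in> Arr B"
  then obtain x y where x: "x \<in> Obj A" "y \<in> Obj A" "Dom A f = rep x" "Cod A f = rep y" by auto
  then show "far (func_comp eps iota) f = far (Idm (over J) B) f"
    using f by (simp add: nu_rep D)
qed

definition nut :: "'u ntrans" where
  "nut = mk_ntrans (Idm (over J) A) (func_comp iota eps) nu"

lemma nut: "nut \<in> cells (over J) (Idm (over J) A) (func_comp iota eps)"
  unfolding nut_def
proof (rule mk_ntrans_cells[OF Idm_hom[OF AD(1)] func_comp_hom[OF eps iota]])
  note D = cat_overD[OF AD(1)] and E = hom_overD[OF eps]
  show "nu x \<in> Arr A \<and> Dom A (nu x) = fob (Idm (over J) A) x \<and> Cod A (nu x) = fob (func_comp iota eps) x"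
    if "x \<in> Obj A" for x
    using that nu_arr[OF that] E(5)[OF that] by simp
  fix f assume f: "f \<in> Arr A"
  note n = nu_arr[OF D(1)[OF f]] nu_arr[OF D(2)[OF f]]
  let ?nc = "nu (Cod A f)" and ?nd = "nui (Dom A f)" and ?n = "nu (Dom A f)"
  have "Com A (Com A ?nc (Com A f ?nd)) ?n = Com A ?nc (Com A (Com A f ?nd) ?n)"
    using f n by (intro D(13)[symmetric]) (simp_all add: D)
  also have "Com A (Com A f ?nd) ?n = Com A f (Com A ?nd ?n)"
    using f n by (intro D(13)[symmetric]) (simp_all add: D)
  also have "\<dots> = f" using f n by (simp add: D)
  finally show "Com A (nu (Cod A f)) (far (Idm (over J) A) f) = Com A (far (func_comp iota eps) f) (nu (Dom A f))"
    using f E(6)[OF f] by simp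
qed

text \<open>Applying \<open>eps\<close> makes the choice of representatives irrelevant.\<close>

definition act_B :: "'u func" where
  "act_B = func_comp (func_comp eps a) (F1 (T_fun T) iota)"

lemma act_B: "act_B \<in> hom (over J) (T_cat T B) B"
  unfolding act_B_def using func_comp_hom[OF T_fun_hom[OF iota] func_comp_hom[OF AD(4) eps]] .

lemma T_N:
  assumes z: "z \<in> Obj (T_cat T A)" and p: "\<And>x. x \<in> set (args z) \<Longrightarrow> N x (p x) (t x)"
    and w: "w \<in> Arr (T_cat T A)" "args w = map t (args z)"
  shows "N (Dom A (far a w)) (Cod A (far a w)) (far a w)"
proof (rule N_action[OF w(1)])
  fix f assume "f \<in> set (args w)"
  then obtain x where "x \<in> set (args z)" "f = t x" using w(2) by auto
  then show "N (Dom A f) (Cod A f) f" using p[of x] N_arr(4,5)[OF p[of x]] by simp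
qed

text \<open>The entries of this arrow of \<open>T_cat T A\<close> lie in \<open>N\<close>, and
  \<open>N\<close> is closed under the action.\<close>

lemma T_nut:
  assumes z: "z \<in> Obj (T_cat T A)"
  shows "N (fob a z) (fob a (fob (F1 (T_fun T) (func_comp iota eps)) z)) (far a (ncmp (F2 (T_fun T) nut) z))"
proof -
  note t = T_fun_cells[OF nut Idm_hom[OF AD(1)]]
  note tD = cells_overD[OF t T_fun_hom[OF Idm_hom[OF AD(1)]]]
  have xs: "x \<in> Obj A" if "x \<in> set (args z)" for x using T_obj_components(3)[OF z] that by auto
  have w: "ncmp (F2 (T_fun T) nut) z \<in> Arr (T_cat T A)" "Dom (T_cat T A) (ncmp (F2 (T_fun T) nut) z) = z"
    using tD(4,5)[OF z] TM.F1_Idm[OF AD(1)] z by simp_all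
  have "map (ncmp nut) (args z) = map nu (args z)" using xs by (simp add: nut_def)
  then have "args (ncmp (F2 (T_fun T) nut) z) = map nu (args z)"
    using T_fun_cell[OF nut Idm_hom[OF AD(1)] z] by simp
  from T_N[OF z _ w(1) this] have "N (Dom A (far a (ncmp (F2 (T_fun T) nut) z)))
      (Cod A (far a (ncmp (F2 (T_fun T) nut) z))) (far a (ncmp (F2 (T_fun T) nut) z))"
    using nu[OF xs] by blast
  then show ?thesis using w tD(6)[OF z] hom_overD(9,10)[OF AD(4) w(1)] by simp
qed

text \<open>After the action, the components of the transformation obtained from \<open>nut\<close>
  lie in \<open>N\<close>, so \<open>eps\<close> makes them identities. Its naturality square then
  says that replacing arguments by their representatives changes nothing once \<open>eps\<close> is
  applied.\<close>

lemma eps_act: "func_comp eps a = func_comp act_B (F1 (T_fun T) eps)"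
proof -
  let ?ie = "func_comp iota eps"
  note ie = func_comp_hom[OF eps iota]
  note Te = T_fun_hom[OF eps] and Ti = T_fun_hom[OF iota] and Tie = T_fun_hom[OF ie]
  note ea = func_comp_hom[OF AD(4) eps]
  note t = T_fun_cells[OF nut Idm_hom[OF AD(1)]]
  note TI = T_fun_hom[OF Idm_hom[OF AD(1)]]
  note tD = cells_overD[OF t TI]
  note D = cat_overD[OF AD(1)] and TD = cat_overD[OF AD(2)] and BD = cat_overD[OF B_over]
    and aD = hom_overD[OF AD(4)] and eD = hom_overD[OF eps] and eaD = hom_overD[OF ea] and TieD = hom_overD[OF Tie]
  have T1: "F1 (T_fun T) (Idm (over J) A) = Idm (over J) (T_cat T A)" using TM.F1_Idm[OF AD(1)] by simp
  have "func_comp act_B (F1 (T_fun T) eps) = func_comp (func_comp eps a) (F1 (T_fun T) ?ie)"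
    unfolding act_B_def using func_comp_assoc[OF Te Ti ea] TM.F1_comp[OF eps iota] by simp
  also have "\<dots> = func_comp eps a"
  proof (rule hom_over_eqI[OF func_comp_hom[OF Tie ea] ea])
    fix z assume z: "z \<in> Obj (T_cat T A)"
    show "fob (func_comp (func_comp eps a) (F1 (T_fun T) ?ie)) z = fob (func_comp eps a) z"
      using rep_eq[OF T_nut[OF z]] z TieD(5)[OF z] aD(5)[OF z] aD(5)[OF TieD(5)[OF z]] by (simp add: aD TieD(3) hom_overD(3)[OF eps])
  next
    fix w assume w: "w \<in> Arr (T_cat T A)"
    let ?x = "Dom (T_cat T A) w" and ?y = "Cod (T_cat T A) w"
    have o: "?x \<in> Obj (T_cat T A)" "?y \<in> Obj (T_cat T A)" using TD w by auto
    let ?n = "\<lambda>z. ncmp (F2 (T_fun T) nut) z"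
    have ta: "?n ?x \<in> Arr (T_cat T A)" "?n ?y \<in> Arr (T_cat T A)" using tD(4) o by auto
    have sq: "Com (T_cat T A) (?n ?y) w = Com (T_cat T A) (far (F1 (T_fun T) ?ie) w) (?n ?x)"
      using tD(7)[OF w] w T1 by simp
    have k: "far (func_comp eps a) (?n z) = Ide A (rep (fob a z))" if z: "z \<in> Obj (T_cat T A)" for z
      using eps_N[OF T_nut[OF z]] rep_eq[OF T_nut[OF z]] tD(4)[OF z] aD by simp
    have "far (func_comp eps a) (Com (T_cat T A) (?n ?y) w) = Com B (Ide A (rep (fob a ?y))) (far (func_comp eps a) w)"
      using eaD(11)[OF w ta(2)] tD(5)[OF o(2)] T1 o(2) k[OF o(2)] by simp
    also have "\<dots> = far (func_comp eps a) w"
      using BD(9)[OF eaD(6)[OF w], of "rep (fob a ?y)"] eaD(10)[OF w] o(2) aD(3) aD(5)[OF o(2)] by simp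
    finally have l: "far (func_comp eps a) (Com (T_cat T A) (?n ?y) w) = far (func_comp eps a) w" .
    let ?w = "far (F1 (T_fun T) ?ie) w"
    have wA: "?w \<in> Arr (T_cat T A)" using TieD(6)[OF w] .
    have dw: "Dom (T_cat T A) ?w = fob (F1 (T_fun T) ?ie) ?x" using TieD(9)[OF w] .
    have "far (func_comp eps a) (Com (T_cat T A) ?w (?n ?x)) = Com B (far (func_comp eps a) ?w) (Ide A (rep (fob a ?x)))"
      using eaD(11)[OF ta(1) wA] tD(6)[OF o(1)] dw k[OF o(1)] by simp
    also have "\<dots> = far (func_comp eps a) ?w"
    proof -
      have "Dom B (far (func_comp eps a) ?w) = fob (func_comp eps a) (fob (F1 (T_fun T) ?ie) ?x)"
        using eaD(9)[OF wA] dw by simp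
      also have "\<dots> = rep (fob a (fob (F1 (T_fun T) ?ie) ?x))"
        using TieD(5)[OF o(1)] aD(3) aD(5)[OF TieD(5)[OF o(1)]] by simp
      also have "\<dots> = rep (fob a ?x)" using rep_eq[OF T_nut[OF o(1)]] by simp
      finally have "Dom B (far (func_comp eps a) ?w) = rep (fob a ?x)" .
      then show ?thesis using BD(8)[OF eaD(6)[OF wA], of "rep (fob a ?x)"] by simp
    qed
    finally have "far (func_comp eps a) ?w = far (func_comp eps a) w" using l sq by simp
    then show "far (func_comp (func_comp eps a) (F1 (T_fun T) ?ie)) w = far (func_comp eps a) w"
      using w TieD(3) by simp
  qed
  finally show ?thesis ..
qed

text \<open>Both laws are carried back along \<open>iota\<close> to those of \<open>a\<close>;
  \<open>eps_act\<close> then absorbs the inner passage to representatives.\<close>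

lemma B_alg: "(B, act_B) \<in> algs (over J) (T_monad T)"
proof -
  note Te = T_fun_hom[OF eps] and Ti = T_fun_hom[OF iota] and ea = func_comp_hom[OF AD(4) eps]
  note TTi = T_fun_hom[OF Ti] and TB = T_fun_hom[OF act_B]
  note eB = eta_hom[OF B_over] and mB = mu_hom[OF B_over]
  have "func_comp act_B (eta (T_monad T) B) = func_comp (func_comp eps a) (func_comp (eta (T_monad T) A) iota)"
    unfolding act_B_def using func_comp_assoc[OF eB Ti ea] TM.eta_natural[OF iota] by simp
  also have "\<dots> = func_comp eps (func_comp (func_comp a (eta (T_monad T) A)) iota)"
    using func_comp_assoc[OF func_comp_hom[OF iota AD(6)] AD(4) eps] func_comp_assoc[OF iota AD(6,4)] by simp
  also have "\<dots> = Idm (over J) B" using AD(8) func_comp_Idm[OF iota] eps_iota by simp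
  finally have 1: "func_comp act_B (eta (T_monad T) B) = Idm (over J) B" .
  have "func_comp act_B (mu (T_monad T) B) = func_comp (func_comp eps a) (func_comp (mu (T_monad T) A) (F1 (T_fun T) (F1 (T_fun T) iota)))"
    unfolding act_B_def using func_comp_assoc[OF mB Ti ea] mu_natural[OF iota] by simp
  also have "\<dots> = func_comp eps (func_comp (func_comp a (mu (T_monad T) A)) (F1 (T_fun T) (F1 (T_fun T) iota)))"
    using func_comp_assoc[OF func_comp_hom[OF TTi AD(7)] AD(4) eps] func_comp_assoc[OF TTi AD(7,4)] by simp
  also have "\<dots> = func_comp (func_comp eps a) (func_comp (F1 (T_fun T) a) (F1 (T_fun T) (F1 (T_fun T) iota)))"
    using AD(9) func_comp_assoc[OF func_comp_hom[OF TTi AD(5)] AD(4) eps] func_comp_assoc[OF TTi AD(5,4)] by simp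
  also have "\<dots> = func_comp act_B (func_comp (F1 (T_fun T) eps) (func_comp (F1 (T_fun T) a) (F1 (T_fun T) (F1 (T_fun T) iota))))"
    unfolding eps_act by (rule func_comp_assoc[OF func_comp_hom[OF TTi AD(5)] Te act_B])
  also have "func_comp (F1 (T_fun T) eps) (func_comp (F1 (T_fun T) a) (F1 (T_fun T) (F1 (T_fun T) iota))) = F1 (T_fun T) act_B"
    unfolding act_B_def using TM.F1_comp[OF Ti ea] TM.F1_comp[OF AD(4) eps] func_comp_assoc[OF TTi AD(5) Te] by simp
  finally show ?thesis unfolding algs_over using B_over act_B 1 by simp
qed

lemma eps_sfun: "eps \<in> sfun J (T_monad T) (A, a) (B, act_B)"
  using eps eps_act by (simp add: sfun_iff)

section \<open>Commutativity and universality of the quotient\<close>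

lemma N_perm_arrow:
  assumes z: "z \<in> Obj (T_cat T A)" and r: "\<rho> \<in> perms (length (args z))"
  shows "N (fob a (permute \<rho> z)) (fob a z) (far a (perm_arrow A \<rho> z))"
proof -
  note p = perm_arrow[OF AD(1) z r]
  have "N (Dom A (far a (perm_arrow A \<rho> z))) (Cod A (far a (perm_arrow A \<rho> z))) (far a (perm_arrow A \<rho> z))"
  proof (rule N_action[OF p(1)])
    fix f assume "f \<in> set (args (perm_arrow A \<rho> z))"
    then obtain k where "k \<in> set \<rho>" "f = Ide A (args z ! k)" by (auto simp: perm_arrow_def)
    moreover have "args z ! k \<in> Obj A" if "k \<in> set \<rho>" for k
      using permsD(3)[OF r] T_obj_components(3)[OF z] that by auto
    ultimately show "N (Dom A f) (Cod A f) f" using N_Ide cat_overD(6,7)[OF AD(1)] by simp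
  qed
  then show ?thesis using hom_overD(9,10)[OF AD(4) p(1)] p by simp
qed

lemma T_iota_ob:
  assumes z: "z \<in> Obj (T_cat T B)"
  shows "fob (F1 (T_fun T) iota) z = z" "z \<in> Obj (T_cat T A)"
proof -
  note c = T_obj_components[OF z]
  have "map (fob iota) (args z) = args z" using c(3) by (intro map_idI) auto
  then show 1: "fob (F1 (T_fun T) iota) z = z" using T_fun_ob[OF iota z] c(1) by simp
  show "z \<in> Obj (T_cat T A)" using hom_overD(5)[OF T_fun_hom[OF iota] z] 1 by simp
qed

text \<open>The action of \<open>A\<close> sends permutation arrows into \<open>N\<close>, and
  \<open>eps\<close> sends \<open>N\<close> to identities.\<close>

lemma B_kills_perms: "kills_perms T B act_B"
  unfolding kills_perms_def
proof (intro ballI)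
  fix u \<rho> assume u: "u \<in> Obj (T_cat T B)" and r: "\<rho> \<in> perms (length (args u))"
  note p = perm_arrow[OF B_over u r] and i = T_iota_ob[OF u] and aD = hom_overD[OF AD(4)]
  note pA = perm_arrow[OF AD(1) i(2) r]
  have e: "perm_arrow B \<rho> u = perm_arrow A \<rho> u" by (simp add: perm_arrow_def)
  have m: "map (far iota) (args (perm_arrow B \<rho> u)) = args (perm_arrow B \<rho> u)"
    using T_arr_components(5)[OF p(1)] by (intro map_idI) auto
  have "far (F1 (T_fun T) iota) (perm_arrow B \<rho> u) = perm_arrow A \<rho> u"
    using T_fun_ar[OF iota p(1)] T_arr_components(1)[OF p(1)] m e by simp
  moreover have "far (F1 (T_fun T) iota) (perm_arrow B \<rho> u) \<in> Arr (T_cat T A)"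
    using hom_overD(6)[OF T_fun_hom[OF iota] p(1)] .
  ultimately have "far act_B (perm_arrow B \<rho> u) = far eps (far a (perm_arrow A \<rho> u))"
    unfolding act_B_def using p(1) aD(3) hom_overD(3)[OF T_fun_hom[OF iota]] by simp
  also have "\<dots> = Ide A (rep (fob a u))" by (rule eps_N[OF N_perm_arrow[OF i(2) r]])
  also have "\<dots> = Ide (ftgt act_B) (fob act_B u)"
    unfolding act_B_def using u i aD(3,5) hom_overD(3)[OF T_fun_hom[OF iota]] by simp
  finally show "far act_B (perm_arrow B \<rho> u) = Ide (ftgt act_B) (fob act_B u)" .
qed

text \<open>A functor that kills \<open>N\<close> does not notice conjugation by arrows of
  \<open>N\<close>, so it is recovered from its restriction to the representatives.\<close>

lemma kills_N_factor:
  assumes X: "(X, x) \<in> algs (over J) (T_monad T)" and w: "w \<in> sfun J (T_monad T) (A, a) (X, x)"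
    and k: "\<And>y z f. N y z f \<Longrightarrow> far w f = Ide X (fob w z)"
  shows "func_comp w iota \<in> sfun J (T_monad T) (B, act_B) (X, x)" "func_comp (func_comp w iota) eps = w"
proof -
  have wh: "w \<in> hom (over J) A X" and ws: "func_comp x (F1 (T_fun T) w) = func_comp w a"
    using w by (simp_all add: sfun_iff)
  note X' = TM.algD[OF X, simplified]
  note wi = func_comp_hom[OF iota wh]
  note D = cat_overD[OF AD(1)] and XD = cat_overD[OF X'(1)] and wD = hom_overD[OF wh] and eD = hom_overD[OF eps]
  have ko: "fob w y = fob w z" if n: "N y z f" for y z f
  proof -
    note a = N_arr[OF n]
    have "fob w y = Dom X (far w f)" using wD(9)[OF a(3)] a by simp
    also have "\<dots> = fob w z" using k[OF n] XD(6)[OF wD(5)[OF a(2)]] by simp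
    finally show ?thesis .
  qed
  show e: "func_comp (func_comp w iota) eps = w"
  proof (rule hom_over_eqI[OF func_comp_hom[OF eps wi] wh])
    show "fob (func_comp (func_comp w iota) eps) y = fob w y" if "y \<in> Obj A" for y
      using that ko[OF nu[OF that]] by simp
    fix f assume f: "f \<in> Arr A"
    note n = nu_arr[OF D(1)[OF f]] nu_arr[OF D(2)[OF f]]
    have g: "Com A f (nui (Dom A f)) \<in> Arr A" "Cod A (Com A f (nui (Dom A f))) = Cod A f"
      using f n by (simp_all add: D)
    have "far w (Com A (nu (Cod A f)) (Com A f (nui (Dom A f)))) = Com X (far w (nu (Cod A f))) (Com X (far w f) (far w (nui (Dom A f))))"
      using f n g by (simp add: wD(11))
    also have "\<dots> = far w f"
      using k[OF nu[OF D(2)[OF f]]] ko[OF nu[OF D(2)[OF f]]] k[OF nui[OF D(1)[OF f]]] wD(6,9,10)[OF f]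
      by (simp add: XD(8,9))
    finally show "far (func_comp (func_comp w iota) eps) f = far w f"
      using f eD(6)[OF f] by simp
  qed
  note Tw = T_fun_hom[OF wh] and Ti = T_fun_hom[OF iota] and ea = func_comp_hom[OF AD(4) eps]
  have "func_comp x (F1 (T_fun T) (func_comp w iota)) = func_comp (func_comp w a) (F1 (T_fun T) iota)"
    using TM.F1_comp[OF iota wh] func_comp_assoc[OF Ti Tw X'(4)] ws by simp
  also have "func_comp w a = func_comp (func_comp w iota) (func_comp eps a)"
    using func_comp_assoc[OF AD(4) eps wi] e by simp
  also have "func_comp (func_comp (func_comp w iota) (func_comp eps a)) (F1 (T_fun T) iota) = func_comp (func_comp w iota) act_B"
    unfolding act_B_def by (rule func_comp_assoc[OF Ti ea wi])
  finally show "func_comp w iota \<in> sfun J (T_monad T) (B, act_B) (X, x)"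
    using wi by (simp add: sfun_iff)
qed

end

section \<open>The quotient as an equivalence\<close>

text \<open>Composing a naturality square with the inverse components on both sides shows that
  pointwise inverses are again natural.\<close>

lemma invertible_cell_overI:
  assumes t: "t \<in> cells (over J) G H" and G: "G \<in> hom (over J) X Y"
    and u: "\<And>x. x \<in> Obj X \<Longrightarrow> u x \<in> Arr Y \<and> Dom Y (u x) = fob H x \<and> Cod Y (u x) = fob G x \<and>
      Com Y (u x) (ncmp t x) = Ide Y (fob G x) \<and> Com Y (ncmp t x) (u x) = Ide Y (fob H x)"
  shows "mk_ntrans H G u \<in> cells (over J) H G" "Vc (over J) (mk_ntrans H G u) t = Idc (over J) G"
    "Vc (over J) t (mk_ntrans H G u) = Idc (over J) H" "invertible_cell (over J) t"
proof -
  note tD = cells_overD[OF t G]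
  note GD = hom_overD[OF G] and HD = hom_overD[OF tD(1)]
  note XD = cat_overD[OF GD(1)] and YD = cat_overD[OF GD(2)]
  show c: "mk_ntrans H G u \<in> cells (over J) H G"
  proof (rule mk_ntrans_cells[OF tD(1) G])
    show "u x \<in> Arr Y \<and> Dom Y (u x) = fob H x \<and> Cod Y (u x) = fob G x" if "x \<in> Obj X" for x
      using u[OF that] by simp
    fix f assume f: "f \<in> Arr X"
    let ?x = "Dom X f" and ?y = "Cod X f"
    have o: "?x \<in> Obj X" "?y \<in> Obj X" using f XD by auto
    note ux = u[OF o(1)] and uy = u[OF o(2)] and tx = tD(4-6)[OF o(1)] and ty = tD(4-6)[OF o(2)]
      and Gf = GD(6,9,10)[OF f] and Hf = HD(6,9,10)[OF f]
    have "Com Y (u ?y) (far H f) = Com Y (Com Y (u ?y) (far H f)) (Com Y (ncmp t ?x) (u ?x))"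
      using ux uy tx ty Gf Hf by (simp add: YD(8,10-12))
    also have "\<dots> = Com Y (Com Y (Com Y (u ?y) (far H f)) (ncmp t ?x)) (u ?x)"
      using ux uy tx ty Gf Hf by (intro YD(13)) (simp_all add: YD(10-12))
    also have "Com Y (Com Y (u ?y) (far H f)) (ncmp t ?x) = Com Y (u ?y) (Com Y (far H f) (ncmp t ?x))"
      using ux uy tx ty Gf Hf by (intro YD(13)[symmetric]) simp_all
    also have "Com Y (far H f) (ncmp t ?x) = Com Y (ncmp t ?y) (far G f)" using tD(7)[OF f] by simp
    also have "Com Y (u ?y) (Com Y (ncmp t ?y) (far G f)) = Com Y (Com Y (u ?y) (ncmp t ?y)) (far G f)"
      using ux uy tx ty Gf Hf by (intro YD(13)) simp_all
    also have "\<dots> = far G f" using uy Gf by (simp add: YD(9))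
    finally show "Com Y (u ?y) (far H f) = Com Y (far G f) (u ?x)" .
  qed
  show 1: "Vc (over J) (mk_ntrans H G u) t = Idc (over J) G" "Vc (over J) t (mk_ntrans H G u) = Idc (over J) H"
    unfolding Vc_over Idc_over using u by (auto simp: mk_ntrans_eq_iff tD GD HD)
  show "invertible_cell (over J) t"
    unfolding invertible_cell_def using t c 1 by (auto simp: cells_over intro!: bexI[of _ "mk_ntrans H G u"])
qed

text \<open>A strict morphism carries permutation arrows to permutation arrows, and the commutative
  action of \<open>X\<close> sends those to identities.\<close>

lemma (in set_operad) sfun_kills_perm_arrow:
  assumes A: "(A, a) \<in> algs (over J) (T_monad T)" and X: "(X, x) \<in> algs (over J) (T_monad T)" "kills_perms T X x"
    and w: "w \<in> sfun J (T_monad T) (A, a) (X, x)" and u: "u \<in> Obj (T_cat T A)" and r: "\<rho> \<in> perms (length (args u))"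
  shows "far w (far a (perm_arrow A \<rho> u)) = Ide X (fob w (fob a u))"
proof -
  have wh: "w \<in> hom (over J) A X" and ws: "func_comp x (F1 (T_fun T) w) = func_comp w a"
    using w by (simp_all add: sfun_iff)
  note AD = TM.algD[OF A, simplified] and XD = TM.algD[OF X(1), simplified] and wD = hom_overD[OF wh]
  note p = perm_arrow[OF AD(1) u r] and Tw = hom_overD[OF T_fun_hom[OF wh]]
  have xs: "args u ! k \<in> Obj A" if "k \<in> set \<rho>" for k
    using T_obj_components(3)[OF u] permsD(3)[OF r] that by auto
  have "far (F1 (T_fun T) w) (perm_arrow A \<rho> u) = perm_arrow X \<rho> (fob (F1 (T_fun T) w) u)"
    using T_fun_ar[OF wh p(1)] T_fun_ob[OF wh u] xs permsD(3)[OF r] by (simp add: perm_arrow_def wD)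
  moreover have "far x (perm_arrow X \<rho> (fob (F1 (T_fun T) w) u)) = Ide X (fob x (fob (F1 (T_fun T) w) u))"
    using X(2) Tw(5)[OF u] r hom_overD(4)[OF XD(4)] T_fun_ob[OF wh u] unfolding kills_perms_def by simp
  moreover have "far w (far a (perm_arrow A \<rho> u)) = far x (far (F1 (T_fun T) w) (perm_arrow A \<rho> u))"
    using arg_cong[OF ws, of "\<lambda>H. far H (perm_arrow A \<rho> u)"] p(1) Tw(3) hom_overD(3)[OF AD(4)] by simp
  moreover have "fob x (fob (F1 (T_fun T) w) u) = fob w (fob a u)"
    using arg_cong[OF ws, of "\<lambda>H. fob H u"] u Tw(3) hom_overD(3)[OF AD(4)] by simp
  ultimately show ?thesis by simp
qed

context thin_congruence
begin

lemma iota_eps: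
  "func_comp iota eps \<in> hom (over J) A A" "x \<in> Obj A \<Longrightarrow> fob (func_comp iota eps) x = rep x"
  using func_comp_hom[OF eps iota] by auto

text \<open>The transformation \<open>nut\<close> whiskered with
  \<open>func_comp a (F1 (T_fun T) s)\<close>; it is a coherence for \<open>s\<close> when
  \<open>s\<close> is strict up to passing to representatives.\<close>

definition nu_cell :: "'u cat \<Rightarrow> 'u func \<Rightarrow> 'u func \<Rightarrow> 'u ntrans" where
  "nu_cell D d s = mk_ntrans (func_comp a (F1 (T_fun T) s)) (func_comp s d) (\<lambda>z. nu (fob a (fob (F1 (T_fun T) s) z)))"

text \<open>This serves both the pseudo-inverse and the idempotent
  \<open>func_comp iota eps\<close>. By \<open>so\<close> the values of \<open>s\<close> are
  representatives, where the connecting arrow is the identity; this is the unit law. The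
  multiplication law holds because both sides are arrows of \<open>N\<close> with the same
  ends.\<close>

lemma nu_cell:
  assumes D: "(D, d) \<in> algs (over J) (T_monad T)" and s: "s \<in> hom (over J) D A"
    and sd: "func_comp s d = func_comp (func_comp iota eps) (func_comp a (F1 (T_fun T) s))"
    and so: "\<forall>x\<in>Obj D. rep (fob s x) = fob s x"
  shows "nu_cell D d s \<in> cells (over J) (func_comp a (F1 (T_fun T) s)) (func_comp s d)"
    "\<lparr>msrc = (D, d), mtgt = (A, a), und = s, coh = nu_cell D d s\<rparr> \<in> lax_mors (over J) (T_monad T)"
    "invertible_cell (over J) (nu_cell D d s)"
    "z \<in> Obj (T_cat T D) \<Longrightarrow> N (fob a (fob (F1 (T_fun T) s) z)) (fob s (fob d z)) (ncmp (nu_cell D d s) z)"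
proof -
  note DD = TM.algD[OF D, simplified]
  note Ts = T_fun_hom[OF s] and Td = T_fun_hom[OF DD(4)]
  note aTs = func_comp_hom[OF Ts AD(4)]
  note TsD = hom_overD[OF Ts] and sD = hom_overD[OF s] and aD = hom_overD[OF AD(4)] and dD = hom_overD[OF DD(4)]
    and aTsD = hom_overD[OF aTs] and TdD = hom_overD[OF Td]
  let ?c = "nu_cell D d s"
  have cz: "ncmp ?c z = nu (fob a (fob (F1 (T_fun T) s) z))" if "z \<in> Obj (T_cat T D)" for z
    using that by (simp add: nu_cell_def sD)
  have o: "fob a (fob (F1 (T_fun T) s) z) \<in> Obj A" if "z \<in> Obj (T_cat T D)" for z
    using aD(5)[OF TsD(5)[OF that]] .
  have r: "rep (fob a (fob (F1 (T_fun T) s) z)) = fob s (fob d z)" if "z \<in> Obj (T_cat T D)" for z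
    using arg_cong[OF sd, of "\<lambda>H. fob H z"] that o[OF that] by (simp add: dD aTsD sD)
  show cN: "N (fob a (fob (F1 (T_fun T) s) z)) (fob s (fob d z)) (ncmp ?c z)" if "z \<in> Obj (T_cat T D)" for z
    using nu[OF o[OF that]] r[OF that] cz[OF that] by simp
  have "?c = mk_ntrans (func_comp (Idm (over J) A) (func_comp a (F1 (T_fun T) s)))
      (func_comp (func_comp iota eps) (func_comp a (F1 (T_fun T) s))) (\<lambda>x. ncmp nut (fob (func_comp a (F1 (T_fun T) s)) x))"
    unfolding nu_cell_def mk_ntrans_eq_iff using sd func_comp_Idm(2)[OF aTs] o by (simp add: nut_def sD)
  also have "\<dots> = whisker_right nut (func_comp a (F1 (T_fun T) s))"
    by (simp add: whisker_right_def nut_def)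
  finally have w: "?c = whisker_right nut (func_comp a (F1 (T_fun T) s))" .
  show c: "?c \<in> cells (over J) (func_comp a (F1 (T_fun T) s)) (func_comp s d)"
    using whisker_right_cells[OF nut Idm_hom[OF AD(1)] aTs] func_comp_Idm(2)[OF aTs] sd w by simp
  note cD = cells_overD[OF c aTs]
  show "invertible_cell (over J) ?c"
  proof (rule invertible_cell_overI(4)[OF c aTs])
    show "nui (fob a (fob (F1 (T_fun T) s) z)) \<in> Arr A \<and>
      Dom A (nui (fob a (fob (F1 (T_fun T) s) z))) = fob (func_comp s d) z \<and>
      Cod A (nui (fob a (fob (F1 (T_fun T) s) z))) = fob (func_comp a (F1 (T_fun T) s)) z \<and>
      Com A (nui (fob a (fob (F1 (T_fun T) s) z))) (ncmp ?c z) = Ide A (fob (func_comp a (F1 (T_fun T) s)) z) \<and>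
      Com A (ncmp ?c z) (nui (fob a (fob (F1 (T_fun T) s) z))) = Ide A (fob (func_comp s d) z)"
      if z: "z \<in> Obj (T_cat T D)" for z
      using nu_arr[OF o[OF z]] r[OF z] cz[OF z] z by (simp add: dD sD(3))
  qed
  have Tc: "F2 (T_fun T) ?c \<in> cells (over J) (F1 (T_fun T) (func_comp a (F1 (T_fun T) s))) (F1 (T_fun T) (func_comp s d))"
    by (rule T_fun_cells[OF c aTs])
  note TaTs = T_fun_hom[OF aTs]
  note TcD = cells_overD[OF Tc TaTs] and TaTsD = hom_overD[OF TaTs]
  have unit: "ncmp ?c (fob (eta (T_monad T) D) x) = Ide A (fob s x)" if x: "x \<in> Obj D" for x
  proof -
    note e = hom_overD[OF DD(6)]
    have "fob (F1 (T_fun T) s) (fob (eta (T_monad T) D) x) = fob (eta (T_monad T) A) (fob s x)"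
      using arg_cong[OF TM.eta_natural[OF s], of "\<lambda>H. fob H x"] x by (simp only: func_comp_simps sD(3) e(3) T_monad_simps(1))
    then have "ncmp ?c (fob (eta (T_monad T) D) x) = nu (fob s x)"
      using cz[OF e(5)[OF x]] AD(10)[OF sD(5)[OF x]] by simp
    also have "\<dots> = Ide A (fob s x)" using nu_rep(1)[OF sD(5)[OF x]] so x by simp
    finally show ?thesis .
  qed
  have mult: "ncmp ?c (fob (mu (T_monad T) D) w) = Com A (ncmp ?c (fob (F1 (T_fun T) d) w)) (far a (ncmp (F2 (T_fun T) ?c) w))"
    if w: "w \<in> Obj (T_cat T (T_cat T D))" for w
  proof -
    note m = hom_overD[OF DD(7)]
    let ?u = "fob (mu (T_monad T) D) w" and ?v = "fob (F1 (T_fun T) d) w" and ?k = "ncmp (F2 (T_fun T) ?c) w"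
    have uv: "?u \<in> Obj (T_cat T D)" "?v \<in> Obj (T_cat T D)" using m(5)[OF w] TdD(5)[OF w] by auto
    note wc = T_obj_components[OF w]
    have k: "?k \<in> Arr (T_cat T A)" "Dom (T_cat T A) ?k = fob (F1 (T_fun T) (func_comp a (F1 (T_fun T) s))) w"
      "Cod (T_cat T A) ?k = fob (F1 (T_fun T) (func_comp s d)) w"
      using TcD(4-6)[OF w] by auto
    \<comment> \<open>The entries of \<open>?k\<close> are components of the coherence, which lie in
      \<open>N\<close>.\<close>
    have "N (Dom A (far a ?k)) (Cod A (far a ?k)) (far a ?k)"
    proof (rule N_action[OF k(1)])
      fix f assume "f \<in> set (args ?k)"
      then obtain z where "z \<in> set (args w)" "f = ncmp ?c z" using T_fun_cell[OF c aTs w] by auto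
      then show "N (Dom A f) (Cod A f) f" using cN[of z] wc(3) N_arr(4,5)[OF cN[of z]] by auto
    qed
    moreover have "Dom A (far a ?k) = fob a (fob (F1 (T_fun T) s) ?u)"
    proof -
      have "fob a (fob (F1 (T_fun T) (func_comp a (F1 (T_fun T) s))) w) = fob a (fob (F1 (T_fun T) a) (fob (F1 (T_fun T) (F1 (T_fun T) s)) w))"
        using TM.F1_comp[OF Ts AD(4)] w hom_overD(3)[OF T_fun_hom[OF Ts]] by simp
      also have "\<dots> = fob a (fob (mu (T_monad T) A) (fob (F1 (T_fun T) (F1 (T_fun T) s)) w))"
        using AD(12)[OF hom_overD(5)[OF T_fun_hom[OF Ts] w]] by simp
      also have "fob (mu (T_monad T) A) (fob (F1 (T_fun T) (F1 (T_fun T) s)) w) = fob (F1 (T_fun T) s) ?u"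
        using arg_cong[OF mu_natural[OF s], of "\<lambda>H. fob H w"] w
        by (simp only: func_comp_simps hom_overD(3)[OF T_fun_hom[OF Ts]] m(3))
      finally show ?thesis using aD(9)[OF k(1)] k(2) by simp
    qed
    moreover have "Cod A (far a ?k) = fob a (fob (F1 (T_fun T) s) ?v)"
      using aD(10)[OF k(1)] k(3) TM.F1_comp[OF DD(4) s] w TdD(3) by simp
    ultimately have n1: "N (fob a (fob (F1 (T_fun T) s) ?u)) (fob a (fob (F1 (T_fun T) s) ?v)) (far a ?k)" by simp
    have "N (fob a (fob (F1 (T_fun T) s) ?u)) (rep (fob a (fob (F1 (T_fun T) s) ?v))) (Com A (ncmp ?c ?v) (far a ?k))"
      using N_Com[OF n1 nu[OF o[OF uv(2)]]] cz[OF uv(2)] by simp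
    moreover have "N (fob a (fob (F1 (T_fun T) s) ?u)) (rep (fob a (fob (F1 (T_fun T) s) ?v))) (ncmp ?c ?u)"
      using nu[OF o[OF uv(1)]] cz[OF uv(1)] rep_eq[OF n1] by simp
    ultimately show ?thesis using N_thin by blast
  qed
  show "\<lparr>msrc = (D, d), mtgt = (A, a), und = s, coh = ?c\<rparr> \<in> lax_mors (over J) (T_monad T)"
    unfolding TM.lax_mors_iff[OF D alg] using s c unit mult by simp
qed

text \<open>The pseudo-inverse is \<open>func_comp iota n\<close>. One composite is the identity on
  the nose; the other is the idempotent \<open>func_comp iota eps\<close>, to which
  \<open>nut\<close> connects the identity.\<close>

lemma equivalence:
  assumes D: "(D, d) \<in> algs (over J) (T_monad T)" and m: "m \<in> sfun J (T_monad T) (A, a) (D, d)"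
    and n: "n \<in> sfun J (T_monad T) (D, d) (B, act_B)" and nm: "func_comp n m = eps"
    and mn: "func_comp m (func_comp iota n) = Idm (over J) D"
    and kill: "\<And>x y f. N x y f \<Longrightarrow> far m f = Ide D (fob m y)"
  shows "equivalence_in (Alg (over J) (T_monad T)) (strict_mor J (A, a) (D, d) m)"
proof -
  let ?K = "Alg (over J) (T_monad T)" and ?m = "strict_mor J (A, a) (D, d) m"
  note DD = TM.algD[OF D, simplified]
  have mh: "m \<in> hom (over J) A D" and ms: "func_comp d (F1 (T_fun T) m) = func_comp m a"
    and nh: "n \<in> hom (over J) D B" and ns: "func_comp act_B (F1 (T_fun T) n) = func_comp n d"
    using m n by (simp_all add: sfun_iff)
  define s where "s = func_comp iota n"
  have s: "s \<in> hom (over J) D A" unfolding s_def by (rule func_comp_hom[OF nh iota])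
  note Tn = T_fun_hom[OF nh] and Ti = T_fun_hom[OF iota] and Ts = T_fun_hom[OF s] and Tm = T_fun_hom[OF mh]
  note ea = func_comp_hom[OF AD(4) eps] and aTs = func_comp_hom[OF Ts AD(4)]
  note ie = iota_eps(1)
  have "func_comp s d = func_comp iota (func_comp (func_comp eps a) (func_comp (F1 (T_fun T) iota) (F1 (T_fun T) n)))"
    unfolding s_def using func_comp_assoc[OF DD(4) nh iota] ns[symmetric] func_comp_assoc[OF Tn Ti ea] by (simp add: act_B_def)
  also have "\<dots> = func_comp iota (func_comp eps (func_comp a (F1 (T_fun T) s)))"
    unfolding s_def using TM.F1_comp[OF nh iota] func_comp_assoc[OF Ts AD(4) eps] by (simp add: s_def)
  also have "\<dots> = func_comp (func_comp iota eps) (func_comp a (F1 (T_fun T) s))"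
    by (rule func_comp_assoc[OF aTs eps iota, symmetric])
  finally have sd: "func_comp s d = func_comp (func_comp iota eps) (func_comp a (F1 (T_fun T) s))" .
  have so: "\<forall>x\<in>Obj D. rep (fob s x) = fob s x"
  proof
    fix x assume x: "x \<in> Obj D"
    then obtain y where "y \<in> Obj A" "fob n x = rep y" using hom_overD(5)[OF nh x] by auto
    then show "rep (fob s x) = fob s x" using x hom_overD(3,5)[OF nh] rep_rep by (simp add: s_def)
  qed
  have sm: "func_comp s m = func_comp iota eps" unfolding s_def using func_comp_assoc[OF mh nh iota] nm by simp
  note ns = nu_cell[OF D s sd so]
  \<comment> \<open>By \<open>eps_act\<close> the idempotent satisfies the same condition as
    \<open>s\<close>, with \<open>A\<close> itself as source.\<close>
  have smd: "func_comp (func_comp iota eps) a = func_comp (func_comp iota eps) (func_comp a (F1 (T_fun T) (func_comp iota eps)))"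
  proof -
    have "func_comp eps a = func_comp (func_comp eps a) (F1 (T_fun T) (func_comp iota eps))"
      using eps_act func_comp_assoc[OF T_fun_hom[OF eps] Ti ea] TM.F1_comp[OF eps iota] by (simp add: act_B_def)
    then show ?thesis
      using func_comp_assoc[OF AD(4) eps iota] func_comp_assoc[OF T_fun_hom[OF ie] AD(4) eps]
        func_comp_assoc[OF func_comp_hom[OF T_fun_hom[OF ie] AD(4)] eps iota] by simp
  qed
  have smo: "\<forall>x\<in>Obj A. rep (fob (func_comp iota eps) x) = fob (func_comp iota eps) x"
    using iota_eps(2) rep_rep by simp
  note ni = nu_cell[OF alg ie smd smo]
  let ?s = "\<lparr>msrc = (D, d), mtgt = (A, a), und = s, coh = nu_cell D d s\<rparr>"
  let ?e = "\<lparr>msrc = (A, a), mtgt = (A, a), und = func_comp iota eps, coh = nu_cell A a (func_comp iota eps)\<rparr>"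
  have ml: "?m \<in> lax_mors (over J) (T_monad T)" by (rule TM.strict_mor_lax[OF alg D mh]) (simp add: ms)
  have strict_inv: "invertible_cell (over J) (Idc (over J) H)" if H: "H \<in> hom (over J) X Y" for H X Y
    using hom_overD[OF H]
    by (intro invertible_cell_overI(4)[OF Idc_cells[OF H] H, where u = "\<lambda>x. Ide Y (fob H x)"]) (simp add: cat_overD)
  have ma: "func_comp m a \<in> hom (over J) (T_cat T A) D" using func_comp_hom[OF AD(4) mh] .
  have mM: "?m \<in> hom ?K (A, a) (D, d)" and sM: "?s \<in> hom ?K (D, d) (A, a)" and eM: "?e \<in> hom ?K (A, a) (A, a)"
    using ml strict_inv[OF ma] ns ni by (simp_all add: hom_def) (simp_all add: strict_mor_def)
  have ids: "alg_id (over J) X \<in> hom ?K X X" if X: "X \<in> algs (over J) (T_monad T)" for X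
  proof -
    obtain X1 x where XX: "X = (X1, x)" by (cases X)
    note i = TM.alg_id_strict[OF X[unfolded XX]]
    have "alg_id (over J) X \<in> lax_mors (over J) (T_monad T)" using i(2) by (simp add: hom_def XX)
    then show ?thesis using strict_inv[OF TM.algD(4)[OF X[unfolded XX]]]
      by (simp add: hom_def) (simp add: alg_id_def XX)
  qed
  \<comment> \<open>The coherence of \<open>s\<close> consists of arrows of \<open>N\<close>, which
    \<open>m\<close> sends to identities; so the composite is strict.\<close>
  have c1: "Cmp ?K ?m ?s = alg_id (over J) (D, d)"
  proof -
    have "Cmp ?K ?m ?s = postcomp (D, d) m ?s"
      using TM.strict_mor_comp[OF ns(2), of A a m D d] mh D ms by simp
    also have "\<dots> = alg_id (over J) (D, d)"
    proof -
      have "func_comp m (func_comp a (F1 (T_fun T) s)) = func_comp d (F1 (T_fun T) (func_comp m s))"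
        using func_comp_assoc[OF Ts AD(4) mh] ms[symmetric] func_comp_assoc[OF Ts Tm DD(4)] TM.F1_comp[OF s mh] by simp
      also have "\<dots> = d" using mn TM.F1_Idm[OF DD(1)] func_comp_Idm[OF DD(4)] by (simp add: s_def)
      finally have 1: "func_comp m (func_comp a (F1 (T_fun T) s)) = d" .
      have 2: "func_comp m (func_comp s d) = d"
        using func_comp_assoc[OF DD(4) s mh] mn func_comp_Idm[OF DD(4)] by (simp add: s_def)
      have 3: "far m (ncmp (nu_cell D d s) z) = Ide D (fob d z)" if z: "z \<in> Obj (T_cat T D)" for z
        using kill[OF ns(4)[OF z]] arg_cong[OF 2, of "\<lambda>H. fob H z"] z hom_overD(3)[OF DD(4)] hom_overD(3)[OF s] by simp
      have "whisker_left m (nu_cell D d s) = Idc (over J) d"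
        unfolding whisker_left_def Idc_over cells_overD(2,3)[OF ns(1) aTs] mk_ntrans_eq_iff
        using 1 2 3 hom_overD(3)[OF Ts] hom_overD(3,4)[OF DD(4)] by simp
      then show ?thesis using mn by (simp add: postcomp_def alg_id_def s_def)
    qed
    finally show ?thesis .
  qed
  \<comment> \<open>The coherence of \<open>m\<close> is an identity. What is left is the coherence
    of \<open>s\<close> at the images of objects under \<open>F1 (T_fun T) m\<close>, and this is
    the coherence of the idempotent because \<open>func_comp s m\<close> is
    \<open>func_comp iota eps\<close>.\<close>
  have c2: "Cmp ?K ?s ?m = ?e"
  proof -
    have Tsm: "func_comp (F1 (T_fun T) s) (F1 (T_fun T) m) = F1 (T_fun T) (func_comp iota eps)"
      using TM.F1_comp[OF mh s] sm by simp
    have src: "func_comp (func_comp a (F1 (T_fun T) s)) (F1 (T_fun T) m) = func_comp a (F1 (T_fun T) (func_comp iota eps))"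
      using func_comp_assoc[OF Tm Ts AD(4)] Tsm by simp
    have tgt: "func_comp s (func_comp m a) = func_comp (func_comp iota eps) a"
      using func_comp_assoc[OF AD(4) mh s] sm by simp
    have "Vc (over J) (whisker_left s (Idc (over J) (func_comp m a))) (whisker_right (nu_cell D d s) (F1 (T_fun T) m)) =
        nu_cell A a (func_comp iota eps)"
      unfolding Vc_over nu_cell_def[of A] mk_ntrans_eq_iff whisker_simps cells_overD(2,3)[OF ns(1) aTs] Idc_over_simps src tgt
    proof (intro conjI ballI refl)
      fix z assume "z \<in> Obj (fsrc (func_comp a (F1 (T_fun T) (func_comp iota eps))))"
      then have z: "z \<in> Obj (T_cat T A)" by simp
      let ?t = "fob (F1 (T_fun T) m) z"
      have t: "?t \<in> Obj (T_cat T D)" using hom_overD(5)[OF Tm z] .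
      note n = ns(4)[OF t]
      have n1: "ncmp (nu_cell D d s) ?t = nu (fob a (fob (F1 (T_fun T) (func_comp iota eps)) z))"
        using t arg_cong[OF Tsm, of "\<lambda>H. fob H z"] z hom_overD(3)[OF Tm] hom_overD(3)[OF Ts] by (simp add: nu_cell_def)
      have "fob s (fob d ?t) = fob s (fob m (fob a z))"
        using arg_cong[OF ms, of "\<lambda>H. fob H z"] z hom_overD(3)[OF Tm] hom_overD(3)[OF AD(4)] by simp
      then have cd: "Cod A (ncmp (nu_cell D d s) ?t) = fob s (fob m (fob a z))" using N_arr(5)[OF n] by simp
      have "ncmp (whisker_left s (Idc (over J) (func_comp m a))) z = Ide A (fob s (fob m (fob a z)))"
        using z hom_overD(3)[OF AD(4)] hom_overD(4)[OF mh] hom_overD(8)[OF s hom_overD(5)[OF mh hom_overD(5)[OF AD(4) z]]] by simp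
      moreover have "ncmp (whisker_right (nu_cell D d s) (F1 (T_fun T) m)) z = ncmp (nu_cell D d s) ?t"
        using z hom_overD(3)[OF Tm] by simp
      ultimately show "Com (ftgt (func_comp a (F1 (T_fun T) (func_comp iota eps))))
          (ncmp (whisker_left s (Idc (over J) (func_comp m a))) z) (ncmp (whisker_right (nu_cell D d s) (F1 (T_fun T) m)) z) =
          nu (fob a (fob (F1 (T_fun T) (func_comp iota eps)) z))"
        using n1 cat_overD(9)[OF AD(1) N_arr(3)[OF n] cd] hom_overD(4)[OF AD(4)] by simp
    qed
    then show ?thesis
      using Hc_Idc[OF ns(1) aTs Tm] Idc_Hc[OF Idc_cells[OF ma] ma s] sm
      by (simp add: alg_comp_def strict_mor_def)
  qed
  note nutD = cells_overD[OF nut Idm_hom[OF AD(1)]]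
  have inv: "nui x \<in> Arr A \<and> Dom A (nui x) = fob (func_comp iota eps) x \<and> Cod A (nui x) = fob (Idm (over J) A) x \<and>
      Com A (nui x) (ncmp nut x) = Ide A (fob (Idm (over J) A) x) \<and> Com A (ncmp nut x) (nui x) = Ide A (fob (func_comp iota eps) x)"
    if "x \<in> Obj A" for x
    using nu_arr[OF that] iota_eps(2)[OF that] that by (simp add: nut_def)
  let ?nuti = "mk_ntrans (func_comp iota eps) (Idm (over J) A) nui"
  note nuti = invertible_cell_overI(1-3)[OF nut Idm_hom[OF AD(1)] inv]
  let ?id = "alg_id (over J) (A, a)"
  let ?p = "\<lparr>csrc = ?id, ctgt = ?e, cund = nut\<rparr>" and ?q = "\<lparr>csrc = ?e, ctgt = ?id, cund = ?nuti\<rparr>"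
  have idl: "?id \<in> lax_mors (over J) (T_monad T)" "?e \<in> lax_mors (over J) (T_monad T)"
    using ids[OF alg] eM by (auto simp: hom_def)
  note Tnut = T_fun_cells[OF nut Idm_hom[OF AD(1)]] and Tnuti = T_fun_cells[OF nuti(1) ie]
  note TI = T_fun_hom[OF Idm_hom[OF AD(1)]] and Tie = T_fun_hom[OF ie]
  have T1: "F1 (T_fun T) (Idm (over J) A) = Idm (over J) (T_cat T A)" using TM.F1_Idm[OF AD(1)] by simp
  have aI: "func_comp a (Idm (over J) (T_cat T A)) = a" "func_comp (Idm (over J) A) a = a" using func_comp_Idm[OF AD(4)] by auto
  \<comment> \<open>The condition on a 2-cell of algebras compares two arrows of \<open>N\<close>
    with the same ends.\<close>
  have p: "?p \<in> Cell ?K"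
  proof -
    have "Vc (over J) (nu_cell A a (func_comp iota eps)) (whisker_left a (F2 (T_fun T) nut)) =
        Vc (over J) (whisker_right nut a) (Idc (over J) a)"
      unfolding Vc_over mk_ntrans_eq_iff whisker_simps Idc_over_simps cells_overD(2,3)[OF Tnut TI]
        cells_overD(2,3)[OF ni(1) func_comp_hom[OF Tie AD(4)]] nutD(2,3) T1 aI
    proof (intro conjI ballI refl)
      fix z assume "z \<in> Obj (fsrc a)"
      then have z: "z \<in> Obj (T_cat T A)" using hom_overD(3)[OF AD(4)] by simp
      have az: "fob a z \<in> Obj A" using hom_overD(5)[OF AD(4) z] .
      have w: "ncmp (whisker_left a (F2 (T_fun T) nut)) z = far a (ncmp (F2 (T_fun T) nut) z)"
        using z cells_overD(2)[OF Tnut TI] T1 by simp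
      have v: "ncmp (whisker_right nut a) z = nu (fob a z)" using z az hom_overD(3)[OF AD(4)] by (simp add: nut_def)
      have "N (fob a z) (fob (func_comp iota eps) (fob a z)) (Com A (ncmp (nu_cell A a (func_comp iota eps)) z) (far a (ncmp (F2 (T_fun T) nut) z)))"
        by (rule N_Com[OF T_nut[OF z] ni(4)[OF z]])
      then have "Com A (ncmp (nu_cell A a (func_comp iota eps)) z) (far a (ncmp (F2 (T_fun T) nut) z)) = nu (fob a z)"
        using nu[OF az] N_thin iota_eps(2)[OF az] by metis
      moreover have "Com A (nu (fob a z)) (Ide A (fob a z)) = nu (fob a z)"
        using cat_overD(8)[OF AD(1) nu_arr(1,2)[OF az]] .
      ultimately show "Com (ftgt a) (ncmp (nu_cell A a (func_comp iota eps)) z) (ncmp (whisker_left a (F2 (T_fun T) nut)) z) =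
          Com (ftgt a) (ncmp (whisker_right nut a) z) (ncmp (Idc (over J) a) z)"
        using w v z hom_overD(3,4)[OF AD(4)] by simp
    qed
    then show ?thesis
      using idl eM ids[OF alg] nut Idc_Hc[OF Tnut TI AD(4)] Hc_Idc[OF nut Idm_hom[OF AD(1)] AD(4)]
      by (simp add: hom_def alg_cells_def) (simp add: alg_id_def)
  qed
  \<comment> \<open>The inverse cell satisfies its condition for the same reason, with the arrows
    \<open>nui\<close> from the representatives.\<close>
  have q: "?q \<in> Cell ?K"
  proof -
    have "Vc (over J) (Idc (over J) a) (whisker_left a (F2 (T_fun T) ?nuti)) =
        Vc (over J) (whisker_right ?nuti a) (nu_cell A a (func_comp iota eps))"
      unfolding Vc_over mk_ntrans_eq_iff whisker_simps Idc_over_simps T_monad_simps(7,8) mk_ntrans_simps(1,2)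
        cells_overD(2,3)[OF ni(1) func_comp_hom[OF Tie AD(4)]] T1 aI
    proof (intro conjI ballI refl)
      fix z assume "z \<in> Obj (fsrc (func_comp a (F1 (T_fun T) (func_comp iota eps))))"
      then have z: "z \<in> Obj (T_cat T A)" by simp
      have az: "fob a z \<in> Obj A" using hom_overD(5)[OF AD(4) z] .
      let ?k = "ncmp (F2 (T_fun T) ?nuti) z"
      have k: "?k \<in> Arr (T_cat T A)" "Dom (T_cat T A) ?k = fob (F1 (T_fun T) (func_comp iota eps)) z" "Cod (T_cat T A) ?k = z"
        using cells_overD(4-6)[OF Tnuti Tie z] T1 z by auto
      have xs: "x \<in> Obj A" if "x \<in> set (args z)" for x using T_obj_components(3)[OF z] that by auto
      have "args ?k = map nui (args z)" using T_fun_cell[OF nuti(1) ie z] xs by simp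
      then have "N (Dom A (far a ?k)) (Cod A (far a ?k)) (far a ?k)"
        using nui[OF xs] N_arr(4,5)[OF nui[OF xs]] by (intro N_action[OF k(1)]) auto
      then have kN: "N (fob a (fob (F1 (T_fun T) (func_comp iota eps)) z)) (fob a z) (far a ?k)"
        using hom_overD(9,10)[OF AD(4) k(1)] k by simp
      have w: "ncmp (whisker_left a (F2 (T_fun T) ?nuti)) z = far a ?k"
        using z cells_overD(2)[OF Tnuti Tie] by simp
      have v: "ncmp (whisker_right ?nuti a) z = nui (fob a z)" using z az hom_overD(3)[OF AD(4)] by simp
      have "N (fob a (fob (F1 (T_fun T) (func_comp iota eps)) z)) (fob a z) (Com A (nui (fob a z)) (ncmp (nu_cell A a (func_comp iota eps)) z))"
        using N_Com[OF ni(4)[OF z]] nui[OF az] iota_eps(2)[OF az] by simp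
      then have "Com A (nui (fob a z)) (ncmp (nu_cell A a (func_comp iota eps)) z) = far a ?k" using kN N_thin by blast
      moreover have "Com A (Ide A (fob a z)) (far a ?k) = far a ?k"
        using cat_overD(9)[OF AD(1) N_arr(3,5)[OF kN]] .
      ultimately show "Com (ftgt (func_comp a (F1 (T_fun T) (func_comp iota eps)))) (ncmp (Idc (over J) a) z) (ncmp (whisker_left a (F2 (T_fun T) ?nuti)) z) =
          Com (ftgt (func_comp a (F1 (T_fun T) (func_comp iota eps)))) (ncmp (whisker_right ?nuti a) z) (ncmp (nu_cell A a (func_comp iota eps)) z)"
        using w v z hom_overD(3,4)[OF AD(4)] by simp
    qed
    then show ?thesis
      using idl eM ids[OF alg] nuti(1) Idc_Hc[OF Tnuti Tie AD(4)] Hc_Idc[OF nuti(1) ie AD(4)]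
      by (simp add: hom_def alg_cells_def) (simp add: alg_id_def)
  qed
  have ip: "invertible_cell ?K ?p"
    unfolding invertible_cell_def using p q nuti(2,3)
    by (auto simp: cells_def alg_id_def intro!: bexI[of _ ?q])
  \<comment> \<open>As the composite on \<open>D\<close> is the identity, an identity cell serves
    there.\<close>
  let ?i = "Idc ?K (alg_id (over J) (D, d))"
  have ic: "?i \<in> Cell ?K" and ii: "invertible_cell ?K ?i"
  proof -
    note IdD = Idm_hom[OF DD(1)]
    have dI: "func_comp d (Idm (over J) (T_cat T D)) = d" "func_comp (Idm (over J) D) d = d" using func_comp_Idm[OF DD(4)] by auto
    have F: "F2 (T_fun T) (Idc (over J) (Idm (over J) D)) = Idc (over J) (Idm (over J) (T_cat T D))"
      using TM.F2_Idc[OF IdD] TM.F1_Idm[OF DD(1)] by simp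
    note ITD = Idm_hom[OF DD(2)]
    have "Hc (over J) (Idc (over J) d) (Idc (over J) (Idm (over J) (T_cat T D))) = Idc (over J) d"
      unfolding Hc_Idc[OF Idc_cells[OF DD(4)] DD(4) ITD] unfolding whisker_right_def Idc_over mk_ntrans_eq_iff
      using dI hom_overD(3)[OF DD(4)] by simp
    moreover have "Hc (over J) (Idc (over J) (Idm (over J) D)) (Idc (over J) d) = Idc (over J) d"
      unfolding Hc_Idc[OF Idc_cells[OF IdD] IdD DD(4)] unfolding whisker_right_def Idc_over mk_ntrans_eq_iff
      using dI hom_overD(3,4,5)[OF DD(4)] by simp
    ultimately show ic: "?i \<in> Cell ?K"
      using ids[OF D] Idc_cells[OF IdD] F by (simp add: hom_def alg_cells_def) (simp add: alg_id_def)
    have "Vc (over J) (Idc (over J) (Idm (over J) D)) (Idc (over J) (Idm (over J) D)) = Idc (over J) (Idm (over J) D)"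
      unfolding Vc_over Idc_over mk_ntrans_eq_iff using cat_overD[OF DD(1)] by simp
    then show "invertible_cell ?K ?i"
      unfolding invertible_cell_def using ic by (auto simp: cells_def alg_id_def intro!: bexI[of _ ?i])
  qed
  have "\<exists>\<phi>\<in>cells ?K (Idm ?K (A, a)) (Cmp ?K ?s ?m). invertible_cell ?K \<phi>"
    unfolding c2 using p ip by (intro bexI[of _ ?p]) (simp_all add: cells_def)
  moreover have "\<exists>\<psi>\<in>cells ?K (Cmp ?K ?m ?s) (Idm ?K (D, d)). invertible_cell ?K \<psi>"
    unfolding c1 using ic ii by (intro bexI[of _ ?i]) (simp_all add: cells_def)
  moreover have "Src ?K ?m = (A, a)" "Tgt ?K ?m = (D, d)" by (simp_all add: strict_mor_def)
  ultimately show ?thesis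
    unfolding equivalence_in_def using mM sM by (auto simp: hom_def intro!: bexI[of _ ?s])
qed

end

section \<open>The congruence on a split algebra\<close>

context set_operad
begin

text \<open>Acting by the inverse of \<sigma> turns the equation into one that fixes
  \<alpha>.\<close>

lemma sigma_free_act:
  assumes sf: "sigma_free T" and \<alpha>: "\<alpha> \<in> ops T"
    and r: "\<rho> \<in> perms (length (ins T \<alpha>))" and s: "\<sigma> \<in> perms (length (ins T \<alpha>))" and eq: "act T \<alpha> \<rho> = act T \<alpha> \<sigma>"
  shows "\<rho> = \<sigma>"
proof -
  let ?n = "length (ins T \<alpha>)"
  note s' = perm_inv_perms[OF s]
  have "act T \<alpha> (perm_comp \<rho> (perm_inv \<sigma>)) = act T \<alpha> (perm_comp \<sigma> (perm_inv \<sigma>))"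
    using operadD(16)[OF \<alpha> r s'] operadD(16)[OF \<alpha> s s'] eq by simp
  then have "act T \<alpha> (perm_comp \<rho> (perm_inv \<sigma>)) = \<alpha>" using perm_comp_inv(1)[OF s] operadD(15)[OF \<alpha>] by simp
  then have 1: "perm_comp \<rho> (perm_inv \<sigma>) = [0..<?n]"
    using sf \<alpha> perm_comp_perms[OF r s'] unfolding sigma_free_def by blast
  have "perm_comp (perm_comp \<rho> (perm_inv \<sigma>)) \<sigma> = perm_comp \<rho> (perm_comp (perm_inv \<sigma>) \<sigma>)"
    using permsD[OF s] by (auto simp: perm_comp_def)
  then show ?thesis using 1 perm_comp_inv(2)[OF s] perm_comp_id[OF r] perm_comp_id[OF s] by simp
qed

text \<open>Permutation arrows are recognized by their entries; this is applied to images under the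
  multiplication, whose entries are easy to list.\<close>

lemma perm_arrow_cod_args:
  assumes X: "cat_over J X" and u: "u \<in> Arr (T_cat T X)"
    and i: "\<And>\<gamma>. \<gamma> \<in> set (args u) \<Longrightarrow> \<gamma> = Ide X (Cod X \<gamma>)"
  shows "u = perm_arrow X (prm u) (Cod (T_cat T X) u)" "prm u \<in> perms (length (args (Cod (T_cat T X) u)))"
proof -
  note c = T_arr_components[OF u]
  have l: "length (prm u) = length (args u)" using permsD(1)[OF c(3)] c(4) by simp
  have d: "Cod (T_cat T X) u = tup [] (opn u) (map (\<lambda>k. Cod X (args u ! k)) (perm_inv (prm u)))"
    by (subst c(1)) simp
  show "prm u \<in> perms (length (args (Cod (T_cat T X) u)))"
    using c(3,4) l by (simp add: d)
  have "map (\<lambda>k. Ide X (map (\<lambda>k. Cod X (args u ! k)) (perm_inv (prm u)) ! k)) (prm u) = args u"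
    using cods_nth[OF c(3), of _ "Cod X" "args u"] c(4) l i by (auto intro!: nth_equalityI)
  then show "u = perm_arrow X (prm u) (Cod (T_cat T X) u)"
    using c(1) by (simp add: d perm_arrow_def)
qed

lemma splitting_congruence:
  assumes sf: "sigma_free T" and A: "(A, a) \<in> algs (over J) (T_monad T)"
    and t: "\<And>x. x \<in> Obj A \<Longrightarrow> \<tau> x \<in> Obj (T_cat T A)" "\<And>x. x \<in> Obj A \<Longrightarrow> fob a (\<tau> x) = x"
    and ta: "\<And>z. z \<in> Obj (T_cat T A) \<Longrightarrow> \<tau> (fob a z) = fob (mu (T_monad T) A) (tup [] (opn z) (map \<tau> (args z)))"
  shows "thin_congruence T A a (\<lambda>x y f. x \<in> Obj A \<and> y \<in> Obj A \<and>
    (\<exists>\<rho>\<in>perms (length (args (\<tau> y))). \<tau> x = permute \<rho> (\<tau> y) \<and> f = far a (perm_arrow A \<rho> (\<tau> y))))"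
    (is "thin_congruence T A a ?N")
proof unfold_locales
  note AD = TM.algD[OF A, simplified]
  note aD = hom_overD[OF AD(4)] and XD = cat_overD[OF AD(1)]
  have pa: "perm_arrow A \<rho> (\<tau> y) \<in> Arr (T_cat T A)" "Dom (T_cat T A) (perm_arrow A \<rho> (\<tau> y)) = permute \<rho> (\<tau> y)"
    "Cod (T_cat T A) (perm_arrow A \<rho> (\<tau> y)) = \<tau> y"
    if "y \<in> Obj A" "\<rho> \<in> perms (length (args (\<tau> y)))" for y \<rho>
    using perm_arrow(1-3)[OF AD(1) t(1)[OF that(1)] that(2)] by auto
  show "(A, a) \<in> algs (over J) (T_monad T)" by fact
  show arr: "f \<in> Arr A" "Dom A f = x" "Cod A f = y" if N: "?N x y f" for x y f
  proof -
    obtain \<rho> where r: "\<rho> \<in> perms (length (args (\<tau> y)))" "\<tau> x = permute \<rho> (\<tau> y)" "f = far a (perm_arrow A \<rho> (\<tau> y))"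
      and o: "x \<in> Obj A" "y \<in> Obj A" using N by blast
    note p = pa[OF o(2) r(1)]
    show "f \<in> Arr A" "Dom A f = x" "Cod A f = y"
      using aD(6,9,10)[OF p(1)] p r(2)[symmetric] t(2)[OF o(1)] t(2)[OF o(2)] by (simp_all add: r(3))
  qed
  show "x \<in> Obj A" "y \<in> Obj A" if "?N x y f" for x y f using that by auto
  show "f = g" if f: "?N x y f" and g: "?N x y g" for x y f g
  proof -
    obtain \<rho> \<sigma> where r: "\<rho> \<in> perms (length (args (\<tau> y)))" "\<tau> x = permute \<rho> (\<tau> y)" "f = far a (perm_arrow A \<rho> (\<tau> y))"
      and s: "\<sigma> \<in> perms (length (args (\<tau> y)))" "\<tau> x = permute \<sigma> (\<tau> y)" "g = far a (perm_arrow A \<sigma> (\<tau> y))"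
      and o: "y \<in> Obj A" using f g by blast
    note c = T_obj_components[OF t(1)[OF o]]
    have "act T (opn (\<tau> y)) \<rho> = act T (opn (\<tau> y)) \<sigma>"
      using arg_cong[OF trans[OF r(2)[symmetric] s(2)], of opn] by simp
    then have "\<rho> = \<sigma>" using sigma_free_act[OF sf c(2)] r(1) s(1) c(5) by simp
    then show ?thesis using r(3) s(3) by simp
  qed
  show "?N x x (Ide A x)" if x: "x \<in> Obj A" for x
  proof -
    note tx = t(1)[OF x]
    have "far a (perm_arrow A [0..<length (args (\<tau> x))] (\<tau> x)) = Ide A x"
      using perm_arrow_id[OF tx] aD(8)[OF tx] t(2)[OF x] by simp
    then show ?thesis using x permute_id[OF tx] by (intro conjI bexI[of _ "[0..<length (args (\<tau> x))]"]) auto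
  qed
  show "\<exists>g. ?N y x g" if N: "?N x y f" for x y f
  proof -
    have o: "x \<in> Obj A" "y \<in> Obj A" and "same_orbit (\<tau> x) (\<tau> y)" using N by (auto simp: same_orbit_def)
    then have "same_orbit (\<tau> y) (\<tau> x)" using same_orbit(4)[OF AD(1) t(1)] by blast
    then show ?thesis using o by (auto simp: same_orbit_def)
  qed
  show "?N x z (Com A g f)" if f: "?N x y f" and g: "?N y z g" for x y z f g
  proof -
    obtain \<rho> \<sigma> where s: "\<sigma> \<in> perms (length (args (\<tau> y)))" "\<tau> x = permute \<sigma> (\<tau> y)" "f = far a (perm_arrow A \<sigma> (\<tau> y))"
      and r: "\<rho> \<in> perms (length (args (\<tau> z)))" "\<tau> y = permute \<rho> (\<tau> z)" "g = far a (perm_arrow A \<rho> (\<tau> z))"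
      and o: "x \<in> Obj A" "y \<in> Obj A" "z \<in> Obj A" using f g by blast
    note tz = t(1)[OF o(3)]
    have s': "\<sigma> \<in> perms (length (args (\<tau> z)))" using s(1) permsD(1)[OF r(1)] by (simp add: r(2))
    have "Com A g f = far a (Com (T_cat T A) (perm_arrow A \<rho> (\<tau> z)) (perm_arrow A \<sigma> (\<tau> y)))"
      using aD(11)[OF pa(1)[OF o(2) s(1)] pa(1)[OF o(3) r(1)]] pa(3)[OF o(2) s(1)] pa(2)[OF o(3) r(1)] r(2)
      by (simp add: r(3) s(3))
    also have "\<dots> = far a (perm_arrow A (perm_comp \<rho> \<sigma>) (\<tau> z))"
      using perm_arrow_comp[OF AD(1) tz r(1) s'] r(2) by simp
    finally have "Com A g f = far a (perm_arrow A (perm_comp \<rho> \<sigma>) (\<tau> z))" .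
    moreover have "\<tau> x = permute (perm_comp \<rho> \<sigma>) (\<tau> z)"
      using permute_permute[OF tz r(1) s'] s(2) r(2) by simp
    ultimately show ?thesis using o perm_comp_perms[OF r(1) s'] by blast
  qed
  show "?N (Dom A (far a w)) (Cod A (far a w)) (far a w)"
    if w: "w \<in> Arr (T_cat T A)" and N: "\<And>f. f \<in> set (args w) \<Longrightarrow> ?N (Dom A f) (Cod A f) f" for w
  proof -
    note wc = T_arr_components[OF w]
    have fA: "f \<in> Arr A" "Dom A f \<in> Obj A" "Cod A f \<in> Obj A" if "f \<in> set (args w)" for f
      using wc(5) that XD by auto
    have "\<exists>\<rho>. \<rho> \<in> perms (length (args (\<tau> (Cod A f)))) \<and> \<tau> (Dom A f) = permute \<rho> (\<tau> (Cod A f)) \<and>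
        f = far a (perm_arrow A \<rho> (\<tau> (Cod A f)))" if "f \<in> set (args w)" for f
      using N[OF that] by blast
    then obtain r where r: "\<And>f. f \<in> set (args w) \<Longrightarrow> r f \<in> perms (length (args (\<tau> (Cod A f))))"
      "\<And>f. f \<in> set (args w) \<Longrightarrow> \<tau> (Dom A f) = permute (r f) (\<tau> (Cod A f))"
      "\<And>f. f \<in> set (args w) \<Longrightarrow> f = far a (perm_arrow A (r f) (\<tau> (Cod A f)))"
      by metis
    \<comment> \<open>\<open>k f\<close> lifts \<open>f\<close> to a permutation arrow between the
      decompositions of its ends.\<close>
    define k where "k f = perm_arrow A (r f) (\<tau> (Cod A f))" for f
    have k: "k f \<in> Arr (T_cat T A)" "Dom (T_cat T A) (k f) = \<tau> (Dom A f)" "Cod (T_cat T A) (k f) = \<tau> (Cod A f)"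
      if "f \<in> set (args w)" for f
      using pa[OF fA(3)[OF that] r(1)[OF that]] r(2)[OF that] by (simp_all add: k_def)
    have fk: "far a (k f) = f" if "f \<in> set (args w)" for f using r(3)[OF that] by (simp add: k_def)
    have colk: "Col (T_cat T A) (\<tau> y) = Col A y" if "y \<in> Obj A" for y
      using aD(7)[OF t(1)[OF that]] t(2)[OF that] by simp
    \<comment> \<open>Replacing the entries of \<open>w\<close> by their lifts gives an arrow over
      \<open>w\<close>. By associativity, \<open>a\<close> has the same value on \<open>w\<close> as
      on the image \<open>?U\<close> of \<open>?W\<close> under the multiplication.\<close>
    let ?W = "tup (prm w) (opn w) (map k (args w))"
    have W: "?W \<in> Arr (T_cat T (T_cat T A))"
      unfolding T_Arr_list_iff
    proof (intro conjI)
      show "set (map k (args w)) \<subseteq> Arr (T_cat T A)" using k(1) by auto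
      have "map (\<lambda>\<gamma>. Col (T_cat T A) (Cod (T_cat T A) \<gamma>)) (map k (args w)) = map (\<lambda>\<gamma>. Col A (Cod A \<gamma>)) (args w)"
        using k(3) colk fA(3) by simp
      then show "map (\<lambda>\<gamma>. Col (T_cat T A) (Cod (T_cat T A) \<gamma>)) (map k (args w)) = map (\<lambda>j. ins T (opn w) ! j) (prm w)"
        using wc(6) by (rule trans)
    qed (use wc in auto)
    have "map (far a) (map k (args w)) = args w" using fk by (simp add: map_idI)
    then have Ta: "far (F1 (T_fun T) a) ?W = w"
      using T_fun_ar[OF AD(4) W] wc(1) by simp
    let ?U = "far (mu (T_monad T) A) ?W"
    note mD = hom_overD[OF mu_hom[OF AD(1)]]
    have U: "?U \<in> Arr (T_cat T A)" "far a ?U = far a w"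
      using mD(6)[OF W] AD(13)[OF W] Ta by auto
    \<comment> \<open>The entries of \<open>?U\<close> are entries of permutation arrows, hence
      identities, so \<open>?U\<close> is itself a permutation arrow.\<close>
    have "args ?U = concat (map args (map k (args w)))" using W by simp
    moreover have "\<gamma> = Ide A (Cod A \<gamma>)" if f: "f \<in> set (args w)" and g: "\<gamma> \<in> set (args (k f))" for f \<gamma>
    proof -
      obtain j where j: "j \<in> set (r f)" "\<gamma> = Ide A (args (\<tau> (Cod A f)) ! j)"
        using g by (auto simp: k_def perm_arrow_def)
      then have "args (\<tau> (Cod A f)) ! j \<in> Obj A"
        using permsD(3)[OF r(1)[OF f]] T_obj_components(3)[OF t(1)[OF fA(3)[OF f]]] by auto
      then show ?thesis using j XD(7) by simp
    qed
    ultimately have i: "\<gamma> = Ide A (Cod A \<gamma>)" if "\<gamma> \<in> set (args ?U)" for \<gamma> using that by auto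
    note p = perm_arrow_cod_args[OF AD(1) U(1) i]
    \<comment> \<open>By compatibility of \<tau> with the action, the ends of \<open>?U\<close> are
      the decompositions of the ends of the image of \<open>w\<close>.\<close>
    have "map (\<lambda>j. Cod (T_cat T A) (map k (args w) ! j)) (perm_inv (prm w)) =
        map \<tau> (map (\<lambda>j. Cod A (args w ! j)) (perm_inv (prm w)))"
      using k(3) permsD(3)[OF perm_inv_perms[OF wc(3)]] wc(4) by simp
    then have "Cod (T_cat T (T_cat T A)) ?W = tup [] (opn (Cod (T_cat T A) w)) (map \<tau> (args (Cod (T_cat T A) w)))"
      by (subst (2 3) wc(1)) simp
    then have cU: "Cod (T_cat T A) ?U = \<tau> (Cod A (far a w))"
      using mD(10)[OF W] ta[OF cat_overD(2)[OF AD(2) w]] aD(10)[OF w] by simp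
    have "Dom (T_cat T (T_cat T A)) ?W = tup [] (opn (Dom (T_cat T A) w)) (map \<tau> (args (Dom (T_cat T A) w)))"
      using k(2) by (subst (2 3) wc(1)) simp
    then have dU: "Dom (T_cat T A) ?U = \<tau> (Dom A (far a w))"
      using mD(9)[OF W] ta[OF cat_overD(1)[OF AD(2) w]] aD(9)[OF w] by simp
    have o: "Dom A (far a w) \<in> Obj A" "Cod A (far a w) \<in> Obj A" using aD(6)[OF w] XD by auto
    have pU: "prm ?U \<in> perms (length (args (\<tau> (Cod A (far a w)))))" using p(2) cU by simp
    have eU: "?U = perm_arrow A (prm ?U) (\<tau> (Cod A (far a w)))" using p(1) cU by simp
    have "\<tau> (Dom A (far a w)) = permute (prm ?U) (\<tau> (Cod A (far a w)))"
      using pa(2)[OF o(2) pU] dU eU by simp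
    moreover have "far a w = far a (perm_arrow A (prm ?U) (\<tau> (Cod A (far a w))))" using U(2) eU by simp
    ultimately show ?thesis using o pU by blast
  qed
qed

end

text \<open>The quotient by the congruence has the universal property of the reflection: its
  projection factors through \<open>m\<close> because the quotient is commutative, and
  \<open>m\<close> factors through the projection because it kills the congruence. So
  \<open>m\<close> inherits a pseudo-inverse from the projection.\<close>

theorem (in sigma_map) reflection_equivalence:
  assumes sf: "sigma_free T" and cl: "classifier (over I) (T_monad S) (over J) (T_monad T) (adj_F S T f F) E A g"
    and m: "reflection A D m"
  shows "equivalence_in (Alg (over J) (T_monad T)) (strict_mor J A (F0 qbT D) m)"
proof -
  obtain A1 a where A: "A = (A1, a)" by (cases A)
  obtain D1 d where D: "D = (D1, d)" by (cases D)
  note alg = classifier_bij(1)[OF cl, unfolded A]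
  have Da: "D \<in> algs (over J) TQ" and mm: "m \<in> sfun J (T_monad T) A (F0 qbT D)"
    and mb: "\<And>X. X \<in> algs (over J) TQ \<Longrightarrow> bij_betw (\<lambda>u. func_comp u m) (sfun J TQ D X) (sfun J (T_monad T) A (F0 qbT X))"
    using m by (auto simp: reflection_def)
  let ?d = "func_comp d (qT D1)"
  have qD: "F0 qbT D = (D1, ?d)" by (simp add: D T.q_bar_simps)
  have DT: "(D1, ?d) \<in> algs (over J) (T_monad T)" using T.q_bar_algs(1)[OF Da] by (simp add: qD)
  have kD: "kills_perms T D1 ?d" using T.q_alg_kills_perms[OF Da[unfolded D]] .
  obtain \<tau> where t: "\<And>x. x \<in> Obj A1 \<Longrightarrow> \<tau> x \<in> Obj (T_cat T A1)" "\<And>x. x \<in> Obj A1 \<Longrightarrow> fob a (\<tau> x) = x"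
    and ta: "\<And>z. z \<in> Obj (T_cat T A1) \<Longrightarrow> \<tau> (fob a z) = fob (mu (T_monad T) A1) (tup [] (opn z) (map \<tau> (args z)))"
    using classifier_splitting[OF cl[unfolded A]] by metis
  let ?N = "\<lambda>x y f. x \<in> Obj A1 \<and> y \<in> Obj A1 \<and>
    (\<exists>\<rho>\<in>perms (length (args (\<tau> y))). \<tau> x = T.permute \<rho> (\<tau> y) \<and> f = far a (perm_arrow A1 \<rho> (\<tau> y)))"
  interpret N: thin_congruence T A1 a ?N
    by (rule T.splitting_congruence[OF sf alg t ta])
  have mA: "m \<in> sfun J (T_monad T) (A1, a) (D1, ?d)" using mm by (simp add: A qD)
  have kill: "far m h = Ide D1 (fob m y)" if n: "?N x y h" for x y h
  proof -
    obtain \<rho> where r: "\<rho> \<in> perms (length (args (\<tau> y)))" "h = far a (perm_arrow A1 \<rho> (\<tau> y))" and y: "y \<in> Obj A1"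
      using n by blast
    show ?thesis using T.sfun_kills_perm_arrow[OF alg DT kD mA t(1)[OF y] r(1)] t(2)[OF y] by (simp add: r(2))
  qed
  obtain b where b: "(N.B, b) \<in> algs (over J) TQ" "N.act_B = func_comp b (qT N.B)"
    using T.commutative_alg[OF N.B_alg N.B_kills_perms] .
  have qB: "F0 qbT (N.B, b) = (N.B, N.act_B)" using b(2) by (simp add: T.q_bar_simps)
  obtain n where n: "n \<in> sfun J TQ D (N.B, b)" "func_comp n m = N.eps"
    using N.eps_sfun bij_betw_imp_surj_on[OF mb[OF b(1)], symmetric] by (auto simp: A qB)
  have nT: "n \<in> sfun J (T_monad T) (D1, ?d) (N.B, N.act_B)"
    using n(1) T.q_bar_sfun(1)[OF Da b(1)] by (simp add: qD qB)
  have f: "func_comp m N.iota \<in> sfun J (T_monad T) (N.B, N.act_B) (D1, ?d)" "func_comp (func_comp m N.iota) N.eps = m"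
    by (rule N.kills_N_factor[OF DT mA]; erule kill)+
  have iT: "func_comp m N.iota \<in> sfun J TQ (N.B, b) D"
    using f(1) T.q_bar_sfun(1)[OF b(1) Da] by (simp add: qD qB)
  have mh: "m \<in> hom (over J) A1 D1" and nh: "n \<in> hom (over J) D1 N.B"
    using mA nT by (simp_all add: sfun_iff)
  \<comment> \<open>The two endomorphisms of \<open>D\<close> agree after \<open>m\<close>, so the
    universal property of the reflection makes them equal.\<close>
  have "func_comp (func_comp (func_comp m N.iota) n) m = func_comp (Idm (over J) D1) m"
    using func_comp_assoc[OF mh nh func_comp_hom[OF N.iota mh]] n(2) f(2) func_comp_Idm(2)[OF mh] by simp
  moreover have "func_comp (func_comp m N.iota) n \<in> sfun J TQ D D"
    by (rule T.QM.sfun_comp(1)[OF Da b(1) Da n(1) iT])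
  moreover have "Idm (over J) D1 \<in> sfun J TQ D D" using T.QM.sfun_Idm(1)[OF Da] by (simp add: D)
  ultimately have "func_comp (func_comp m N.iota) n = Idm (over J) D1"
    using inj_onD[OF bij_betw_imp_inj_on[OF mb[OF Da]]] by blast
  then have mn: "func_comp m (func_comp N.iota n) = Idm (over J) D1"
    using func_comp_assoc[OF nh N.iota mh] by simp
  show ?thesis unfolding A qD by (rule N.equivalence[OF DT mA nT n(2) mn]) (erule kill)
qed

text \<open>The isomorphisms \<theta> and \<chi> are canonical: the equations with \<open>h\<close>,
  \<open>g\<close> and \<open>k\<close> say that they respect the universal lax morphisms, compared
  over \<open>T_monad S\<close>, and this determines them. The map in the second part is the unit
  followed by \<chi>, as \<chi> identifies the reflection with the classifier over the
  quotients.\<close>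

theorem theorem6p6p4:
  fixes S T :: "'u::small operad" and f F :: "'u \<Rightarrow> 'u"
    and SQ TQ :: "'u over_monad" and qS qT FQ :: "'u cat \<Rightarrow> 'u func"
    and A B D :: "'u cat \<times> 'u func"
    and g h k :: "('u cat, 'u func, 'u ntrans) lmor"
    and C :: "('u cat \<times> 'u func, ('u cat, 'u func, 'u ntrans) lmor, ('u cat, 'u func, 'u ntrans) acell,
               'u cat \<times> 'u func, ('u cat, 'u func, 'u ntrans) lmor, ('u cat, 'u func, 'u ntrans) acell) twofun"
    and r e :: "'u cat \<times> 'u func \<Rightarrow> ('u cat, 'u func, 'u ntrans) lmor"
  defines "K \<equiv> over (colours T)" and "L \<equiv> over (colours S)"
  assumes "operad S" and "operad T" and "operad_morphism S T f F"
    and "quotient_monad S SQ qS" and "quotient_monad T TQ qT"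
    and "quotient_coherence S T f F SQ qS TQ qT FQ"
    and "two_adjunction (Alg_s K (T_monad T)) (Alg_s K TQ) C (q_bar K qT) r e"
    and "classifier L (T_monad S) K (T_monad T) (adj_F S T f F)
           (terminal_alg (colours S) (T_monad S)) A g"
    and "classifier L (T_monad S) K TQ (adj_qF S T f F qT)
           (terminal_alg (colours S) (T_monad S)) B h"
    and "classifier L SQ K TQ (adj_FQ S f FQ)
           (terminal_alg (colours S) SQ) D k"
  shows "\<exists>\<theta> \<chi>.
     (\<theta> \<in> hom (Alg_s K (T_monad T)) (F0 (q_bar K qT) B) (F0 (q_bar K qT) D) \<and>
      isomorphism_in (Alg_s K (T_monad T)) \<theta> \<and>
      Cmp (Alg_l L (T_monad S)) (F1 (G_bar L (adj_F S T f F)) \<theta>) h = F1 (q_bar L qS) k) \<and>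
     (\<chi> \<in> hom (Alg_s K (T_monad T)) (F0 (q_bar K qT) (F0 C A)) (F0 (q_bar K qT) D) \<and>
      isomorphism_in (Alg_s K (T_monad T)) \<chi> \<and>
      Cmp (Alg_l L (T_monad S))
        (F1 (G_bar L (adj_F S T f F)) (Cmp (Alg_s K (T_monad T)) \<chi> (r A))) g = F1 (q_bar L qS) k) \<and>
     (sigma_free T \<longrightarrow>
        equivalence_in (Alg K (T_monad T)) (Cmp (Alg K (T_monad T)) \<chi> (r A)))"
proof -
  interpret sigma_map S T f F SQ TQ qS qT FQ
    using assms(3-8) by unfold_locales
  let ?E = "terminal_alg (colours S) (T_monad S)"
  note clA = assms(10)[unfolded K_def L_def] and clB = assms(11)[unfolded K_def L_def]
    and clD = assms(12)[unfolded K_def L_def] and adj = assms(9)[unfolded K_def]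
  \<comment> \<open>The terminal \<open>SQ\<close>-algebra is seen to be an algebra because it is
    the source of the lax morphism \<open>k\<close>.\<close>
  have "k \<in> hom (Alg_l (over I) SQ) (terminal_alg I SQ) (F0 GQ D)"
    using clD unfolding classifier_def universal_arrow_def by blast
  then have ES: "terminal_alg I SQ \<in> algs (over I) SQ"
    using S.QM.lax_morsD(1)[of k "fst (msrc k)" "snd (msrc k)" "fst (mtgt k)" "snd (mtgt k)"] by (auto simp: hom_Alg_l)
  have rD: "represents ?E D (F1 qbS k)"
    using classifier_Q_represents[OF clD ES] terminal_alg_q_bar[OF ES] by simp
  have rB: "represents ?E B h" by (rule classifier_qF_represents[OF clB])
  note A = classifier_bij(1)[OF clA]
  obtain m where m: "r A = strict_mor J A (F0 qbT (F0 C A)) m" "reflection A (F0 C A) m"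
    using two_adjunction_reflection[OF adj A] by blast
  note rC = reflection_represents[OF clA m(2)]
  have D: "D \<in> algs (over J) TQ" and B: "B \<in> algs (over J) TQ" and CA: "F0 C A \<in> algs (over J) TQ"
    using rD rB rC by (auto simp: represents_def)
  \<comment> \<open>Mutually inverse functors over \<open>TQ\<close> give mutually inverse strict
    morphisms over \<open>T_monad T\<close>, since both have the same underlying functors.\<close>
  have iso: "strict_mor J (F0 qbT P) (F0 qbT D) u \<in> hom (Alg_s (over J) (T_monad T)) (F0 qbT P) (F0 qbT D) \<and>
      isomorphism_in (Alg_s (over J) (T_monad T)) (strict_mor J (F0 qbT P) (F0 qbT D) u)"
    if P: "P \<in> algs (over J) TQ" and u: "u \<in> sfun J TQ P D" and v: "v \<in> sfun J TQ D P"
      and vu: "func_comp v u = Idm (over J) (fst P)" "func_comp u v = Idm (over J) (fst D)" for P u v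
  proof -
    note tP = T.q_bar_algs[OF P] and tD = T.q_bar_algs[OF D]
    have u': "u \<in> sfun J (T_monad T) (F0 qbT P) (F0 qbT D)" and v': "v \<in> sfun J (T_monad T) (F0 qbT D) (F0 qbT P)"
      using u v T.q_bar_sfun(1)[OF P D] T.q_bar_sfun(1)[OF D P] by auto
    note hu = T.TM.strict_mor_sfun[OF tP(1) tD(1) u'] and hv = T.TM.strict_mor_sfun[OF tD(1) tP(1) v']
    have "alg_comp (over J) (T_monad T) (strict_mor J (F0 qbT D) (F0 qbT P) v) (strict_mor J (F0 qbT P) (F0 qbT D) u) = alg_id (over J) (F0 qbT P)"
      "alg_comp (over J) (T_monad T) (strict_mor J (F0 qbT P) (F0 qbT D) u) (strict_mor J (F0 qbT D) (F0 qbT P) v) = alg_id (over J) (F0 qbT D)"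
      using T.TM.sfun_comp(2)[OF tP(1) tD(1) tP(1) u' v'] T.TM.sfun_comp(2)[OF tD(1) tP(1) tD(1) v' u']
        T.TM.sfun_Idm(2)[OF tP(1)] T.TM.sfun_Idm(2)[OF tD(1)] vu tP(2) tD(2) by simp_all
    then have "isomorphism_in (Alg_s (over J) (T_monad T)) (strict_mor J (F0 qbT P) (F0 qbT D) u)"
      unfolding isomorphism_in_def using hu hv
      by (intro conjI bexI[of _ "strict_mor J (F0 qbT D) (F0 qbT P) v"]) (simp_all add: hom_def)
    then show ?thesis using hu by blast
  qed
  obtain u v where u: "u \<in> sfun J TQ B D" "v \<in> sfun J TQ D B" "func_comp v u = Idm (over J) (fst B)"
    "func_comp u v = Idm (over J) (fst D)" "postcomp (F0 G (F0 qbT D)) (\<Delta>1 u) h = F1 qbS k"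
    using represents_unique[OF rB rD] by metis
  obtain u' v' where u': "u' \<in> sfun J TQ (F0 C A) D" "v' \<in> sfun J TQ D (F0 C A)" "func_comp v' u' = Idm (over J) (fst (F0 C A))"
    "func_comp u' v' = Idm (over J) (fst D)"
    "postcomp (F0 G (F0 qbT D)) (\<Delta>1 u') (postcomp (F0 G (F0 qbT (F0 C A))) (\<Delta>1 m) g) = F1 qbS k"
    using represents_unique[OF rC rD] by metis
  note tB = T.q_bar_algs[OF B] and tD = T.q_bar_algs[OF D] and tC = T.q_bar_algs[OF CA]
  let ?\<theta> = "strict_mor J (F0 qbT B) (F0 qbT D) u" and ?\<chi> = "strict_mor J (F0 qbT (F0 C A)) (F0 qbT D) u'"
  have uT: "u \<in> sfun J (T_monad T) (F0 qbT B) (F0 qbT D)" and uT': "u' \<in> sfun J (T_monad T) (F0 qbT (F0 C A)) (F0 qbT D)"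
    using u(1) u'(1) T.q_bar_sfun(1)[OF B D] T.q_bar_sfun(1)[OF CA D] by auto
  have mm: "m \<in> sfun J (T_monad T) A (F0 qbT (F0 C A))" using m(2) by (simp add: reflection_def)
  have hB: "h \<in> hom (Alg_l (over I) (T_monad S)) ?E (F0 G (F0 qbT B))" using rB by (simp add: represents_def)
  have 1: "Cmp (Alg_l (over I) (T_monad S)) (F1 G ?\<theta>) h = F1 qbS k"
    using G_postcomp(1)[OF tB(1) tD(1) uT hB] u(5) by simp
  have chi: "alg_comp (over J) (T_monad T) ?\<chi> (r A) = strict_mor J A (F0 qbT D) (func_comp u' m)"
    and um: "func_comp u' m \<in> sfun J (T_monad T) A (F0 qbT D)"
    using T.TM.sfun_comp[OF A tC(1) tD(1) mm uT'] by (simp_all add: m(1))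
  have 2: "Cmp (Alg_l (over I) (T_monad S)) (F1 G (strict_mor J A (F0 qbT D) (func_comp u' m))) g = F1 qbS k"
  proof -
    note mh = T.TM.sfunD[OF mm, unfolded tC(2)] and uh = T.QM.sfunD[OF u'(1)]
    have "Cmp (Alg_l (over I) (T_monad S)) (F1 G (strict_mor J A (F0 qbT D) (func_comp u' m))) g =
        postcomp (F0 G (F0 qbT D)) (\<Delta>1 (func_comp u' m)) g"
      by (rule G_postcomp(1)[OF A tD(1) um classifier_bij(2)[OF clA]])
    also have "\<dots> = postcomp (F0 G (F0 qbT D)) (\<Delta>1 u') (postcomp (F0 G (F0 qbT (F0 C A))) (\<Delta>1 m) g)"
    proof -
      obtain A1 a where AA: "A = (A1, a)" by (cases A)
      have gm: "g \<in> lax_mors (over I) (T_monad S)" "mtgt g = (\<Delta> A1, func_comp (\<Delta>1 a) (FC A1))"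
        using classifier_bij(2)[OF clA] by (simp_all add: hom_Alg_l AA G_ob)
      have mh': "m \<in> hom (over J) A1 (fst (F0 C A))" using mh by (simp add: AA)
      show ?thesis
        using S.TM.postcomp_postcomp[OF gm Delta_hom[OF mh', of I f] Delta_hom[OF uh, of I f]] Delta_comp[OF mh' uh, of I f] by simp
    qed
    finally show ?thesis using u'(5) by simp
  qed
  \<comment> \<open>The unit followed by \<chi> is again a reflection, now with \<open>D\<close> as
    its target.\<close>
  have 3: "equivalence_in (Alg (over J) (T_monad T)) (strict_mor J A (F0 qbT D) (func_comp u' m))" if "sigma_free T"
    by (rule reflection_equivalence[OF that clA reflection_iso[OF m(2) A D u'(1-4)]])
  show ?thesis
    unfolding K_def L_def
    using iso[OF B u(1-4)] iso[OF CA u'(1-4)] 1 2 3 chi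
    by (intro exI[of _ ?\<theta>] exI[of _ ?\<chi>]) simp
qed

end
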